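(* Let $b$ be a holomorphic function on the unit ball $\mathbb{B}_n\subset\mathbb{C}^n$, and let $P$ be the Bergman projection on $\mathbb{B}_n$. The following are equivalent: (1) $b\in\mathcal{B}$ (the Bloch space). (2) There exists $C>0$ such that for all bounded, compactly supported functions $f$ on $\mathbb{B}_n$ and all $\lambda>0$, $$\left|\left\{z\in\mathbb{B}_n: |[\bar b,P]f(z)|>\lambda\right\}\right|\le C\int_{\mathbb{B}_n}\frac{|f(z)|}{\lambda}\left(1+\log^+\left(\frac{|f(z)|}{\lambda}\right)\right)dV(z).$$ (3) There exists $C>0$ such that for all measurable sets $A\subset\mathbb{B}_n$ and all $\lambda>1$, $$\left|\left\{z\in\mathbb{B}_n: |[\bar b,P](\mathbf{1}_A)(z)|>\lambda\right\}\right|\le C\frac{|A|}{\lambda}.$$ (4) There exist $C,r>0$ such that for all $z\in\mathbb{B}_n$ and all $\lambda>1$, $$\left|\left\{w\in\mathbb{B}_n: |[\bar b,P](\mathbf{1}_{E(z,\hat r)})(w)|>\lambda\right\}\right|\le C\frac{|E(z,\hat r)|}{\lambda}.$$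
   Context: $V$ is Lebesgue volume measure and $|E|=V(E)$; $\log^+t=\max\{0,\log t\}$; $\mathbf{1}_A$ is the characteristic function of $A$. The Bergman projection is $Pf(z)=c_n\int_{\mathbb{B}_n}\frac{f(w)}{(1-\langle z,w\rangle)^{n+1}}\,dV(w)$, $c_n=n!/\pi^n$. The commutator is $[\bar b,P]f=\bar b\,Pf-P(\bar b f)$. The Bloch space is $\mathcal{B}=\{f\text{ holomorphic on }\mathbb{B}_n:\sup_{z\in\mathbb{B}_n}|\nabla f(z)|(1-|z|)<\infty\}$, where $\nabla$ is the holomorphic gradient. Polydisks: for $z\in\mathbb{B}_n\setminus\{0\}$ let $e_1=z/|z|$ and fix vectors $e_2,\dots,e_n$ such that $e_1,\dots,e_n$ is an orthonormal basis of $\mathbb{C}^n$; for $z=0$ fix any orthonormal basis. Write $w=\sum_{j=1}^n\xi_je_j$ and let $P_zw=\xi_1e_1$. For $s>0$ set $E(z,s)=\{w\in\mathbb{C}^n:|P_zw-z|<s,\ |\xi_j|<s^{1/2}\text{ for }j=2,\dots,n\}$. For $r>0$ put $R=\tanh r$, $\sigma=\frac{1-|z|^2}{1-R^2|z|^2}$ and $\hat r=2R\sigma$ (so $\hat r$ depends on both $r$ and $z$); $E(z,\hat r)$ is a polydisk comparable to the Bergman metric ball of radius $r$ centered at $z$. *)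

theory Defs
  imports "HOL-Analysis.Analysis"
begin

text \<open>The space of complex \<open>n\<close>-tuples is \<open>complex ^ 'n\<close> with \<open>n = CARD('n)\<close>; its library norm is the
  Euclidean norm, \<open>ball 0 1\<close> is the open unit ball, and \<open>lebesgue\<close> is the
  \<open>2n\<close>-dimensional Lebesgue measure.\<close>

definition cinner :: "complex ^ 'n \<Rightarrow> complex ^ 'n \<Rightarrow> complex" where
  "cinner z w = (\<Sum>i\<in>UNIV. z $ i * cnj (w $ i))"

text \<open>Holomorphy in several variables, for open sets: real differentiability with a
  complex-linear derivative.\<close>

definition holomorphic_multi_on :: "(complex ^ 'n \<Rightarrow> complex) \<Rightarrow> (complex ^ 'n) set \<Rightarrow> bool" where
  "holomorphic_multi_on f S \<longleftrightarrow>
    (\<forall>z\<in>S. \<exists>D. (f has_derivative D) (at z) \<and> (\<forall>c v. D (c *s v) = c * D v))"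

definition cgrad :: "(complex ^ 'n \<Rightarrow> complex) \<Rightarrow> complex ^ 'n \<Rightarrow> complex ^ 'n" where
  "cgrad f z = (\<chi> j. deriv (\<lambda>t. f (z + t *s axis j 1)) 0)"

definition bloch :: "(complex ^ 'n \<Rightarrow> complex) set" where
  "bloch = {f. holomorphic_multi_on f (ball 0 1) \<and>
               bdd_above ((\<lambda>z. norm (cgrad f z) * (1 - norm z)) ` ball 0 1)}"

definition bergman_kernel :: "complex ^ 'n \<Rightarrow> complex ^ 'n \<Rightarrow> complex" where
  "bergman_kernel z w =
    complex_of_real (fact CARD('n) / pi ^ CARD('n)) / (1 - cinner z w) ^ (CARD('n) + 1)"

text \<open>The Bochner integral is \<open>0\<close> when the integrand is not integrable; \<open>bergman_defined f\<close> says
  that the integral defining \<open>Pf\<close> converges at every point of the ball. Values of \<open>f\<close> outside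
  the ball are irrelevant.\<close>

definition bergman_defined :: "(complex ^ 'n \<Rightarrow> complex) \<Rightarrow> bool" where
  "bergman_defined f \<longleftrightarrow>
    (\<forall>z\<in>ball 0 1. set_integrable lebesgue (ball 0 1) (\<lambda>w. bergman_kernel z w * f w))"

definition bergman_proj :: "(complex ^ 'n \<Rightarrow> complex) \<Rightarrow> complex ^ 'n \<Rightarrow> complex" where
  "bergman_proj f z = (LINT w:ball 0 1|lebesgue. bergman_kernel z w * f w)"

text \<open>The commutator of \<open>P\<close> with multiplication by the conjugate of \<open>b\<close>. Only the second projection
  can fail to be defined when \<open>f\<close> is bounded and measurable.\<close>

definition commutator ::
  "(complex ^ 'n \<Rightarrow> complex) \<Rightarrow> (complex ^ 'n \<Rightarrow> complex) \<Rightarrow> complex ^ 'n \<Rightarrow> complex" where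
  "commutator b f z = cnj (b z) * bergman_proj f z - bergman_proj (\<lambda>w. cnj (b w) * f w) z"

definition commutator_defined ::
  "(complex ^ 'n \<Rightarrow> complex) \<Rightarrow> (complex ^ 'n \<Rightarrow> complex) \<Rightarrow> bool" where
  "commutator_defined b f \<longleftrightarrow> bergman_defined f \<and> bergman_defined (\<lambda>w. cnj (b w) * f w)"

definition compactly_supported_in ::
  "('a::topological_space \<Rightarrow> 'b::zero) \<Rightarrow> 'a set \<Rightarrow> bool" where
  "compactly_supported_in f S \<longleftrightarrow> (\<exists>K. compact K \<and> K \<subseteq> S \<and> (\<forall>z\<in>S - K. f z = 0))"

definition log_plus :: "real \<Rightarrow> real" where
  "log_plus t = max 0 (ln t)"

text \<open>A choice, for each \<open>z\<close>, of an orthonormal basis \<open>e z\<close> whose distinguished member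
  \<open>e z k\<close> is \<open>z / \<bar>z\<bar>\<close> if \<open>z \<noteq> 0\<close>.  The index \<open>k\<close> plays the role of \<open>1\<close> in \<open>1, \<dots>, n\<close>.\<close>

definition adapted_frames :: "(complex ^ 'n \<Rightarrow> 'n \<Rightarrow> complex ^ 'n) \<Rightarrow> 'n \<Rightarrow> bool" where
  "adapted_frames e k \<longleftrightarrow>
    (\<forall>z i j. cinner (e z i) (e z j) = (if i = j then 1 else 0)) \<and>
    (\<forall>z. z \<noteq> 0 \<longrightarrow> e z k = z /\<^sub>R norm z)"

text \<open>The coordinates of \<open>w\<close> in the orthonormal basis \<open>e z\<close> are \<open>cinner w (e z j)\<close>.\<close>

definition polydisk ::
  "(complex ^ 'n \<Rightarrow> 'n \<Rightarrow> complex ^ 'n) \<Rightarrow> 'n \<Rightarrow> complex ^ 'n \<Rightarrow> real \<Rightarrow> (complex ^ 'n) set" where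
  "polydisk e k z s =
    {w. norm (cinner w (e z k) *s e z k - z) < s \<and>
        (\<forall>j. j \<noteq> k \<longrightarrow> norm (cinner w (e z j)) < sqrt s)}"

definition rhat :: "real \<Rightarrow> complex ^ 'n \<Rightarrow> real" where
  "rhat r z = 2 * tanh r * ((1 - (norm z)\<^sup>2) / (1 - (tanh r)\<^sup>2 * (norm z)\<^sup>2))"

end

theory Submission
  imports Defs "HOL-Complex_Analysis.Complex_Analysis"
begin

text \<open>Let \<open>d(z, w) = |1 - \<langle>z, w\<rangle>|\<close> and \<open>\<rho>(z) = 1 - |z|\<close>. A Bloch function satisfies
  \<open>|b(z) - b(w)| \<le> C (1 + log (d / \<rho>(z)) + log (d / \<rho>(w)))\<close>, so the commutator is dominated by the
  operator \<open>T\<close> with positive kernel \<open>K = (1 + log (d / \<rho>(z)) + log (d / \<rho>(w))) / d\<^bsup>n+1\<^esup>\<close>. On bounded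
  densities \<open>T\<close> is controlled by a Schur test. For general \<open>f\<close>, a Vitali family of tents
  \<open>{w. d(a, w) < r}\<close> carries the part of \<open>f\<close> whose averages are large; the total volume of these tents
  is bounded by the \<open>L log L\<close> integral of \<open>f\<close>, and away from them \<open>T f\<close> is bounded by \<open>T g\<close> for
  bounded densities \<open>g\<close> (characteristic functions of tents, and \<open>f\<close> smeared at the scale \<open>\<rho>\<close>), since
  \<open>log (d / \<rho>(w))\<close> is exponentially integrable over a tent.

  Conversely, let \<open>\<epsilon> = \<rho>(w\<^sub>0)\<close> and let \<open>A\<close> be a set of volume comparable to \<open>\<epsilon>\<^bsup>n+1\<^esup>\<close> that is so close
  to \<open>w\<^sub>0 / |w\<^sub>0|\<close> that the kernel \<open>1 / (1 - \<langle>w, u\<rangle>)\<^bsup>n+1\<^esup>\<close> is nearly constant for \<open>u \<in> A\<close> and \<open>w\<close> in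
  an ellipsoid of size \<open>\<epsilon>\<close> around \<open>w\<^sub>0\<close>. There \<open>g = P 1\<^sub>A\<close> is bounded away from \<open>0\<close>, and dividing the
  commutator by \<open>g\<close> leaves \<open>cnj b - q\<close> with \<open>q\<close> holomorphic. The mean value property turns the
  weak-type bound for this function into a pointwise bound, so the real parts of \<open>b - q\<close> and of
  \<open>\<i> (b + q)\<close> are bounded, and Cauchy's inequality for their exponentials bounds the gradient of \<open>b\<close>
  at \<open>w\<^sub>0\<close> by a multiple of \<open>1 / \<epsilon>\<close>.\<close>

section \<open>Kernels on spaces of tents\<close>

text \<open>Only the size of the kernel is used: a logarithm costs a small power of
  \<open>d / \<rho>\<close>, which the Schur test can afford. The obstacle is the endpoint. The
  factor \<open>ln (d / \<rho>(w))\<close> is unbounded near the boundary, so the mass of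
  \<open>f\<close> in a tent cannot simply be averaged; the inequality
  \<open>mult_one_plus_ln_le\<close> trades it for one logarithm of \<open>f\<close>, which is where
  \<open>L log L\<close> comes from. Since \<open>d(z, z) \<ge> \<rho>(z) > 0\<close>, there are no
  small scales, and smearing takes the place of Lebesgue differentiation. In the converse
  \<open>q\<close> depends on \<open>w\<^sub>0\<close> and \<open>A\<close> and nothing is known
  about its growth, so no bound on \<open>b\<close> itself results; only the gradient survives,
  through a combination of \<open>b - q\<close> and \<open>b + q\<close> that eliminates
  \<open>q\<close>. Weak type gives no integrability of \<open>cnj b - q\<close>, so its mean values
  are split at half of a suitably chosen value. The three conditions differ only in the sets
  \<open>A\<close> that they admit; polydisks with fixed \<open>r\<close> cannot be rescaled, so
  they are moved towards the boundary instead.\<close>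

lemma vitali_disjoint_subfamily:
  fixes Q :: "'i \<Rightarrow> 'b set" and r :: "'i \<Rightarrow> real"
  assumes bound: "\<And>i. i \<in> P \<Longrightarrow> 0 < r i \<and> r i \<le> R" and ne: "\<And>i. i \<in> P \<Longrightarrow> Q i \<noteq> {}"
  shows "\<exists>H\<subseteq>P. pairwise (\<lambda>i j. disjnt (Q i) (Q j)) H \<and>
    (\<forall>i\<in>P. \<exists>j\<in>H. \<not> disjnt (Q i) (Q j) \<and> r i \<le> 2 * r j)"
proof -
  \<comment> \<open>Only members of \<open>P\<close> that already meet \<open>H\<close> are asked to
    meet a comparably large member: this holds for \<open>{}\<close>, passes to unions of chains,
    and maximality later makes every member of \<open>P\<close> meet \<open>H\<close>. The sets
    \<open>Q i\<close> carry no metric; a quasi-triangle inequality enters only where the selected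
    sets are enlarged.\<close>
  define good where "good H \<longleftrightarrow> H \<subseteq> P \<and> pairwise (\<lambda>i j. disjnt (Q i) (Q j)) H \<and>
    (\<forall>i\<in>P. (\<exists>j\<in>H. \<not> disjnt (Q i) (Q j)) \<longrightarrow> (\<exists>j\<in>H. \<not> disjnt (Q i) (Q j) \<and> r i \<le> 2 * r j))" for H
  have "\<exists>H\<in>Collect good. \<forall>X\<in>Collect good. H \<subseteq> X \<longrightarrow> X = H"
  proof (rule subset_Zorn_nonempty)
    have "good {}" by (simp add: good_def)
    then show "Collect good \<noteq> {}" by blast
  next
    fix C assume C: "C \<noteq> {}" "subset.chain (Collect good) C"
    then have g: "\<And>H. H \<in> C \<Longrightarrow> good H" by (auto simp: subset.chain_def)
    have "pairwise (\<lambda>i j. disjnt (Q i) (Q j)) (\<Union>C)"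
      unfolding pairwise_def
    proof (intro ballI impI)
      fix x y assume "x \<in> \<Union>C" "y \<in> \<Union>C" "x \<noteq> y"
      then obtain X Y where XY: "X \<in> C" "Y \<in> C" "x \<in> X" "y \<in> Y" by blast
      then have "X \<subseteq> Y \<or> Y \<subseteq> X" using C(2) by (auto simp: subset.chain_def)
      then obtain Z where "Z \<in> C" "x \<in> Z" "y \<in> Z" using XY by blast
      then show "disjnt (Q x) (Q y)" using g[of Z] \<open>x \<noteq> y\<close> by (auto simp: good_def pairwise_def)
    qed
    moreover have "\<Union>C \<subseteq> P" using g by (auto simp: good_def)
    moreover have "\<exists>j\<in>\<Union>C. \<not> disjnt (Q i) (Q j) \<and> r i \<le> 2 * r j"
      if "i \<in> P" and ex: "\<exists>j\<in>\<Union>C. \<not> disjnt (Q i) (Q j)" for i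
    proof -
      obtain H where "H \<in> C" "\<exists>j\<in>H. \<not> disjnt (Q i) (Q j)" using ex by blast
      then show ?thesis using g[of H] that(1) unfolding good_def by blast
    qed
    ultimately show "\<Union>C \<in> Collect good" by (simp add: good_def)
  qed
  then obtain H where H: "good H" and mx: "\<And>X. good X \<Longrightarrow> H \<subseteq> X \<Longrightarrow> X = H" by blast
  have "\<exists>j\<in>H. \<not> disjnt (Q i) (Q j)" if i: "i \<in> P" for i
  proof (rule ccontr)
    define P' where "P' = {i\<in>P. \<forall>j\<in>H. disjnt (Q i) (Q j)}"
    assume "\<not> (\<exists>j\<in>H. \<not> disjnt (Q i) (Q j))"
    then have iP': "i \<in> P'" using i by (auto simp: P'_def)
    have bdd: "bdd_above (r ` P')" using bound by (auto simp: P'_def intro!: bdd_aboveI[of _ R])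
    define s where "s = Sup (r ` P')"
    have "s > 0" using bound[OF i] cSup_upper[OF _ bdd, of "r i"] iP' unfolding s_def by force
    then have "s / 2 < s" by simp
    \<comment> \<open>The supremum need not be attained, whence the factor 2. A member of
      \<open>P'\<close> meets no set of \<open>H\<close>, so after adding \<open>i0\<close> it can
      only meet \<open>Q i0\<close>, whose radius is large enough.\<close>
    then obtain i0 where i0: "i0 \<in> P'" "s / 2 < r i0"
      unfolding s_def using less_cSup_iff[OF _ bdd] iP' by blast
    have le: "r j \<le> 2 * r i0" if "j \<in> P'" for j
      using cSup_upper[OF _ bdd, of "r j"] that i0(2) unfolding s_def by force
    have "good (insert i0 H)"
      unfolding good_def
    proof (intro conjI ballI impI)
      show "insert i0 H \<subseteq> P" using H i0 by (auto simp: good_def P'_def)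
      show "pairwise (\<lambda>i j. disjnt (Q i) (Q j)) (insert i0 H)"
        using H i0 by (auto simp: good_def P'_def pairwise_insert disjnt_sym)
      fix i assume i: "i \<in> P" and ex: "\<exists>j\<in>insert i0 H. \<not> disjnt (Q i) (Q j)"
      show "\<exists>j\<in>insert i0 H. \<not> disjnt (Q i) (Q j) \<and> r i \<le> 2 * r j"
      proof (cases "i \<in> P'")
        case True
        then show ?thesis using ex le by (auto simp: P'_def)
      next
        case False
        then show ?thesis using i H by (auto simp: P'_def good_def)
      qed
    qed
    then have "i0 \<in> H" using mx by blast
    then have "disjnt (Q i0) (Q i0)" using i0 by (auto simp: P'_def)
    then show False using ne[of i0] i0 by (auto simp: P'_def disjnt_def)
  qed
  then show ?thesis using H by (intro exI[of _ H]) (auto simp: good_def)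
qed

lemma two_powr_neg_less_1: "(2::real) powr (-1/8) < 1"
proof -
  have "(2::real) powr x < 2 powr 0" if "x < 0" for x :: real
    using that by (rule powr_less_mono) simp
  from this[of "-1/8"] show ?thesis by simp
qed

text \<open>A Young inequality between \<open>L log L\<close> and exponential integrability. The
  threshold is \<open>q = y powr (1/4)\<close>: for \<open>t \<le> q\<close> the term
  \<open>t * ln y = 4 * t * ln q\<close> is at most \<open>4 * q\<^sup>2 = 4 * sqrt y\<close>, for
  larger \<open>t\<close> the logarithm of \<open>q\<close> is below that of \<open>t\<close>. The
  square root is the weight that \<open>tent_upper\<close> integrates.\<close>

lemma mult_one_plus_ln_le:
  fixes t y :: real
  assumes "0 \<le> t" "1 \<le> y"
  shows "t * (1 + ln y) \<le> 4 * (t * (1 + log_plus t)) + 4 * sqrt y"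
proof -
  define q where "q = y powr (1/4)"
  have q1: "q \<ge> 1" using assms by (simp add: q_def ge_one_powr_ge_zero)
  have y: "y = q ^ 4" using assms by (simp add: q_def powr_power)
  have qq: "sqrt y = q ^ 2" using q1 by (simp add: y real_sqrt_unique power_mult[symmetric])
  have lny: "ln y = 4 * ln q" using q1 by (simp add: y ln_realpow)
  have lp: "log_plus t \<ge> 0" by (simp add: log_plus_def)
  show ?thesis
  proof (cases "t \<le> q")
    case True
    have "ln q \<le> q" using q1 ln_le_minus_one[of q] by linarith
    then have "t * (4 * ln q) \<le> q * (4 * q)" using assms True q1 by (intro mult_mono) auto
    moreover have "t * log_plus t \<ge> 0" using assms lp by simp
    ultimately show ?thesis using assms unfolding lny qq by (simp add: algebra_simps power2_eq_square)
  next
    case False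
    then have "ln q \<le> log_plus t" using q1 by (simp add: log_plus_def)
    then have "t * ln q \<le> t * log_plus t" using assms by (intro mult_left_mono)
    moreover have "0 \<le> q\<^sup>2" by simp
    ultimately show ?thesis using assms unfolding lny qq distrib_left by linarith
  qed
qed

text \<open>The ball enters the kernel estimates only through this interface. Tents of size at most
  \<open>\<rho> a\<close> over \<open>a\<close> are empty, by \<open>rho_le_d\<close>. The square
  root in \<open>tent_upper\<close> stands for the exponential integrability of
  \<open>ln (r / \<rho> w)\<close>. \<open>tent_lower\<close> measures only the part of a tent above
  height \<open>r / 6\<close>, as smearing needs points of comparable height.
  \<open>open_tent\<close> serves the countability of disjoint families. In the ball
  \<open>N\<close> is \<open>n + 1\<close>.\<close>

locale tent_space = finite_measure M for M :: "'a::second_countable_topology measure" +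
  fixes d :: "'a \<Rightarrow> 'a \<Rightarrow> real" and \<rho> :: "'a \<Rightarrow> real" and N :: nat and C0 c0 :: real
  assumes d_measurable: "case_prod d \<in> borel_measurable (M \<Otimes>\<^sub>M M)"
    and rho_measurable [measurable]: "\<rho> \<in> borel_measurable M"
    and open_tent: "a \<in> space M \<Longrightarrow> open {w \<in> space M. d a w < r}"
    and d_sym: "z \<in> space M \<Longrightarrow> w \<in> space M \<Longrightarrow> d z w = d w z"
    and d_tri: "x \<in> space M \<Longrightarrow> y \<in> space M \<Longrightarrow> z \<in> space M \<Longrightarrow> d x z \<le> 4 * (d x y + d y z)"
    and rho_pos: "z \<in> space M \<Longrightarrow> 0 < \<rho> z" and rho_le_1: "z \<in> space M \<Longrightarrow> \<rho> z \<le> 1"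
    and rho_le_d: "z \<in> space M \<Longrightarrow> w \<in> space M \<Longrightarrow> \<rho> z \<le> d z w"
    and C0_pos: "0 < C0" and c0_pos: "0 < c0"
    and tent_upper: "a \<in> space M \<Longrightarrow> 0 < r \<Longrightarrow>
      (\<integral>\<^sup>+w. ennreal (sqrt (r / \<rho> w)) * indicator {w \<in> space M. d a w < r} w \<partial>M) \<le> ennreal (C0 * r ^ N)"
    and tent_lower: "a \<in> space M \<Longrightarrow> \<rho> a \<le> r \<Longrightarrow> r \<le> 1 \<Longrightarrow>
      ennreal (c0 * r ^ N) \<le> emeasure M {u \<in> space M. d a u < 2 * r \<and> r < 6 * \<rho> u}"
begin

abbreviation Q :: "'a \<Rightarrow> real \<Rightarrow> 'a set" where
  "Q a r \<equiv> {w \<in> space M. d a w < r}"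

text \<open>\<open>d z w\<close> is \<open>|1 - \<langle>z, w\<rangle>|\<close> and \<open>\<rho> z\<close> is \<open>1 - |z|\<close> in the ball, where \<open>L\<close> dominates
  \<open>|b z - b w|\<close> for Bloch functions \<open>b\<close>, and \<open>K\<close> the kernel of the commutator.\<close>

definition L :: "'a \<Rightarrow> 'a \<Rightarrow> real" where
  "L z w = 1 + ln (d z w / \<rho> z) + ln (d z w / \<rho> w)"

definition K :: "'a \<Rightarrow> 'a \<Rightarrow> real" where
  "K z w = L z w / d z w ^ N"

definition T :: "('a \<Rightarrow> ennreal) \<Rightarrow> 'a \<Rightarrow> ennreal" where
  "T g z = (\<integral>\<^sup>+w. ennreal (K z w) * g w \<partial>M)"

lemma d_measurable' [measurable (raw)]:
  "f \<in> measurable P M \<Longrightarrow> g \<in> measurable P M \<Longrightarrow> (\<lambda>x. d (f x) (g x)) \<in> borel_measurable P"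
  using measurable_compose[OF measurable_Pair d_measurable, of f P g] by simp

lemma K_measurable [measurable (raw)]:
  assumes [measurable]: "f \<in> measurable P M" "g \<in> measurable P M"
  shows "(\<lambda>x. K (f x) (g x)) \<in> borel_measurable P"
  unfolding K_def L_def by measurable

lemma rho_le_d': "z \<in> space M \<Longrightarrow> w \<in> space M \<Longrightarrow> \<rho> w \<le> d z w"
  using rho_le_d d_sym by metis

lemma d_pos: "z \<in> space M \<Longrightarrow> w \<in> space M \<Longrightarrow> 0 < d z w"
  using rho_le_d rho_pos by fastforce

lemma L_ge_1:
  assumes "z \<in> space M" "w \<in> space M"
  shows "1 \<le> L z w"
  using assms rho_le_d rho_le_d' rho_pos by (simp add: L_def)

lemma K_pos: "z \<in> space M \<Longrightarrow> w \<in> space M \<Longrightarrow> 0 < K z w"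
  using L_ge_1[of z w] d_pos[of z w] by (simp add: K_def)

lemma K_sym: "z \<in> space M \<Longrightarrow> w \<in> space M \<Longrightarrow> K z w = K w z"
  by (simp add: K_def L_def d_sym[of z w])

lemma T_measurable [measurable]:
  assumes [measurable]: "g \<in> borel_measurable M"
  shows "T g \<in> borel_measurable M"
  unfolding T_def by measurable

text \<open>Moving the second argument from \<open>w\<close> to \<open>u\<close> at comparable
  distance from \<open>z\<close> costs a power of \<open>c\<close> but only a logarithm of the
  height ratio \<open>y\<close>, since heights occur in \<open>L\<close> alone. The ratio is bounded
  on one side: a lower \<open>u\<close> only makes \<open>K z u\<close> larger.
  \<open>L \<ge> 1\<close> turns the additive error in \<open>L\<close> into a factor.\<close>

lemma K_le:
  assumes X: "z \<in> space M" "w \<in> space M" "u \<in> space M"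
    and c: "1 \<le> c" "d z w \<le> c * d z u" "d z u \<le> c * d z w"
    and y: "1 \<le> y" "\<rho> u \<le> y * \<rho> w"
  shows "K z w \<le> c ^ N * (1 + 2 * ln c) * (1 + ln y) * K z u"
proof -
  note p = d_pos[OF X(1,2)] d_pos[OF X(1,3)] rho_pos[OF X(1)] rho_pos[OF X(2)] rho_pos[OF X(3)]
  have 1: "ln (d z w / \<rho> z) \<le> ln c + ln (d z u / \<rho> z)"
  proof -
    have "ln (d z w / \<rho> z) \<le> ln (c * (d z u / \<rho> z))"
      using c p by (subst ln_le_cancel_iff) (auto simp: field_simps)
    also have "\<dots> = ln c + ln (d z u / \<rho> z)" using c p by (subst ln_mult) auto
    finally show ?thesis .
  qed
  have 2: "ln (d z w / \<rho> w) \<le> ln c + ln y + ln (d z u / \<rho> u)"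
  proof -
    have "d z w * \<rho> u \<le> (c * d z u) * (y * \<rho> w)" using c y p by (intro mult_mono) auto
    then have "ln (d z w / \<rho> w) \<le> ln ((c * y) * (d z u / \<rho> u))"
      using c y p by (subst ln_le_cancel_iff) (auto simp: field_simps)
    also have "\<dots> = ln c + ln y + ln (d z u / \<rho> u)" using c y p
      by (subst ln_mult) (auto simp: ln_mult)
    finally show ?thesis .
  qed
  have lnp: "ln c \<ge> 0" "ln y \<ge> 0" using c y by auto
  have L1: "L z u \<ge> 1" using L_ge_1 X by auto
  have "L z w \<le> L z u + 2 * ln c + ln y" using 1 2 by (simp add: L_def)
  also have "\<dots> \<le> (1 + 2 * ln c) * (1 + ln y) * L z u"
  proof -
    have "(1 + 2 * ln c) * (1 + ln y) * L z u \<ge> (1 + 2 * ln c + ln y) * L z u"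
      using L1 lnp by (intro mult_right_mono) (auto simp: algebra_simps)
    moreover have "2 * ln c * L z u \<ge> 2 * ln c" "ln y * L z u \<ge> ln y"
      using mult_left_mono[OF L1, of "2 * ln c"] mult_left_mono[OF L1, of "ln y"] lnp by auto
    ultimately show ?thesis by (simp add: algebra_simps)
  qed
  finally have L: "L z w \<le> (1 + 2 * ln c) * (1 + ln y) * L z u" .
  have "d z u ^ N \<le> (c * d z w) ^ N" using c p by (intro power_mono) auto
  then have inv: "1 / d z w ^ N \<le> c ^ N / d z u ^ N" using p by (simp add: field_simps power_mult_distrib)
  have "K z w = L z w * (1 / d z w ^ N)" by (simp add: K_def)
  also have "\<dots> \<le> ((1 + 2 * ln c) * (1 + ln y) * L z u) * (c ^ N / d z u ^ N)"
    using L inv L1 lnp p L_ge_1[OF X(1,2)] by (intro mult_mono) auto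
  also have "\<dots> = c ^ N * (1 + 2 * ln c) * (1 + ln y) * K z u" by (simp add: K_def)
  finally show ?thesis .
qed

section \<open>Tent volumes and the Schur test\<close>

lemma measure_tent:
  assumes "a \<in> space M" "0 < r"
  shows "emeasure M (Q a r) \<le> ennreal (C0 * r ^ N)"
proof -
  have "emeasure M (Q a r) = (\<integral>\<^sup>+w. 1 * indicator (Q a r) w \<partial>M)"
    using assms by simp
  \<comment> \<open>On the tent \<open>\<rho> w \<le> d a w < r\<close>, so the weight is at least
    1.\<close>
  also have "\<dots> \<le> (\<integral>\<^sup>+w. ennreal (sqrt (r / \<rho> w)) * indicator (Q a r) w \<partial>M)"
  proof (intro nn_integral_mono)
    fix w assume "w \<in> space M"
    then show "1 * indicator (Q a r) w \<le> ennreal (sqrt (r / \<rho> w)) * indicator (Q a r) w"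
      using rho_pos[of w] rho_le_d'[OF assms(1), of w]
      by (auto simp: indicator_def)
  qed
  also have "\<dots> \<le> ennreal (C0 * r ^ N)" by (rule tent_upper[OF assms])
  finally show ?thesis .
qed

lemma measure_tent_lower:
  assumes "a \<in> space M" "2 * \<rho> a \<le> r" "r \<le> 2"
  shows "ennreal (c0 * (r / 2) ^ N) \<le> emeasure M (Q a r)"
proof -
  have "ennreal (c0 * (r / 2) ^ N) \<le> emeasure M {u \<in> space M. d a u < 2 * (r/2) \<and> r/2 < 6 * \<rho> u}"
    using assms by (intro tent_lower) auto
  also have "\<dots> \<le> emeasure M (Q a r)" using assms(1) by (intro emeasure_mono) auto
  finally show ?thesis .
qed


text \<open>Cut into shells \<open>2 ^ k * \<rho> z \<le> d z w < 2 ^ (k + 1) * \<rho> z\<close>,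
  starting at \<open>k = 0\<close> because \<open>\<rho> z \<le> d z w\<close>. On each shell
  \<open>tent_upper\<close> gives a multiple of the \<open>N\<close>-th power of the radius, which
  cancels the first factor, and the power \<open>-1/8\<close> leaves a convergent geometric
  series.\<close>

lemma nn_integral_geometric_tents:
  assumes z: "z \<in> space M"
  shows "(\<integral>\<^sup>+w. ennreal (d z w powr (- real N) * (d z w / \<rho> z) powr (-1/8) * sqrt (d z w / \<rho> w)) \<partial>M)
    \<le> ennreal (2 ^ N * C0 * (\<Sum>k. (2 powr (-1/8)) ^ k))"
proof -
  define q where "q = (2::real) powr (-1/8)"
  have q: "0 < q" "q < 1" using two_powr_neg_less_1 by (auto simp: q_def)
  define c where "c k = (2 ^ k * \<rho> z) powr (- real N) * q ^ k" for k :: nat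
  define g where "g k w = ennreal (c k) * (ennreal (sqrt (2 * 2 ^ k * \<rho> z / \<rho> w)) * indicator (Q z (2 * 2 ^ k * \<rho> z)) w)"
    for k w
  have rz: "\<rho> z > 0" using rho_pos z by auto
  have [measurable]: "Q z s \<in> sets M" for s using z by measurable
  have gm [measurable]: "g k \<in> borel_measurable M" for k unfolding g_def by measurable
  have le: "ennreal (d z w powr (- real N) * (d z w / \<rho> z) powr (-1/8) * sqrt (d z w / \<rho> w)) \<le> (\<Sum>k. g k w)"
    if w: "w \<in> space M" for w
  proof -
    define x where "x = d z w / \<rho> z"
    have x1: "x \<ge> 1" using rho_le_d[OF z w] rz by (simp add: x_def)
    obtain k where k: "2 ^ k \<le> x" "x < 2 ^ Suc k"
    proof -
      define n where "n = nat \<lfloor>log 2 x\<rfloor>"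
      have "log 2 x \<ge> 0" using x1 by simp
      then have "real n \<le> log 2 x" "log 2 x < real (Suc n)" unfolding n_def by linarith+
      then have "2 powr real n \<le> x" "x < 2 powr real (Suc n)" using x1
        by (auto simp: le_log_iff log_less_iff)
      then show ?thesis using that[of n] by (simp only: powr_realpow)
    qed
    have dl: "2 ^ k * \<rho> z \<le> d z w" "d z w < 2 * 2 ^ k * \<rho> z" using k rz by (auto simp: x_def field_simps)
    have a1: "d z w powr (- real N) \<le> (2 ^ k * \<rho> z) powr (- real N)"
      using dl rz by (intro powr_mono2') auto
    have a2: "x powr (-1/8) \<le> q ^ k"
    proof -
      have "x powr (-1/8) \<le> (2 ^ k) powr (-1/8)" using k by (intro powr_mono2') auto
      also have "((2::real) ^ k) powr (-1/8) = (2 powr real k) powr (-1/8)" by (subst powr_realpow) auto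
      also have "\<dots> = q powr real k" unfolding q_def powr_powr by (simp only: mult.commute)
      also have "\<dots> = q ^ k" using q by (intro powr_realpow) auto
      finally show ?thesis .
    qed
    have a3: "sqrt (d z w / \<rho> w) \<le> sqrt (2 * 2 ^ k * \<rho> z / \<rho> w)"
      using dl rho_pos[OF w] by (intro real_sqrt_le_mono divide_right_mono) auto
    have "d z w powr (- real N) * x powr (-1/8) * sqrt (d z w / \<rho> w) \<le> c k * sqrt (2 * 2 ^ k * \<rho> z / \<rho> w)"
      unfolding c_def using a1 a2 a3 q rho_pos[OF w] d_pos[OF z w] by (intro mult_mono) auto
    then have "ennreal (d z w powr (- real N) * x powr (-1/8) * sqrt (d z w / \<rho> w)) \<le> g k w"
      using dl w q unfolding g_def
      by (simp add: ennreal_mult[symmetric] c_def rz rho_pos[OF w] less_imp_le)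
    also have "\<dots> \<le> (\<Sum>k. g k w)" using sum_le_suminf[of "\<lambda>k. g k w" "{k}"] by simp
    finally show ?thesis by (simp add: x_def)
  qed
  have "(\<integral>\<^sup>+w. ennreal (d z w powr (- real N) * (d z w / \<rho> z) powr (-1/8) * sqrt (d z w / \<rho> w)) \<partial>M)
    \<le> (\<integral>\<^sup>+w. (\<Sum>k. g k w) \<partial>M)" by (intro nn_integral_mono le)
  also have "\<dots> = (\<Sum>k. \<integral>\<^sup>+w. g k w \<partial>M)" by (intro nn_integral_suminf) measurable
  also have "\<dots> \<le> (\<Sum>k. ennreal (2 ^ N * C0 * q ^ k))"
  proof (intro suminf_le allI)
    fix k
    have "(\<integral>\<^sup>+w. g k w \<partial>M) = ennreal (c k) * (\<integral>\<^sup>+w. ennreal (sqrt (2 * 2 ^ k * \<rho> z / \<rho> w)) * indicator (Q z (2 * 2 ^ k * \<rho> z)) w \<partial>M)"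
      unfolding g_def by (intro nn_integral_cmult) measurable
    also have "\<dots> \<le> ennreal (c k) * ennreal (C0 * (2 * 2 ^ k * \<rho> z) ^ N)"
      using rz z by (intro mult_left_mono tent_upper) auto
    also have "\<dots> = ennreal (2 ^ N * C0 * q ^ k)"
      using rz q C0_pos by (simp add: ennreal_mult[symmetric] c_def powr_minus powr_realpow field_simps power_mult_distrib)
    finally show "(\<integral>\<^sup>+w. g k w \<partial>M) \<le> ennreal (2 ^ N * C0 * q ^ k)" .
  qed auto
  also have "\<dots> = ennreal (\<Sum>k. 2 ^ N * C0 * q ^ k)"
    using q C0_pos by (intro suminf_ennreal2) (auto intro!: summable_mult summable_geometric)
  also have "(\<Sum>k. 2 ^ N * C0 * q ^ k) = 2 ^ N * C0 * (\<Sum>k. q ^ k)"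
    using q by (intro suminf_mult summable_geometric) auto
  finally show ?thesis by (simp add: q_def)
qed

definition schur_const :: real where
  "schur_const = 8 * (2 ^ N * C0 * (\<Sum>k. (2 powr (-1/8)) ^ k))"

lemma schur_const_pos: "0 < schur_const"
proof -
  have "summable (\<lambda>k. ((2::real) powr (-1/8)) ^ k)" 
    using two_powr_neg_less_1 by (intro summable_geometric) auto
  then have "0 < (\<Sum>k. ((2::real) powr (-1/8)) ^ k)" by (intro suminf_pos) auto
  then show ?thesis using C0_pos by (simp add: schur_const_def)
qed

text \<open>The test function is \<open>\<rho> powr (-1/4)\<close>. With
  \<open>x = d / \<rho> z\<close> and \<open>y = d / \<rho> w\<close> the weight is
  \<open>(y / x) powr (1/4)\<close>; the logarithms cost \<open>x powr (1/8) * y powr (1/8)\<close>,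
  so \<open>x\<close> keeps the negative exponent \<open>-1/8\<close> and \<open>y\<close> gets
  \<open>3/8\<close>, below the \<open>1/2\<close> that tents integrate.\<close>

lemma schur_test:
  assumes z: "z \<in> space M"
  shows "(\<integral>\<^sup>+w. ennreal (K z w * (\<rho> z / \<rho> w) powr (1/4)) \<partial>M) \<le> ennreal schur_const"
proof -
  have [measurable]: "(\<lambda>w. d z w) \<in> borel_measurable M" using z by measurable
  have "(\<integral>\<^sup>+w. ennreal (K z w * (\<rho> z / \<rho> w) powr (1/4)) \<partial>M) \<le>
    (\<integral>\<^sup>+w. 8 * ennreal (d z w powr (- real N) * (d z w / \<rho> z) powr (-1/8) * sqrt (d z w / \<rho> w)) \<partial>M)"
  proof (intro nn_integral_mono)
    fix w assume w: "w \<in> space M"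
    define x y where "x = d z w / \<rho> z" and "y = d z w / \<rho> w"
    have p: "\<rho> z > 0" "\<rho> w > 0" "d z w > 0" using rho_pos d_pos z w by auto
    have x1: "x \<ge> 1" using rho_le_d[OF z w] p by (simp add: x_def)
    have y1: "y \<ge> 1" using rho_le_d'[OF z w] p by (simp add: y_def)
    \<comment> \<open>Eight times the left side is \<open>8 + ln x + ln y\<close>, which dominates
      \<open>L\<close>.\<close>
    have "1 + (ln x / 8 + ln y / 8) \<le> exp (ln x / 8 + ln y / 8)" by (rule exp_ge_add_one_self)
    also have "\<dots> = x powr (1/8) * y powr (1/8)" using x1 y1 by (simp add: powr_def exp_add)
    finally have Lle: "L z w \<le> 8 * (x powr (1/8) * y powr (1/8))" by (simp add: L_def x_def y_def)
    have r: "\<rho> z / \<rho> w = y / x" using p by (simp add: x_def y_def)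
    have "K z w * (\<rho> z / \<rho> w) powr (1/4) = L z w * (d z w powr (- real N) * (y / x) powr (1/4))"
      using p by (simp add: K_def r powr_minus powr_realpow field_simps)
    also have "\<dots> \<le> 8 * (x powr (1/8) * y powr (1/8)) * (d z w powr (- real N) * (y / x) powr (1/4))"
      by (intro mult_right_mono Lle) auto
    also have "\<dots> = 8 * (d z w powr (- real N) * (x powr (-1/8) * y powr (3/8)))"
    proof -
      have "x powr (1/8) * y powr (1/8) * (y / x) powr (1/4) = (x powr (1/8) / x powr (1/4)) * (y powr (1/8) * y powr (1/4))"
        using x1 y1 by (simp add: powr_divide)
      also have "\<dots> = x powr (-1/8) * y powr (3/8)" by (simp flip: powr_diff powr_add)
      finally show ?thesis by (simp add: algebra_simps)
    qed
    also have "\<dots> \<le> 8 * (d z w powr (- real N) * (x powr (-1/8) * y powr (1/2)))"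
      using y1 by (intro mult_left_mono powr_mono) auto
    finally have "K z w * (\<rho> z / \<rho> w) powr (1/4) \<le> 8 * (d z w powr (- real N) * x powr (-1/8) * sqrt y)"
      using y1 by (simp add: powr_half_sqrt mult.assoc)
    then show "ennreal (K z w * (\<rho> z / \<rho> w) powr (1/4)) \<le>
        8 * ennreal (d z w powr (- real N) * (d z w / \<rho> z) powr (-1/8) * sqrt (d z w / \<rho> w))"
      unfolding x_def y_def by (metis ennreal_leI ennreal_mult'' ennreal_numeral zero_le_numeral ennreal_mult' )
  qed
  also have "\<dots> = 8 * (\<integral>\<^sup>+w. ennreal (d z w powr (- real N) * (d z w / \<rho> z) powr (-1/8) * sqrt (d z w / \<rho> w)) \<partial>M)"
    by (intro nn_integral_cmult) measurable
  also have "\<dots> \<le> 8 * ennreal (2 ^ N * C0 * (\<Sum>k. (2 powr (-1/8)) ^ k))"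
    by (intro mult_left_mono nn_integral_geometric_tents z) auto
  also have "\<dots> = ennreal schur_const" unfolding schur_const_def
    by (metis ennreal_mult' ennreal_numeral zero_le_numeral)
  finally show ?thesis .
qed

text \<open>For a bounded density the weak-type bound comes from splitting
  \<open>g \<le> \<epsilon> (\<rho> z / \<rho> w)\<^sup>1\<^sup>/\<^sup>4 + g / (\<epsilon> (\<rho> z / \<rho> w)\<^sup>1\<^sup>/\<^sup>4)\<close>: the Schur test makes the first
  contribution small at every point and the second one small in mean.\<close>

lemma weak_type_bounded_density:
  assumes [measurable]: "g \<in> borel_measurable M" and g1: "\<And>w. w \<in> space M \<Longrightarrow> g w \<le> 1" and t: "0 < t"
  shows "emeasure M {z \<in> space M. ennreal t < T g z} \<le> ennreal ((2 * schur_const / t)\<^sup>2) * (\<integral>\<^sup>+w. g w \<partial>M)"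
proof -
  \<comment> \<open>With this choice the Schur test bounds the first part of the splitting by
    \<open>t / 2\<close>, so a superlevel point of \<open>T g\<close> must have
    \<open>U z / \<epsilon> > t / 2\<close>.\<close>
  define \<epsilon> where "\<epsilon> = t / (2 * schur_const)"
  have \<epsilon>: "\<epsilon> > 0" using t schur_const_pos by (simp add: \<epsilon>_def)
  define X where "X z w = (\<rho> z / \<rho> w) powr (1/4)" for z w
  have Xp: "X z w > 0" if "z \<in> space M" "w \<in> space M" for z w
    using that rho_pos[of z] rho_pos[of w] by (auto simp: X_def)
  define U where "U z = (\<integral>\<^sup>+w. ennreal (K z w / X z w) * g w \<partial>M)" for z
  have [measurable]: "U \<in> borel_measurable M" unfolding U_def X_def by measurable
  have sub: "{z \<in> space M. ennreal t < T g z} \<subseteq> {z \<in> space M. 1 \<le> ennreal (2 / (\<epsilon> * t)) * U z}"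
  proof safe
    fix z assume z: "z \<in> space M" and tz: "ennreal t < T g z"
    have [measurable]: "(\<lambda>w. K z w) \<in> borel_measurable M" "(\<lambda>w. X z w) \<in> borel_measurable M"
      using z unfolding X_def by measurable
    have "T g z \<le> (\<integral>\<^sup>+w. ennreal \<epsilon> * ennreal (K z w * X z w) + ennreal (1 / \<epsilon>) * (ennreal (K z w / X z w) * g w) \<partial>M)"
      unfolding T_def
    proof (intro nn_integral_mono)
      fix w assume w: "w \<in> space M"
      note p = Xp[OF z w] K_pos[OF z w]
      show "ennreal (K z w) * g w \<le> ennreal \<epsilon> * ennreal (K z w * X z w) + ennreal (1 / \<epsilon>) * (ennreal (K z w / X z w) * g w)"
      proof (cases "\<epsilon> * X z w \<ge> 1")
        case True
        have "ennreal (K z w) * g w \<le> ennreal (K z w) * 1" using g1[OF w] by (intro mult_left_mono) auto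
        also have "\<dots> \<le> ennreal (\<epsilon> * (K z w * X z w))"
          using mult_left_mono[OF True, of "K z w"] p by (simp add: algebra_simps ennreal_leI)
        also have "\<dots> = ennreal \<epsilon> * ennreal (K z w * X z w)" using p \<epsilon> by (intro ennreal_mult) auto
        finally show ?thesis by (simp add: add_increasing2)
      next
        case False
        then have "K z w \<le> 1 / \<epsilon> * (K z w / X z w)" using p \<epsilon> by (simp add: field_simps)
        then have "ennreal (K z w) * g w \<le> ennreal (1 / \<epsilon> * (K z w / X z w)) * g w"
          by (intro mult_right_mono ennreal_leI) auto
        also have "\<dots> = ennreal (1 / \<epsilon>) * (ennreal (K z w / X z w) * g w)"
          using p \<epsilon> by (subst ennreal_mult) (auto simp: mult.assoc)
        finally show ?thesis by (simp add: add_increasing)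
      qed
    qed
    also have "\<dots> = ennreal \<epsilon> * (\<integral>\<^sup>+w. ennreal (K z w * X z w) \<partial>M) + ennreal (1 / \<epsilon>) * U z"
      unfolding U_def by (subst nn_integral_add) (auto simp: nn_integral_cmult)
    also have "\<dots> \<le> ennreal \<epsilon> * ennreal schur_const + ennreal (1 / \<epsilon>) * U z"
      using schur_test[OF z] unfolding X_def by (intro add_mono mult_left_mono) auto
    also have "ennreal \<epsilon> * ennreal schur_const = ennreal (t / 2)"
      using \<epsilon> schur_const_pos by (simp add: ennreal_mult[symmetric] \<epsilon>_def)
    finally have *: "ennreal t < ennreal (t / 2) + ennreal (1 / \<epsilon>) * U z" using tz by simp
    show "1 \<le> ennreal (2 / (\<epsilon> * t)) * U z"
    proof (cases "U z")
      case (real x)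
      then have "t < t / 2 + 1 / \<epsilon> * x" using * t \<epsilon>
        by (simp add: ennreal_mult[symmetric] ennreal_plus[symmetric] del: ennreal_plus)
           (metis (no_types, lifting) ennreal_less_iff less_eq_real_def add_nonneg_nonneg divide_nonneg_nonneg)
      then have "1 \<le> 2 / (\<epsilon> * t) * x" using t \<epsilon> by (simp add: field_simps)
      then show ?thesis using real t \<epsilon> by (simp add: ennreal_mult[symmetric])
    next
      case top
      then show ?thesis using t \<epsilon> by (simp add: ennreal_mult_top)
    qed
  qed
  \<comment> \<open>By the symmetry of \<open>K\<close> and
    \<open>1 / X z w = (\<rho> w / \<rho> z) powr (1/4)\<close> the inner integral over
    \<open>z\<close> is again a Schur integral, now based at \<open>w\<close>.\<close>
  have "(\<integral>\<^sup>+z. U z \<partial>M) = (\<integral>\<^sup>+w. (\<integral>\<^sup>+z. ennreal (K z w / X z w) * g w \<partial>M) \<partial>M)"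
  proof -
    interpret pair_sigma_finite M M ..
    show ?thesis unfolding U_def X_def by (intro Fubini'[symmetric]) measurable
  qed
  also have "\<dots> \<le> (\<integral>\<^sup>+w. ennreal schur_const * g w \<partial>M)"
  proof (intro nn_integral_mono)
    fix w assume w: "w \<in> space M"
    have [measurable]: "(\<lambda>z. K z w / X z w) \<in> borel_measurable M" using w unfolding X_def by measurable
    have "(\<integral>\<^sup>+z. ennreal (K z w / X z w) * g w \<partial>M) = (\<integral>\<^sup>+z. ennreal (K z w / X z w) \<partial>M) * g w"
      by (intro nn_integral_multc) measurable
    also have "(\<integral>\<^sup>+z. ennreal (K z w / X z w) \<partial>M) = (\<integral>\<^sup>+z. ennreal (K w z * (\<rho> w / \<rho> z) powr (1/4)) \<partial>M)"
    proof (intro nn_integral_cong)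
      fix z assume z: "z \<in> space M"
      have "1 / X z w = (\<rho> w / \<rho> z) powr (1/4)" using rho_pos[OF z] rho_pos[OF w]
        by (simp add: X_def powr_divide)
      then show "ennreal (K z w / X z w) = ennreal (K w z * (\<rho> w / \<rho> z) powr (1/4))"
        using K_sym[OF z w] by (metis times_divide_eq_right mult.right_neutral)
    qed
    also have "\<dots> \<le> ennreal schur_const" by (rule schur_test[OF w])
    finally show "(\<integral>\<^sup>+z. ennreal (K z w / X z w) * g w \<partial>M) \<le> ennreal schur_const * g w"
      by (simp add: mult_right_mono)
  qed
  also have "\<dots> = ennreal schur_const * (\<integral>\<^sup>+w. g w \<partial>M)" by (intro nn_integral_cmult) measurable
  finally have I: "(\<integral>\<^sup>+z. U z \<partial>M) \<le> ennreal schur_const * (\<integral>\<^sup>+w. g w \<partial>M)" .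
  have "emeasure M {z \<in> space M. ennreal t < T g z} \<le> emeasure M {z \<in> space M. 1 \<le> ennreal (2 / (\<epsilon> * t)) * U z}"
    by (intro emeasure_mono sub) measurable
  also have "\<dots> \<le> ennreal (2 / (\<epsilon> * t)) * (\<integral>\<^sup>+z. U z * indicator (space M) z \<partial>M)"
    by (intro nn_integral_Markov_inequality) auto
  also have "\<dots> = ennreal (2 / (\<epsilon> * t)) * (\<integral>\<^sup>+z. U z \<partial>M)"
    by (intro arg_cong2[where f = "(*)"] nn_integral_cong) auto
  also have "\<dots> \<le> ennreal (2 / (\<epsilon> * t)) * (ennreal schur_const * (\<integral>\<^sup>+w. g w \<partial>M))"
    by (intro mult_left_mono I) auto
  also have "ennreal (2 / (\<epsilon> * t)) * (ennreal schur_const * (\<integral>\<^sup>+w. g w \<partial>M)) = ennreal ((2 * schur_const / t)\<^sup>2) * (\<integral>\<^sup>+w. g w \<partial>M)"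
  proof -
    have "2 / (\<epsilon> * t) * schur_const = (2 * schur_const / t)\<^sup>2"
      using t schur_const_pos by (simp add: \<epsilon>_def power2_eq_square)
    then have "ennreal (2 / (\<epsilon> * t)) * ennreal schur_const = ennreal ((2 * schur_const / t)\<^sup>2)"
      using \<epsilon> t schur_const_pos by (subst ennreal_mult[symmetric]) auto
    then show ?thesis by (simp only: mult.assoc[symmetric])
  qed
  finally show ?thesis .
qed


end

lemma ennreal_numeral_mult: "ennreal (numeral k * x) = numeral k * ennreal x"
  using ennreal_mult'[of "numeral k" x] by simp

lemma ennreal_mult3:
  "0 \<le> a \<Longrightarrow> 0 \<le> b \<Longrightarrow> 0 \<le> c \<Longrightarrow> ennreal a * ennreal b * ennreal c = ennreal (a * b * c)"
  by (simp add: ennreal_mult)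

lemma ennreal_le_of_mult_le:
  assumes "0 < \<alpha>" "0 \<le> \<beta>" "I * ennreal \<alpha> \<le> ennreal \<beta> * J"
  shows "I \<le> ennreal (\<beta> / \<alpha>) * J"
proof -
  have "I = I * (ennreal \<alpha> * ennreal (1 / \<alpha>))" using assms by (simp add: ennreal_mult[symmetric])
  also have "\<dots> = (I * ennreal \<alpha>) * ennreal (1 / \<alpha>)" by (simp add: mult.assoc)
  also have "\<dots> \<le> (ennreal \<beta> * J) * ennreal (1 / \<alpha>)" by (intro mult_right_mono assms) auto
  also have "\<dots> = (ennreal \<beta> * ennreal (1 / \<alpha>)) * J" by (simp add: mult_ac)
  also have "ennreal \<beta> * ennreal (1 / \<alpha>) = ennreal (\<beta> / \<alpha>)" using assms by (simp add: ennreal_mult[symmetric])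
  finally show ?thesis .
qed

section \<open>Distant tents and smeared densities\<close>

context tent_space begin

text \<open>Seen from a distant \<open>z\<close> the kernel is constant on the tent up to the factor
  \<open>1 + ln (68 * r / \<rho> w)\<close>. \<open>mult_one_plus_ln_le\<close> pairs this logarithm
  with \<open>F\<close>: the \<open>L log L\<close> part is controlled by \<open>m\<close>, the
  square root by \<open>tent_upper\<close>. Hence the mass of \<open>F\<close> in the big tent acts
  like a multiple of \<open>r ^ N\<close>, which can be spread evenly over
  \<open>Q a r\<close>.\<close>

lemma tent_contribution:
  assumes [measurable]: "F \<in> borel_measurable M" and F0: "\<And>w. w \<in> space M \<Longrightarrow> 0 \<le> F w"
    and a: "a \<in> space M" "2 * \<rho> a \<le> r" "r \<le> 1"
    and m: "(\<integral>\<^sup>+w. ennreal (F w * (1 + log_plus (F w))) * indicator (Q a (68 * r)) w \<partial>M) \<le> ennreal ((68 * r) ^ N)"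
    and z: "z \<in> space M" "544 * r \<le> d z a"
  shows "(\<integral>\<^sup>+w. ennreal (K z w) * (ennreal (F w) * indicator (Q a (68 * r)) w) \<partial>M) \<le>
    ennreal (64 ^ N * (1 + 2 * ln 64) * (4 * (1 + C0) * 68 ^ N) * 2 ^ N / c0) * (\<integral>\<^sup>+u. ennreal (K z u) * indicator (Q a r) u \<partial>M)"
    (is "?I \<le> _ * ?J")
proof -
  define C2 :: real where "C2 = 64 ^ N * (1 + 2 * ln 64)"
  define C3 where "C3 = 4 * (1 + C0) * 68 ^ N"
  have C2: "C2 > 0" unfolding C2_def by (intro mult_pos_pos add_pos_nonneg) auto
  have C3: "C3 > 0" using C0_pos unfolding C3_def by (intro mult_pos_pos add_pos_pos) auto
  have r: "r > 0" using rho_pos[OF a(1)] a by linarith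
  have lpm [measurable]: "(\<lambda>w. log_plus (F w)) \<in> borel_measurable M" unfolding log_plus_def by measurable
  have [measurable]: "Q a s \<in> sets M" for s using a by measurable
  have [measurable]: "(\<lambda>w. K z w) \<in> borel_measurable M" using z by measurable
  have Y: "(\<integral>\<^sup>+w. ennreal (F w * (1 + ln (68 * r / \<rho> w))) * indicator (Q a (68 * r)) w \<partial>M) \<le> ennreal (C3 * r ^ N)"
  proof -
    have "(\<integral>\<^sup>+w. ennreal (F w * (1 + ln (68 * r / \<rho> w))) * indicator (Q a (68 * r)) w \<partial>M) \<le>
      (\<integral>\<^sup>+w. 4 * (ennreal (F w * (1 + log_plus (F w))) * indicator (Q a (68 * r)) w) +
              4 * (ennreal (sqrt (68 * r / \<rho> w)) * indicator (Q a (68 * r)) w) \<partial>M)"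
    proof (intro nn_integral_mono)
      fix w assume w: "w \<in> space M"
      show "ennreal (F w * (1 + ln (68 * r / \<rho> w))) * indicator (Q a (68 * r)) w \<le>
        4 * (ennreal (F w * (1 + log_plus (F w))) * indicator (Q a (68 * r)) w) +
        4 * (ennreal (sqrt (68 * r / \<rho> w)) * indicator (Q a (68 * r)) w)"
      proof (cases "w \<in> Q a (68 * r)")
        case True
        then have "1 \<le> 68 * r / \<rho> w" using rho_le_d'[OF a(1) w] rho_pos[OF w] by simp
        then have "F w * (1 + ln (68 * r / \<rho> w)) \<le> 4 * (F w * (1 + log_plus (F w))) + 4 * sqrt (68 * r / \<rho> w)"
          by (intro mult_one_plus_ln_le F0 w)
        moreover have "0 \<le> F w * (1 + log_plus (F w))" using F0[OF w] by (simp add: log_plus_def)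
        moreover have "0 \<le> sqrt (68 * r / \<rho> w)" using r rho_pos[OF w] by simp
        ultimately have "ennreal (F w * (1 + ln (68 * r / \<rho> w))) \<le>
          ennreal (4 * (F w * (1 + log_plus (F w)))) + ennreal (4 * sqrt (68 * r / \<rho> w))"
          by (metis (no_types) ennreal_leI ennreal_plus mult_nonneg_nonneg zero_le_numeral)
        then have "ennreal (F w * (1 + ln (68 * r / \<rho> w))) \<le>
          4 * ennreal (F w * (1 + log_plus (F w))) + 4 * ennreal (sqrt (68 * r / \<rho> w))"
          by (simp only: ennreal_numeral_mult)
        then show ?thesis using True by simp
      qed auto
    qed
    also have "\<dots> = 4 * (\<integral>\<^sup>+w. ennreal (F w * (1 + log_plus (F w))) * indicator (Q a (68 * r)) w \<partial>M) +
      4 * (\<integral>\<^sup>+w. ennreal (sqrt (68 * r / \<rho> w)) * indicator (Q a (68 * r)) w \<partial>M)"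
      by (subst nn_integral_add, measurable) (subst nn_integral_cmult, measurable)+
    also have "\<dots> \<le> 4 * ennreal ((68 * r) ^ N) + 4 * ennreal (C0 * (68 * r) ^ N)"
      using r a by (intro add_mono mult_left_mono m tent_upper) auto
    also have "\<dots> = ennreal (4 * (68 * r) ^ N + 4 * (C0 * (68 * r) ^ N))"
      using r C0_pos by (simp add: ennreal_numeral_mult)
    also have "4 * (68 * r) ^ N + 4 * (C0 * (68 * r) ^ N) = C3 * r ^ N"
      by (simp add: C3_def power_mult_distrib algebra_simps)
    finally show ?thesis .
  qed
  have I: "?I \<le> ennreal (C2 * C3 * r ^ N) * ennreal (K z u)" if u: "u \<in> Q a r" for u
  proof -
    have uX: "u \<in> space M" and du: "d a u < r" using u by auto
    have "?I \<le> (\<integral>\<^sup>+w. ennreal (C2 * K z u) * (ennreal (F w * (1 + ln (68 * r / \<rho> w))) * indicator (Q a (68 * r)) w) \<partial>M)"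
    proof (intro nn_integral_mono)
      fix w assume w: "w \<in> space M"
      show "ennreal (K z w) * (ennreal (F w) * indicator (Q a (68 * r)) w) \<le>
        ennreal (C2 * K z u) * (ennreal (F w * (1 + ln (68 * r / \<rho> w))) * indicator (Q a (68 * r)) w)"
      proof (cases "w \<in> Q a (68 * r)")
        case True
        then have dw: "d a w < 68 * r" by auto
        \<comment> \<open>As \<open>544 = 8 * 68\<close>, \<open>d z a\<close> exceeds 8 times every
          distance from \<open>a\<close> in the big tent. Both \<open>d z w\<close> and
          \<open>d z u\<close> are then comparable to \<open>d z a\<close>, and 64 bounds the
          ratios.\<close>
        have "d z w \<le> 4 * (d z a + d a w)" "d z a \<le> 4 * (d z w + d w a)"
          "d z u \<le> 4 * (d z a + d a u)" "d z a \<le> 4 * (d z u + d u a)"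
          using d_tri z w a uX by auto
        then have "d z w \<le> 64 * d z u \<and> d z u \<le> 64 * d z w"
          using dw du z(2) r d_sym[OF a(1) w] d_sym[OF a(1) uX] by argo
        then have dd: "d z w \<le> 64 * d z u" "d z u \<le> 64 * d z w" by auto
        have y1: "1 \<le> 68 * r / \<rho> w" using dw rho_le_d'[OF a(1) w] rho_pos[OF w] by simp
        have "\<rho> u \<le> 68 * r / \<rho> w * \<rho> w" using du rho_le_d'[OF a(1) uX] r rho_pos[OF w] by simp
        then have "K z w \<le> C2 * (1 + ln (68 * r / \<rho> w)) * K z u" unfolding C2_def
          using dd y1 z w uX by (intro K_le) auto
        then have "K z w * F w \<le> (C2 * (1 + ln (68 * r / \<rho> w)) * K z u) * F w"
          using F0[OF w] by (intro mult_right_mono)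
        then have "K z w * F w \<le> (C2 * K z u) * (F w * (1 + ln (68 * r / \<rho> w)))" by (simp add: mult_ac)
        then show ?thesis using True C2 K_pos[OF z(1) uX] K_pos[OF z(1) w] F0[OF w] y1
          by (simp add: ennreal_mult[symmetric])
      qed auto
    qed
    also have "\<dots> = ennreal (C2 * K z u) * (\<integral>\<^sup>+w. ennreal (F w * (1 + ln (68 * r / \<rho> w))) * indicator (Q a (68 * r)) w \<partial>M)"
      by (intro nn_integral_cmult) measurable
    also have "\<dots> \<le> ennreal (C2 * K z u) * ennreal (C3 * r ^ N)" by (intro mult_left_mono Y) auto
    also have "\<dots> = ennreal (C2 * C3 * r ^ N) * ennreal (K z u)"
      using C2 C3 r K_pos[OF z(1) uX] by (simp add: ennreal_mult[symmetric] mult_ac)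
    finally show ?thesis .
  qed
  \<comment> \<open>The left side of the bound \<open>I\<close> does not depend on \<open>u\<close>:
    integrating over \<open>Q a r\<close> and dividing by the lower bound for its volume turns the
    pointwise bound into one by \<open>?J\<close>.\<close>
  have "?I * ennreal (c0 * (r / 2) ^ N) \<le> ?I * emeasure M (Q a r)"
    using a by (intro mult_left_mono measure_tent_lower) auto
  also have "\<dots> = (\<integral>\<^sup>+u. ?I * indicator (Q a r) u \<partial>M)" by (intro nn_integral_cmult_indicator[symmetric]) measurable
  also have "\<dots> \<le> (\<integral>\<^sup>+u. ennreal (C2 * C3 * r ^ N) * (ennreal (K z u) * indicator (Q a r) u) \<partial>M)"
    using I by (intro nn_integral_mono) (auto simp: indicator_def)
  also have "\<dots> = ennreal (C2 * C3 * r ^ N) * ?J" by (intro nn_integral_cmult) measurable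
  finally have "?I \<le> ennreal (C2 * C3 * r ^ N / (c0 * (r / 2) ^ N)) * ?J"
    using c0_pos C2 C3 r by (intro ennreal_le_of_mult_le) auto
  also have "C2 * C3 * r ^ N / (c0 * (r / 2) ^ N) = C2 * C3 * 2 ^ N / c0" using r by (simp add: power_divide)
  finally show ?thesis by (simp add: C2_def C3_def)
qed

text \<open>Smearing the density over \<open>Q u (12 * \<rho> u)\<close> makes it bounded; the restriction
  \<open>\<rho> u < 2 * \<rho> w\<close> keeps the smeared mass of a point finite.\<close>

lemma smeared_density:
  fixes F :: "'a \<Rightarrow> ennreal"
  assumes [measurable]: "F \<in> borel_measurable M"
    and F: "\<And>u. u \<in> space M \<Longrightarrow> (\<integral>\<^sup>+w. F w * indicator (Q u (12 * \<rho> u)) w \<partial>M) \<le> ennreal ((12 * \<rho> u) ^ N)"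
  obtains g where "g \<in> borel_measurable M" "\<And>u. u \<in> space M \<Longrightarrow> g u \<le> 1"
    "(\<integral>\<^sup>+u. g u \<partial>M) \<le> ennreal (C0 * 24 ^ N) * (\<integral>\<^sup>+w. F w \<partial>M)"
    "\<And>z. z \<in> space M \<Longrightarrow> T F z \<le> ennreal (52 ^ N * (1 + 2 * ln 52) * (1 + ln 2) * 24 ^ N / c0) * T g z"
proof -
  interpret pair_sigma_finite M M ..
  \<comment> \<open>The relation makes the heights comparable:
    \<open>\<rho> w \<le> d u w < 12 * \<rho> u\<close> and \<open>\<rho> u < 2 * \<rho> w\<close>.
    The numbers come from \<open>tent_lower\<close> at \<open>r = \<rho> w\<close>, where
    \<open>d w u < 2 * \<rho> w\<close> and \<open>\<rho> w < 6 * \<rho> u\<close>.\<close>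
  define S where "S u w \<longleftrightarrow> d u w < 12 * \<rho> u \<and> \<rho> u < 2 * \<rho> w" for u w
  have [measurable]: "Measurable.pred (M \<Otimes>\<^sub>M M) (\<lambda>(u, w). S u w)" unfolding S_def split_beta by measurable
  define k where "k u w = ennreal (1 / (12 * \<rho> u) ^ N) * (F w * (if S u w then 1 else 0))" for u w
  have km [measurable]: "(\<lambda>(u, w). k u w) \<in> borel_measurable (M \<Otimes>\<^sub>M M)"
    unfolding k_def split_beta S_def by measurable
  define g where "g u = (\<integral>\<^sup>+w. k u w \<partial>M)" for u
  have gm [measurable]: "g \<in> borel_measurable M" unfolding g_def by measurable
  have Sm1 [measurable]: "Measurable.pred M (\<lambda>w. S u w)" if "u \<in> space M" for u
    using that unfolding S_def by measurable
  have Sm2 [measurable]: "Measurable.pred M (\<lambda>u. S u w)" if "w \<in> space M" for w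
    using that unfolding S_def by measurable
  show ?thesis
  proof (rule that[OF gm])
    fix u assume u: "u \<in> space M"
    have p: "(12 * \<rho> u) ^ N > 0" using rho_pos[OF u] by simp
    have [measurable]: "Q u (12 * \<rho> u) \<in> sets M" using u by measurable
    have "g u \<le> (\<integral>\<^sup>+w. ennreal (1 / (12 * \<rho> u) ^ N) * (F w * indicator (Q u (12 * \<rho> u)) w) \<partial>M)"
      unfolding g_def k_def by (intro nn_integral_mono mult_left_mono) (auto simp: S_def indicator_def)
    also have "\<dots> = ennreal (1 / (12 * \<rho> u) ^ N) * (\<integral>\<^sup>+w. F w * indicator (Q u (12 * \<rho> u)) w \<partial>M)"
      by (intro nn_integral_cmult) measurable
    also have "\<dots> \<le> ennreal (1 / (12 * \<rho> u) ^ N) * ennreal ((12 * \<rho> u) ^ N)" by (intro mult_left_mono F u) auto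
    also have "\<dots> = 1" using p rho_pos[OF u] by (simp add: ennreal_mult[symmetric])
    finally show "g u \<le> 1" .
  next
    have "(\<integral>\<^sup>+u. g u \<partial>M) = (\<integral>\<^sup>+w. (\<integral>\<^sup>+u. k u w \<partial>M) \<partial>M)"
      unfolding g_def by (intro Fubini'[symmetric]) measurable
    also have "\<dots> \<le> (\<integral>\<^sup>+w. ennreal (C0 * 24 ^ N) * F w \<partial>M)"
    proof (intro nn_integral_mono)
      fix w assume w: "w \<in> space M"
      have rw: "\<rho> w > 0" using rho_pos[OF w] .
      have [measurable]: "Q w (24 * \<rho> w) \<in> sets M" using w by measurable
      have "(\<integral>\<^sup>+u. k u w \<partial>M) \<le> (\<integral>\<^sup>+u. (ennreal (1 / \<rho> w ^ N) * F w) * indicator (Q w (24 * \<rho> w)) u \<partial>M)"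
      proof (intro nn_integral_mono)
        fix u assume u: "u \<in> space M"
        show "k u w \<le> (ennreal (1 / \<rho> w ^ N) * F w) * indicator (Q w (24 * \<rho> w)) u"
        proof (cases "S u w")
          case True
          then have "\<rho> w \<le> 12 * \<rho> u" "u \<in> Q w (24 * \<rho> w)"
            using rho_le_d'[OF u w] d_sym[OF u w] u by (auto simp: S_def)
          then have "1 / (12 * \<rho> u) ^ N \<le> 1 / \<rho> w ^ N" using rw by (intro divide_left_mono power_mono) auto
          then show ?thesis using True \<open>u \<in> Q w (24 * \<rho> w)\<close>
            by (simp add: k_def mult_right_mono ennreal_leI)
        qed (simp add: k_def)
      qed
      also have "\<dots> = (ennreal (1 / \<rho> w ^ N) * F w) * emeasure M (Q w (24 * \<rho> w))"
        by (intro nn_integral_cmult_indicator) measurable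
      also have "\<dots> \<le> (ennreal (1 / \<rho> w ^ N) * F w) * ennreal (C0 * (24 * \<rho> w) ^ N)"
        using rw w by (intro mult_left_mono measure_tent) auto
      also have "\<dots> = (ennreal (1 / \<rho> w ^ N) * ennreal (C0 * (24 * \<rho> w) ^ N)) * F w" by (simp add: mult_ac)
      also have "ennreal (1 / \<rho> w ^ N) * ennreal (C0 * (24 * \<rho> w) ^ N) = ennreal (C0 * 24 ^ N)"
        using rw C0_pos by (simp add: ennreal_mult[symmetric] power_mult_distrib)
      finally show "(\<integral>\<^sup>+u. k u w \<partial>M) \<le> ennreal (C0 * 24 ^ N) * F w" .
    qed
    also have "\<dots> = ennreal (C0 * 24 ^ N) * (\<integral>\<^sup>+w. F w \<partial>M)" by (intro nn_integral_cmult) measurable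
    finally show "(\<integral>\<^sup>+u. g u \<partial>M) \<le> ennreal (C0 * 24 ^ N) * (\<integral>\<^sup>+w. F w \<partial>M)" .
  next
    fix z assume z: "z \<in> space M"
    define C' :: real where "C' = 52 ^ N * (1 + 2 * ln 52) * (1 + ln 2)"
    have C': "C' > 0" unfolding C'_def by (intro mult_pos_pos add_pos_nonneg) auto
    have [measurable]: "(\<lambda>w. K z w) \<in> borel_measurable M" using z by measurable
    have "T g z = (\<integral>\<^sup>+u. (\<integral>\<^sup>+w. ennreal (K z u) * k u w \<partial>M) \<partial>M)"
      unfolding T_def
    proof (intro nn_integral_cong)
      fix u assume u: "u \<in> space M"
      have [measurable]: "(\<lambda>w. k u w) \<in> borel_measurable M" using u unfolding k_def by measurable
      show "ennreal (K z u) * g u = (\<integral>\<^sup>+w. ennreal (K z u) * k u w \<partial>M)"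
        unfolding g_def by (intro nn_integral_cmult[symmetric]) measurable
    qed
    also have "\<dots> = (\<integral>\<^sup>+w. (\<integral>\<^sup>+u. ennreal (K z u) * k u w \<partial>M) \<partial>M)" 
      by (intro Fubini'[symmetric]) measurable
    finally have Tg: "T g z = (\<integral>\<^sup>+w. (\<integral>\<^sup>+u. ennreal (K z u) * k u w \<partial>M) \<partial>M)" .
    have "T F z \<le> (\<integral>\<^sup>+w. ennreal (C' * 24 ^ N / c0) * (\<integral>\<^sup>+u. ennreal (K z u) * k u w \<partial>M) \<partial>M)"
      unfolding T_def
    proof (intro nn_integral_mono)
      fix w assume w: "w \<in> space M"
      have rw: "\<rho> w > 0" using rho_pos[OF w] .
      \<comment> \<open>The set of \<open>tent_lower\<close> at \<open>w\<close>: all its points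
        \<open>u\<close> satisfy \<open>S u w\<close>, and its volume is at least
        \<open>c0 * \<rho> w ^ N\<close>, enough to recover \<open>K z w\<close> from an average of
        \<open>K z u\<close>.\<close>
      define A where "A = {u \<in> space M. d w u < 2 * \<rho> w \<and> \<rho> w < 6 * \<rho> u}"
      have [measurable]: "A \<in> sets M" unfolding A_def using w by measurable
      have pw: "ennreal (K z w / (C' * (24 * \<rho> w) ^ N)) * F w * indicator A u \<le> ennreal (K z u) * k u w"
        if u: "u \<in> space M" for u
      proof (cases "u \<in> A")
        case True
        then have S: "S u w" using rho_le_d'[OF w u] d_sym[OF w u] by (auto simp: S_def A_def)
        have ru: "\<rho> u > 0" using rho_pos[OF u] .
        have "d z w \<le> 4 * (d z u + d u w)" "d z u \<le> 4 * (d z w + d w u)" using d_tri z w u by auto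
        \<comment> \<open>\<open>d u w < 12 * \<rho> u \<le> 12 * d z u\<close>, so the first ratio
          is at most \<open>4 * (1 + 12) = 52\<close>.\<close>
        then have dd: "d z w \<le> 52 * d z u" "d z u \<le> 52 * d z w"
          using S True rho_le_d'[OF z u] rho_le_d'[OF z w] unfolding S_def A_def by auto
        then have "K z w \<le> C' * K z u" unfolding C'_def
          using S z w u by (intro K_le) (auto simp: S_def)
        moreover have "(12 * \<rho> u) ^ N \<le> (24 * \<rho> w) ^ N" using S ru by (intro power_mono) (auto simp: S_def)
        ultimately have "K z w * (12 * \<rho> u) ^ N \<le> (C' * K z u) * (24 * \<rho> w) ^ N"
          using C' K_pos[OF z u] ru by (intro mult_mono) auto
        then have "K z w / (C' * (24 * \<rho> w) ^ N) \<le> K z u * (1 / (12 * \<rho> u) ^ N)"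
          using C' rw ru by (simp add: field_simps)
        then have "ennreal (K z w / (C' * (24 * \<rho> w) ^ N)) * F w \<le> ennreal (K z u * (1 / (12 * \<rho> u) ^ N)) * F w"
          by (intro mult_right_mono ennreal_leI) auto
        also have "\<dots> = ennreal (K z u) * k u w"
          using S K_pos[OF z u] ru by (subst ennreal_mult) (auto simp: k_def mult.assoc)
        finally show ?thesis using True by simp
      qed auto
      have [measurable]: "(\<lambda>u. ennreal (K z u) * k u w) \<in> borel_measurable M"
        using w unfolding k_def by measurable
      have "ennreal (K z w / (C' * (24 * \<rho> w) ^ N)) * F w * ennreal (c0 * \<rho> w ^ N) \<le>
        ennreal (K z w / (C' * (24 * \<rho> w) ^ N)) * F w * emeasure M A"
        unfolding A_def using w rho_le_1[OF w] by (intro mult_left_mono tent_lower) auto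
      also have "\<dots> = (\<integral>\<^sup>+u. ennreal (K z w / (C' * (24 * \<rho> w) ^ N)) * F w * indicator A u \<partial>M)"
        by (intro nn_integral_cmult_indicator[symmetric]) measurable
      also have "\<dots> \<le> (\<integral>\<^sup>+u. ennreal (K z u) * k u w \<partial>M)" by (intro nn_integral_mono pw)
      finally have "ennreal (C' * 24 ^ N / c0) * (ennreal (K z w / (C' * (24 * \<rho> w) ^ N)) * F w * ennreal (c0 * \<rho> w ^ N))
        \<le> ennreal (C' * 24 ^ N / c0) * (\<integral>\<^sup>+u. ennreal (K z u) * k u w \<partial>M)"
        by (intro mult_left_mono) auto
      also have "ennreal (C' * 24 ^ N / c0) * (ennreal (K z w / (C' * (24 * \<rho> w) ^ N)) * F w * ennreal (c0 * \<rho> w ^ N))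
        = (ennreal (C' * 24 ^ N / c0) * ennreal (K z w / (C' * (24 * \<rho> w) ^ N)) * ennreal (c0 * \<rho> w ^ N)) * F w"
        by (simp add: mult_ac)
      also have "ennreal (C' * 24 ^ N / c0) * ennreal (K z w / (C' * (24 * \<rho> w) ^ N)) * ennreal (c0 * \<rho> w ^ N) =
          ennreal (C' * 24 ^ N / c0 * (K z w / (C' * (24 * \<rho> w) ^ N)) * (c0 * \<rho> w ^ N))"
        using C' c0_pos rw K_pos[OF z w] by (intro ennreal_mult3) auto
      also have "C' * 24 ^ N / c0 * (K z w / (C' * (24 * \<rho> w) ^ N)) * (c0 * \<rho> w ^ N) = K z w"
        using C' c0_pos rw by (simp add: power_mult_distrib)
      finally show "ennreal (K z w) * F w \<le> ennreal (C' * 24 ^ N / c0) * (\<integral>\<^sup>+u. ennreal (K z u) * k u w \<partial>M)" .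
    qed
    also have "\<dots> = ennreal (C' * 24 ^ N / c0) * T g z"
      unfolding Tg by (intro nn_integral_cmult) measurable
    finally show "T F z \<le> ennreal (52 ^ N * (1 + 2 * ln 52) * (1 + ln 2) * 24 ^ N / c0) * T g z"
      by (simp add: C'_def)
  qed
qed

end

section \<open>Selection of tents and the L log L inequality\<close>

lemma disjoint_indicators_le_1:
  assumes "pairwise (\<lambda>i j. disjnt (X i) (X j)) I"
  shows "(\<integral>\<^sup>+i. indicator (X i) w \<partial>count_space I) \<le> (1::ennreal)"
proof (cases "\<exists>j\<in>I. w \<in> X j")
  case True
  then obtain j where j: "j \<in> I" "w \<in> X j" by blast
  then have "indicator (X i) w \<le> (indicator {j} i :: ennreal)" if "i \<in> I" for i
    using assms that by (auto simp: indicator_def pairwise_def disjnt_iff)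
  then have "(\<integral>\<^sup>+i. indicator (X i) w \<partial>count_space I) \<le> (\<integral>\<^sup>+i. indicator {j} i \<partial>count_space I)"
    by (intro nn_integral_mono) auto
  also have "\<dots> = 1" using j by simp
  finally show ?thesis .
next
  case False
  then have "(\<integral>\<^sup>+i. indicator (X i) w \<partial>count_space I) = (\<integral>\<^sup>+i. 0 \<partial>count_space I)"
    by (intro nn_integral_cong) (auto simp: indicator_def)
  then show ?thesis by simp
qed

lemma emeasure_UN_countable_le:
  assumes X [measurable]: "\<And>i. i \<in> I \<Longrightarrow> X i \<in> sets M" and I: "countable I"
  shows "emeasure M (\<Union>i\<in>I. X i) \<le> (\<integral>\<^sup>+i. emeasure M (X i) \<partial>count_space I)"
proof -
  have [measurable]: "(\<Union>i\<in>I. X i) \<in> sets M" using X I by (intro sets.countable_UN') auto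
  have "emeasure M (\<Union>i\<in>I. X i) = (\<integral>\<^sup>+w. indicator (\<Union>i\<in>I. X i) w \<partial>M)" by simp
  also have "\<dots> \<le> (\<integral>\<^sup>+w. \<integral>\<^sup>+i. indicator (X i) w \<partial>count_space I \<partial>M)"
  proof (intro nn_integral_mono)
    fix w
    show "indicator (\<Union>i\<in>I. X i) w \<le> (\<integral>\<^sup>+i. indicator (X i) w \<partial>count_space I :: ennreal)"
    proof (cases "\<exists>j\<in>I. w \<in> X j")
      case True
      then obtain j where j: "j \<in> I" "w \<in> X j" by blast
      then show ?thesis using nn_integral_ge_point[OF j(1), of "\<lambda>i. indicator (X i) w"] by (auto simp: indicator_def)
    qed (auto simp: indicator_def)
  qed
  also have "\<dots> = (\<integral>\<^sup>+i. \<integral>\<^sup>+w. indicator (X i) w \<partial>M \<partial>count_space I)"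
    using I by (intro nn_integral_count_space_nn_integral) auto
  also have "\<dots> = (\<integral>\<^sup>+i. emeasure M (X i) \<partial>count_space I)"
    by (intro nn_integral_cong) auto
  finally show ?thesis .
qed

context tent_space begin

text \<open>A tent is bad if its \<open>\<Phi>\<close>-mass exceeds \<open>r ^ N\<close>. Total mass
  below 1 keeps bad radii at most 1, so at each centre a radius can be chosen that is maximal up to
  a factor 2, and the Vitali selection is applied to these tents. Badness makes the radii summable;
  near-maximality makes the dilates harmless.\<close>

lemma tent_family:
  fixes \<Phi> :: "'a \<Rightarrow> ennreal"
  assumes [measurable]: "\<Phi> \<in> borel_measurable M" and small: "(\<integral>\<^sup>+w. \<Phi> w \<partial>M) < 1"
  obtains H where "countable H" "pairwise (\<lambda>i j. disjnt (case_prod Q i) (case_prod Q j)) H"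
    "\<And>a r. (a, r) \<in> H \<Longrightarrow> a \<in> space M \<and> 2 * \<rho> a \<le> r \<and> r \<le> 1"
    "\<And>a r. (a, r) \<in> H \<Longrightarrow> ennreal (r ^ N) < (\<integral>\<^sup>+w. \<Phi> w * indicator (Q a r) w \<partial>M)"
    "\<And>a r. (a, r) \<in> H \<Longrightarrow> (\<integral>\<^sup>+w. \<Phi> w * indicator (Q a (68 * r)) w \<partial>M) \<le> ennreal ((68 * r) ^ N)"
    "\<And>a r. a \<in> space M \<Longrightarrow> 2 * \<rho> a \<le> r \<Longrightarrow>
      ennreal (r ^ N) < (\<integral>\<^sup>+w. \<Phi> w * indicator (Q a r) w \<partial>M) \<Longrightarrow> Q a r \<subseteq> (\<Union>(a, r)\<in>H. Q a (68 * r))"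
proof -
  define m where "m A = (\<integral>\<^sup>+w. \<Phi> w * indicator A w \<partial>M)" for A
  define bad where "bad a r \<longleftrightarrow> a \<in> space M \<and> 2 * \<rho> a \<le> r \<and> ennreal (r ^ N) < m (Q a r)" for a r
  have r1: "r \<le> 1" if "bad a r" for a r
  proof (rule ccontr)
    assume "\<not> r \<le> 1"
    have "m (Q a r) \<le> (\<integral>\<^sup>+w. \<Phi> w \<partial>M)" unfolding m_def by (intro nn_integral_mono) (auto simp: indicator_def)
    moreover have "ennreal (r ^ N) < m (Q a r)" using that by (simp add: bad_def)
    ultimately have "ennreal (r ^ N) < 1" using small by (meson less_le_trans less_trans)
    then have "r ^ N < 1" by simp
    then show False using \<open>\<not> r \<le> 1\<close> by (simp add: not_less one_le_power leD)
  qed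
  have rp: "0 < r" if "bad a r" for a r using that rho_pos[of a] by (auto simp: bad_def)
  \<comment> \<open>No radius from \<open>2 * r\<close> on is bad at the same centre, so the dilate
    \<open>68 * r\<close> of a selected tent is not bad. By \<open>ex\<close> every bad tent lies in
    a tent of \<open>P\<close> with the same centre.\<close>
  define P where "P = {(a, r). bad a r \<and> (\<forall>s\<ge>2 * r. \<not> bad a s)}"
  have ex: "\<exists>s\<ge>r. (a, s) \<in> P" if "bad a r" for a r
  proof -
    let ?S = "{s. r \<le> s \<and> bad a s}"
    have bdd: "bdd_above ?S" using r1 by (intro bdd_aboveI[of _ 1]) auto
    have rS: "r \<in> ?S" using that by simp
    then have "r \<le> Sup ?S" using bdd by (intro cSup_upper) auto
    then have "Sup ?S / 2 < Sup ?S" using rp[OF that] by simp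
    then obtain s where s: "s \<in> ?S" "Sup ?S / 2 < s" using less_cSup_iff[OF _ bdd] rS by blast
    have "\<not> bad a t" if t: "t \<ge> 2 * s" for t
    proof
      assume "bad a t"
      then have "t \<in> ?S" using s t rp[of a s] by auto
      then have "t \<le> Sup ?S" using bdd by (intro cSup_upper)
      then show False using s t by auto
    qed
    then show ?thesis using s by (auto simp: P_def)
  qed
  have ne: "case_prod Q i \<noteq> {}" if "i \<in> P" for i
  proof -
    obtain a r where "i = (a, r)" by (cases i)
    then have i: "i = (a, r)" "bad a r" using that unfolding P_def by blast+
    then have "m (Q a r) \<noteq> 0" by (auto simp: bad_def)
    then show ?thesis using i by (auto simp: m_def simp del: Collect_empty_eq)
  qed
  have bd: "\<And>i. i \<in> P \<Longrightarrow> 0 < snd i \<and> snd i \<le> 1" using rp r1 by (auto simp: P_def)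
  have "\<exists>H\<subseteq>P. pairwise (\<lambda>i j. disjnt (case_prod Q i) (case_prod Q j)) H \<and>
    (\<forall>i\<in>P. \<exists>j\<in>H. \<not> disjnt (case_prod Q i) (case_prod Q j) \<and> snd i \<le> 2 * snd j)"
    by (rule vitali_disjoint_subfamily[where R = 1]) (fact bd, fact ne)
  then obtain H where H: "H \<subseteq> P" and dis: "pairwise (\<lambda>i j. disjnt (case_prod Q i) (case_prod Q j)) H"
    and cov0: "\<forall>i\<in>P. \<exists>j\<in>H. \<not> disjnt (case_prod Q i) (case_prod Q j) \<and> snd i \<le> 2 * snd j"
    by (elim exE conjE) (rule that)
  note cov = bspec[OF cov0]
  have HP: "bad a r" "\<not> bad a (68 * r)" if "(a, r) \<in> H" for a r
    using that H rp[of a r] by (auto simp: P_def subset_iff)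
  \<comment> \<open>Distinct selected tents are disjoint and nonempty, so \<open>H\<close> is as
    countable as the family of its tents, which are disjoint open sets in a second countable
    space.\<close>
  have inj: "inj_on (case_prod Q) H"
  proof (rule inj_onI, rule ccontr)
    fix i j assume ij: "i \<in> H" "j \<in> H" and eq: "case_prod Q i = case_prod Q j" and "i \<noteq> j"
    then have "disjnt (case_prod Q i) (case_prod Q j)" by (intro pairwiseD[OF dis])
    then have "case_prod Q i = {}" unfolding eq disjnt_def by simp
    then show False using ne[of i] ij H by blast
  qed
  have "countable (case_prod Q ` H)"
  proof (rule countable_disjoint_open_subsets)
    show "open S" if "S \<in> case_prod Q ` H" for S using that HP open_tent by (auto simp: bad_def)
    show "pairwise disjnt (case_prod Q ` H)" using dis by (auto simp: pairwise_def)
  qed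
  then have cH: "countable H" using inj by (rule countable_image_inj_on)
  have cover: "Q a r \<subseteq> (\<Union>(a, r)\<in>H. Q a (68 * r))" if "bad a r" for a r
  proof
    fix w assume w: "w \<in> Q a r"
    obtain s where s: "s \<ge> r" "(a, s) \<in> P" using ex[OF \<open>bad a r\<close>] by blast
    obtain a' r' where h: "(a', r') \<in> H" "\<not> disjnt (Q a s) (Q a' r')" "s \<le> 2 * r'" using cov[OF s(2)] by auto
    then obtain x where x: "x \<in> Q a s" "x \<in> Q a' r'" by (auto simp: disjnt_iff)
    have aX: "a \<in> space M" "a' \<in> space M" using \<open>bad a r\<close> HP(1)[OF h(1)] by (auto simp: bad_def)
    \<comment> \<open>Through the common point \<open>x\<close>:
      \<open>d x w < 4 * (s + s) \<le> 16 * r'\<close>, hence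
      \<open>d a' w < 4 * (1 + 16) * r' = 68 * r'\<close>.\<close>
    have "d a' w \<le> 4 * (d a' x + d x w)" "d x w \<le> 4 * (d x a + d a w)" using aX x w d_tri by auto
    moreover have "d x a < s" using x aX d_sym by auto
    ultimately have "d a' w < 68 * r'" using w s h x by auto
    then show "w \<in> (\<Union>(a, r)\<in>H. Q a (68 * r))" using h w by auto
  qed
  show ?thesis
  proof (rule that[OF cH dis])
    fix a r assume ar: "(a, r) \<in> H"
    note b = HP[OF ar]
    show "a \<in> space M \<and> 2 * \<rho> a \<le> r \<and> r \<le> 1" using b r1 by (auto simp: bad_def)
    show "ennreal (r ^ N) < (\<integral>\<^sup>+w. \<Phi> w * indicator (Q a r) w \<partial>M)" using b by (auto simp: bad_def m_def)
    show "(\<integral>\<^sup>+w. \<Phi> w * indicator (Q a (68 * r)) w \<partial>M) \<le> ennreal ((68 * r) ^ N)"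
      using b rp[OF b(1)] by (auto simp: bad_def m_def not_less)
  next
    fix a r assume "a \<in> space M" "2 * \<rho> a \<le> r"
      "ennreal (r ^ N) < (\<integral>\<^sup>+w. \<Phi> w * indicator (Q a r) w \<partial>M)"
    then show "Q a r \<subseteq> (\<Union>(a, r)\<in>H. Q a (68 * r))" by (intro cover) (simp add: bad_def m_def)
  qed
qed

lemma T_superlevel_add:
  assumes [measurable]: "g \<in> borel_measurable M" "h \<in> borel_measurable M" "\<Omega> \<in> sets M"
    and c: "0 < c" "0 < c'"
    and le: "\<And>z. z \<in> space M - \<Omega> \<Longrightarrow> T f z \<le> ennreal c * T g z + ennreal c' * T h z"
  shows "{z \<in> space M. 1 < T f z} \<subseteq>
    \<Omega> \<union> {z \<in> space M. ennreal (1 / (2 * c)) < T g z} \<union> {z \<in> space M. ennreal (1 / (2 * c')) < T h z}"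
proof (rule subsetI, rule ccontr)
  fix z assume z: "z \<in> {z \<in> space M. 1 < T f z}"
    and n: "z \<notin> \<Omega> \<union> {z \<in> space M. ennreal (1 / (2 * c)) < T g z} \<union> {z \<in> space M. ennreal (1 / (2 * c')) < T h z}"
  then have "T f z \<le> ennreal c * T g z + ennreal c' * T h z" by (intro le) auto
  also have "\<dots> \<le> ennreal c * ennreal (1 / (2 * c)) + ennreal c' * ennreal (1 / (2 * c'))"
    using z n by (intro add_mono mult_left_mono) (auto simp: not_less)
  also have "\<dots> = ennreal (1/2) + ennreal (1/2)" using c by (simp add: ennreal_mult[symmetric])
  also have "\<dots> = 1" by (subst ennreal_plus[symmetric]) auto
  finally show False using z by auto
qed

text \<open>The level 1 is split evenly between the two bounded densities, whence the levels
  \<open>1 / (2 * C4)\<close> and \<open>1 / (2 * C5)\<close>. The three terms of \<open>C\<close>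
  account for the exceptional tents, for \<open>g1\<close> and for \<open>g2\<close>. Mass below 1
  is what \<open>tent_family\<close> asks for.\<close>

lemma weak_type_LlogL_aux:
  "\<exists>C>0. \<forall>F\<in>borel_measurable M. (\<forall>w\<in>space M. 0 \<le> F w) \<longrightarrow>
    (\<integral>\<^sup>+w. ennreal (F w * (1 + log_plus (F w))) \<partial>M) < 1 \<longrightarrow>
    emeasure M {z \<in> space M. 1 < T (\<lambda>w. ennreal (F w)) z} \<le>
      ennreal C * (\<integral>\<^sup>+w. ennreal (F w * (1 + log_plus (F w))) \<partial>M)"
proof -
  define C4 where "C4 = 64 ^ N * (1 + 2 * ln 64) * (4 * (1 + C0) * 68 ^ N) * 2 ^ N / c0"
  define C5 where "C5 = 52 ^ N * (1 + 2 * ln 52) * (1 + ln 2) * 24 ^ N / c0"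
  have C4: "C4 > 0" unfolding C4_def using C0_pos c0_pos
    by (intro divide_pos_pos mult_pos_pos add_pos_nonneg add_pos_pos) auto
  have C5: "C5 > 0" unfolding C5_def using c0_pos
    by (intro divide_pos_pos mult_pos_pos add_pos_nonneg) auto
  define w4 where "w4 = (2 * schur_const / (1 / (2 * C4)))\<^sup>2"
  define w5 where "w5 = (2 * schur_const / (1 / (2 * C5)))\<^sup>2"
  define C where "C = C0 * 544 ^ N + w4 * C0 + w5 * (C0 * 24 ^ N)"
  have w: "w4 \<ge> 0" "w5 \<ge> 0" by (auto simp: w4_def w5_def)
  have C: "C > 0" unfolding C_def using C0_pos w by (intro add_pos_nonneg) auto
  have "emeasure M {z \<in> space M. 1 < T (\<lambda>w. ennreal (F w)) z} \<le>
      ennreal C * (\<integral>\<^sup>+w. ennreal (F w * (1 + log_plus (F w))) \<partial>M)"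
    if Fm [measurable]: "F \<in> borel_measurable M" and F0: "\<And>w. w \<in> space M \<Longrightarrow> 0 \<le> F w"
    and small: "(\<integral>\<^sup>+w. ennreal (F w * (1 + log_plus (F w))) \<partial>M) < 1" for F
  proof -
    define \<Phi> where "\<Phi> w = ennreal (F w * (1 + log_plus (F w)))" for w
    have \<Phi>m [measurable]: "\<Phi> \<in> borel_measurable M" unfolding \<Phi>_def log_plus_def by measurable
    have F\<Phi>: "ennreal (F w) \<le> \<Phi> w" if "w \<in> space M" for w
      unfolding \<Phi>_def using F0[OF that] mult_left_mono[of 1 "1 + log_plus (F w)" "F w"]
      by (intro ennreal_leI) (auto simp: log_plus_def)
    have "(\<integral>\<^sup>+w. \<Phi> w \<partial>M) < 1" using small by (simp add: \<Phi>_def)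
    from tent_family[OF \<Phi>m this] obtain H where Hc: "countable H"
      and dis: "pairwise (\<lambda>i j. disjnt (case_prod Q i) (case_prod Q j)) H"
      and H1: "\<And>a r. (a, r) \<in> H \<Longrightarrow> a \<in> space M \<and> 2 * \<rho> a \<le> r \<and> r \<le> 1"
      and H2: "\<And>a r. (a, r) \<in> H \<Longrightarrow> ennreal (r ^ N) < (\<integral>\<^sup>+w. \<Phi> w * indicator (Q a r) w \<partial>M)"
      and H3: "\<And>a r. (a, r) \<in> H \<Longrightarrow> (\<integral>\<^sup>+w. \<Phi> w * indicator (Q a (68 * r)) w \<partial>M) \<le> ennreal ((68 * r) ^ N)"
      and H4: "\<And>a r. a \<in> space M \<Longrightarrow> 2 * \<rho> a \<le> r \<Longrightarrow>
        ennreal (r ^ N) < (\<integral>\<^sup>+w. \<Phi> w * indicator (Q a r) w \<partial>M) \<Longrightarrow> Q a r \<subseteq> (\<Union>(a, r)\<in>H. Q a (68 * r))"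
      by blast
    have H0: "r > 0" if "(a, r) \<in> H" for a r using H1[OF that] rho_pos[of a] by auto
    \<comment> \<open>Used with \<open>c = 1\<close> (the tents), \<open>c = 68\<close> (where
      \<open>F\<close> is cut) and \<open>c = 544\<close> (the exceptional set, off which every
      selected tent is far enough for \<open>tent_contribution\<close>).\<close>
    define G where "G c = (\<Union>(a, r)\<in>H. Q a (c * r))" for c
    have Qm: "case i of (a, r) \<Rightarrow> Q a (c * r) \<in> sets M" if "i \<in> H" for c i
      using that H1 by (auto split: prod.splits)
    have Gm [measurable]: "G c \<in> sets M" for c
      unfolding G_def using Hc Qm by (intro sets.countable_UN') (auto split: prod.splits)
    \<comment> \<open>Each selected tent carries more \<open>\<Phi>\<close>-mass than
      \<open>r ^ N\<close>, and by disjointness these masses add up to at most the whole.\<close>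
    have sumH: "(\<integral>\<^sup>+i. (case i of (a, r) \<Rightarrow> ennreal (r ^ N)) \<partial>count_space H) \<le> (\<integral>\<^sup>+w. \<Phi> w \<partial>M)"
    proof -
      have "(\<integral>\<^sup>+i. (case i of (a, r) \<Rightarrow> ennreal (r ^ N)) \<partial>count_space H) \<le>
          (\<integral>\<^sup>+i. (\<integral>\<^sup>+w. \<Phi> w * indicator (case_prod Q i) w \<partial>M) \<partial>count_space H)"
        using H2 by (intro nn_integral_mono) (auto intro: less_imp_le)
      also have "\<dots> = (\<integral>\<^sup>+w. (\<integral>\<^sup>+i. \<Phi> w * indicator (case_prod Q i) w \<partial>count_space H) \<partial>M)"
        using Hc Qm[of _ 1] by (intro nn_integral_count_space_nn_integral[symmetric]) (auto split: prod.splits)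
      also have "\<dots> \<le> (\<integral>\<^sup>+w. \<Phi> w \<partial>M)"
      proof (intro nn_integral_mono)
        fix w assume "w \<in> space M"
        have "(\<integral>\<^sup>+i. \<Phi> w * indicator (case_prod Q i) w \<partial>count_space H) = \<Phi> w * (\<integral>\<^sup>+i. indicator (case_prod Q i) w \<partial>count_space H)"
          by (intro nn_integral_cmult) auto
        also have "\<dots> \<le> \<Phi> w * 1"
          using dis by (intro mult_left_mono disjoint_indicators_le_1) auto
        finally show "(\<integral>\<^sup>+i. \<Phi> w * indicator (case_prod Q i) w \<partial>count_space H) \<le> \<Phi> w" by simp
      qed
      finally show ?thesis .
    qed
    have Gmeas: "emeasure M (G c) \<le> ennreal (C0 * c ^ N) * (\<integral>\<^sup>+w. \<Phi> w \<partial>M)" if "c > 0" for c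
    proof -
      have "emeasure M (G c) \<le> (\<integral>\<^sup>+i. emeasure M (case i of (a, r) \<Rightarrow> Q a (c * r)) \<partial>count_space H)"
        unfolding G_def using Hc Qm by (intro emeasure_UN_countable_le) (auto split: prod.splits)
      also have "\<dots> \<le> (\<integral>\<^sup>+i. ennreal (C0 * c ^ N) * (case i of (a, r) \<Rightarrow> ennreal (r ^ N)) \<partial>count_space H)"
      proof (intro nn_integral_mono)
        fix i assume "i \<in> space (count_space H)"
        then obtain a r where i: "i = (a, r)" "(a, r) \<in> H" by (cases i) auto
        have "emeasure M (Q a (c * r)) \<le> ennreal (C0 * (c * r) ^ N)"
          using H1[OF i(2)] H0[OF i(2)] that by (intro measure_tent) auto
        also have "\<dots> = ennreal (C0 * c ^ N) * ennreal (r ^ N)"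
          using C0_pos that H0[OF i(2)] by (simp add: ennreal_mult[symmetric] power_mult_distrib mult_ac)
        finally show "emeasure M (case i of (a, r) \<Rightarrow> Q a (c * r)) \<le> ennreal (C0 * c ^ N) * (case i of (a, r) \<Rightarrow> ennreal (r ^ N))"
          by (simp add: i)
      qed
      also have "\<dots> = ennreal (C0 * c ^ N) * (\<integral>\<^sup>+i. (case i of (a, r) \<Rightarrow> ennreal (r ^ N)) \<partial>count_space H)"
        by (intro nn_integral_cmult) auto
      also have "\<dots> \<le> ennreal (C0 * c ^ N) * (\<integral>\<^sup>+w. \<Phi> w \<partial>M)" by (intro mult_left_mono sumH) auto
      finally show ?thesis .
    qed
    define F2 where "F2 w = ennreal (F w) * indicator (space M - G 68) w" for w
    have F2m [measurable]: "F2 \<in> borel_measurable M" unfolding F2_def by measurable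
    \<comment> \<open>If the tent lies in \<open>G 68\<close>, then \<open>F2\<close> vanishes on
      it. Otherwise it is not covered by the dilates, hence not bad; \<open>H4\<close> applies
      because \<open>12 * \<rho> u \<ge> 2 * \<rho> u\<close>.\<close>
    have F2b: "(\<integral>\<^sup>+w. F2 w * indicator (Q u (12 * \<rho> u)) w \<partial>M) \<le> ennreal ((12 * \<rho> u) ^ N)" if u: "u \<in> space M" for u
    proof (cases "Q u (12 * \<rho> u) \<subseteq> G 68")
      case True
      then have "F2 w * indicator (Q u (12 * \<rho> u)) w = 0" for w by (auto simp: F2_def indicator_def)
      then have "(\<integral>\<^sup>+w. F2 w * indicator (Q u (12 * \<rho> u)) w \<partial>M) = (\<integral>\<^sup>+w. 0 \<partial>M)"
        by (intro nn_integral_cong)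
      then show ?thesis by simp
    next
      case False
      then have "\<not> ennreal ((12 * \<rho> u) ^ N) < (\<integral>\<^sup>+w. \<Phi> w * indicator (Q u (12 * \<rho> u)) w \<partial>M)"
        using H4[OF u, of "12 * \<rho> u"] rho_pos[OF u] unfolding G_def by auto
      then have "(\<integral>\<^sup>+w. \<Phi> w * indicator (Q u (12 * \<rho> u)) w \<partial>M) \<le> ennreal ((12 * \<rho> u) ^ N)" by (simp add: not_less)
      moreover have "(\<integral>\<^sup>+w. F2 w * indicator (Q u (12 * \<rho> u)) w \<partial>M) \<le> (\<integral>\<^sup>+w. \<Phi> w * indicator (Q u (12 * \<rho> u)) w \<partial>M)"
        using F\<Phi> by (intro nn_integral_mono) (auto simp: F2_def indicator_def)
      ultimately show ?thesis by (rule order_trans[rotated])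
    qed
    obtain g2 where g2 [measurable]: "g2 \<in> borel_measurable M" "\<And>u. u \<in> space M \<Longrightarrow> g2 u \<le> 1"
      "(\<integral>\<^sup>+u. g2 u \<partial>M) \<le> ennreal (C0 * 24 ^ N) * (\<integral>\<^sup>+w. F2 w \<partial>M)"
      "\<And>z. z \<in> space M \<Longrightarrow> T F2 z \<le> ennreal C5 * T g2 z"
      unfolding C5_def using smeared_density[OF F2m F2b] by metis
    define g1 :: "'a \<Rightarrow> ennreal" where "g1 w = indicator (G 1) w" for w
    have g1m [measurable]: "g1 \<in> borel_measurable M" unfolding g1_def by measurable
    \<comment> \<open>The dilates may overlap, so the indicator of their union is bounded by a sum
      over \<open>H\<close>. After \<open>tent_contribution\<close> the sum runs over the disjoint
      original tents and collapses to \<open>g1\<close>.\<close>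
    have part1: "(\<integral>\<^sup>+w. ennreal (K z w) * (ennreal (F w) * indicator (G 68) w) \<partial>M) \<le> ennreal C4 * T g1 z"
      if z: "z \<in> space M - G 544" for z
    proof -
      have zX: "z \<in> space M" using z by auto
      have Km [measurable]: "(\<lambda>w. K z w) \<in> borel_measurable M" using zX by measurable
      have "(\<integral>\<^sup>+w. ennreal (K z w) * (ennreal (F w) * indicator (G 68) w) \<partial>M) \<le>
        (\<integral>\<^sup>+w. (\<integral>\<^sup>+i. ennreal (K z w) * (ennreal (F w) * indicator (case i of (a, r) \<Rightarrow> Q a (68 * r)) w) \<partial>count_space H) \<partial>M)"
      proof (intro nn_integral_mono)
        fix w assume w: "w \<in> space M"
        show "ennreal (K z w) * (ennreal (F w) * indicator (G 68) w) \<le>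
          (\<integral>\<^sup>+i. ennreal (K z w) * (ennreal (F w) * indicator (case i of (a, r) \<Rightarrow> Q a (68 * r)) w) \<partial>count_space H)"
        proof (cases "w \<in> G 68")
          case True
          then obtain a r where ar: "(a, r) \<in> H" "w \<in> Q a (68 * r)" by (auto simp: G_def)
          have "(\<integral>\<^sup>+i. ennreal (K z w) * (ennreal (F w) * indicator (case i of (a, r) \<Rightarrow> Q a (68 * r)) w) \<partial>count_space H)
            \<ge> ennreal (K z w) * (ennreal (F w) * indicator (Q a (68 * r)) w)"
            using nn_integral_ge_point[OF ar(1), of "\<lambda>i. ennreal (K z w) * (ennreal (F w) * indicator (case i of (a, r) \<Rightarrow> Q a (68 * r)) w)"]
            by simp
          then show ?thesis using ar True by simp
        qed auto
      qed
      also have "\<dots> = (\<integral>\<^sup>+i. (\<integral>\<^sup>+w. ennreal (K z w) * (ennreal (F w) * indicator (case i of (a, r) \<Rightarrow> Q a (68 * r)) w) \<partial>M) \<partial>count_space H)"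
        using Hc Qm by (intro nn_integral_count_space_nn_integral) (auto split: prod.splits)
      also have "\<dots> \<le> (\<integral>\<^sup>+i. (\<integral>\<^sup>+w. ennreal C4 * (ennreal (K z w) * indicator (case_prod Q i) w) \<partial>M) \<partial>count_space H)"
      proof (rule nn_integral_mono)
        fix i assume "i \<in> space (count_space H)"
        then obtain a r where i: "i = (a, r)" "(a, r) \<in> H" by (cases i) auto
        have [measurable]: "Q a r \<in> sets M" using H1[OF i(2)] by auto
        have "544 * r \<le> d z a" using z i H1[OF i(2)] d_sym[of z a] by (force simp: G_def)
        then have "(\<integral>\<^sup>+w. ennreal (K z w) * (ennreal (F w) * indicator (Q a (68 * r)) w) \<partial>M) \<le>
            ennreal C4 * (\<integral>\<^sup>+w. ennreal (K z w) * indicator (Q a r) w \<partial>M)"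
          unfolding C4_def using H1[OF i(2)] H3[OF i(2)] zX F0
          by (intro tent_contribution) (auto simp: \<Phi>_def)
        also have "\<dots> = (\<integral>\<^sup>+w. ennreal C4 * (ennreal (K z w) * indicator (Q a r) w) \<partial>M)"
          by (intro nn_integral_cmult[symmetric]) measurable
        finally show "(\<integral>\<^sup>+w. ennreal (K z w) * (ennreal (F w) * indicator (case i of (a, r) \<Rightarrow> Q a (68 * r)) w) \<partial>M)
          \<le> (\<integral>\<^sup>+w. ennreal C4 * (ennreal (K z w) * indicator (case_prod Q i) w) \<partial>M)" by (simp add: i)
      qed
      also have "\<dots> = (\<integral>\<^sup>+w. (\<integral>\<^sup>+i. ennreal C4 * (ennreal (K z w) * indicator (case_prod Q i) w) \<partial>count_space H) \<partial>M)"
        using Hc Qm[of _ 1] by (intro nn_integral_count_space_nn_integral[symmetric]) (auto split: prod.splits)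
      also have "\<dots> \<le> (\<integral>\<^sup>+w. ennreal C4 * (ennreal (K z w) * g1 w) \<partial>M)"
      proof (intro nn_integral_mono)
        fix w assume "w \<in> space M"
        have eq: "(\<integral>\<^sup>+i. ennreal C4 * (ennreal (K z w) * indicator (case_prod Q i) w) \<partial>count_space H) =
          ennreal C4 * (ennreal (K z w) * (\<integral>\<^sup>+i. indicator (case_prod Q i) w \<partial>count_space H))"
          by (subst nn_integral_cmult, simp)+ simp
        have "(\<integral>\<^sup>+i. indicator (case_prod Q i) w \<partial>count_space H) \<le> g1 w"
        proof (cases "w \<in> G 1")
          case True
          then show ?thesis using disjoint_indicators_le_1[OF dis] by (simp add: g1_def)
        next
          case False
          then have "indicator (case_prod Q i) w = (0::ennreal)" if "i \<in> H" for i
            using that by (cases i) (force simp: G_def indicator_def)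
          then have "(\<integral>\<^sup>+i. indicator (case_prod Q i) w \<partial>count_space H) = (\<integral>\<^sup>+i. 0 \<partial>count_space H)"
            by (intro nn_integral_cong) auto
          then show ?thesis by simp
        qed
        then show "(\<integral>\<^sup>+i. ennreal C4 * (ennreal (K z w) * indicator (case_prod Q i) w) \<partial>count_space H) \<le>
            ennreal C4 * (ennreal (K z w) * g1 w)"
          unfolding eq by (intro mult_left_mono) auto
      qed
      also have "\<dots> = ennreal C4 * T g1 z" unfolding T_def by (intro nn_integral_cmult) measurable
      finally show ?thesis .
    qed
    have bound: "T (\<lambda>w. ennreal (F w)) z \<le> ennreal C4 * T g1 z + ennreal C5 * T g2 z" if z: "z \<in> space M - G 544" for z
    proof -
      have zX: "z \<in> space M" using z by auto
      have [measurable]: "(\<lambda>w. K z w) \<in> borel_measurable M" using zX by measurable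
      have "T (\<lambda>w. ennreal (F w)) z =
        (\<integral>\<^sup>+w. ennreal (K z w) * (ennreal (F w) * indicator (G 68) w) + ennreal (K z w) * F2 w \<partial>M)"
        unfolding T_def by (intro nn_integral_cong) (auto simp: F2_def indicator_def)
      also have "\<dots> = (\<integral>\<^sup>+w. ennreal (K z w) * (ennreal (F w) * indicator (G 68) w) \<partial>M) + T F2 z"
        unfolding T_def by (intro nn_integral_add) measurable
      also have "\<dots> \<le> ennreal C4 * T g1 z + ennreal C5 * T g2 z"
        using z by (intro add_mono part1 g2) auto
      finally show ?thesis .
    qed
    have "emeasure M {z \<in> space M. 1 < T (\<lambda>w. ennreal (F w)) z} \<le>
      emeasure M (G 544 \<union> {z \<in> space M. ennreal (1 / (2 * C4)) < T g1 z} \<union> {z \<in> space M. ennreal (1 / (2 * C5)) < T g2 z})"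
      using C4 C5 bound by (intro emeasure_mono T_superlevel_add) auto
    also have "\<dots> \<le> emeasure M (G 544) + emeasure M {z \<in> space M. ennreal (1 / (2 * C4)) < T g1 z}
        + emeasure M {z \<in> space M. ennreal (1 / (2 * C5)) < T g2 z}"
      by (intro order_trans[OF emeasure_subadditive] add_mono) auto
    also have "\<dots> \<le> ennreal (C0 * 544 ^ N) * (\<integral>\<^sup>+w. \<Phi> w \<partial>M) + ennreal (w4 * C0) * (\<integral>\<^sup>+w. \<Phi> w \<partial>M)
        + ennreal (w5 * (C0 * 24 ^ N)) * (\<integral>\<^sup>+w. \<Phi> w \<partial>M)"
    proof (intro add_mono)
      show "emeasure M (G 544) \<le> ennreal (C0 * 544 ^ N) * (\<integral>\<^sup>+w. \<Phi> w \<partial>M)" by (intro Gmeas) simp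
      have "emeasure M {z \<in> space M. ennreal (1 / (2 * C4)) < T g1 z} \<le> ennreal w4 * (\<integral>\<^sup>+w. g1 w \<partial>M)"
        unfolding w4_def using C4 by (intro weak_type_bounded_density) (auto simp: g1_def indicator_def)
      also have "(\<integral>\<^sup>+w. g1 w \<partial>M) = emeasure M (G 1)" unfolding g1_def by simp
      also have "ennreal w4 * emeasure M (G 1) \<le> ennreal w4 * (ennreal (C0 * 1 ^ N) * (\<integral>\<^sup>+w. \<Phi> w \<partial>M))"
        by (intro mult_left_mono Gmeas) auto
      also have "\<dots> = ennreal (w4 * C0) * (\<integral>\<^sup>+w. \<Phi> w \<partial>M)" using w C0_pos by (simp add: ennreal_mult mult.assoc)
      finally show "emeasure M {z \<in> space M. ennreal (1 / (2 * C4)) < T g1 z} \<le> ennreal (w4 * C0) * (\<integral>\<^sup>+w. \<Phi> w \<partial>M)" .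
      have "emeasure M {z \<in> space M. ennreal (1 / (2 * C5)) < T g2 z} \<le> ennreal w5 * (\<integral>\<^sup>+w. g2 w \<partial>M)"
        unfolding w5_def using C5 g2 by (intro weak_type_bounded_density) auto
      also have "\<dots> \<le> ennreal w5 * (ennreal (C0 * 24 ^ N) * (\<integral>\<^sup>+w. \<Phi> w \<partial>M))"
      proof (intro mult_left_mono order_trans[OF g2(3)])
        show "(\<integral>\<^sup>+w. F2 w \<partial>M) \<le> (\<integral>\<^sup>+w. \<Phi> w \<partial>M)"
          using F\<Phi> by (intro nn_integral_mono) (auto simp: F2_def indicator_def)
      qed auto
      also have "\<dots> = ennreal (w5 * (C0 * 24 ^ N)) * (\<integral>\<^sup>+w. \<Phi> w \<partial>M)"
        using w C0_pos by (subst ennreal_mult) (auto simp: mult.assoc)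
      finally show "emeasure M {z \<in> space M. ennreal (1 / (2 * C5)) < T g2 z} \<le> ennreal (w5 * (C0 * 24 ^ N)) * (\<integral>\<^sup>+w. \<Phi> w \<partial>M)" .
    qed
    also have "\<dots> = ennreal C * (\<integral>\<^sup>+w. \<Phi> w \<partial>M)"
      unfolding C_def using w C0_pos by (simp add: distrib_right)
    finally show ?thesis by (simp add: \<Phi>_def)
  qed
  then show ?thesis using C by blast
qed

text \<open>Once the integral is at least 1, the finite measure of the whole space is a sufficient
  bound.\<close>

theorem weak_type_LlogL:
  "\<exists>C>0. \<forall>F\<in>borel_measurable M. (\<forall>w\<in>space M. 0 \<le> F w) \<longrightarrow>
    emeasure M {z \<in> space M. 1 < T (\<lambda>w. ennreal (F w)) z} \<le>
      ennreal C * (\<integral>\<^sup>+w. ennreal (F w * (1 + log_plus (F w))) \<partial>M)"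
proof -
  obtain C where C: "0 < C" and aux: "\<forall>F\<in>borel_measurable M. (\<forall>w\<in>space M. 0 \<le> F w) \<longrightarrow>
    (\<integral>\<^sup>+w. ennreal (F w * (1 + log_plus (F w))) \<partial>M) < 1 \<longrightarrow>
    emeasure M {z \<in> space M. 1 < T (\<lambda>w. ennreal (F w)) z} \<le>
      ennreal C * (\<integral>\<^sup>+w. ennreal (F w * (1 + log_plus (F w))) \<partial>M)"
    using weak_type_LlogL_aux by (elim exE conjE)
  have "emeasure M {z \<in> space M. 1 < T (\<lambda>w. ennreal (F w)) z} \<le>
      ennreal (C + measure M (space M)) * (\<integral>\<^sup>+w. ennreal (F w * (1 + log_plus (F w))) \<partial>M)"
    if F: "F \<in> borel_measurable M" "\<And>w. w \<in> space M \<Longrightarrow> 0 \<le> F w" for F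
  proof (cases "(\<integral>\<^sup>+w. ennreal (F w * (1 + log_plus (F w))) \<partial>M) < 1")
    case True
    have "emeasure M {z \<in> space M. 1 < T (\<lambda>w. ennreal (F w)) z} \<le>
      ennreal C * (\<integral>\<^sup>+w. ennreal (F w * (1 + log_plus (F w))) \<partial>M)"
      using aux F True by blast
    then show ?thesis
      by (rule order_trans) (intro mult_right_mono ennreal_leI, auto)
  next
    case False
    have "emeasure M {z \<in> space M. 1 < T (\<lambda>w. ennreal (F w)) z} \<le> emeasure M (space M)"
      by (intro emeasure_mono) auto
    also have "\<dots> = ennreal (measure M (space M)) * 1" by (simp add: emeasure_eq_measure)
    also have "\<dots> \<le> ennreal (C + measure M (space M)) * (\<integral>\<^sup>+w. ennreal (F w * (1 + log_plus (F w))) \<partial>M)"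
      using False C by (intro mult_mono ennreal_leI) (auto simp: not_less)
    finally show ?thesis .
  qed
  moreover have "0 < C + measure M (space M)" using C by (simp add: add_pos_nonneg)
  ultimately show ?thesis by blast
qed

end

section \<open>Unitary geometry and Lebesgue measure\<close>

lemma cinner_add_left: "cinner (x + y) z = cinner x z + cinner y z"
  and cinner_add_right: "cinner x (y + z) = cinner x y + cinner x z"
  and cinner_diff_left: "cinner (x - y) z = cinner x z - cinner y z"
  and cinner_diff_right: "cinner x (y - z) = cinner x y - cinner x z"
  and cinner_smult_left: "cinner (c *s x) y = c * cinner x y"
  and cinner_smult_right: "cinner x (c *s y) = cnj c * cinner x y"
  and cinner_scaleR_left: "cinner (r *\<^sub>R x) y = of_real r * cinner x y"
  and cinner_scaleR_right: "cinner x (r *\<^sub>R y) = of_real r * cinner x y"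
  and cinner_zero_left: "cinner 0 x = 0"
  and cinner_zero_right: "cinner x 0 = 0"
  unfolding cinner_def vector_add_component vector_minus_component vector_smult_component vector_scaleR_component
  by (simp_all add: sum.distrib[symmetric] sum_subtractf[symmetric] sum_distrib_left algebra_simps scaleR_conv_of_real)

lemma cinner_sum_left: "cinner (\<Sum>i\<in>A. f i) y = (\<Sum>i\<in>A. cinner (f i) y)"
  by (induction A rule: infinite_finite_induct) (auto simp: cinner_add_left cinner_zero_left)

lemma cnj_cinner: "cnj (cinner x y) = cinner y x"
  by (simp add: cinner_def mult.commute)

lemma Re_cinner: "Re (cinner x y) = inner x y"
  by (simp add: cinner_def inner_vec_def inner_complex_def)

lemma cinner_self: "cinner x x = of_real ((norm x)\<^sup>2)"
proof (rule complex_eqI)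
  show "Im (cinner x x) = Im (of_real ((norm x)\<^sup>2))"
    using cnj_cinner[of x x] by (metis Im_complex_of_real Reals_cnj_iff complex_is_Real_iff)
qed (simp add: Re_cinner power2_norm_eq_inner)

lemma norm_cinner_le: "norm (cinner x y) \<le> norm x * norm y"
proof -
  have "norm (cinner x y) \<le> (\<Sum>i\<in>UNIV. norm (x $ i) * norm (y $ i))"
    unfolding cinner_def by (rule sum_norm_le) (simp add: norm_mult)
  also have "\<dots> \<le> L2_set (\<lambda>i. norm (x $ i)) UNIV * L2_set (\<lambda>i. norm (y $ i)) UNIV"
    using L2_set_mult_ineq[of "\<lambda>i. norm (x $ i)" "\<lambda>i. norm (y $ i)" UNIV] by simp
  finally show ?thesis by (simp add: norm_vec_def)
qed

lemma norm_add_cinner: "(norm (x + y))\<^sup>2 = (norm x)\<^sup>2 + (norm y)\<^sup>2 + 2 * Re (cinner x y)"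
  by (simp add: Re_cinner power2_norm_eq_inner inner_add inner_commute)

lemma norm_diff_cinner: "(norm (x - y))\<^sup>2 = (norm x)\<^sup>2 + (norm y)\<^sup>2 - 2 * Re (cinner x y)"
  by (simp add: Re_cinner power2_norm_eq_inner inner_diff inner_commute)

lemma norm_smult: "norm (c *s (x::complex^'n)) = norm c * norm x"
proof -
  have "of_real ((norm (c *s x))\<^sup>2) = (of_real ((norm c * norm x)\<^sup>2) :: complex)"
    by (simp only: cinner_self[symmetric] cinner_smult_left cinner_smult_right)
       (simp add: cinner_self power_mult_distrib complex_norm_square mult_ac del: of_real_power)
  then have "(norm (c *s x))\<^sup>2 = (norm c * norm x)\<^sup>2" by (simp only: of_real_eq_iff)
  then show ?thesis by (rule power2_eq_imp_eq) auto
qed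

text \<open>For a unit vector \<open>e\<close> the component along \<open>e\<close> is multiplied by
  \<open>\<alpha>\<close> and the orthogonal one by \<open>\<beta>\<close>, written without
  completing \<open>e\<close> to a basis. Images of the unit ball are the ellipsoids of the proof;
  complex linearity sends complex lines to complex lines.\<close>

definition stretch :: "complex ^ 'n \<Rightarrow> real \<Rightarrow> real \<Rightarrow> complex ^ 'n \<Rightarrow> complex ^ 'n" where
  "stretch e \<alpha> \<beta> w = \<beta> *\<^sub>R w + (of_real (\<alpha> - \<beta>) * cinner w e) *s e"

lemma stretch_add: "stretch e \<alpha> \<beta> (x + y) = stretch e \<alpha> \<beta> x + stretch e \<alpha> \<beta> y"
  by (simp add: stretch_def cinner_add_left vec_eq_iff algebra_simps)

lemma stretch_smult: "stretch e \<alpha> \<beta> (c *s x) = c *s stretch e \<alpha> \<beta> x"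
  by (simp add: stretch_def cinner_smult_left vec_eq_iff algebra_simps scaleR_conv_of_real[where 'a=complex])

lemma stretch_scaleR: "stretch e \<alpha> \<beta> (r *\<^sub>R x) = r *\<^sub>R stretch e \<alpha> \<beta> x"
  by (simp add: stretch_def cinner_scaleR_left vec_eq_iff algebra_simps scaleR_conv_of_real[where 'a=complex])

lemma linear_stretch: "linear (stretch e \<alpha> \<beta>)"
  by (rule linearI) (simp_all add: stretch_add stretch_scaleR)

lemma cinner_unit: "norm e = 1 \<Longrightarrow> cinner e e = 1"
  by (simp add: cinner_self)

lemma cinner_stretch: "norm e = 1 \<Longrightarrow> cinner (stretch e \<alpha> \<beta> w) e = of_real \<alpha> * cinner w e"
  by (simp add: stretch_def cinner_add_left cinner_scaleR_left cinner_smult_left cinner_unit) (simp add: algebra_simps)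

lemma stretch_stretch:
  assumes "norm e = 1"
  shows "stretch e \<gamma> \<delta> (stretch e \<alpha> \<beta> w) = stretch e (\<gamma> * \<alpha>) (\<delta> * \<beta>) w"
proof -
  have "stretch e \<gamma> \<delta> (stretch e \<alpha> \<beta> w) = \<delta> *\<^sub>R stretch e \<alpha> \<beta> w + (of_real (\<gamma> - \<delta>) * (of_real \<alpha> * cinner w e)) *s e"
    by (subst stretch_def) (simp only: cinner_stretch[OF assms])
  then show ?thesis by (simp add: stretch_def vec_eq_iff algebra_simps scaleR_conv_of_real[where 'a=complex])
qed

lemma stretch_1: "stretch e 1 1 w = w"
  by (simp add: stretch_def)

lemma stretch_inverse:
  assumes "norm e = 1" "\<alpha> \<noteq> 0" "\<beta> \<noteq> 0"
  shows "stretch e (1 / \<alpha>) (1 / \<beta>) (stretch e \<alpha> \<beta> w) = w"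
  using assms by (simp add: stretch_stretch stretch_1)

lemma norm_perp:
  assumes "norm e = 1"
  shows "(norm (w - cinner w e *s e))\<^sup>2 = (norm w)\<^sup>2 - (norm (cinner w e))\<^sup>2"
proof -
  have "cinner w (cinner w e *s e) = of_real ((norm (cinner w e))\<^sup>2)"
    by (simp add: cinner_smult_right complex_norm_square mult.commute del: of_real_power)
  then show ?thesis using assms by (simp add: norm_diff_cinner norm_smult)
qed

lemma norm_stretch:
  assumes "norm e = 1"
  shows "(norm (stretch e \<alpha> \<beta> w))\<^sup>2 = \<alpha>\<^sup>2 * (norm (cinner w e))\<^sup>2 + \<beta>\<^sup>2 * ((norm w)\<^sup>2 - (norm (cinner w e))\<^sup>2)"
proof -
  have eq: "stretch e \<alpha> \<beta> w - cinner (stretch e \<alpha> \<beta> w) e *s e = \<beta> *\<^sub>R (w - cinner w e *s e)"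
    unfolding cinner_stretch[OF assms] by (simp add: stretch_def vec_eq_iff algebra_simps scaleR_conv_of_real[where 'a=complex])
  have "(norm (stretch e \<alpha> \<beta> w))\<^sup>2 = (norm (cinner (stretch e \<alpha> \<beta> w) e))\<^sup>2 + (norm (\<beta> *\<^sub>R (w - cinner w e *s e)))\<^sup>2"
    using norm_perp[OF assms, of "stretch e \<alpha> \<beta> w"] unfolding eq by simp
  then show ?thesis
    by (simp add: cinner_stretch[OF assms] norm_mult power_mult_distrib norm_perp[OF assms])
qed

lemma norm_cinner_unit_le:
  assumes "norm e = 1"
  shows "(norm (cinner w e))\<^sup>2 \<le> (norm w)\<^sup>2"
  using power_mono[OF norm_cinner_le[of w e], of 2] assms by simp

section \<open>Lebesgue measure under isometries and complex stretches\<close>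

lemma nn_integral_lborel_translate:
  fixes f :: "'a::euclidean_space \<Rightarrow> ennreal"
  assumes [measurable]: "f \<in> borel_measurable borel"
  shows "(\<integral>\<^sup>+x. f (c + x) \<partial>lborel) = (\<integral>\<^sup>+x. f x \<partial>lborel)"
proof -
  have "(\<integral>\<^sup>+x. f x \<partial>lborel) = (\<integral>\<^sup>+x. f x \<partial>distr lborel borel ((+) c))" by (simp only: lborel_distr_plus)
  also have "\<dots> = (\<integral>\<^sup>+x. f (c + x) \<partial>lborel)" by (subst nn_integral_distr) auto
  finally show ?thesis by simp
qed

lemma nn_integral_lborel_reflect:
  fixes f :: "'a::euclidean_space \<Rightarrow> ennreal"
  assumes [measurable]: "f \<in> borel_measurable borel"
  shows "(\<integral>\<^sup>+x. f (c - x) \<partial>lborel) = (\<integral>\<^sup>+x. f x \<partial>lborel)"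
proof -
  have eq: "(lborel :: 'a measure) = density (distr lborel borel (\<lambda>x. c + (-1) *\<^sub>R x)) (\<lambda>_. ennreal (\<bar>-1\<bar> ^ DIM('a)))"
    by (rule lborel_affine) simp
  have "(\<integral>\<^sup>+x. f x \<partial>lborel) =
      (\<integral>\<^sup>+x. f x \<partial>density (distr lborel borel (\<lambda>x. c + (-1) *\<^sub>R x)) (\<lambda>_. ennreal (\<bar>-1\<bar> ^ DIM('a))))"
    using eq by (rule arg_cong)
  also have "\<dots> = (\<integral>\<^sup>+x. f x \<partial>distr lborel borel (\<lambda>x. c + (-1) *\<^sub>R x))"
    by (subst nn_integral_density) auto
  also have "\<dots> = (\<integral>\<^sup>+x. f (c - x) \<partial>lborel)"
    by (subst nn_integral_distr) auto
  finally show ?thesis by simp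
qed

text \<open>Uniqueness of Haar measure: the image measure is translation invariant, and comparing
  \<open>\<integral>\<integral> 1\<^sub>A(U x) 1\<^sub>B(y + U x) dx dy\<close> in the two orders identifies it up to the factor
  \<open>|U\<^sup>-\<^sup>1B| / |B|\<close>, which is \<open>1\<close> for the unit ball \<open>B\<close>.\<close>

lemma emeasure_isometry_vimage:
  fixes U :: "'a::euclidean_space \<Rightarrow> 'a"
  assumes U: "linear U" "\<And>x. norm (U x) = norm x" and A: "A \<in> sets borel"
  shows "emeasure lborel (U -` A) = emeasure lborel A"
proof -
  let ?B = "ball (0::'a) 1"
  have Um [measurable]: "U \<in> borel_measurable borel"
    using U(1) by (intro borel_measurable_continuous_onI linear_continuous_on linear_conv_bounded_linear[THEN iffD1])
  note A [measurable]
  have Bs [measurable]: "?B \<in> sets borel" by auto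
  have Am: "(indicator A :: 'a \<Rightarrow> ennreal) \<in> borel_measurable borel" using A by (rule borel_measurable_indicator)
  have Bm: "(indicator ?B :: 'a \<Rightarrow> ennreal) \<in> borel_measurable borel" by (intro borel_measurable_indicator) auto
  have "x = 0" if "U x = 0" for x using U(2)[of x] that by simp
  then have inj: "inj U" using linear_injective_0[OF U(1)] by simp
  have surj: "surj U" using linear_inj_imp_surj[OF U(1) inj] .
  have UA [measurable]: "U -` A \<in> sets borel" using measurable_sets[OF Um A] by simp
  have "emeasure lborel (U -` A) * emeasure lborel ?B =
      (\<integral>\<^sup>+x. indicator A (U x) * (\<integral>\<^sup>+y. indicator ?B (U x + y) \<partial>lborel) \<partial>lborel)"
  proof -
    have "(\<integral>\<^sup>+y. indicator ?B (U x + y) \<partial>lborel) = emeasure lborel ?B" for x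
      using nn_integral_lborel_translate[OF Bm, of "U x"] by simp
    then have "(\<integral>\<^sup>+x. indicator A (U x) * (\<integral>\<^sup>+y. indicator ?B (U x + y) \<partial>lborel) \<partial>lborel) =
       (\<integral>\<^sup>+x. indicator (U -` A) x * emeasure lborel ?B \<partial>lborel)"
      by (intro nn_integral_cong) (auto simp: indicator_def)
    also have "\<dots> = emeasure lborel (U -` A) * emeasure lborel ?B"
      by (subst nn_integral_multc) auto
    finally show ?thesis by simp
  qed
  also have "\<dots> = (\<integral>\<^sup>+x. (\<integral>\<^sup>+y. indicator A (U x) * indicator ?B (U x + y) \<partial>lborel) \<partial>lborel)"
    by (intro nn_integral_cong nn_integral_cmult[symmetric]) measurable
  also have "\<dots> = (\<integral>\<^sup>+y. (\<integral>\<^sup>+x. indicator A (U x) * indicator ?B (U x + y) \<partial>lborel) \<partial>lborel)"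
    by (intro lborel_pair.Fubini'[symmetric]) measurable
  also have "\<dots> = (\<integral>\<^sup>+y. (\<integral>\<^sup>+x. indicator A (U x - y) * indicator ?B (U x) \<partial>lborel) \<partial>lborel)"
  proof (rule nn_integral_cong)
    fix y
    \<comment> \<open>Shifting \<open>x\<close> by a preimage \<open>v\<close> of \<open>y\<close>
      moves the translation from the argument of \<open>?B\<close> to that of \<open>A\<close>,
      where the reflection \<open>y \<mapsto> U x - y\<close> integrates it out.\<close>
    obtain v where v: "y = U v" using surjD[OF surj, of y] by blast
    have "(\<integral>\<^sup>+x. indicator A (U x - y) * indicator ?B (U x) \<partial>lborel) =
       (\<integral>\<^sup>+x. (indicator A (U (v + x) - y) * indicator ?B (U (v + x)) :: ennreal) \<partial>lborel)"
      by (intro nn_integral_lborel_translate[symmetric, where f = "\<lambda>x. indicator A (U x - y) * indicator ?B (U x)"]) measurable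
    also have "\<dots> = (\<integral>\<^sup>+x. indicator A (U x) * indicator ?B (U x + y) \<partial>lborel)"
      by (simp add: linear_add[OF U(1)] v add.commute)
    finally show "(\<integral>\<^sup>+x. indicator A (U x) * indicator ?B (U x + y) \<partial>lborel) =
      (\<integral>\<^sup>+x. indicator A (U x - y) * indicator ?B (U x) \<partial>lborel)" by simp
  qed
  also have "\<dots> = (\<integral>\<^sup>+x. (\<integral>\<^sup>+y. indicator A (U x - y) * indicator ?B (U x) \<partial>lborel) \<partial>lborel)"
    by (intro lborel_pair.Fubini') measurable
  also have "\<dots> = (\<integral>\<^sup>+x. emeasure lborel A * indicator ?B (U x) \<partial>lborel)"
  proof (rule nn_integral_cong)
    fix x
    have "(\<integral>\<^sup>+y. indicator A (U x - y) * indicator ?B (U x) \<partial>lborel) = (\<integral>\<^sup>+y. indicator A (U x - y) \<partial>lborel) * indicator ?B (U x)"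
      by (intro nn_integral_multc) measurable
    also have "(\<integral>\<^sup>+y. indicator A (U x - y) \<partial>lborel) = emeasure lborel A"
      using nn_integral_lborel_reflect[OF Am, of "U x"] A by simp
    finally show "(\<integral>\<^sup>+y. indicator A (U x - y) * indicator ?B (U x) \<partial>lborel) = emeasure lborel A * indicator ?B (U x)" .
  qed
  also have "\<dots> = (\<integral>\<^sup>+x. emeasure lborel A * indicator ?B x \<partial>lborel)"
    using U(2) by (intro nn_integral_cong) (auto simp: indicator_def)
  also have "\<dots> = emeasure lborel A * emeasure lborel ?B" by (intro nn_integral_cmult_indicator) auto
  finally have eq: "emeasure lborel (U -` A) * emeasure lborel ?B = emeasure lborel A * emeasure lborel ?B" .
  have "emeasure lborel ?B \<noteq> \<infinity>" using emeasure_lborel_ball_finite[of "0::'a" 1] by simp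
  moreover have "emeasure lborel ?B \<noteq> 0"
    using content_ball_pos[of 1 "0::'a"] by (auto simp: measure_def)
  ultimately show ?thesis using eq by (simp add: ennreal_mult_cancel_left mult.commute[of _ "emeasure lborel ?B"])
qed

text \<open>In the real basis the complex coordinate \<open>k\<close> contributes the two vectors
  \<open>axis k 1\<close> and \<open>axis k \<i>\<close>, the other coordinates
  \<open>2 * (n - 1)\<close> vectors; these are the exponents in the determinant.\<close>

lemma emeasure_diagonal_vimage:
  fixes k :: "'n::finite"
  assumes pos: "0 < \<alpha>" "0 < \<beta>" and S: "S \<in> sets borel"
  shows "emeasure lborel S = ennreal (\<alpha>\<^sup>2 * \<beta> ^ (2 * (CARD('n) - 1))) *
    emeasure lborel ((\<lambda>x :: complex ^ 'n. \<chi> i. (if i = k then \<alpha> else \<beta>) *\<^sub>R x $ i) -` S)"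
proof -
  define c :: "complex ^ 'n \<Rightarrow> real" where "c b = (if b $ k \<noteq> 0 then \<alpha> else \<beta>)" for b
  define D where "D x = (\<chi> i. (if i = k then \<alpha> else \<beta>) *\<^sub>R x $ i)" for x :: "complex ^ 'n"
  have c: "c j \<noteq> 0" for j using pos by (simp add: c_def)
  have D: "D = (\<lambda>x. 0 + (\<Sum>j\<in>Basis. (c j * (x \<bullet> j)) *\<^sub>R j))"
  proof
    fix x show "D x = 0 + (\<Sum>j\<in>Basis. (c j * (x \<bullet> j)) *\<^sub>R j)"
    proof (rule euclidean_eqI)
      fix b :: "complex ^ 'n" assume b: "b \<in> Basis"
      then obtain i u where iu: "b = axis i u" "u \<in> Basis" by (auto simp: Basis_vec_def)
      then have "u \<noteq> 0" by (auto simp: nonzero_Basis)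
      then have cb: "c b = (if i = k then \<alpha> else \<beta>)" using iu by (simp add: c_def axis_def)
      have "D x \<bullet> b = c b * (x \<bullet> b)" unfolding cb unfolding iu by (simp add: D_def inner_axis)
      then show "D x \<bullet> b = (0 + (\<Sum>j\<in>Basis. (c j * (x \<bullet> j)) *\<^sub>R j)) \<bullet> b"
        using b by (simp add: inner_sum_left_Basis)
    qed
  qed
  have Dm [measurable]: "D \<in> borel_measurable borel" unfolding D by measurable
  have "(\<Prod>j\<in>Basis. \<bar>c j\<bar>) = (\<Prod>j\<in>(Basis :: (complex^'n) set). if j $ k \<noteq> 0 then \<alpha> else \<beta>)"
    using pos by (intro prod.cong) (auto simp: c_def)
  also have "\<dots> = \<alpha> ^ card (Basis \<inter> {j :: complex^'n. j $ k \<noteq> 0}) * \<beta> ^ card (Basis \<inter> - {j :: complex^'n. j $ k \<noteq> 0})"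
    by (subst prod.If_cases) auto
  also have c1: "Basis \<inter> {j :: complex^'n. j $ k \<noteq> 0} = {axis k 1, axis k \<i>}"
    by (auto simp: Basis_vec_def axis_def Basis_complex_def split: if_splits)
  have card1: "card {axis k 1, axis k \<i> :: complex^'n} = 2" by (simp add: axis_eq_axis)
  have "card (Basis \<inter> - {j :: complex^'n. j $ k \<noteq> 0}) = card (Basis :: (complex^'n) set) - card (Basis \<inter> {j :: complex^'n. j $ k \<noteq> 0})"
    by (subst card_Diff_subset_Int[symmetric]) (auto simp: Diff_eq)
  then have card2: "card (Basis \<inter> - {j :: complex^'n. j $ k \<noteq> 0}) = 2 * (CARD('n) - 1)"
    unfolding c1 card1 by simp
  note c1
  finally have pr: "(\<Prod>j\<in>Basis. \<bar>c j\<bar>) = \<alpha>\<^sup>2 * \<beta> ^ (2 * (CARD('n) - 1))"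
    unfolding card1 card2 .
  have "emeasure lborel S = emeasure (density (distr lborel borel D) (\<lambda>_. ennreal (\<Prod>j\<in>Basis. \<bar>c j\<bar>))) S"
    unfolding D using lborel_affine_euclidean[of c 0] c by simp
  also have "\<dots> = ennreal (\<alpha>\<^sup>2 * \<beta> ^ (2 * (CARD('n) - 1))) * emeasure lborel (D -` S)"
    using S unfolding pr by (subst emeasure_density_const) (auto simp: emeasure_distr)
  finally show ?thesis by (simp add: D_def[abs_def])
qed

definition unitary_frame :: "('n::finite \<Rightarrow> complex ^ 'n) \<Rightarrow> bool" where
  "unitary_frame v \<longleftrightarrow> (\<forall>i j. cinner (v i) (v j) = (if i = j then 1 else 0))"

lemma unitary_frame_norm: "unitary_frame v \<Longrightarrow> norm (v i) = 1"
proof -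
  assume "unitary_frame v"
  then have "cinner (v i) (v i) = 1" by (simp add: unitary_frame_def)
  then have "(norm (v i))\<^sup>2 = 1" by (simp only: cinner_self of_real_eq_1_iff)
  then show ?thesis using norm_ge_zero[of "v i"] unfolding power2_eq_1_iff by linarith
qed

definition frame_map :: "('n::finite \<Rightarrow> complex ^ 'n) \<Rightarrow> complex ^ 'n \<Rightarrow> complex ^ 'n" where
  "frame_map v x = (\<Sum>i\<in>UNIV. x $ i *s v i)"

lemma linear_frame_map: "linear (frame_map v)"
  by (rule linearI) (simp_all add: frame_map_def sum.distrib[symmetric] vec_eq_iff scaleR_sum_right algebra_simps)

lemma cinner_frame_map:
  assumes "unitary_frame v"
  shows "cinner (frame_map v x) (v j) = x $ j"
proof -
  have "cinner (frame_map v x) (v j) = (\<Sum>i\<in>UNIV. if i = j then x $ i else 0)"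
    unfolding frame_map_def cinner_sum_left cinner_smult_left using assms
    by (intro sum.cong) (auto simp: unitary_frame_def)
  then show ?thesis by simp
qed

lemma norm_frame_map:
  assumes "unitary_frame v"
  shows "norm (frame_map v x) = norm x"
proof -
  let ?U = "frame_map v"
  have "cinner (?U x) (?U x) = (\<Sum>i\<in>UNIV. x $ i * cinner (v i) (?U x))"
    by (subst frame_map_def) (simp add: cinner_sum_left cinner_smult_left)
  also have "\<dots> = cinner x x"
    by (subst (2) cinner_def) (simp add: cnj_cinner[of "?U x", symmetric] cinner_frame_map[OF assms])
  finally have "(norm (?U x))\<^sup>2 = (norm x)\<^sup>2" by (simp only: cinner_self of_real_eq_iff)
  then show ?thesis by (rule power2_eq_imp_eq) auto
qed

text \<open>The frame map is a linear isometry, so it is injective and, in finite dimension, onto: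
  every \<open>w\<close> has coordinates in the frame.\<close>

lemma unitary_frame_parseval:
  assumes "unitary_frame v"
  shows "(norm w)\<^sup>2 = (\<Sum>j\<in>UNIV. (norm (cinner w (v j)))\<^sup>2)"
proof -
  have "inj (frame_map v)"
    unfolding linear_injective_0[OF linear_frame_map] by (metis norm_frame_map[OF assms] norm_eq_zero)
  then obtain x where x: "w = frame_map v x"
    using linear_injective_imp_surjective[OF linear_frame_map] by (meson surjD)
  have "(norm x)\<^sup>2 = (\<Sum>j\<in>UNIV. (norm (x $ j))\<^sup>2)" unfolding norm_vec_def L2_set_def by (simp add: sum_nonneg)
  then show ?thesis unfolding x norm_frame_map[OF assms] cinner_frame_map[OF assms] .
qed

text \<open>The isometry \<open>frame_map v\<close> conjugates the stretch along \<open>v k\<close>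
  to a diagonal scaling, and isometries preserve the measure.\<close>

lemma emeasure_stretch_vimage:
  fixes v :: "'n::finite \<Rightarrow> complex ^ 'n"
  assumes v: "unitary_frame v" and pos: "0 < \<alpha>" "0 < \<beta>" and S: "S \<in> sets borel"
  shows "emeasure lborel S = ennreal (\<alpha>\<^sup>2 * \<beta> ^ (2 * (CARD('n) - 1))) * emeasure lborel (stretch (v k) \<alpha> \<beta> -` S)"
proof -
  define U where "U = frame_map v"
  define D where "D x = (\<chi> i. (if i = k then \<alpha> else \<beta>) *\<^sub>R x $ i)" for x :: "complex ^ 'n"
  note cU = cinner_frame_map[OF v, folded U_def] and iso = norm_frame_map[OF v, folded U_def]
  have lin: "linear U" unfolding U_def by (rule linear_frame_map)
  have U_eq: "U x = (\<Sum>i\<in>UNIV. x $ i *s v i)" for x by (simp add: U_def frame_map_def)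
  have comm: "stretch (v k) \<alpha> \<beta> (U x) = U (D x)" for x
  proof -
    have "U (D x) = (\<Sum>i\<in>UNIV. \<beta> *\<^sub>R (x $ i *s v i) + (if i = k then of_real (\<alpha> - \<beta>) * x $ i else 0) *s v i)"
      unfolding U_eq D_def by (intro sum.cong) (auto simp: vec_eq_iff scaleR_conv_of_real[where 'a=complex] algebra_simps)
    also have "\<dots> = \<beta> *\<^sub>R U x + (\<Sum>i\<in>UNIV. (if i = k then of_real (\<alpha> - \<beta>) * x $ i else 0) *s v i)"
      by (simp add: sum.distrib U_eq scaleR_sum_right)
    also have "(\<Sum>i\<in>UNIV. (if i = k then of_real (\<alpha> - \<beta>) * x $ i else 0) *s v i) = (of_real (\<alpha> - \<beta>) * x $ k) *s v k"
      by (subst sum.mono_neutral_right[of UNIV "{k}"]) auto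
    finally show ?thesis by (simp add: stretch_def cU)
  qed
  have [measurable]: "stretch (v k) \<alpha> \<beta> \<in> borel_measurable borel" "U \<in> borel_measurable borel"
    using lin linear_stretch
    by (auto intro!: borel_measurable_continuous_onI linear_continuous_on linear_conv_bounded_linear[THEN iffD1])
  have m: "stretch (v k) \<alpha> \<beta> -` S \<in> sets borel" "U -` S \<in> sets borel"
    using measurable_sets[OF _ S, of "stretch (v k) \<alpha> \<beta>" borel] measurable_sets[OF _ S, of U borel] by auto
  have "emeasure lborel (stretch (v k) \<alpha> \<beta> -` S) = emeasure lborel (U -` (stretch (v k) \<alpha> \<beta> -` S))"
    by (rule emeasure_isometry_vimage[OF lin iso m(1), symmetric])
  also have "U -` (stretch (v k) \<alpha> \<beta> -` S) = D -` (U -` S)" by (auto simp: comm)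
  finally have "ennreal (\<alpha>\<^sup>2 * \<beta> ^ (2 * (CARD('n) - 1))) * emeasure lborel (stretch (v k) \<alpha> \<beta> -` S) = emeasure lborel (U -` S)"
    using emeasure_diagonal_vimage[OF pos m(2), of k] by (simp add: D_def[abs_def])
  also have "\<dots> = emeasure lborel S" by (rule emeasure_isometry_vimage[OF lin iso S])
  finally show ?thesis by simp
qed

lemma continuous_stretch: "continuous_on A (stretch e \<alpha> \<beta>)"
  by (rule linear_continuous_on) (simp add: linear_stretch linear_conv_bounded_linear[symmetric])

lemma stretch_image:
  assumes "norm e = 1" "0 < \<alpha>" "0 < \<beta>"
  shows "stretch e \<alpha> \<beta> ` S = stretch e (1 / \<alpha>) (1 / \<beta>) -` S"
proof -
  have 1: "stretch e (1 / \<alpha>) (1 / \<beta>) (stretch e \<alpha> \<beta> w) = w" for w using assms by (simp add: stretch_inverse)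
  have 2: "stretch e \<alpha> \<beta> (stretch e (1 / \<alpha>) (1 / \<beta>) w) = w" for w
    using stretch_inverse[of e "1 / \<alpha>" "1 / \<beta>" w] assms by simp
  show ?thesis
  proof safe
    fix x assume "x \<in> S" then show "stretch e \<alpha> \<beta> x \<in> stretch e (1 / \<alpha>) (1 / \<beta>) -` S" by (simp add: 1)
  next
    fix x assume "stretch e (1 / \<alpha>) (1 / \<beta>) x \<in> S"
    then show "x \<in> stretch e \<alpha> \<beta> ` S" using 2[of x] by (metis imageI)
  qed
qed

lemma affine_stretch_image:
  fixes v :: "'n::finite \<Rightarrow> complex ^ 'n"
  assumes v: "unitary_frame v" and pos: "0 < \<alpha>" "0 < \<beta>" and S: "S \<in> sets borel"
  shows sets_affine_stretch_image: "(\<lambda>\<zeta>. a + stretch (v k) \<alpha> \<beta> \<zeta>) ` S \<in> sets borel"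
    and emeasure_affine_stretch_image: "emeasure lborel ((\<lambda>\<zeta>. a + stretch (v k) \<alpha> \<beta> \<zeta>) ` S) =
      ennreal (\<alpha>\<^sup>2 * \<beta> ^ (2 * (CARD('n) - 1))) * emeasure lborel S"
proof -
  have n1: "norm (v k) = 1" by (rule unitary_frame_norm[OF v])
  let ?X = "stretch (v k) \<alpha> \<beta> ` S"
  have bm: "stretch (v k) \<alpha>' \<beta>' \<in> borel_measurable borel" for \<alpha>' \<beta>'
    by (intro borel_measurable_continuous_onI continuous_stretch)
  have X: "?X \<in> sets borel"
    unfolding stretch_image[OF n1 pos] using measurable_sets[OF bm S, of "1 / \<alpha>" "1 / \<beta>"] by simp
  have eq: "(\<lambda>\<zeta>. a + stretch (v k) \<alpha> \<beta> \<zeta>) ` S = (\<lambda>x. - a + x) -` ?X"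
  proof safe
    fix x z assume "z \<in> S" "- a + x = stretch (v k) \<alpha> \<beta> z"
    then have "x = a + stretch (v k) \<alpha> \<beta> z" by (metis add.assoc add.right_inverse add_0)
    then show "x \<in> (\<lambda>\<zeta>. a + stretch (v k) \<alpha> \<beta> \<zeta>) ` S" using \<open>z \<in> S\<close> by blast
  qed auto
  have t: "(\<lambda>x. - a + x) \<in> borel_measurable borel" by measurable
  have X': "(\<lambda>x. - a + x) -` ?X \<in> sets borel"
    using measurable_sets[OF t X] by (simp only: space_borel Int_UNIV_right)
  then show "(\<lambda>\<zeta>. a + stretch (v k) \<alpha> \<beta> \<zeta>) ` S \<in> sets borel" unfolding eq .
  have "emeasure lborel ((\<lambda>\<zeta>. a + stretch (v k) \<alpha> \<beta> \<zeta>) ` S) = (\<integral>\<^sup>+x. indicator ((\<lambda>x. - a + x) -` ?X) x \<partial>lborel)"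
    unfolding eq using X' by (intro nn_integral_indicator[symmetric]) (simp only: sets_lborel)
  also have "\<dots> = (\<integral>\<^sup>+x. indicator ?X (- a + x) \<partial>lborel)" by (intro nn_integral_cong) (auto simp: indicator_def)
  also have "\<dots> = (\<integral>\<^sup>+x. indicator ?X x \<partial>lborel)" by (rule nn_integral_lborel_translate[OF borel_measurable_indicator[OF X]])
  also have "\<dots> = emeasure lborel ?X" using X by simp
  also have "\<dots> = ennreal (\<alpha>\<^sup>2 * \<beta> ^ (2 * (CARD('n) - 1))) * emeasure lborel (stretch (v k) \<alpha> \<beta> -` ?X)"
    by (rule emeasure_stretch_vimage[OF v pos X])
  also have "stretch (v k) \<alpha> \<beta> -` ?X = S"
  proof -
    have "inj (stretch (v k) \<alpha> \<beta>)" 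
      by (rule inj_on_inverseI[where g = "stretch (v k) (1 / \<alpha>) (1 / \<beta>)"]) (use pos in \<open>simp add: stretch_inverse n1\<close>)
    then show ?thesis by (rule inj_vimage_image_eq)
  qed
  finally show "emeasure lborel ((\<lambda>\<zeta>. a + stretch (v k) \<alpha> \<beta> \<zeta>) ` S) =
      ennreal (\<alpha>\<^sup>2 * \<beta> ^ (2 * (CARD('n) - 1))) * emeasure lborel S" .
qed

lemma mem_ellipsoid_iff:
  assumes e: "norm e = 1" and pos: "0 < \<alpha>" "0 < \<beta>"
  shows "w \<in> (\<lambda>\<zeta>. a + stretch e \<alpha> \<beta> \<zeta>) ` ball 0 1 \<longleftrightarrow>
    (norm (cinner (w - a) e))\<^sup>2 / \<alpha>\<^sup>2 + ((norm (w - a))\<^sup>2 - (norm (cinner (w - a) e))\<^sup>2) / \<beta>\<^sup>2 < 1"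
proof -
  have "w \<in> (\<lambda>\<zeta>. a + stretch e \<alpha> \<beta> \<zeta>) ` ball 0 1 \<longleftrightarrow> w - a \<in> stretch e \<alpha> \<beta> ` ball 0 1"
    by (auto simp: image_iff algebra_simps)
  also have "\<dots> \<longleftrightarrow> norm (stretch e (1 / \<alpha>) (1 / \<beta>) (w - a)) < 1"
    unfolding stretch_image[OF assms] by simp
  also have "\<dots> \<longleftrightarrow> (norm (stretch e (1 / \<alpha>) (1 / \<beta>) (w - a)))\<^sup>2 < 1"
    by (simp add: power2_less_1_iff) (smt (verit) norm_ge_zero)
  also have "\<dots> \<longleftrightarrow> (norm (cinner (w - a) e))\<^sup>2 / \<alpha>\<^sup>2 + ((norm (w - a))\<^sup>2 - (norm (cinner (w - a) e))\<^sup>2) / \<beta>\<^sup>2 < 1"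
    unfolding norm_stretch[OF e] by (simp add: power_divide)
  finally show ?thesis .
qed

section \<open>Tents in the unit ball\<close>

abbreviation kdist :: "complex ^ 'n \<Rightarrow> complex ^ 'n \<Rightarrow> real" where
  "kdist z w \<equiv> norm (1 - cinner z w)"

lemma kdist_commute: "kdist z w = kdist w z"
  by (metis cnj_cinner complex_cnj_diff complex_cnj_one complex_mod_cnj)

lemma kdist_ge:
  assumes "norm w \<le> 1"
  shows "1 - norm z \<le> kdist z w"
proof -
  have "norm (cinner z w) \<le> norm z * 1" 
    using norm_cinner_le[of z w] mult_left_mono[OF assms, of "norm z"] by simp
  then show ?thesis using norm_triangle_ineq2[of 1 "cinner z w"] by simp
qed

lemma norm_diff_le_kdist:
  assumes "norm z \<le> 1" "norm w \<le> 1"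
  shows "(norm (z - w))\<^sup>2 \<le> 2 * kdist z w"
proof -
  have "(norm z)\<^sup>2 \<le> 1" "(norm w)\<^sup>2 \<le> 1" using assms by (auto simp: power_le_one)
  moreover have "Re (1 - cinner z w) \<le> kdist z w" by (rule complex_Re_le_cmod)
  ultimately show ?thesis by (simp add: norm_diff_cinner)
qed

text \<open>Near the boundary \<open>y - z\<close> is only of order \<open>sqrt (kdist y z)\<close>,
  but its component along \<open>y\<close> is of order \<open>kdist y z\<close>, because
  \<open>\<langle>y, y - z\<rangle>\<close> differs from \<open>1 - \<langle>y, z\<rangle>\<close>
  only by \<open>1 - |y|\<^sup>2\<close>.\<close>

lemma norm_cinner_diff_self_le:
  assumes "norm y \<le> 1" "norm z \<le> 1"
  shows "norm (cinner y (y - z)) \<le> 3 * kdist y z"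
proof -
  have "cinner y (y - z) = (1 - cinner y z) - of_real (1 - (norm y)\<^sup>2)"
    by (simp add: cinner_diff_right cinner_self)
  then have "norm (cinner y (y - z)) \<le> kdist y z + norm (of_real (1 - (norm y)\<^sup>2) :: complex)"
    by (metis norm_triangle_ineq4)
  moreover have "norm (of_real (1 - (norm y)\<^sup>2) :: complex) = 1 - (norm y)\<^sup>2"
    unfolding norm_of_real using assms by (simp add: power_le_one)
  ultimately have "norm (cinner y (y - z)) \<le> kdist y z + (1 - (norm y)\<^sup>2)" by simp
  moreover have "1 - (norm y)\<^sup>2 \<le> 2 * (1 - norm y)"
    using zero_le_power2[of "1 - norm y"] by (simp add: power2_eq_square algebra_simps)
  moreover have "1 - norm y \<le> kdist y z" using assms by (intro kdist_ge)
  ultimately show ?thesis by argo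
qed

text \<open>Expand \<open>1 - \<langle>x, z\<rangle>\<close> around \<open>y\<close>. The linear
  error is radial, hence of order \<open>kdist y z\<close>; the quadratic error
  \<open>\<langle>x - y, y - z\<rangle>\<close> is a product of two terms of square root order,
  hence bounded by the sum of the two distances.\<close>

lemma kdist_triangle:
  assumes "norm x \<le> 1" "norm y \<le> 1" "norm z \<le> 1"
  shows "kdist x z \<le> 4 * (kdist x y + kdist y z)"
proof -
  have "1 - cinner x z = (1 - cinner x y) + cinner y (y - z) + cinner (x - y) (y - z)"
    by (simp add: cinner_diff_left cinner_diff_right)
  then have "kdist x z \<le> kdist x y + norm (cinner y (y - z)) + norm (cinner (x - y) (y - z))"
    by (metis add_mono_thms_linordered_semiring(3) norm_triangle_le norm_triangle_ineq order_refl)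
  moreover have "norm (cinner (x - y) (y - z)) \<le> kdist x y + kdist y z"
  proof -
    have "norm (cinner (x - y) (y - z)) \<le> norm (x - y) * norm (y - z)" by (rule norm_cinner_le)
    also have "\<dots> \<le> ((norm (x - y))\<^sup>2 + (norm (y - z))\<^sup>2) / 2"
      using zero_le_power2[of "norm (x - y) - norm (y - z)"] by (simp add: power2_eq_square algebra_simps)
    also have "\<dots> \<le> kdist x y + kdist y z"
      using norm_diff_le_kdist[of x y] norm_diff_le_kdist[of y z] assms by auto
    finally show ?thesis .
  qed
  moreover have "norm (cinner y (y - z)) \<le> 3 * kdist y z" using norm_cinner_diff_self_le assms by auto
  moreover have "kdist x y \<ge> 0" "kdist y z \<ge> 0" by auto
  ultimately show ?thesis by (smt (verit))
qed

lemma unit_vector_exists: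
  fixes z :: "complex ^ 'n"
  obtains e where "norm e = 1" "z = norm z *\<^sub>R e"
proof (cases "z = 0")
  case True
  obtain e :: "complex ^ 'n" where "norm e = 1" using vector_choose_size[of 1] by auto
  then show ?thesis using that[of e] True by simp
next
  case False
  then show ?thesis using that[of "z /\<^sub>R norm z"] by simp
qed

text \<open>The tent over \<open>a\<close> of size \<open>r\<close> is comparable to an ellipsoid centred at the boundary point
  \<open>a / |a|\<close> with complex semi-axes \<open>r\<close> (radially) and \<open>r\<^sup>1\<^sup>/\<^sup>2\<close> (tangentially).\<close>

lemma tent_subset_ellipsoid:
  assumes e: "norm e = 1" "a = norm a *\<^sub>R e" and a: "norm a < 1" and r: "0 < r"
  shows "{w \<in> ball 0 1. kdist a w < r} \<subseteq> (\<lambda>\<zeta>. e + stretch e (3 * r) (3 * sqrt r) \<zeta>) ` ball 0 1"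
proof safe
  fix w assume w: "w \<in> ball 0 1" and d: "kdist a w < r"
  define w1 where "w1 = cinner w e"
  have nw: "norm w < 1" using w by simp
  have nw1: "norm w1 < 1" using norm_cinner_le[of w e] e nw by (simp add: w1_def)
  have "cinner w a = norm a * w1" by (subst e(2)) (simp add: cinner_scaleR_right w1_def)
  \<comment> \<open>Replacing \<open>a\<close> by its boundary point costs at most
    \<open>1 - norm a \<le> kdist a w < r\<close>.\<close>
  then have "1 - w1 = (1 - cinner w a) - of_real (1 - norm a) * w1" by (simp add: algebra_simps)
  then have "norm (1 - w1) \<le> kdist w a + norm (of_real (1 - norm a) * w1)" by (metis norm_triangle_ineq4)
  moreover have "norm (of_real (1 - norm a) * w1) \<le> 1 - norm a"
    using a nw1 mult_left_mono[of "norm w1" 1 "1 - norm a"] unfolding norm_mult norm_of_real by simp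
  moreover have "1 - norm a \<le> kdist a w" using kdist_ge[of w a] nw by simp
  ultimately have d1: "norm (1 - w1) < 2 * r" using d kdist_commute[of a w] by linarith
  have "1 - norm w1 \<le> norm (1 - w1)" using norm_triangle_ineq2[of 1 w1] by simp
  then have "1 - (norm w1)\<^sup>2 \<le> 4 * r"
    using d1 zero_le_power2[of "1 - norm w1"] by (simp add: power2_eq_square algebra_simps)
  then have perp: "(norm w)\<^sup>2 - (norm w1)\<^sup>2 \<le> 4 * r" using nw power_le_one[of "norm w" 2] by simp
  have c: "cinner (w - e) e = w1 - 1" by (simp add: cinner_diff_left w1_def cinner_unit[OF e(1)])
  have p: "(norm (w - e))\<^sup>2 - (norm (cinner (w - e) e))\<^sup>2 = (norm w)\<^sup>2 - (norm w1)\<^sup>2"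
  proof -
    have h: "(w - e) - cinner (w - e) e *s e = w - w1 *s e" unfolding c by (simp add: vec_eq_iff algebra_simps)
    from norm_perp[OF e(1), of "w - e"] norm_perp[OF e(1), of w] show ?thesis
      unfolding h unfolding w1_def by linarith
  qed
  have "(norm (w1 - 1))\<^sup>2 \<le> (2 * r)\<^sup>2" using d1 by (intro power_mono) (auto simp: norm_minus_commute)
  then have "(norm (w1 - 1))\<^sup>2 / (3 * r)\<^sup>2 \<le> (2 * r)\<^sup>2 / (3 * r)\<^sup>2" by (intro divide_right_mono) auto
  also have "\<dots> = 4 / 9" using r by (simp add: power2_eq_square)
  finally have 1: "(norm (w1 - 1))\<^sup>2 / (3 * r)\<^sup>2 \<le> 4 / 9" .
  have "((norm w)\<^sup>2 - (norm w1)\<^sup>2) / (3 * sqrt r)\<^sup>2 \<le> 4 * r / (3 * sqrt r)\<^sup>2" using perp by (intro divide_right_mono) auto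
  also have "\<dots> = 4 / 9" using r by (simp add: power_mult_distrib)
  finally have 2: "((norm w)\<^sup>2 - (norm w1)\<^sup>2) / (3 * sqrt r)\<^sup>2 \<le> 4 / 9" .
  show "w \<in> (\<lambda>\<zeta>. e + stretch e (3 * r) (3 * sqrt r) \<zeta>) ` ball 0 1"
    using 1 2 r by (subst mem_ellipsoid_iff) (auto simp only: e c p[unfolded c] mult_pos_pos zero_less_numeral real_sqrt_gt_zero)
qed

lemma ellipse_bounds:
  fixes X Y :: real
  assumes r: "0 < r" and Y: "0 \<le> Y" and X: "0 \<le> X" and sum: "X\<^sup>2 / (r / 8)\<^sup>2 + Y / (sqrt r / 2)\<^sup>2 < 1"
  shows "X < r / 8" "Y < r / 4"
proof -
  have s: "(sqrt r / 2)\<^sup>2 = r / 4" using r by (simp add: power_divide)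
  have p: "0 \<le> X\<^sup>2 / (r / 8)\<^sup>2" "0 \<le> Y / (r / 4)" using r Y by simp_all
  have "Y / (r / 4) < 1" using sum p unfolding s by linarith
  then show "Y < r / 4" using r by (subst (asm) pos_divide_less_eq) simp_all
  have "X\<^sup>2 / (r / 8)\<^sup>2 < 1" using sum p unfolding s by linarith
  then have "X\<^sup>2 < (r / 8)\<^sup>2" using r by (subst (asm) pos_divide_less_eq) simp_all
  then show "X < r / 8" by (rule power2_less_imp_less) (use r in simp)
qed

text \<open>The centre sits on the radius of \<open>a\<close> at height \<open>r / 2\<close>. The
  radial axis \<open>r / 8\<close> and the squared tangential axis \<open>r / 4\<close> give
  \<open>|u|\<^sup>2 < 1 - 39 * r / 64 + r / 4 = 1 - 23 * r / 64\<close>, so the height of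
  \<open>u\<close> exceeds \<open>23 * r / 128\<close>, which is more than
  \<open>r / 6\<close>.\<close>

lemma ellipsoid_subset_tent:
  assumes e: "norm e = 1" "a = norm a *\<^sub>R e" and a: "norm a < 1" and r: "1 - norm a \<le> r" "r \<le> 1"
  shows "(\<lambda>\<zeta>. (1 - r / 2) *\<^sub>R e + stretch e (r / 8) (sqrt r / 2) \<zeta>) ` ball 0 1 \<subseteq>
    {u \<in> ball 0 1. kdist a u < 2 * r \<and> r < 6 * (1 - norm u)}"
proof
  fix u assume u: "u \<in> (\<lambda>\<zeta>. (1 - r / 2) *\<^sub>R e + stretch e (r / 8) (sqrt r / 2) \<zeta>) ` ball 0 1"
  have r0: "r > 0" using r a by linarith
  define c where "c = (1 - r / 2) *\<^sub>R e"
  define u1 where "u1 = cinner u e"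
  have ce: "cinner (u - c) e = u1 - of_real (1 - r / 2)"
    by (simp add: c_def cinner_diff_left cinner_scaleR_left cinner_unit[OF e(1)] u1_def)
  have p: "(norm (u - c))\<^sup>2 - (norm (cinner (u - c) e))\<^sup>2 = (norm u)\<^sup>2 - (norm u1)\<^sup>2"
  proof -
    have h: "(u - c) - cinner (u - c) e *s e = u - u1 *s e"
      unfolding ce by (simp add: c_def vec_eq_iff algebra_simps scaleR_conv_of_real[where 'a=complex])
    from norm_perp[OF e(1), of "u - c"] norm_perp[OF e(1), of u] show ?thesis
      unfolding h unfolding u1_def by linarith
  qed
  have perp0: "0 \<le> (norm u)\<^sup>2 - (norm u1)\<^sup>2" using norm_cinner_unit_le[OF e(1), of u] by (simp add: u1_def)
  have sum: "(norm (u1 - of_real (1 - r / 2)))\<^sup>2 / (r / 8)\<^sup>2 + ((norm u)\<^sup>2 - (norm u1)\<^sup>2) / (sqrt r / 2)\<^sup>2 < 1"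
    using u r0 mem_ellipsoid_iff[OF e(1), of "r / 8" "sqrt r / 2" u c] unfolding c_def[symmetric] ce p[unfolded ce] by simp
  have n1: "norm (u1 - of_real (1 - r / 2)) < r / 8" and n2: "(norm u)\<^sup>2 - (norm u1)\<^sup>2 < r / 4"
    by (rule ellipse_bounds[OF r0 perp0 norm_ge_zero sum])+
  have "norm u1 \<le> norm (u1 - of_real (1 - r / 2)) + norm (of_real (1 - r / 2) :: complex)"
    using norm_triangle_ineq[of "u1 - of_real (1 - r / 2)" "of_real (1 - r / 2)"] by (simp only: diff_add_cancel)
  also have "norm (of_real (1 - r / 2) :: complex) = 1 - r / 2" unfolding norm_of_real using r by simp
  finally have nu1: "norm u1 \<le> 1 - 3 * r / 8" using n1 by simp
  then have "(norm u1)\<^sup>2 \<le> (1 - 3 * r / 8)\<^sup>2" by (intro power_mono) auto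
  moreover have "(1 - 3 * r / 8)\<^sup>2 \<le> 1 - 39 * r / 64"
    using r r0 mult_left_mono[of r 1 r] by (simp add: power2_eq_square algebra_simps)
  ultimately have nu: "(norm u)\<^sup>2 < 1 - 23 * r / 64" using n2 by simp
  then have "norm u < 1" using r0 by (intro power2_less_imp_less[of _ 1]) auto
  moreover have "r < 6 * (1 - norm u)"
  proof -
    have "1 - (norm u)\<^sup>2 \<le> 2 * (1 - norm u)"
      using zero_le_power2[of "1 - norm u"] by (simp add: power2_eq_square algebra_simps)
    then show ?thesis using nu r0 by linarith
  qed
  moreover have "kdist a u < 2 * r"
  proof -
    have "cinner u a = norm a * u1" by (subst e(2)) (simp add: cinner_scaleR_right u1_def)
    then have "1 - cinner u a = of_real (1 - norm a) + of_real (norm a) * (1 - u1)" by (simp add: algebra_simps)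
    then have "kdist u a \<le> norm (of_real (1 - norm a) :: complex) + norm (of_real (norm a) * (1 - u1))"
      by (simp only: norm_triangle_ineq)
    also have "norm (of_real (1 - norm a) :: complex) = 1 - norm a" unfolding norm_of_real using a by simp
    also have "norm (of_real (norm a) * (1 - u1)) \<le> norm (1 - u1)"
      unfolding norm_mult norm_of_real using a mult_right_mono[of "norm a" 1 "norm (1 - u1)"] by simp
    also have "norm (1 - u1) \<le> r / 2 + r / 8"
    proof -
      have "1 - u1 = of_real (r / 2) - (u1 - of_real (1 - r / 2))" by simp
      then have "norm (1 - u1) \<le> norm (of_real (r / 2) :: complex) + norm (u1 - of_real (1 - r / 2))"
        by (simp only: norm_triangle_ineq4)
      then show ?thesis using n1 r0 unfolding norm_of_real by simp
    qed
    finally show ?thesis using r r0 by (simp add: kdist_commute)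
  qed
  ultimately show "u \<in> {u \<in> ball 0 1. kdist a u < 2 * r \<and> r < 6 * (1 - norm u)}" by simp
qed

section \<open>Volumes of tents and of thin boundary layers\<close>

lemma ennreal_lborel_ball: "emeasure lborel (ball (0::'a::euclidean_space) 1) = ennreal (measure lborel (ball (0::'a) 1))"
  using emeasure_lborel_ball_finite[of "0::'a" 1] by (intro emeasure_eq_ennreal_measure) auto

lemma tent_sets_borel: "{w \<in> ball 0 1. kdist a w < r} \<in> sets borel"
proof -
  have "continuous_on UNIV (\<lambda>w. kdist a w)" unfolding cinner_def by (intro continuous_intros)
  then have "(\<lambda>w. kdist a w) \<in> borel_measurable borel" by (rule borel_measurable_continuous_onI)
  then show ?thesis by measurable
qed

text \<open>True for every dimension by Gram-Schmidt, but the adapted frames of the theorem provide it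
  for free.\<close>

definition framed :: "'n::finite itself \<Rightarrow> bool" where
  "framed _ \<longleftrightarrow> (\<forall>e :: complex ^ 'n. norm e = 1 \<longrightarrow> (\<exists>v k. unitary_frame v \<and> v k = e))"

lemma adapted_frames_framed:
  fixes e :: "complex ^ 'n \<Rightarrow> 'n::finite \<Rightarrow> complex ^ 'n"
  assumes "adapted_frames e k"
  shows "framed TYPE('n)"
  unfolding framed_def
proof (intro allI impI)
  fix u :: "complex ^ 'n" assume u: "norm u = 1"
  then have "u \<noteq> 0" by auto
  then have "unitary_frame (e u) \<and> e u k = u"
    using assms u unfolding adapted_frames_def unitary_frame_def by simp
  then show "\<exists>v k. unitary_frame v \<and> v k = u" by blast
qed

lemma emeasure_tent_upper:
  fixes a :: "complex ^ 'n"
  assumes fr: "framed TYPE('n)" and a: "norm a < 1" and r: "0 < r"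
  shows "emeasure lborel {w \<in> ball 0 1. kdist a w < r} \<le>
    ennreal (9 ^ CARD('n) * measure lborel (ball (0 :: complex ^ 'n) 1) * r ^ (CARD('n) + 1))"
proof -
  obtain e where e: "norm e = 1" "a = norm a *\<^sub>R e" by (rule unit_vector_exists)
  obtain v k where v: "unitary_frame v" "v k = e" using fr e by (auto simp: framed_def)
  obtain m where m: "CARD('n) = Suc m" using not0_implies_Suc[of "CARD('n)"] by auto
  note im = affine_stretch_image[OF v(1), of "3 * r" "3 * sqrt r" "ball 0 1" e k, unfolded v(2)]
  have "emeasure lborel {w \<in> ball 0 1. kdist a w < r} \<le>
      emeasure lborel ((\<lambda>\<zeta>. e + stretch e (3 * r) (3 * sqrt r) \<zeta>) ` ball 0 1)"
    using im(1) r by (intro emeasure_mono tent_subset_ellipsoid e a r) auto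
  also have "\<dots> = ennreal ((3 * r)\<^sup>2 * (3 * sqrt r) ^ (2 * (CARD('n) - 1))) * emeasure lborel (ball (0 :: complex ^ 'n) 1)"
    using r by (intro im(2)) auto
  also have "(3 * r)\<^sup>2 * (3 * sqrt r) ^ (2 * (CARD('n) - 1)) = 9 ^ CARD('n) * r ^ (CARD('n) + 1)"
    using r by (simp add: m power_mult power_mult_distrib power2_eq_square)
  also have "ennreal (9 ^ CARD('n) * r ^ (CARD('n) + 1)) * emeasure lborel (ball (0 :: complex ^ 'n) 1) =
      ennreal (9 ^ CARD('n) * measure lborel (ball (0 :: complex ^ 'n) 1) * r ^ (CARD('n) + 1))"
    unfolding ennreal_lborel_ball using r by (subst ennreal_mult[symmetric]) (auto simp: mult_ac)
  finally show ?thesis .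
qed

lemma emeasure_tent_lower:
  fixes a :: "complex ^ 'n"
  assumes fr: "framed TYPE('n)" and a: "norm a < 1" and r: "1 - norm a \<le> r" "r \<le> 1"
  shows "ennreal (measure lborel (ball (0 :: complex ^ 'n) 1) / (16 * 4 ^ CARD('n)) * r ^ (CARD('n) + 1)) \<le>
    emeasure lborel {u \<in> ball 0 1. kdist a u < 2 * r \<and> r < 6 * (1 - norm u)}"
proof -
  have r0: "r > 0" using a r by linarith
  obtain e where e: "norm e = 1" "a = norm a *\<^sub>R e" by (rule unit_vector_exists)
  obtain v k where v: "unitary_frame v" "v k = e" using fr e by (auto simp: framed_def)
  obtain m where m: "CARD('n) = Suc m" using not0_implies_Suc[of "CARD('n)"] by auto
  note im = affine_stretch_image[OF v(1), of "r / 8" "sqrt r / 2" "ball 0 1" "(1 - r / 2) *\<^sub>R e" k, unfolded v(2)]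
  have "ennreal (measure lborel (ball (0 :: complex ^ 'n) 1) / (16 * 4 ^ CARD('n)) * r ^ (CARD('n) + 1)) =
      ennreal ((r / 8)\<^sup>2 * (sqrt r / 2) ^ (2 * (CARD('n) - 1))) * emeasure lborel (ball (0 :: complex ^ 'n) 1)"
  proof -
    have "(sqrt r / 2) ^ (2 * j) = (r / 4) ^ j" for j
      unfolding power_mult using r0 by (simp add: power_divide)
    then have "(r / 8)\<^sup>2 * (sqrt r / 2) ^ (2 * (CARD('n) - 1)) = r ^ (CARD('n) + 1) / (16 * 4 ^ CARD('n))"
      by (simp add: m power_divide power2_eq_square)
    then show ?thesis
      unfolding ennreal_lborel_ball using r0 by (simp add: ennreal_mult[symmetric] mult_ac)
  qed
  also have "\<dots> = emeasure lborel ((\<lambda>\<zeta>. (1 - r / 2) *\<^sub>R e + stretch e (r / 8) (sqrt r / 2) \<zeta>) ` ball 0 1)"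
    using r0 by (intro im(2)[symmetric]) auto
  also have "\<dots> \<le> emeasure lborel {u \<in> ball 0 1. kdist a u < 2 * r \<and> r < 6 * (1 - norm u)}"
  proof (intro emeasure_mono ellipsoid_subset_tent e a r)
    have "{u \<in> ball 0 1. kdist a u < 2 * r \<and> r < 6 * (1 - norm u)} = {u \<in> ball 0 1. kdist a u < 2 * r} \<inter> {u. r < 6 * (1 - norm u)}"
      by auto
    moreover have "{u. r < 6 * (1 - norm (u :: complex ^ 'n))} \<in> sets borel" by measurable
    ultimately show "{u \<in> ball 0 1. kdist a u < 2 * r \<and> r < 6 * (1 - norm u)} \<in> sets lborel"
      using tent_sets_borel[of a "2 * r"] by simp
  qed
  finally show ?thesis .
qed

text \<open>The dilates \<open>(1 - \<eta>)\<^sup>m X\<close> of a thin boundary layer \<open>X\<close> of the tent lie in disjoint annuli and,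
  for \<open>m \<le> r / (4 * \<eta>)\<close>, in the tent of size \<open>2 * r\<close>; so \<open>X\<close> has at most \<open>O(\<eta> / r)\<close> of its volume.\<close>

lemma emeasure_thin_tent:
  fixes a :: "complex ^ 'n"
  assumes fr: "framed TYPE('n)" and a: "norm a < 1" and r: "0 < r" "r \<le> 2" and \<eta>: "0 < \<eta>"
  shows "emeasure lborel {w \<in> ball 0 1. kdist a w < r \<and> 1 - norm w < \<eta>} \<le>
    ennreal (16 * 72 ^ CARD('n) * measure lborel (ball (0 :: complex ^ 'n) 1) * \<eta> * r ^ CARD('n))"
proof -
  define n where "n = CARD('n)"
  define VV where "VV = measure lborel (ball (0 :: complex ^ 'n) 1)"
  define X where "X = {w \<in> ball 0 1. kdist a w < r \<and> 1 - norm w < \<eta>}"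
  have VV: "VV \<ge> 0" by (simp add: VV_def)
  have Xeq: "X = {w \<in> ball 0 1. kdist a w < r} \<inter> {w. 1 - norm w < \<eta>}" by (auto simp: X_def)
  have "{w. 1 - norm (w :: complex ^ 'n) < \<eta>} \<in> sets borel" by measurable
  then have Xb: "X \<in> sets borel" unfolding Xeq using tent_sets_borel[of a r] by (intro sets.Int)
  show ?thesis
  \<comment> \<open>For a layer thicker than a fixed fraction of \<open>r\<close> the volume of the
    whole tent is a good enough bound.\<close>
  proof (cases "\<eta> > r / 8")
    case True
    have "emeasure lborel X \<le> emeasure lborel {w \<in> ball 0 1. kdist a w < r}"
      unfolding X_def using tent_sets_borel[of a r] by (intro emeasure_mono) auto
    also have "\<dots> \<le> ennreal (9 ^ n * VV * r ^ (n + 1))"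
      unfolding n_def VV_def by (rule emeasure_tent_upper[OF fr a r(1)])
    also have "\<dots> \<le> ennreal (16 * 72 ^ n * VV * \<eta> * r ^ n)"
    proof (intro ennreal_leI)
      have "9 ^ n * VV * r ^ (n + 1) = (9 ^ n * r) * (VV * r ^ n)" by simp
      also have "\<dots> \<le> (72 ^ n * (16 * \<eta>)) * (VV * r ^ n)"
        using True r VV \<eta> by (intro mult_right_mono mult_mono power_mono) auto
      finally show "9 ^ n * VV * r ^ (n + 1) \<le> 16 * 72 ^ n * VV * \<eta> * r ^ n" by (simp add: mult_ac)
    qed
    finally show ?thesis by (simp add: X_def n_def VV_def)
  next
    case False
    then have \<eta>r: "\<eta> \<le> r / 8" by simp
    \<comment> \<open>\<open>M * \<eta> \<le> r / 4\<close> keeps the dilates in the doubled tent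
      and, as \<open>r \<le> 2\<close>, their factors at least \<open>1 / 2\<close>. Since
      \<open>r / (4 * \<eta>) \<ge> 2\<close>, rounding down loses at most half.\<close>
    define M where "M = nat \<lfloor>r / (4 * \<eta>)\<rfloor>"
    have q2: "r / (4 * \<eta>) \<ge> 2" using \<eta>r \<eta> by (simp add: field_simps)
    have M1: "real M \<le> r / (4 * \<eta>)" "r / (4 * \<eta>) < real M + 1" using q2 unfolding M_def by linarith+
    then have M2: "real M * \<eta> \<le> r / 4" using \<eta> by (simp add: field_simps)
    have "r / (8 * \<eta>) = r / (4 * \<eta>) / 2" using \<eta> by (simp add: field_simps)
    then have M3: "r / (8 * \<eta>) \<le> real M" using M1 q2 by linarith
    have \<eta>1: "\<eta> < 1" using \<eta>r r by linarith
    \<comment> \<open>With equal factors the stretch is a dilation, so any direction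
      \<open>u\<close> serves.\<close>
    obtain u :: "complex ^ 'n" where u: "norm u = 1" using vector_choose_size[of 1] by auto
    obtain v k where v: "unitary_frame v" "v k = u" using fr u by (auto simp: framed_def)
    define s where "s m = (1 - \<eta>) ^ m" for m :: nat
    have s_pos: "s m > 0" for m using \<eta>1 by (simp add: s_def)
    have s_ge: "s m \<ge> 1 - real m * \<eta>" for m
      using Bernoulli_inequality[of "- \<eta>" m] \<eta>1 by (simp add: s_def)
    have s_le: "s m \<le> 1" for m using \<eta>1 \<eta> unfolding s_def by (intro power_le_one) auto
    define Y where "Y m = (\<lambda>\<zeta>. 0 + stretch u (s m) (s m) \<zeta>) ` X" for m
    have Ymem: "\<exists>x\<in>X. y = s m *\<^sub>R x" if "y \<in> Y m" for y m using that by (auto simp: Y_def stretch_def)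
    have Yb: "Y m \<in> sets borel" for m
      using affine_stretch_image(1)[OF v(1) s_pos s_pos Xb, of 0 k m m] by (simp add: Y_def v(2))
    have Yem: "emeasure lborel (Y m) = ennreal (s m ^ (2 * n)) * emeasure lborel X" for m
    proof -
      have "(s m)\<^sup>2 * s m ^ (2 * (CARD('n) - 1)) = s m ^ (2 * n)"
        using not0_implies_Suc[of "CARD('n)"] by (auto simp: n_def power2_eq_square)
      then show ?thesis
        using affine_stretch_image(2)[OF v(1) s_pos s_pos Xb, of 0 k m m] by (simp add: Y_def v(2))
    qed
    have disj: "disjoint_family_on Y {..<M}"
    proof -
      \<comment> \<open>\<open>X\<close> lies in the annulus \<open>1 - \<eta> < norm w < 1\<close>,
        and consecutive dilation factors have the ratio \<open>1 - \<eta>\<close>.\<close>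
      have ann: "s (Suc m) < norm y \<and> norm y < s m" if y: "y \<in> Y m" for y m
      proof -
        obtain x where x: "x \<in> X" "y = s m *\<^sub>R x" using Ymem[OF y] by blast
        then have "1 - \<eta> < norm x" "norm x < 1" by (auto simp: X_def)
        moreover have "s (Suc m) = s m * (1 - \<eta>)" by (simp add: s_def)
        ultimately show ?thesis using x s_pos[of m] by simp
      qed
      have "antimono s" using \<eta> \<eta>1 unfolding s_def by (intro antimonoI power_decreasing) auto
      then have "Y i \<inter> Y j = {}" if "i < j" for i j
        using ann[of _ i] ann[of _ j] that antimonoD[of s "Suc i" j] by (fastforce simp: Suc_le_eq)
      then show ?thesis unfolding disjoint_family_on_def by (metis Int_commute linorder_neqE_nat)
    qed
    have sub: "Y m \<subseteq> {w \<in> ball 0 1. kdist a w < 2 * r}" if m: "m < M" for m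
    proof
      fix y assume "y \<in> Y m"
      then obtain x where x: "x \<in> X" "y = s m *\<^sub>R x" using Ymem by blast
      have nx: "norm x < 1" "kdist a x < r" using x by (auto simp: X_def)
      have "norm y = s m * norm x" using x s_pos[of m] by simp
      then have "norm y < 1" using nx s_le[of m] s_pos[of m] mult_left_le_one_le[of "norm x" "s m"] by simp
      moreover have "kdist a y < 2 * r"
      proof -
        have "1 - cinner a y = (1 - cinner a x) + of_real (1 - s m) * cinner a x"
          by (simp add: x(2) cinner_scaleR_right algebra_simps)
        then have "kdist a y \<le> kdist a x + norm (of_real (1 - s m) * cinner a x)"
          by (simp only: norm_triangle_ineq)
        also have "norm (of_real (1 - s m) * cinner a x) \<le> (1 - s m) * 1"
        proof -
          have "norm (cinner a x) \<le> 1"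
            using norm_cinner_le[of a x] nx a mult_mono[of "norm a" 1 "norm x" 1] by simp
          then show ?thesis unfolding norm_mult norm_of_real using s_le[of m] by (intro mult_mono) auto
        qed
        also have "\<dots> \<le> r / 4"
        proof -
          have "real m * \<eta> \<le> real M * \<eta>" using m \<eta> by (intro mult_right_mono) auto
          then show ?thesis using s_ge[of m] M2 by simp
        qed
        finally show ?thesis using nx r by simp
      qed
      ultimately show "y \<in> {w \<in> ball 0 1. kdist a w < 2 * r}" by simp
    qed
    have each: "ennreal (1 / 4 ^ n) * emeasure lborel X \<le> emeasure lborel (Y m)" if m: "m < M" for m
    proof -
      have "real m * \<eta> \<le> real M * \<eta>" using m \<eta> by (intro mult_right_mono) auto
      then have "1 / 2 \<le> s m" using s_ge[of m] M2 r by simp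
      then have "(1 / 2) ^ (2 * n) \<le> s m ^ (2 * n)" by (intro power_mono) auto
      then have "1 / 4 ^ n \<le> s m ^ (2 * n)" by (simp add: power_mult power_divide)
      then show ?thesis unfolding Yem by (intro mult_right_mono ennreal_leI) auto
    qed
    have "ennreal (real M) * (ennreal (1 / 4 ^ n) * emeasure lborel X) = (\<Sum>m<M. ennreal (1 / 4 ^ n) * emeasure lborel X)"
      by (simp add: ennreal_of_nat_eq_real_of_nat)
    also have "\<dots> \<le> (\<Sum>m<M. emeasure lborel (Y m))" by (intro sum_mono each) auto
    also have "\<dots> = emeasure lborel (\<Union>m<M. Y m)" using Yb disj by (intro sum_emeasure) auto
    also have "\<dots> \<le> emeasure lborel {w \<in> ball 0 1. kdist a w < 2 * r}"
      using sub tent_sets_borel[of a "2 * r"] by (intro emeasure_mono) auto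
    also have "\<dots> \<le> ennreal (9 ^ n * VV * (2 * r) ^ (n + 1))"
      unfolding n_def VV_def using r by (intro emeasure_tent_upper[OF fr a]) auto
    finally have "emeasure lborel X * ennreal (real M / 4 ^ n) \<le> ennreal (9 ^ n * VV * (2 * r) ^ (n + 1)) * 1"
      by (simp add: mult.assoc[symmetric] ennreal_mult[symmetric]) (simp add: mult.commute)
    then have "emeasure lborel X \<le> ennreal (9 ^ n * VV * (2 * r) ^ (n + 1) / (real M / 4 ^ n)) * 1"
    proof (rule ennreal_le_of_mult_le[rotated 2])
      have "r / (8 * \<eta>) > 0" using r \<eta> by simp
      then show "0 < real M / 4 ^ n" using M3 by simp
      show "0 \<le> 9 ^ n * VV * (2 * r) ^ (n + 1)" using r VV by simp
    qed
    also have "\<dots> \<le> ennreal (16 * 72 ^ n * VV * \<eta> * r ^ n)"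
    proof -
      have rp: "r / (8 * \<eta>) > 0" using r \<eta> by simp
      have p: "0 < real M / 4 ^ n" "0 < r / (8 * \<eta>) / 4 ^ n"
        using less_le_trans[OF rp M3] rp by (simp_all only: zero_less_divide_iff zero_less_power zero_less_numeral simp_thms)
      have "0 \<le> 9 ^ n * VV * (2 * r) ^ (n + 1)" using r VV by simp
      then have "9 ^ n * VV * (2 * r) ^ (n + 1) / (real M / 4 ^ n) \<le> 9 ^ n * VV * (2 * r) ^ (n + 1) / (r / (8 * \<eta>) / 4 ^ n)"
        by (intro divide_left_mono divide_right_mono[OF M3] mult_pos_pos p) simp
      also have "\<dots> = 16 * 72 ^ n * VV * \<eta> * r ^ n"
      proof -
        have "(72::real) ^ n = 9 ^ n * 2 ^ n * 4 ^ n" by (simp flip: power_mult_distrib)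
        then show ?thesis using r \<eta> by (simp add: power_mult_distrib field_simps)
      qed
      finally show ?thesis by (simp add: ennreal_leI)
    qed
    finally show ?thesis by (simp add: X_def n_def VV_def)
  qed
qed

text \<open>The layer \<open>X j\<close> of height below \<open>r / 2 ^ j\<close> has volume of
  order \<open>r ^ (n + 1) / 2 ^ j\<close>, while a point with \<open>j\<close> maximal has weight
  at most \<open>sqrt 2 * sqrt 2 ^ j\<close>. What remains is a geometric series of ratio
  \<open>1 / sqrt 2\<close>.\<close>

lemma tent_weight_aux:
  fixes a :: "complex ^ 'n"
  assumes fr: "framed TYPE('n)" and a: "norm a < 1" and r: "0 < r" "r \<le> 2"
  shows "(\<integral>\<^sup>+w. ennreal (sqrt (r / (1 - norm w))) * indicator {w \<in> ball 0 1. kdist a w < r} w \<partial>lborel) \<le>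
    ennreal (sqrt 2 * (16 * 72 ^ CARD('n) * measure lborel (ball (0 :: complex ^ 'n) 1)) * (\<Sum>j. (1 / sqrt 2) ^ j) * r ^ (CARD('n) + 1))"
proof -
  define C where "C = 16 * 72 ^ CARD('n) * measure lborel (ball (0 :: complex ^ 'n) 1)"
  have C: "C \<ge> 0" by (simp add: C_def)
  define X where "X j = {w \<in> ball 0 1. kdist a w < r \<and> 1 - norm w < r / 2 ^ j}" for j :: nat
  have Xeq: "X j = {w \<in> ball 0 1. kdist a w < r} \<inter> {w. 1 - norm w < r / 2 ^ j}" for j by (auto simp: X_def)
  have "{w. 1 - norm (w :: complex ^ 'n) < r / 2 ^ j} \<in> sets borel" for j :: nat by measurable
  then have Xb: "X j \<in> sets lborel" for j unfolding Xeq using tent_sets_borel[of a r] by simp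
  have le: "ennreal (sqrt (r / (1 - norm w))) * indicator {w \<in> ball 0 1. kdist a w < r} w \<le>
      (\<Sum>j. ennreal (sqrt 2 * sqrt 2 ^ j) * indicator (X j) w)" for w
  proof (cases "w \<in> {w \<in> ball 0 1. kdist a w < r}")
    case True
    define \<rho> where "\<rho> = 1 - norm w"
    have \<rho>: "\<rho> > 0" "\<rho> < r" using True kdist_ge[of a w] kdist_commute[of a w] a by (auto simp: \<rho>_def)
    obtain j where j: "\<rho> < r / 2 ^ j" "r / 2 ^ Suc j \<le> \<rho>"
    proof -
      obtain m where m: "r / \<rho> < 2 ^ m" using real_arch_pow[of 2 "r / \<rho>"] by auto
      define k where "k = (LEAST m. r / \<rho> \<le> 2 ^ m)"
      have k: "r / \<rho> \<le> 2 ^ k" unfolding k_def using m by (intro LeastI[of "\<lambda>m. r / \<rho> \<le> 2 ^ m" m]) auto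
      have "k \<noteq> 0" using k \<rho> by (intro notI) (auto simp: field_simps)
      then obtain j where kj: "k = Suc j" by (cases k) auto
      have "\<not> r / \<rho> \<le> 2 ^ j" using not_less_Least[of j "\<lambda>m. r / \<rho> \<le> 2 ^ m"] kj unfolding k_def by simp
      then show ?thesis using k kj \<rho> by (intro that[of j]) (auto simp: field_simps)
    qed
    have "r / \<rho> \<le> 2 * 2 ^ j" using j \<rho> by (simp add: field_simps)
    then have "sqrt (r / \<rho>) \<le> sqrt (2 * 2 ^ j)" by (rule real_sqrt_le_mono)
    also have "\<dots> = sqrt 2 * sqrt 2 ^ j" by (simp add: real_sqrt_mult real_sqrt_power)
    finally have "ennreal (sqrt (r / \<rho>)) \<le> ennreal (sqrt 2 * sqrt 2 ^ j) * indicator (X j) w"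
      using True j by (simp add: X_def \<rho>_def ennreal_leI)
    also have "\<dots> \<le> (\<Sum>j. ennreal (sqrt 2 * sqrt 2 ^ j) * indicator (X j) w)"
    proof -
      define G :: "nat \<Rightarrow> ennreal" where "G j = ennreal (sqrt 2 * sqrt 2 ^ j) * indicator (X j) w" for j
      have "G j \<le> suminf G" using sum_le_suminf[of G "{j}"] by simp
      then show ?thesis unfolding G_def .
    qed
    finally show ?thesis using True by (simp add: \<rho>_def)
  qed simp
  have "(\<integral>\<^sup>+w. ennreal (sqrt (r / (1 - norm w))) * indicator {w \<in> ball 0 1. kdist a w < r} w \<partial>lborel) \<le>
    (\<integral>\<^sup>+w. (\<Sum>j. ennreal (sqrt 2 * sqrt 2 ^ j) * indicator (X j) w) \<partial>lborel)"
    by (intro nn_integral_mono le)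
  also have "\<dots> = (\<Sum>j. (\<integral>\<^sup>+w. ennreal (sqrt 2 * sqrt 2 ^ j) * indicator (X j) w \<partial>lborel))"
    using Xb by (intro nn_integral_suminf) (auto intro!: borel_measurable_times_ennreal borel_measurable_indicator)
  also have "\<dots> \<le> (\<Sum>j. ennreal (sqrt 2 * C * r ^ (CARD('n) + 1) * (1 / sqrt 2) ^ j))"
  proof (intro suminf_le allI)
    fix j
    have "(\<integral>\<^sup>+w. ennreal (sqrt 2 * sqrt 2 ^ j) * indicator (X j) w \<partial>lborel) = ennreal (sqrt 2 * sqrt 2 ^ j) * emeasure lborel (X j)"
      using Xb by (intro nn_integral_cmult_indicator)
    also have "\<dots> \<le> ennreal (sqrt 2 * sqrt 2 ^ j) * ennreal (C * (r / 2 ^ j) * r ^ CARD('n))"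
      unfolding X_def C_def using r a by (intro mult_left_mono emeasure_thin_tent fr) auto
    also have "\<dots> = ennreal (sqrt 2 * sqrt 2 ^ j * (C * (r / 2 ^ j) * r ^ CARD('n)))"
      using r C by (intro ennreal_mult[symmetric]) auto
    also have "sqrt 2 * sqrt 2 ^ j * (C * (r / 2 ^ j) * r ^ CARD('n)) = sqrt 2 * C * r ^ (CARD('n) + 1) * (1 / sqrt 2) ^ j"
    proof -
      have "(2::real) ^ j = sqrt 2 ^ j * sqrt 2 ^ j" by (simp flip: power_mult_distrib)
      then show ?thesis by (simp add: power_divide)
    qed
    finally show "(\<integral>\<^sup>+w. ennreal (sqrt 2 * sqrt 2 ^ j) * indicator (X j) w \<partial>lborel) \<le>
      ennreal (sqrt 2 * C * r ^ (CARD('n) + 1) * (1 / sqrt 2) ^ j)" .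
  qed auto
  also have "\<dots> = ennreal (\<Sum>j. sqrt 2 * C * r ^ (CARD('n) + 1) * (1 / sqrt 2) ^ j)"
  proof (rule suminf_ennreal2)
    show "0 \<le> sqrt 2 * C * r ^ (CARD('n) + 1) * (1 / sqrt 2) ^ j" for j using r C by simp
    show "summable (\<lambda>j. sqrt 2 * C * r ^ (CARD('n) + 1) * (1 / sqrt 2) ^ j)"
      by (intro summable_mult summable_geometric) simp
  qed
  also have "(\<Sum>j. sqrt 2 * C * r ^ (CARD('n) + 1) * (1 / sqrt 2) ^ j) = sqrt 2 * C * r ^ (CARD('n) + 1) * (\<Sum>j. (1 / sqrt 2) ^ j)"
    by (intro suminf_mult summable_geometric) auto
  finally show ?thesis by (simp add: C_def mult_ac)
qed

text \<open>Beyond \<open>r = 2\<close> the tent is the whole ball, and the left side grows only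
  like \<open>sqrt r\<close>.\<close>

lemma tent_weight:
  fixes a :: "complex ^ 'n"
  assumes fr: "framed TYPE('n)" and a: "norm a < 1" and r: "0 < r"
  shows "(\<integral>\<^sup>+w. ennreal (sqrt (r / (1 - norm w))) * indicator {w \<in> ball 0 1. kdist a w < r} w \<partial>lborel) \<le>
    ennreal (sqrt 2 * (16 * 72 ^ CARD('n) * measure lborel (ball (0 :: complex ^ 'n) 1)) * (\<Sum>j. (1 / sqrt 2) ^ j) * r ^ (CARD('n) + 1))"
proof (cases "r \<le> 2")
  case True
  then show ?thesis using tent_weight_aux[OF fr a r] by simp
next
  case False
  define C where "C = sqrt 2 * (16 * 72 ^ CARD('n) * measure lborel (ball (0 :: complex ^ 'n) 1)) * (\<Sum>j. (1 / sqrt 2) ^ j)"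
  define I where "I r = (\<integral>\<^sup>+w. ennreal (sqrt (r / (1 - norm w))) * indicator {w \<in> ball 0 1. kdist a w < r} w \<partial>lborel)" for r
  have C: "C \<ge> 0" unfolding C_def
    by (intro mult_nonneg_nonneg suminf_nonneg summable_geometric) auto
  have d2: "kdist a w < 2" if "w \<in> ball 0 1" for w
  proof -
    have "kdist a w \<le> 1 + norm (cinner a w)" using norm_triangle_ineq4[of 1 "cinner a w"] by simp
    also have "norm (cinner a w) \<le> norm a * norm w" by (rule norm_cinner_le)
    also have "\<dots> \<le> norm a * 1" using that by (intro mult_left_mono) auto
    finally show ?thesis using a by simp
  qed
  have m: "(\<lambda>w. ennreal (sqrt (2 / (1 - norm w))) * indicator {w \<in> ball 0 1. kdist a w < 2} w) \<in> borel_measurable lborel"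
    using tent_sets_borel[of a 2] by (intro borel_measurable_times_ennreal borel_measurable_indicator) auto
  have "I r \<le> (\<integral>\<^sup>+w. ennreal (sqrt (r / 2)) * (ennreal (sqrt (2 / (1 - norm w))) * indicator {w \<in> ball 0 1. kdist a w < 2} w) \<partial>lborel)"
    unfolding I_def
  proof (intro nn_integral_mono)
    fix w :: "complex ^ 'n"
    have "sqrt (r / (1 - norm w)) = sqrt (r / 2) * sqrt (2 / (1 - norm w))" by (simp flip: real_sqrt_mult)
    then show "ennreal (sqrt (r / (1 - norm w))) * indicator {w \<in> ball 0 1. kdist a w < r} w \<le>
      ennreal (sqrt (r / 2)) * (ennreal (sqrt (2 / (1 - norm w))) * indicator {w \<in> ball 0 1. kdist a w < 2} w)"
      using d2[of w] r by (cases "w \<in> ball 0 1") (auto simp: ennreal_mult indicator_def)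
  qed
  also have "\<dots> = ennreal (sqrt (r / 2)) * I 2" unfolding I_def by (rule nn_integral_cmult[OF m])
  also have "\<dots> \<le> ennreal (sqrt (r / 2)) * ennreal (C * 2 ^ (CARD('n) + 1))"
    unfolding I_def C_def by (intro mult_left_mono tent_weight_aux[OF fr a]) auto
  also have "\<dots> = ennreal (sqrt (r / 2) * (C * 2 ^ (CARD('n) + 1)))" using C r by (intro ennreal_mult[symmetric]) auto
  also have "\<dots> \<le> ennreal (C * r ^ (CARD('n) + 1))"
  proof (intro ennreal_leI)
    have r2: "1 \<le> r / 2" using False by simp
    then have "sqrt (r / 2) \<le> r / 2" by (intro real_le_lsqrt) (auto simp: power2_eq_square mult_ge1_I)
    also have "r / 2 \<le> (r / 2) ^ (CARD('n) + 1)" using r2 self_le_power[of "r / 2" "CARD('n) + 1"] by simp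
    finally have "sqrt (r / 2) * 2 ^ (CARD('n) + 1) \<le> r ^ (CARD('n) + 1)" by (simp add: power_divide field_simps)
    then show "sqrt (r / 2) * (C * 2 ^ (CARD('n) + 1)) \<le> C * r ^ (CARD('n) + 1)"
      using mult_left_mono[OF _ C, of "sqrt (r / 2) * 2 ^ (CARD('n) + 1)" "r ^ (CARD('n) + 1)"] by (simp only: mult_ac)
  qed
  finally show ?thesis unfolding I_def C_def .
qed

abbreviation ball_measure :: "(complex ^ 'n) measure" where
  "ball_measure \<equiv> restrict_space lborel (ball 0 1)"

lemma tent_space_ball:
  assumes fr: "framed TYPE('n::finite)"
  obtains C0 c0 where "tent_space (ball_measure :: (complex ^ 'n) measure) kdist (\<lambda>z. 1 - norm z) (CARD('n) + 1) C0 c0"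
proof -
  define VV where "VV = measure lborel (ball (0 :: complex ^ 'n) 1)"
  define C0 where "C0 = sqrt 2 * (16 * 72 ^ CARD('n) * VV) * (\<Sum>j. (1 / sqrt 2) ^ j)"
  define c0 where "c0 = VV / (16 * 4 ^ CARD('n))"
  have VV: "VV > 0" unfolding VV_def by (rule content_ball_pos) simp
  let ?M = "ball_measure :: (complex ^ 'n) measure"
  have sp: "space ?M = ball 0 1" by (simp add: space_restrict_space)
  have em: "emeasure ?M A = emeasure lborel A" if "A \<subseteq> ball 0 1" for A
    using that by (intro emeasure_restrict_space) auto
  interpret finite_measure ?M
    by (rule finite_measureI) (use em[of "ball 0 1"] emeasure_lborel_ball_finite[of "0 :: complex ^ 'n" 1] in \<open>auto simp: sp\<close>)
  have bm: "f \<in> borel_measurable ?M" if "continuous_on UNIV f" for f :: "complex ^ 'n \<Rightarrow> 'z::real_normed_vector"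
    using borel_measurable_continuous_onI[OF that] by (intro measurable_restrict_space1) simp
  have nth: "(\<lambda>x. x $ i) \<in> borel_measurable ?M" for i by (intro bm continuous_intros)
  have cnj_nth: "(\<lambda>x. cnj (x $ i)) \<in> borel_measurable ?M" for i by (intro bm continuous_intros)
  have "tent_space ?M kdist (\<lambda>z. 1 - norm z) (CARD('n) + 1) C0 c0"
  proof (unfold_locales)
    have "(\<lambda>p. kdist (fst p) (snd p)) \<in> borel_measurable (?M \<Otimes>\<^sub>M ?M)"
    proof -
      have 1: "(\<lambda>p. fst p $ i) \<in> borel_measurable (?M \<Otimes>\<^sub>M ?M)" for i
        by (rule measurable_compose[OF measurable_fst nth])
      have 2: "(\<lambda>p. cnj (snd p $ i)) \<in> borel_measurable (?M \<Otimes>\<^sub>M ?M)" for i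
        by (rule measurable_compose[OF measurable_snd cnj_nth])
      show ?thesis unfolding cinner_def
        by (intro borel_measurable_norm borel_measurable_diff borel_measurable_const borel_measurable_sum
            borel_measurable_times 1 2 measurable_compose[OF _ borel_measurable_norm])
    qed
    then show "(\<lambda>(x, y). kdist x y) \<in> borel_measurable (?M \<Otimes>\<^sub>M ?M)" by (simp add: split_beta)
    show "(\<lambda>z. 1 - norm z) \<in> borel_measurable ?M" by (intro bm continuous_intros)
    show "open {w \<in> space ?M. kdist a w < r}" for a r
    proof -
      have "continuous_on UNIV (\<lambda>w. kdist a w)" unfolding cinner_def by (intro continuous_intros)
      then have "open {w. kdist a w < r}" by (rule open_Collect_less) (rule continuous_on_const)
      moreover have "{w \<in> space ?M. kdist a w < r} = ball 0 1 \<inter> {w. kdist a w < r}" by (auto simp: sp)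
      ultimately show ?thesis by auto
    qed
    show "kdist z w = kdist w z" for z w :: "complex ^ 'n" by (rule kdist_commute)
    show "kdist x z \<le> 4 * (kdist x y + kdist y z)"
      if "x \<in> space ?M" "y \<in> space ?M" "z \<in> space ?M" for x y z
      using that by (intro kdist_triangle) (auto simp: sp)
    show "0 < 1 - norm z" "1 - norm z \<le> 1" if "z \<in> space ?M" for z using that by (auto simp: sp)
    show "1 - norm z \<le> kdist z w" if "z \<in> space ?M" "w \<in> space ?M" for z w
      using that by (intro kdist_ge) (auto simp: sp)
    have "0 < (\<Sum>j. (1 / sqrt 2 :: real) ^ j)" by (intro suminf_pos summable_geometric) auto
    then show "0 < C0" using VV by (simp add: C0_def)
    show "0 < c0" using VV by (simp add: c0_def)
    show "(\<integral>\<^sup>+w. ennreal (sqrt (r / (1 - norm w))) * indicator {w \<in> space ?M. kdist a w < r} w \<partial>?M) \<le> ennreal (C0 * r ^ (CARD('n) + 1))"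
      if "a \<in> space ?M" "0 < r" for a r
    proof -
      have "(\<integral>\<^sup>+w. ennreal (sqrt (r / (1 - norm w))) * indicator {w \<in> space ?M. kdist a w < r} w \<partial>?M) =
        (\<integral>\<^sup>+w. ennreal (sqrt (r / (1 - norm w))) * indicator {w \<in> space ?M. kdist a w < r} w * indicator (ball 0 1) w \<partial>lborel)"
        by (intro nn_integral_restrict_space) auto
      also have "\<dots> = (\<integral>\<^sup>+w. ennreal (sqrt (r / (1 - norm w))) * indicator {w \<in> ball 0 1. kdist a w < r} w \<partial>lborel)"
        by (intro nn_integral_cong) (auto simp: indicator_def sp)
      also have "\<dots> \<le> ennreal (C0 * r ^ (CARD('n) + 1))"
        unfolding C0_def VV_def using that by (intro tent_weight fr) (auto simp: sp)
      finally show ?thesis .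
    qed
    show "ennreal (c0 * r ^ (CARD('n) + 1)) \<le> emeasure ?M {u \<in> space ?M. kdist a u < 2 * r \<and> r < 6 * (1 - norm u)}"
      if "a \<in> space ?M" "1 - norm a \<le> r" "r \<le> 1" for a r
    proof -
      have "emeasure ?M {u \<in> space ?M. kdist a u < 2 * r \<and> r < 6 * (1 - norm u)} =
          emeasure lborel {u \<in> ball 0 1. kdist a u < 2 * r \<and> r < 6 * (1 - norm u)}"
        unfolding sp by (intro em) auto
      then show ?thesis unfolding c0_def VV_def
        using emeasure_tent_lower[OF fr _ that(2,3)] that by (simp add: sp)
    qed
  qed
  then show ?thesis by (rule that)
qed

section \<open>Growth of Bloch functions\<close>

lemma norm_sum_vec_le:
  fixes v g :: "complex ^ 'n"
  shows "norm (\<Sum>j\<in>UNIV. v $ j * g $ j) \<le> norm v * norm g"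
proof -
  have "norm (\<chi> j. cnj (g $ j)) = norm g" by (simp add: norm_vec_def)
  moreover have "cinner v (\<chi> j. cnj (g $ j)) = (\<Sum>j\<in>UNIV. v $ j * g $ j)" by (simp add: cinner_def)
  ultimately show ?thesis using norm_cinner_le[of v "\<chi> j. cnj (g $ j)"] by simp
qed

lemma has_field_derivative_slice_aux:
  fixes b :: "complex ^ 'n \<Rightarrow> complex"
  assumes D: "(b has_derivative D) (at (z + t *s v))" "\<And>c v. D (c *s v) = c * D v"
  shows "((\<lambda>t. b (z + t *s v)) has_field_derivative D v) (at t)"
proof -
  have bl: "bounded_linear (\<lambda>h :: complex. h *s v)"
  proof (rule bounded_linear_intro[where K = "norm v"])
    show "(x + y) *s v = x *s v + y *s v" for x y by (simp add: vec_eq_iff algebra_simps)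
    show "(r *\<^sub>R x) *s v = r *\<^sub>R (x *s v)" for r x by (simp add: vec_eq_iff)
    show "norm (x *s v) \<le> norm x * norm v" for x by (simp add: norm_smult)
  qed
  have "((\<lambda>t. z + t *s v) has_derivative (\<lambda>h. h *s v)) (at t)"
    using has_derivative_add[OF has_derivative_const bounded_linear.has_derivative[OF bl has_derivative_ident], of z "at t"]
    by simp
  from has_derivative_compose[OF this D(1)]
  have "((\<lambda>t. b (z + t *s v)) has_derivative (\<lambda>h. D (h *s v))) (at t)" .
  moreover have "(\<lambda>h. D (h *s v)) = (*) (D v)" by (auto simp: D(2) mult.commute)
  ultimately show ?thesis by (simp add: has_field_derivative_def)
qed

lemma has_field_derivative_slice:
  fixes b :: "complex ^ 'n \<Rightarrow> complex"
  assumes hol: "holomorphic_multi_on b S" and z: "z + t *s v \<in> S"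
  shows "((\<lambda>t. b (z + t *s v)) has_field_derivative (\<Sum>j\<in>UNIV. v $ j * cgrad b (z + t *s v) $ j)) (at t)"
proof -
  obtain D where D: "(b has_derivative D) (at (z + t *s v))" "\<And>c v. D (c *s v) = c * D v"
    using hol z by (auto simp: holomorphic_multi_on_def)
  have lin: "linear D" using D(1) by (rule has_derivative_linear)
  have "cgrad b (z + t *s v) $ j = D (axis j 1)" for j
  proof -
    have "((\<lambda>s. b (z + t *s v + s *s axis j 1)) has_field_derivative D (axis j 1)) (at 0)"
      using D by (intro has_field_derivative_slice_aux) auto
    then show ?thesis by (simp add: cgrad_def DERIV_imp_deriv)
  qed
  moreover have "D v = (\<Sum>j\<in>UNIV. v $ j * D (axis j 1))"
  proof -
    have "D v = D (\<Sum>j\<in>UNIV. v $ j *s axis j 1)" by (simp only: basis_expansion)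
    also have "\<dots> = (\<Sum>j\<in>UNIV. D (v $ j *s axis j 1))" using lin by (rule linear_sum)
    finally show ?thesis by (simp add: D(2))
  qed
  ultimately show ?thesis using has_field_derivative_slice_aux[OF D] by simp
qed

lemma holomorphic_multi_continuous_on:
  assumes "holomorphic_multi_on b S"
  shows "continuous_on S b"
  using assms unfolding holomorphic_multi_on_def
  by (intro continuous_at_imp_continuous_on ballI) (auto dest: has_derivative_continuous)

lemma holomorphic_on_slice:
  assumes hol: "holomorphic_multi_on b S" and "\<And>t. t \<in> T \<Longrightarrow> z + t *s v \<in> S"
  shows "(\<lambda>t. b (z + t *s v)) holomorphic_on T"
  unfolding holomorphic_on_def field_differentiable_def
proof
  fix t assume "t \<in> T"
  then have "z + t *s v \<in> S" by (rule assms(2))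
  from has_field_derivative_at_within[OF has_field_derivative_slice[OF hol this]]
  show "\<exists>f'. ((\<lambda>t. b (z + t *s v)) has_field_derivative f') (at t within T)" by blast
qed

text \<open>The Schwarz lemma for \<open>(c (R * t) - c 0) / (3 * B)\<close>; the numerator is at
  most \<open>2 * B\<close>, and 3 in place of 2 gives the strict bound by 1 that
  \<open>Schwarz_Lemma\<close> asks for.\<close>

lemma norm_diff_le_of_holomorphic_disc:
  assumes hol: "c holomorphic_on ball 0 R" and R: "1 < R" and B: "0 < B"
    and bnd: "\<And>t. norm t < R \<Longrightarrow> norm (c t) \<le> B"
  shows "norm (c 1 - c 0) \<le> 3 * B / R"
proof -
  define g where "g t = (c (of_real R * t) - c 0) / of_real (3 * B)" for t
  have in_ball: "of_real R * t \<in> ball 0 R" if "norm t < 1" for t :: complex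
    using that R by (simp add: norm_mult)
  have "(\<lambda>t. c (of_real R * t)) holomorphic_on ball 0 1"
    using in_ball by (intro holomorphic_on_compose_gen[OF _ hol, unfolded o_def] holomorphic_intros) auto
  then have "g holomorphic_on ball 0 1" unfolding g_def using B by (intro holomorphic_intros) auto
  moreover have "g 0 = 0" by (simp add: g_def)
  moreover have "norm (g t) < 1" if "norm t < 1" for t
  proof -
    have "norm (c (of_real R * t) - c 0) \<le> norm (c (of_real R * t)) + norm (c 0)" by (rule norm_triangle_ineq4)
    also have "\<dots> \<le> B + B" using in_ball[OF that] R by (intro add_mono bnd) auto
    finally have "norm (c (of_real R * t) - c 0) \<le> 2 * B" by simp
    then show ?thesis using B unfolding g_def norm_divide norm_of_real by simp
  qed
  moreover have "norm (1 / of_real R :: complex) < 1" using R by (simp add: norm_divide)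
  ultimately have "norm (g (1 / of_real R)) \<le> norm (1 / of_real R :: complex)" by (rule Schwarz_Lemma(1))
  also have "g (1 / of_real R) = (c 1 - c 0) / of_real (3 * B)" using R by (simp add: g_def)
  also have "norm (1 / of_real R :: complex) = 1 / R" using R by (simp add: norm_divide)
  finally show ?thesis using B R unfolding norm_divide norm_of_real by (simp add: field_simps)
qed

text \<open>The complex line through \<open>z\<close> and \<open>w\<close> is nearly tangential: the
  component of \<open>w - z\<close> along \<open>z\<close> and the square of its length are both of
  order \<open>kdist z w\<close>. The constant is \<open>8 = 2 * 3 + 2\<close>.\<close>

lemma norm_slice_point_le:
  assumes z: "norm z \<le> 1" and w: "norm w \<le> 1" and t: "norm t \<le> R" and R: "1 \<le> R"
  shows "(norm (z + t *s (w - z)))\<^sup>2 \<le> 1 + 8 * kdist z w * R\<^sup>2"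
proof -
  let ?d = "kdist z w"
  have R0: "0 \<le> R" "R \<le> R\<^sup>2" using R by (auto simp: power2_eq_square)
  have "cinner z (w - z) = - cinner z (z - w)" by (simp add: cinner_diff_right)
  then have c: "norm (cinner z (w - z)) \<le> 3 * ?d" using norm_cinner_diff_self_le[OF z w] by simp
  have "Re (cinner z (t *s (w - z))) \<le> norm t * norm (cinner z (w - z))"
    using complex_Re_le_cmod[of "cinner z (t *s (w - z))"]
    unfolding cinner_smult_right norm_mult complex_mod_cnj .
  also have "\<dots> \<le> R * (3 * ?d)" using t c R0 by (intro mult_mono) auto
  finally have 1: "Re (cinner z (t *s (w - z))) \<le> R * (3 * ?d)" .
  have "(norm (t *s (w - z)))\<^sup>2 = (norm t)\<^sup>2 * (norm (z - w))\<^sup>2"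
    by (simp only: norm_smult power_mult_distrib norm_minus_commute[of w z])
  also have "\<dots> \<le> R\<^sup>2 * (2 * ?d)" using t norm_diff_le_kdist[OF z w] by (intro mult_mono power_mono) auto
  finally have 2: "(norm (t *s (w - z)))\<^sup>2 \<le> R\<^sup>2 * (2 * ?d)" .
  have "R * (3 * ?d) \<le> R\<^sup>2 * (3 * ?d)" using R0 by (intro mult_right_mono) auto
  moreover have "(norm z)\<^sup>2 \<le> 1" using z by (simp add: power_le_one)
  ultimately show ?thesis using 1 2 unfolding norm_add_cinner by (simp add: algebra_simps)
qed

section \<open>Radial and tangential oscillation of Bloch functions\<close>

locale bloch_function =
  fixes b :: "complex ^ 'n \<Rightarrow> complex" and M :: real
  assumes hol: "holomorphic_multi_on b (ball 0 1)"
    and M0: "0 \<le> M" and M: "\<And>z. z \<in> ball 0 1 \<Longrightarrow> norm (cgrad b z) * (1 - norm z) \<le> M"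
begin

text \<open>Along the ray the derivative is at most
  \<open>M * norm p / (1 - \<tau> * norm p)\<close>, with primitive \<open>\<phi>\<close>. The point
  \<open>p\<close> may lie outside the ball, as happens on slices through two points of the
  ball.\<close>

lemma radial_difference:
  assumes s: "0 \<le> s2" "s2 \<le> s1" and p: "s1 * norm p < 1"
  shows "norm (b (s1 *\<^sub>R p) - b (s2 *\<^sub>R p)) \<le> M * ln ((1 - s2 * norm p) / (1 - s1 * norm p))"
proof (cases "s1 = s2")
  case True
  then show ?thesis using p by simp
next
  case False
  then have lt: "s2 < s1" using s by simp
  have small: "\<tau> * norm p < 1" if "\<tau> \<le> s1" for \<tau>
    using mult_right_mono[OF that, of "norm p"] p by simp
  have inb: "\<tau> *\<^sub>R p \<in> ball 0 1" if "s2 \<le> \<tau>" "\<tau> \<le> s1" for \<tau>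
    using small[OF that(2)] s that by simp
  define f' where "f' \<tau> = (\<Sum>j\<in>UNIV. p $ j * cgrad b (\<tau> *\<^sub>R p) $ j)" for \<tau>
  have der: "((\<lambda>\<tau>. b (\<tau> *\<^sub>R p)) has_vector_derivative f' \<tau>) (at \<tau>)" if "s2 \<le> \<tau>" "\<tau> \<le> s1" for \<tau>
  proof -
    have eq: "0 + complex_of_real \<tau> *s p = \<tau> *\<^sub>R p" for \<tau> by (simp add: vec_eq_iff scaleR_conv_of_real[where 'a=complex])
    have "((\<lambda>t. b (0 + t *s p)) has_field_derivative f' \<tau>) (at (of_real \<tau>))"
      using has_field_derivative_slice[OF hol, of 0 "of_real \<tau>" p] inb[OF that] unfolding eq f'_def by simp
    from has_vector_derivative_real_field[OF this] show ?thesis unfolding o_def eq .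
  qed
  define \<phi> where "\<phi> \<tau> = - M * ln (1 - \<tau> * norm p)" for \<tau>
  have der\<phi>: "(\<phi> has_vector_derivative M * norm p / (1 - \<tau> * norm p)) (at \<tau>)" if "\<tau> \<le> s1" for \<tau>
    unfolding \<phi>_def has_real_derivative_iff_has_vector_derivative[symmetric]
    by (rule derivative_eq_intros refl | use small[OF that] in \<open>simp add: field_simps\<close>)+
  have "norm (b (s1 *\<^sub>R p) - b (s2 *\<^sub>R p)) \<le> \<phi> s1 - \<phi> s2"
  proof (rule differentiable_bound_general[OF lt, where f = "\<lambda>\<tau>. b (\<tau> *\<^sub>R p)" and f' = f' and \<phi>' = "\<lambda>\<tau>. M * norm p / (1 - \<tau> * norm p)"])
    show "continuous_on {s2..s1} (\<lambda>\<tau>. b (\<tau> *\<^sub>R p))"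
      using der by (intro continuous_at_imp_continuous_on ballI) (auto dest: has_vector_derivative_continuous)
    show "continuous_on {s2..s1} \<phi>"
      using der\<phi> by (intro continuous_at_imp_continuous_on ballI) (auto dest: has_vector_derivative_continuous)
    fix \<tau> assume \<tau>: "s2 < \<tau>" "\<tau> < s1"
    show "((\<lambda>\<tau>. b (\<tau> *\<^sub>R p)) has_vector_derivative f' \<tau>) (at \<tau>)" using der \<tau> by simp
    show "(\<phi> has_vector_derivative M * norm p / (1 - \<tau> * norm p)) (at \<tau>)" using der\<phi> \<tau> by simp
    have "norm (cgrad b (\<tau> *\<^sub>R p)) * (1 - \<tau> * norm p) \<le> M" using M[OF inb[of \<tau>]] \<tau> s by simp
    then have "norm (cgrad b (\<tau> *\<^sub>R p)) \<le> M / (1 - \<tau> * norm p)"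
      using small[of \<tau>] \<tau> by (subst pos_le_divide_eq) simp_all
    then have "norm p * norm (cgrad b (\<tau> *\<^sub>R p)) \<le> norm p * (M / (1 - \<tau> * norm p))" by (intro mult_left_mono) auto
    then show "norm (f' \<tau>) \<le> M * norm p / (1 - \<tau> * norm p)"
      unfolding f'_def using norm_sum_vec_le[of p "cgrad b (\<tau> *\<^sub>R p)"] by (simp add: mult.commute)
  qed
  also have "\<phi> s1 - \<phi> s2 = M * ln ((1 - s2 * norm p) / (1 - s1 * norm p))"
    unfolding \<phi>_def using small[of s1] small[of s2] lt by (subst ln_div) (auto simp: algebra_simps)
  finally show ?thesis .
qed

text \<open>The bound on \<open>p\<close> leaves the upper point at height at least
  \<open>3 * s / 4\<close>, and the two heights have ratio at most 3, with
  \<open>ln 3 \<le> 2\<close>. The maximum with 0 stops the descent at the origin once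
  \<open>2 * s > 1\<close>.\<close>

lemma radial_difference_bounded:
  assumes s: "0 < s" "s \<le> 1" and p: "(norm p)\<^sup>2 \<le> 1 + s / 2"
  defines "t \<equiv> max 0 (1 - 2 * s)"
  shows "(1 - s) * norm p < 1" "norm (b ((1 - s) *\<^sub>R p) - b (t *\<^sub>R p)) \<le> 2 * M"
proof -
  have "(1 + s / 4)\<^sup>2 = 1 + s / 2 + s\<^sup>2 / 16" by (simp add: power2_eq_square algebra_simps)
  then have "(norm p)\<^sup>2 \<le> (1 + s / 4)\<^sup>2" using p zero_le_power2[of s] by linarith
  then have np: "norm p \<le> 1 + s / 4" by (rule power2_le_imp_le) (use s in simp)
  have "(1 - s) * norm p \<le> (1 - s) * (1 + s / 4)" using np s by (intro mult_left_mono) auto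
  also have "\<dots> \<le> 1 - 3 * s / 4" using s by (simp add: algebra_simps)
  finally have den: "3 * s / 4 \<le> 1 - (1 - s) * norm p" by simp
  then show lt: "(1 - s) * norm p < 1" using s by linarith
  have ts: "0 \<le> t" "t \<le> 1 - s" "1 - s - t \<le> s" using s by (auto simp: t_def)
  have "(1 - s - t) * norm p \<le> s * (1 + s / 4)" using ts np s by (intro mult_mono) auto
  also have "\<dots> \<le> s * (5 / 4)" using s by (intro mult_left_mono) auto
  finally have "(1 - s - t) * norm p \<le> s * (5 / 4)" .
  moreover have "1 - t * norm p = (1 - (1 - s) * norm p) + (1 - s - t) * norm p" by (simp add: algebra_simps)
  moreover have "y \<le> 3 * D" if "x \<le> s * (5 / 4)" "y = D + x" "3 * s / 4 \<le> D" for x y D :: real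
    using that s(1) by simp
  ultimately have num: "1 - t * norm p \<le> 3 * (1 - (1 - s) * norm p)" using den by blast
  have "t * norm p \<le> (1 - s) * norm p" using ts by (intro mult_right_mono) auto
  then have pos: "0 < 1 - t * norm p" using lt by linarith
  have "(1 - t * norm p) / (1 - (1 - s) * norm p) \<le> 3" using num lt by (subst pos_divide_le_eq) auto
  then have "ln ((1 - t * norm p) / (1 - (1 - s) * norm p)) \<le> ln 3" using pos lt by (subst ln_le_cancel_iff) auto
  also have "\<dots> \<le> 2" using ln_le_minus_one[of "3::real"] by simp
  finally have "M * ln ((1 - t * norm p) / (1 - (1 - s) * norm p)) \<le> M * 2" using M0 by (intro mult_left_mono)
  then show "norm (b ((1 - s) *\<^sub>R p) - b (t *\<^sub>R p)) \<le> 2 * M"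
    using radial_difference[OF ts(1,2) lt] by simp
qed

text \<open>At height \<open>s\<close> the slice through \<open>z\<close> and \<open>w\<close> contains a disc of radius \<open>(s / d)\<^sup>1\<^sup>/\<^sup>2\<close>, on which
  passing from height \<open>s\<close> to height \<open>2 * s\<close> costs a bounded amount; by the Schwarz lemma the cost
  differs at \<open>z\<close> and \<open>w\<close> by \<open>O((d / s)\<^sup>1\<^sup>/\<^sup>2)\<close>, which sums over dyadic heights.\<close>

lemma tangential_step:
  assumes z: "norm z < 1" and w: "norm w < 1" and s: "64 * kdist z w \<le> s" "s \<le> 1"
  defines "t \<equiv> max 0 (1 - 2 * s)"
  shows "norm (b ((1 - s) *\<^sub>R z) - b ((1 - s) *\<^sub>R w)) \<le>
    12 * (2 * M + 1) * sqrt (kdist z w / s) + norm (b (t *\<^sub>R z) - b (t *\<^sub>R w))"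
proof -
  let ?d = "kdist z w"
  have "1 - norm z \<le> ?d" using w by (intro kdist_ge) simp
  then have d: "0 < ?d" using z by linarith
  have s0: "0 < s" using s d by linarith
  \<comment> \<open>The radius with \<open>8 * ?d * R\<^sup>2 = s / 2\<close>:
    \<open>norm_slice_point_le\<close> then supplies the hypothesis of
    \<open>radial_difference_bounded\<close> on the whole disc. \<open>64 * ?d \<le> s\<close> makes
    \<open>R \<ge> 2\<close>, so the disc contains 1.\<close>
  define R where "R = sqrt (s / ?d) / 4"
  have "sqrt 64 \<le> sqrt (s / ?d)" using s d by (intro real_sqrt_le_mono) (simp add: field_simps)
  moreover have "sqrt 64 = (8::real)" by (rule real_sqrt_unique) auto
  ultimately have R2: "2 \<le> R" by (simp add: R_def)
  have RR: "8 * ?d * R\<^sup>2 = s / 2" using s0 d by (simp add: R_def power_divide)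
  have ts: "0 \<le> t" "t \<le> 1 - s" using s s0 by (auto simp: t_def)
  have pn: "(norm (z + x *s (w - z)))\<^sup>2 \<le> 1 + s / 2" if "norm x < R" for x
    using norm_slice_point_le[of z w x R] that z w R2 RR by simp
  have inb: "(1 - s) *\<^sub>R (z + x *s (w - z)) \<in> ball 0 1" "t *\<^sub>R (z + x *s (w - z)) \<in> ball 0 1" if "norm x < R" for x
  proof -
    have 1: "(1 - s) * norm (z + x *s (w - z)) < 1" by (rule radial_difference_bounded(1)[OF s0 s(2) pn[OF that]])
    moreover have "t * norm (z + x *s (w - z)) \<le> (1 - s) * norm (z + x *s (w - z))" using ts by (intro mult_right_mono) auto
    ultimately have 2: "t * norm (z + x *s (w - z)) < 1" by linarith
    show "(1 - s) *\<^sub>R (z + x *s (w - z)) \<in> ball 0 1" using 1 s by simp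
    show "t *\<^sub>R (z + x *s (w - z)) \<in> ball 0 1" using 2 ts by simp
  qed
  \<comment> \<open>The cost of the descent at the points of the slice; \<open>x = 0\<close> belongs
    to \<open>z\<close> and \<open>x = 1\<close> to \<open>w\<close>. Its bound is taken as
    \<open>2 * M + 1\<close>, which is positive also for \<open>M = 0\<close>.\<close>
  define c where "c x = b ((1 - s) *\<^sub>R (z + x *s (w - z))) - b (t *\<^sub>R (z + x *s (w - z)))" for x
  have slice: "(\<lambda>x. b (r *\<^sub>R (z + x *s (w - z)))) holomorphic_on ball 0 R"
    if "\<And>x. norm x < R \<Longrightarrow> r *\<^sub>R (z + x *s (w - z)) \<in> ball 0 1" for r
  proof -
    have eq: "r *\<^sub>R (z + x *s (w - z)) = r *\<^sub>R z + x *s (r *\<^sub>R (w - z))" for x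
      by (simp add: vec_eq_iff algebra_simps scaleR_conv_of_real[where 'a=complex])
    show ?thesis using that unfolding eq by (intro holomorphic_on_slice[OF hol]) auto
  qed
  have "c holomorphic_on ball 0 R" unfolding c_def by (intro holomorphic_on_diff slice inb)
  moreover have "norm (c x) \<le> 2 * M + 1" if "norm x < R" for x
    using radial_difference_bounded(2)[OF s0 s(2) pn[OF that]] by (simp add: c_def t_def)
  ultimately have c10: "norm (c 1 - c 0) \<le> 3 * (2 * M + 1) / R"
    using R2 M0 by (intro norm_diff_le_of_holomorphic_disc) auto
  have "3 * (2 * M + 1) / R = 12 * (2 * M + 1) * sqrt (?d / s)"
    by (simp add: R_def real_sqrt_divide)
  moreover have "b ((1 - s) *\<^sub>R z) - b ((1 - s) *\<^sub>R w) = (b (t *\<^sub>R z) - b (t *\<^sub>R w)) - (c 1 - c 0)"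
    by (simp add: c_def)
  then have "norm (b ((1 - s) *\<^sub>R z) - b ((1 - s) *\<^sub>R w)) \<le> norm (b (t *\<^sub>R z) - b (t *\<^sub>R w)) + norm (c 1 - c 0)"
    by (simp only: norm_triangle_ineq4)
  ultimately show ?thesis using c10 by linarith
qed

text \<open>\<open>tangential_step\<close> is repeated at \<open>s\<close>, \<open>2 * s\<close>,
  \<open>4 * s\<close> and so on. Once \<open>2 * s > 1\<close>, both lower points are the origin
  and the remaining difference is 0; the induction variable \<open>m\<close> bounds the number of
  doublings.\<close>

lemma tangential_difference:
  assumes z: "norm z < 1" and w: "norm w < 1" and s: "64 * kdist z w \<le> s" "s \<le> 1"
  shows "norm (b ((1 - s) *\<^sub>R z) - b ((1 - s) *\<^sub>R w)) \<le> 48 * (2 * M + 1) * sqrt (kdist z w / s)"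
proof -
  let ?d = "kdist z w"
  define A where "A = 12 * (2 * M + 1)"
  note step = tangential_step[OF z w, folded A_def]
  have "1 - norm z \<le> ?d" using w by (intro kdist_ge) simp
  then have d: "0 < ?d" using z by linarith
  have A: "0 \<le> A" using M0 by (simp add: A_def)
  have main: "\<lbrakk>64 * ?d \<le> s; s \<le> 1; 1 < s * 2 ^ Suc m\<rbrakk> \<Longrightarrow>
    norm (b ((1 - s) *\<^sub>R z) - b ((1 - s) *\<^sub>R w)) \<le> 4 * A * sqrt (?d / s)" for m s
  proof (induction m arbitrary: s)
    case 0
    then have t: "max 0 (1 - 2 * s) = 0" by simp
    have "norm (b ((1 - s) *\<^sub>R z) - b ((1 - s) *\<^sub>R w)) \<le> A * sqrt (?d / s)"
      using step[OF 0(1,2)] unfolding t by simp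
    also have "\<dots> \<le> 4 * A * sqrt (?d / s)" using A 0 d by (intro mult_right_mono) auto
    finally show ?case .
  next
    case (Suc m)
    have s0: "s > 0" using Suc.prems d by linarith
    have q: "0 \<le> sqrt (?d / s)" using s0 by simp
    show ?case
    proof (cases "2 * s \<le> 1")
      case True
      then have t: "max 0 (1 - 2 * s) = 1 - 2 * s" by simp
      have "norm (b ((1 - 2 * s) *\<^sub>R z) - b ((1 - 2 * s) *\<^sub>R w)) \<le> 4 * A * sqrt (?d / (2 * s))"
        using Suc.prems True s0 by (intro Suc.IH) auto
      moreover have "sqrt (?d / (2 * s)) \<le> 3 / 4 * sqrt (?d / s)"
      proof -
        have "sqrt (?d / (2 * s)) = sqrt (1 / 2) * sqrt (?d / s)" by (simp flip: real_sqrt_mult)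
        moreover have "sqrt (1 / 2) \<le> (3 / 4 :: real)" by (intro real_le_lsqrt) (auto simp: power2_eq_square)
        ultimately show ?thesis using mult_right_mono[OF _ q, of "sqrt (1 / 2)" "3 / 4"] by simp
      qed
      \<comment> \<open>In units of \<open>sqrt (?d / s)\<close> the current step costs
        \<open>A\<close> and the remaining ones \<open>4 * A * 3 / 4 = 3 * A\<close>, which closes
        the induction with the constant \<open>4 * A\<close>.\<close>
      then have "4 * A * sqrt (?d / (2 * s)) \<le> 4 * A * (3 / 4 * sqrt (?d / s))" using A by (intro mult_left_mono) auto
      ultimately have "norm (b ((1 - 2 * s) *\<^sub>R z) - b ((1 - 2 * s) *\<^sub>R w)) \<le> 3 * (A * sqrt (?d / s))"
        by (simp add: mult_ac)
      then show ?thesis using step[OF Suc.prems(1,2)] unfolding t by linarith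
    next
      case False
      then have t: "max 0 (1 - 2 * s) = 0" by simp
      have "norm (b ((1 - s) *\<^sub>R z) - b ((1 - s) *\<^sub>R w)) \<le> A * sqrt (?d / s)"
        using step[OF Suc.prems(1,2)] unfolding t by simp
      also have "\<dots> \<le> 4 * A * sqrt (?d / s)" using A q by (intro mult_right_mono) auto
      finally show ?thesis .
    qed
  qed
  have s0: "s > 0" using s d by linarith
  obtain m where "1 / s < 2 ^ m" using real_arch_pow[of 2 "1 / s"] by auto
  also have "(2::real) ^ m \<le> 2 ^ Suc m" by simp
  finally have "1 < s * 2 ^ Suc m" using s0 by (simp add: field_simps)
  from main[OF s this] show ?thesis by (simp add: A_def)
qed

lemma log_growth:
  assumes z: "norm z < 1"
  shows "norm (b z - b 0) \<le> M * ln (1 / (1 - norm z))"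
  using radial_difference[of 0 1 z] z by simp

text \<open>Both points are shrunk by \<open>1 - 64 * kdist z w\<close>, the mildest factor for
  which \<open>tangential_difference\<close> applies, and compared there; if
  \<open>64 * kdist z w > 1\<close>, both values are compared with \<open>b 0\<close>. The 6 is
  \<open>48 * sqrt (1 / 64)\<close>.\<close>

lemma difference_le:
  assumes z: "norm z < 1" and w: "norm w < 1"
  shows "norm (b z - b w) \<le> (6 * (2 * M + 1) + M * 2 * ln 65) * (1 + ln (kdist z w / (1 - norm z)) + ln (kdist z w / (1 - norm w)))"
    (is "_ \<le> ?C * ?L")
proof -
  let ?d = "kdist z w"
  have dz: "1 - norm z \<le> ?d" using kdist_ge[of w z] w by simp
  have dw: "1 - norm w \<le> ?d" using kdist_ge[of z w] z kdist_commute[of w z] by simp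
  have d: "0 < ?d" using dz z by linarith
  have lz: "0 \<le> ln (?d / (1 - norm z))" using dz z by (intro ln_ge_zero) auto
  have lw: "0 \<le> ln (?d / (1 - norm w))" using dw w by (intro ln_ge_zero) auto
  have l65: "0 \<le> ln (65::real)" "1 \<le> ln (65::real)"
  proof -
    have "exp 1 \<le> (65::real)" using exp_le by linarith
    then show "1 \<le> ln (65::real)" using ln_ge_iff[of 65 1] by simp
  qed simp
  have split: "ln (65 * ?d / (1 - norm x)) = ln 65 + ln (?d / (1 - norm x))" if "norm x < 1" for x :: "complex ^ 'n"
    using ln_mult[of 65 "?d / (1 - norm x)"] that d by simp
  have "norm (b z - b w) \<le> 6 * (2 * M + 1) + M * (2 * ln 65 + ln (?d / (1 - norm z)) + ln (?d / (1 - norm w)))"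
  proof (cases "64 * ?d \<le> 1")
    case True
    let ?s = "64 * ?d"
    have radial: "norm (b x - b ((1 - ?s) *\<^sub>R x)) \<le> M * (ln 65 + ln (?d / (1 - norm x)))"
      if x: "norm x < 1" "1 - norm x \<le> ?d" for x
    proof -
      have "norm (b (1 *\<^sub>R x) - b ((1 - ?s) *\<^sub>R x)) \<le> M * ln ((1 - (1 - ?s) * norm x) / (1 - 1 * norm x))"
        using True d x by (intro radial_difference) auto
      also have "\<dots> \<le> M * ln (65 * ?d / (1 - norm x))"
      proof (intro mult_left_mono M0)
        \<comment> \<open>After shrinking, the height is
          \<open>1 - norm x + ?s * norm x \<le> ?d + 64 * ?d\<close>, whence 65.\<close>
        have "?s * norm x \<le> ?s * 1" using x by (intro mult_left_mono) auto
        then have "1 - (1 - ?s) * norm x \<le> 65 * ?d" using x by (simp add: algebra_simps)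
        then have le: "(1 - (1 - ?s) * norm x) / (1 - 1 * norm x) \<le> 65 * ?d / (1 - norm x)"
          using x by (simp add: divide_right_mono)
        have "(1 - ?s) * norm x \<le> 1 * norm x" using d by (intro mult_right_mono) auto
        then have pos: "0 < (1 - (1 - ?s) * norm x) / (1 - 1 * norm x)" using x by (intro divide_pos_pos) linarith+
        show "ln ((1 - (1 - ?s) * norm x) / (1 - 1 * norm x)) \<le> ln (65 * ?d / (1 - norm x))"
          by (rule iffD2[OF ln_le_cancel_iff[OF pos less_le_trans[OF pos le]] le])
      qed
      finally show ?thesis unfolding split[OF x(1)] by simp
    qed
    have "norm (b ((1 - ?s) *\<^sub>R z) - b ((1 - ?s) *\<^sub>R w)) \<le> 48 * (2 * M + 1) * sqrt (?d / ?s)"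
      using True by (intro tangential_difference z w) auto
    also have "sqrt (?d / ?s) = 1 / 8" using d by (intro real_sqrt_unique) (auto simp: power2_eq_square)
    finally have t: "norm (b ((1 - ?s) *\<^sub>R z) - b ((1 - ?s) *\<^sub>R w)) \<le> 6 * (2 * M + 1)" by simp
    have tri: "norm (x + y - v) \<le> norm x + norm y + norm v" for x y v :: complex
      using norm_triangle_ineq4[of "x + y" v] norm_triangle_ineq[of x y] by linarith
    have eq: "b z - b w = (b z - b ((1 - ?s) *\<^sub>R z)) + (b ((1 - ?s) *\<^sub>R z) - b ((1 - ?s) *\<^sub>R w)) - (b w - b ((1 - ?s) *\<^sub>R w))"
      by simp
    have "norm (b z - b w) \<le> norm (b z - b ((1 - ?s) *\<^sub>R z)) + norm (b ((1 - ?s) *\<^sub>R z) - b ((1 - ?s) *\<^sub>R w)) + norm (b w - b ((1 - ?s) *\<^sub>R w))"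
      by (subst eq) (rule tri)
    then show ?thesis using radial[OF z dz] radial[OF w dw] t by (simp add: algebra_simps)
  next
    case False
    have growth: "norm (b x - b 0) \<le> M * (ln 65 + ln (?d / (1 - norm x)))" if x: "norm x < 1" for x
    proof -
      have le: "1 / (1 - norm x) \<le> 65 * ?d / (1 - norm x)" using False x d by (intro divide_right_mono) auto
      have pos: "0 < 1 / (1 - norm x)" using x by simp
      have "M * ln (1 / (1 - norm x)) \<le> M * ln (65 * ?d / (1 - norm x))"
        by (intro mult_left_mono M0 iffD2[OF ln_le_cancel_iff[OF pos less_le_trans[OF pos le]] le])
      then show ?thesis using log_growth[OF x] unfolding split[OF x] by linarith
    qed
    have "b z - b w = (b z - b 0) - (b w - b 0)" by simp
    then have "norm (b z - b w) \<le> norm (b z - b 0) + norm (b w - b 0)" by (simp only: norm_triangle_ineq4)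
    also have "\<dots> \<le> 6 * (2 * M + 1) + M * (2 * ln 65 + ln (?d / (1 - norm z)) + ln (?d / (1 - norm w)))"
      using growth[OF z] growth[OF w] M0 by (simp add: algebra_simps)
    finally show ?thesis .
  qed
  also have "\<dots> \<le> ?C * ?L"
  proof -
    have "M * 1 \<le> M * (2 * ln 65)" using l65 by (intro mult_left_mono M0) auto
    then have MC: "M \<le> ?C" using M0 by simp
    have "M * (ln (?d / (1 - norm z)) + ln (?d / (1 - norm w))) \<le> ?C * (ln (?d / (1 - norm z)) + ln (?d / (1 - norm w)))"
      using lz lw by (intro mult_right_mono MC) auto
    then show ?thesis by (simp only: distrib_left mult_1_right)
  qed
  finally show ?thesis .
qed

end

section \<open>The commutator of a Bloch function\<close>

text \<open>A set that is not measurable has \<open>measure\<close> 0, so the inequality survives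
  this default value. It is applied to superlevel sets of the commutator.\<close>

lemma measure_le_superset:
  assumes "A \<subseteq> G" "G \<in> fmeasurable M"
  shows "measure M A \<le> measure M G"
proof (cases "A \<in> sets M")
  case True
  then show ?thesis using assms by (intro measure_mono_fmeasurable)
qed (simp add: measure_notin_sets)

lemma log_plus_mult_le:
  assumes "1 \<le> c" "0 \<le> x"
  shows "log_plus (c * x) \<le> ln c + log_plus x"
proof (cases "x = 0")
  case True
  then show ?thesis using assms by (simp add: log_plus_def)
next
  case False
  then have "ln (c * x) = ln c + ln x" using assms by (subst ln_mult) auto
  moreover have "0 \<le> ln c" using assms by simp
  ultimately show ?thesis unfolding log_plus_def by linarith
qed

text \<open>Lets a constant factor of the kernel move into the density, at the cost of a constant in
  front of the \<open>L log L\<close> integral.\<close>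

lemma LlogL_mult_le:
  assumes c: "1 \<le> c" and x: "0 \<le> x"
  shows "c * x * (1 + log_plus (c * x)) \<le> c * (1 + ln c) * (x * (1 + log_plus x))"
proof -
  have p: "0 \<le> ln c" "0 \<le> log_plus x" using c by (auto simp: log_plus_def)
  have "1 + log_plus (c * x) \<le> (1 + ln c) * (1 + log_plus x)"
    using log_plus_mult_le[OF c x] mult_nonneg_nonneg[OF p] by (simp add: algebra_simps)
  then have "c * x * (1 + log_plus (c * x)) \<le> c * x * ((1 + ln c) * (1 + log_plus x))"
    using c x by (intro mult_left_mono) auto
  then show ?thesis by (simp add: mult_ac)
qed

lemma borel_measurable_lebesgue_on_iff:
  fixes f :: "'a::euclidean_space \<Rightarrow> 'b::real_normed_vector"
  shows "f \<in> borel_measurable (lebesgue_on (ball 0 1)) \<longleftrightarrow> (\<lambda>x. indicator (ball 0 1) x *\<^sub>R f x) \<in> borel_measurable lebesgue"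
  by (rule borel_measurable_restrict_space_iff) simp

lemma set_integrable_bounded_ball:
  fixes f :: "'a::euclidean_space \<Rightarrow> 'b::{banach, second_countable_topology}"
  assumes f: "f \<in> borel_measurable (lebesgue_on (ball 0 1))" and bnd: "\<And>x. x \<in> ball 0 1 \<Longrightarrow> norm (f x) \<le> B"
  shows "set_integrable lebesgue (ball 0 1) f"
proof -
  have "integrable lebesgue (\<lambda>x. indicator (ball 0 1) x *\<^sub>R (indicator (ball 0 1) x *\<^sub>R f x))"
  proof (rule integrableI_bounded_set_indicator[where B = B])
    show "emeasure lebesgue (ball (0::'a) 1) < \<infinity>" using lmeasurable_ball by (simp add: fmeasurable_def)
    show "AE x in lebesgue. x \<in> ball 0 1 \<longrightarrow> norm (indicator (ball 0 1) x *\<^sub>R f x) \<le> B"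
      using bnd by (intro always_eventually) (auto simp: indicator_def)
  qed (use f in \<open>auto simp: borel_measurable_lebesgue_on_iff\<close>)
  moreover have "(\<lambda>x. indicator (ball 0 1) x *\<^sub>R (indicator (ball 0 1) x *\<^sub>R f x)) = (\<lambda>x. indicator (ball 0 1) x *\<^sub>R f x)"
    by (auto simp: indicator_def)
  ultimately show ?thesis by (simp add: set_integrable_def)
qed

lemma set_integrable_mult_bounded_ball:
  fixes g h :: "'a::euclidean_space \<Rightarrow> complex"
  assumes g: "set_integrable lebesgue (ball 0 1) g"
    and h: "h \<in> borel_measurable (lebesgue_on (ball 0 1))" and bnd: "\<And>x. x \<in> ball 0 1 \<Longrightarrow> norm (h x) \<le> B"
  shows "set_integrable lebesgue (ball 0 1) (\<lambda>x. h x * g x)"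
proof -
  let ?i = "indicator (ball 0 1) :: 'a \<Rightarrow> real"
  have gm: "(\<lambda>x. ?i x *\<^sub>R g x) \<in> borel_measurable lebesgue"
    using g unfolding set_integrable_def by (rule borel_measurable_integrable)
  have hm: "(\<lambda>x. ?i x *\<^sub>R h x) \<in> borel_measurable lebesgue" using h by (simp add: borel_measurable_lebesgue_on_iff)
  have eq: "(\<lambda>x. ?i x *\<^sub>R (h x * g x)) = (\<lambda>x. (?i x *\<^sub>R h x) * (?i x *\<^sub>R g x))" by (auto simp: indicator_def)
  have "integrable lebesgue (\<lambda>x. ?i x *\<^sub>R (h x * g x))"
  proof (rule Bochner_Integration.integrable_bound)
    show "integrable lebesgue (\<lambda>x. B *\<^sub>R (?i x *\<^sub>R g x))"
      using g unfolding set_integrable_def by (rule integrable_scaleR_right)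
    show "(\<lambda>x. ?i x *\<^sub>R (h x * g x)) \<in> borel_measurable lebesgue"
      unfolding eq by (rule borel_measurable_times[OF hm gm])
    show "AE x in lebesgue. norm (?i x *\<^sub>R (h x * g x)) \<le> norm (B *\<^sub>R (?i x *\<^sub>R g x))"
    proof (intro always_eventually allI)
      fix x show "norm (?i x *\<^sub>R (h x * g x)) \<le> norm (B *\<^sub>R (?i x *\<^sub>R g x))"
      proof (cases "x \<in> ball 0 1")
        case True
        have "norm (h x) * norm (g x) \<le> \<bar>B\<bar> * norm (g x)" using bnd[OF True] by (intro mult_right_mono) auto
        then show ?thesis using True by (simp add: norm_mult)
      qed simp
    qed
  qed
  then show ?thesis by (simp add: set_integrable_def)
qed

section \<open>Integral representation of the commutator\<close>

definition bergman_const :: "'n::finite itself \<Rightarrow> real" where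
  "bergman_const _ = fact CARD('n) / pi ^ CARD('n)"

lemma bergman_const_pos: "0 < bergman_const TYPE('n::finite)"
  by (simp add: bergman_const_def)

lemma norm_bergman_kernel:
  fixes z w :: "complex ^ 'n"
  shows "norm (bergman_kernel z w) = bergman_const TYPE('n) / kdist z w ^ (CARD('n) + 1)"
proof -
  have "norm (complex_of_real (fact CARD('n) / pi ^ CARD('n))) = bergman_const TYPE('n)"
    unfolding norm_of_real bergman_const_def by simp
  then show ?thesis unfolding bergman_kernel_def norm_divide norm_power by simp
qed

lemma norm_bergman_kernel_le:
  fixes z w :: "complex ^ 'n"
  assumes z: "norm z < 1" and w: "norm w < 1"
  shows "norm (bergman_kernel z w) \<le> bergman_const TYPE('n) / (1 - norm z) ^ (CARD('n) + 1)"
proof -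
  have "(1 - norm z) ^ (CARD('n) + 1) \<le> kdist z w ^ (CARD('n) + 1)"
    using kdist_ge[of w z] z w by (intro power_mono) auto
  then show ?thesis unfolding norm_bergman_kernel
    using z bergman_const_pos[where 'n = 'n] by (intro divide_left_mono mult_pos_pos zero_less_power less_le_trans[OF _ kdist_ge]) (use w in auto)
qed

lemma kdist_pos: "norm z < 1 \<Longrightarrow> norm w \<le> 1 \<Longrightarrow> 0 < kdist z w"
  by (rule less_le_trans[OF _ kdist_ge]) auto

lemma continuous_on_bergman_kernel:
  assumes z: "norm z < 1"
  shows "continuous_on (ball 0 1) (bergman_kernel z)"
proof -
  have "1 - cinner z w \<noteq> 0" if "w \<in> ball 0 1" for w using kdist_pos[OF z, of w] that by auto
  moreover have "continuous_on (ball 0 1) (cinner z)" unfolding cinner_def[abs_def] by (intro continuous_intros)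
  ultimately show ?thesis unfolding bergman_kernel_def[abs_def] by (intro continuous_intros) auto
qed

lemma continuous_on_ball_measurable:
  fixes f :: "'a::euclidean_space \<Rightarrow> 'b::real_normed_vector"
  assumes "continuous_on (ball 0 1) f"
  shows "f \<in> borel_measurable (lebesgue_on (ball 0 1))"
proof -
  have "(\<lambda>x. indicator (ball 0 1) x *\<^sub>R f x) \<in> borel_measurable borel"
    using assms by (intro borel_measurable_continuous_on_indicator) auto
  then show ?thesis unfolding borel_measurable_lebesgue_on_iff by (simp add: measurable_completion)
qed

lemma bergman_defined_integrable:
  assumes "set_integrable lebesgue (ball 0 1) g"
  shows "bergman_defined g"
  unfolding bergman_defined_def
proof
  fix z :: "complex ^ 'a" assume "z \<in> ball 0 1"
  then have z: "norm z < 1" by simp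
  show "set_integrable lebesgue (ball 0 1) (\<lambda>w. bergman_kernel z w * g w)"
    using norm_bergman_kernel_le[OF z] continuous_on_ball_measurable[OF continuous_on_bergman_kernel[OF z]]
    by (intro set_integrable_mult_bounded_ball[OF assms]) auto
qed

lemma bloch_bloch_function:
  assumes "b \<in> bloch"
  obtains M where "bloch_function b M"
proof -
  have hol: "holomorphic_multi_on b (ball 0 1)" using assms by (simp add: bloch_def)
  obtain M where M: "\<forall>z\<in>ball 0 1. norm (cgrad b z) * (1 - norm z) \<le> M"
    using assms unfolding bloch_def bdd_above_def by blast
  have "bloch_function b (max 0 M)"
  proof (unfold_locales)
    fix z :: "complex ^ 'a" assume "z \<in> ball 0 1"
    then have "norm (cgrad b z) * (1 - norm z) \<le> M" using M by blast
    then show "norm (cgrad b z) * (1 - norm z) \<le> max 0 M" by (rule max.coboundedI2)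
  qed (simp_all add: hol)
  then show ?thesis by (rule that)
qed

text \<open>The ball is the tent of size 2 over the origin.\<close>

lemma weight_finite:
  assumes fr: "framed TYPE('n::finite)"
  shows "(\<integral>\<^sup>+w. ennreal (1 / sqrt (1 - norm w)) * indicator (ball (0 :: complex ^ 'n) 1) w \<partial>lborel) < \<infinity>"
proof -
  have "(\<integral>\<^sup>+w. ennreal (1 / sqrt (1 - norm w)) * indicator (ball (0 :: complex ^ 'n) 1) w \<partial>lborel) \<le>
    (\<integral>\<^sup>+w. ennreal (sqrt (2 / (1 - norm w))) * indicator {w \<in> ball (0 :: complex ^ 'n) 1. kdist 0 w < 2} w \<partial>lborel)"
  proof (intro nn_integral_mono)
    fix w :: "complex ^ 'n"
    have "1 / sqrt (1 - norm w) \<le> sqrt (2 / (1 - norm w))" if "norm w < 1"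
      using that unfolding real_sqrt_divide by (intro divide_right_mono) auto
    then show "ennreal (1 / sqrt (1 - norm w)) * indicator (ball 0 1) w \<le>
        ennreal (sqrt (2 / (1 - norm w))) * indicator {w \<in> ball 0 1. kdist 0 w < 2} w"
      by (auto simp: indicator_def cinner_zero_left intro!: ennreal_leI)
  qed
  also have "\<dots> < \<infinity>" by (rule le_less_trans[OF tent_weight[OF fr]]) auto
  finally show ?thesis .
qed

text \<open>The growth is at most logarithmic and
  \<open>ln (1 / (1 - norm w)) \<le> 2 / sqrt (1 - norm w)\<close>, whose right side is integrable.
  This gives a meaning to the projection of \<open>cnj b\<close> times a bounded function.\<close>

lemma (in bloch_function) set_integrable_ball:
  assumes fr: "framed TYPE('n)"
  shows "set_integrable lebesgue (ball 0 1) b"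
proof -
  have "(\<lambda>x. indicator (ball 0 1) x *\<^sub>R b x) \<in> borel_measurable borel"
    using holomorphic_multi_continuous_on[OF hol] by (intro borel_measurable_continuous_on_indicator) auto
  then have m: "(\<lambda>x. indicator (ball 0 1) x *\<^sub>R b x) \<in> borel_measurable lborel" by simp
  have pw: "norm (b w) \<le> (norm (b 0) + 2 * M) * (1 / sqrt (1 - norm w))" if w: "norm w < 1" for w
  proof -
    define q where "q = 1 / sqrt (1 - norm w)"
    have "sqrt (1 - norm w) \<le> 1" "0 < sqrt (1 - norm w)" using w by auto
    then have q1: "1 \<le> q" unfolding q_def by (simp add: field_simps)
    have "1 / (1 - norm w) = q ^ 2" using w by (simp add: q_def power_divide)
    then have "ln (1 / (1 - norm w)) = 2 * ln q" using q1 by (simp add: ln_realpow)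
    also have "\<dots> \<le> 2 * q" using ln_le_minus_one[of q] q1 by simp
    finally have "M * ln (1 / (1 - norm w)) \<le> M * (2 * q)" by (intro mult_left_mono M0)
    then have "norm (b w - b 0) \<le> M * (2 * q)" using log_growth[OF w] by linarith
    moreover have "norm (b w) \<le> norm (b w - b 0) + norm (b 0)" using norm_triangle_ineq[of "b w - b 0" "b 0"] by simp
    moreover have "norm (b 0) * 1 \<le> norm (b 0) * q" using q1 by (intro mult_left_mono) auto
    ultimately show ?thesis unfolding q_def[symmetric] by (simp add: algebra_simps)
  qed
  have "integrable lborel (\<lambda>x. indicator (ball 0 1) x *\<^sub>R b x)"
  proof (rule integrableI_bounded[OF m])
    have "(\<integral>\<^sup>+w. norm (indicator (ball 0 1) w *\<^sub>R b w) \<partial>lborel) \<le>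
      (\<integral>\<^sup>+w. ennreal (norm (b 0) + 2 * M) * (ennreal (1 / sqrt (1 - norm w)) * indicator (ball (0 :: complex ^ 'n) 1) w) \<partial>lborel)"
    proof (intro nn_integral_mono)
      fix w :: "complex ^ 'n"
      show "ennreal (norm (indicator (ball 0 1) w *\<^sub>R b w)) \<le>
          ennreal (norm (b 0) + 2 * M) * (ennreal (1 / sqrt (1 - norm w)) * indicator (ball 0 1) w)"
      proof (cases "w \<in> ball 0 1")
        case True
        then have "ennreal (norm (b w)) \<le> ennreal ((norm (b 0) + 2 * M) * (1 / sqrt (1 - norm w)))"
          using pw[of w] by (intro ennreal_leI) simp
        also have "\<dots> = ennreal (norm (b 0) + 2 * M) * ennreal (1 / sqrt (1 - norm w))"
          using True M0 by (intro ennreal_mult) auto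
        finally show ?thesis using True by simp
      qed simp
    qed
    also have "\<dots> = ennreal (norm (b 0) + 2 * M) * (\<integral>\<^sup>+w. ennreal (1 / sqrt (1 - norm w)) * indicator (ball (0 :: complex ^ 'n) 1) w \<partial>lborel)"
    proof (rule nn_integral_cmult)
      have [measurable]: "ball (0 :: complex ^ 'n) 1 \<in> sets borel" by simp
      show "(\<lambda>w. ennreal (1 / sqrt (1 - norm w)) * indicator (ball (0 :: complex ^ 'n) 1) w) \<in> borel_measurable lborel"
        by measurable
    qed
    also have "\<dots> < \<infinity>" using weight_finite[OF fr] by (simp add: ennreal_mult_less_top)
    finally show "(\<integral>\<^sup>+w. norm (indicator (ball 0 1) w *\<^sub>R b w) \<partial>lborel) < \<infinity>" .
  qed
  then show ?thesis unfolding set_integrable_def by (subst integrable_completion[OF m])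
qed

lemma set_integrable_cnj:
  "set_integrable M A f \<Longrightarrow> set_integrable M A (\<lambda>x. cnj (f x))"
  unfolding set_integrable_def
  using integrable_bounded_linear[OF bounded_linear_cnj, of M "\<lambda>x. indicator A x *\<^sub>R f x"] by simp

lemma (in bloch_function) commutator_defined_bounded:
  assumes fr: "framed TYPE('n)" and f: "f \<in> borel_measurable (lebesgue_on (ball 0 1))"
    and bnd: "\<And>x. x \<in> ball 0 1 \<Longrightarrow> norm (f x) \<le> B"
  shows "commutator_defined b f"
proof -
  have "set_integrable lebesgue (ball 0 1) (\<lambda>w. f w * cnj (b w))"
    by (rule set_integrable_mult_bounded_ball[OF set_integrable_cnj[OF set_integrable_ball[OF fr]] f bnd])
  then show ?thesis unfolding commutator_defined_def
    using set_integrable_bounded_ball[OF f bnd]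
    by (intro conjI bergman_defined_integrable) (simp_all add: mult.commute)
qed

lemma commutator_eq_integral:
  assumes cd: "commutator_defined b f" and z: "z \<in> ball 0 1"
  shows "set_integrable lebesgue (ball 0 1) (\<lambda>w. (cnj (b z) - cnj (b w)) * (bergman_kernel z w * f w))"
    "commutator b f z = (LINT w:ball 0 1|lebesgue. (cnj (b z) - cnj (b w)) * (bergman_kernel z w * f w))"
proof -
  have 1: "set_integrable lebesgue (ball 0 1) (\<lambda>w. cnj (b z) * (bergman_kernel z w * f w))"
    using cd z by (intro set_integrable_mult_right) (auto simp: commutator_defined_def bergman_defined_def)
  have 2: "set_integrable lebesgue (ball 0 1) (\<lambda>w. bergman_kernel z w * (cnj (b w) * f w))"
    using cd z by (auto simp: commutator_defined_def bergman_defined_def)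
  have eq: "(\<lambda>w. (cnj (b z) - cnj (b w)) * (bergman_kernel z w * f w)) =
      (\<lambda>w. cnj (b z) * (bergman_kernel z w * f w) - bergman_kernel z w * (cnj (b w) * f w))"
    by (auto simp: algebra_simps)
  show "set_integrable lebesgue (ball 0 1) (\<lambda>w. (cnj (b z) - cnj (b w)) * (bergman_kernel z w * f w))"
    unfolding eq by (rule set_integral_diff(1)[OF 1 2])
  show "commutator b f z = (LINT w:ball 0 1|lebesgue. (cnj (b z) - cnj (b w)) * (bergman_kernel z w * f w))"
    unfolding eq set_integral_diff(2)[OF 1 2] commutator_def bergman_proj_def set_integral_mult_right ..
qed

lemma (in bloch_function) norm_commutator_le:
  assumes cd: "commutator_defined b f" and z: "norm z < 1"
  shows "ennreal (norm (commutator b f z)) \<le> (\<integral>\<^sup>+w. ennreal (bergman_const TYPE('n) * (6 * (2 * M + 1) + M * 2 * ln 65) *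
    ((1 + ln (kdist z w / (1 - norm z)) + ln (kdist z w / (1 - norm w))) / kdist z w ^ (CARD('n) + 1)) * norm (f w)) *
    indicator (ball 0 1) w \<partial>lebesgue)"
proof -
  have zb: "z \<in> ball 0 1" using z by simp
  let ?g = "\<lambda>w. (cnj (b z) - cnj (b w)) * (bergman_kernel z w * f w)"
  have "ennreal (norm (commutator b f z)) \<le> (\<integral>\<^sup>+w. norm (indicator (ball 0 1) w *\<^sub>R ?g w) \<partial>lebesgue)"
    unfolding commutator_eq_integral(2)[OF cd zb] set_lebesgue_integral_def
    using commutator_eq_integral(1)[OF cd zb] unfolding set_integrable_def by (rule integral_norm_bound_ennreal)
  also have "\<dots> \<le> (\<integral>\<^sup>+w. ennreal (bergman_const TYPE('n) * (6 * (2 * M + 1) + M * 2 * ln 65) *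
    ((1 + ln (kdist z w / (1 - norm z)) + ln (kdist z w / (1 - norm w))) / kdist z w ^ (CARD('n) + 1)) * norm (f w)) *
    indicator (ball 0 1) w \<partial>lebesgue)"
  proof (intro nn_integral_mono)
    fix w :: "complex ^ 'n"
    show "ennreal (norm (indicator (ball 0 1) w *\<^sub>R ?g w)) \<le> ennreal (bergman_const TYPE('n) * (6 * (2 * M + 1) + M * 2 * ln 65) *
      ((1 + ln (kdist z w / (1 - norm z)) + ln (kdist z w / (1 - norm w))) / kdist z w ^ (CARD('n) + 1)) * norm (f w)) *
      indicator (ball 0 1) w"
    proof (cases "w \<in> ball 0 1")
      case True
      then have w: "norm w < 1" by simp
      have "norm (?g w) = norm (b z - b w) * (bergman_const TYPE('n) / kdist z w ^ (CARD('n) + 1) * norm (f w))"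
        unfolding norm_mult norm_bergman_kernel complex_cnj_diff[symmetric] complex_mod_cnj ..
      also have "\<dots> \<le> ((6 * (2 * M + 1) + M * 2 * ln 65) * (1 + ln (kdist z w / (1 - norm z)) + ln (kdist z w / (1 - norm w)))) *
          (bergman_const TYPE('n) / kdist z w ^ (CARD('n) + 1) * norm (f w))"
        using bergman_const_pos[where 'n = 'n] by (intro mult_right_mono difference_le z w) auto
      finally have le: "norm (?g w) \<le> bergman_const TYPE('n) * (6 * (2 * M + 1) + M * 2 * ln 65) *
          ((1 + ln (kdist z w / (1 - norm z)) + ln (kdist z w / (1 - norm w))) / kdist z w ^ (CARD('n) + 1)) * norm (f w)"
        by (simp only: times_divide_eq_left times_divide_eq_right mult_ac)
      have "indicator (ball 0 1) w *\<^sub>R ?g w = ?g w" using True by simp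
      then show ?thesis using True ennreal_leI[OF le] by (simp only: indicator_simps mult_1_right)
    qed simp
  qed
  finally show ?thesis .
qed

text \<open>Dividing \<open>f\<close> by \<open>lam\<close> turns the level \<open>lam\<close> into
  the level 1 of \<open>weak_type_LlogL\<close>, and \<open>norm_commutator_le\<close> passes from
  the commutator to the positive operator \<open>TS.T\<close>.\<close>

theorem bloch_weak_type:
  fixes b :: "complex ^ 'n \<Rightarrow> complex"
  assumes fr: "framed TYPE('n)" and b: "b \<in> bloch"
  shows "\<exists>C>0. \<forall>f. f \<in> borel_measurable (lebesgue_on (ball 0 1)) \<longrightarrow> bounded (f ` ball 0 1) \<longrightarrow>
    (\<forall>lam>0. measure lebesgue {z \<in> ball 0 1. norm (commutator b f z) > lam}
       \<le> C * (LINT z:ball 0 1|lebesgue. norm (f z) / lam * (1 + log_plus (norm (f z) / lam))))"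
proof -
  obtain M where "bloch_function b M" using b by (rule bloch_bloch_function)
  then interpret bloch_function b M .
  obtain C0 c0 where "tent_space (ball_measure :: (complex ^ 'n) measure) kdist (\<lambda>z. 1 - norm z) (CARD('n) + 1) C0 c0"
    using fr by (rule tent_space_ball)
  then interpret TS: tent_space "ball_measure :: (complex ^ 'n) measure" kdist "\<lambda>z. 1 - norm z" "CARD('n) + 1" C0 c0 .
  let ?B = "ball (0 :: complex ^ 'n) 1"
  have sp: "space (ball_measure :: (complex ^ 'n) measure) = ?B" by (simp add: space_restrict_space)
  obtain C1 where C1: "0 < C1" and wt: "\<forall>F\<in>borel_measurable ball_measure. (\<forall>w\<in>space ball_measure. 0 \<le> F w) \<longrightarrow>
    emeasure ball_measure {z \<in> space ball_measure. 1 < TS.T (\<lambda>w. ennreal (F w)) z} \<le>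
      ennreal C1 * (\<integral>\<^sup>+w. ennreal (F w * (1 + log_plus (F w))) \<partial>ball_measure)"
    using TS.weak_type_LlogL by (elim exE conjE)
  define Cb where "Cb = bergman_const TYPE('n) * (6 * (2 * M + 1) + M * 2 * ln 65)"
  \<comment> \<open>\<open>LlogL_mult_le\<close> works with factors at least 1.\<close>
  define \<kappa> where "\<kappa> = max 1 Cb"
  have \<kappa>: "1 \<le> \<kappa>" "Cb \<le> \<kappa>" by (auto simp: \<kappa>_def)
  define C where "C = C1 * (\<kappa> * (1 + ln \<kappa>))"
  have "0 < 1 + ln \<kappa>" using \<kappa> ln_ge_zero[of \<kappa>] by linarith
  then have C: "0 < C" using C1 \<kappa> by (simp add: C_def)
  have "measure lebesgue {z \<in> ?B. norm (commutator b f z) > lam}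
       \<le> C * (LINT z:?B|lebesgue. norm (f z) / lam * (1 + log_plus (norm (f z) / lam)))"
    if f: "f \<in> borel_measurable (lebesgue_on ?B)" and bf: "bounded (f ` ?B)" and lam: "0 < lam" for f lam
  proof -
    obtain Bd where "\<forall>x\<in>?B. norm (f x) \<le> Bd" using bf unfolding bounded_iff by blast
    then have Bd: "\<And>x. x \<in> ?B \<Longrightarrow> norm (f x) \<le> Bd" by blast
    have cd: "commutator_defined b f" by (rule commutator_defined_bounded[OF fr f Bd])
    have fm: "(\<lambda>x. norm (indicator ?B x *\<^sub>R f x)) \<in> borel_measurable lebesgue"
      using f unfolding borel_measurable_lebesgue_on_iff by (rule borel_measurable_norm[THEN measurable_compose[rotated]])
    \<comment> \<open>\<open>weak_type_LlogL\<close> concerns Borel functions. The Lebesgue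
      measurable \<open>norm (f x)\<close> agrees on the ball with such a \<open>g\<close> almost
      everywhere, which the integrals do not notice; \<open>g\<close> may be negative on a null set,
      hence the absolute value in \<open>F\<close>.\<close>
    then obtain g where gm: "g \<in> borel_measurable lborel" and ae: "AE x in lborel. norm (indicator ?B x *\<^sub>R f x) = g x"
      using completion_ex_borel_measurable_real[of "\<lambda>x. norm (indicator ?B x *\<^sub>R f x)" lborel] by auto
    define F where "F w = \<kappa> * (\<bar>g w\<bar> / lam)" for w
    have Fm0: "F \<in> borel_measurable lborel" using gm unfolding F_def by measurable
    then have Fm: "F \<in> borel_measurable ball_measure" by (rule measurable_restrict_space1)
    have F0: "0 \<le> F w" for w using \<kappa> lam by (simp add: F_def)
    define G where "G = {z \<in> space ball_measure. 1 < TS.T (\<lambda>w. ennreal (F w)) z}"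
    have TFm: "TS.T (\<lambda>w. ennreal (F w)) \<in> borel_measurable ball_measure"
      using Fm by (intro TS.T_measurable) auto
    then have "G \<in> sets ball_measure" unfolding G_def by measurable
    then have Gs: "G \<in> sets lborel" "G \<subseteq> ?B" by (auto simp: sets_restrict_space_iff)
    have nn_ball: "(\<integral>\<^sup>+w. h w \<partial>ball_measure) = (\<integral>\<^sup>+w. h w * indicator ?B w \<partial>lborel)" for h
      by (intro nn_integral_restrict_space) auto
    have sub: "{z \<in> ?B. norm (commutator b f z) > lam} \<subseteq> G"
    proof safe
      fix z assume z: "z \<in> ?B" and gt: "lam < norm (commutator b f z)"
      have nz: "norm z < 1" using z by simp
      have "ennreal lam < ennreal (norm (commutator b f z))" using gt lam by (simp add: ennreal_less_iff)
      also have "\<dots> \<le> (\<integral>\<^sup>+w. ennreal (Cb * TS.K z w * norm (f w)) * indicator ?B w \<partial>lebesgue)"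
        using norm_commutator_le[OF cd nz] unfolding Cb_def TS.K_def TS.L_def .
      also have "\<dots> = (\<integral>\<^sup>+w. ennreal (Cb * TS.K z w * norm (f w)) * indicator ?B w \<partial>lborel)"
        by (rule nn_integral_completion)
      also have "\<dots> \<le> (\<integral>\<^sup>+w. ennreal lam * (ennreal (TS.K z w) * ennreal (F w)) * indicator ?B w \<partial>lborel)"
      proof (intro nn_integral_mono_AE)
        show "AE w in lborel. ennreal (Cb * TS.K z w * norm (f w)) * indicator ?B w \<le>
            ennreal lam * (ennreal (TS.K z w) * ennreal (F w)) * indicator ?B w"
          using ae
        proof eventually_elim
          case (elim w)
          show ?case
          proof (cases "w \<in> ?B")
            case True
            have K0: "0 \<le> TS.K z w" using TS.K_pos[of z w] z True by (simp add: sp)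
            have "norm (f w) = g w" using elim True by simp
            then have gw: "\<bar>g w\<bar> = norm (f w)" by (metis abs_norm_cancel)
            have "Cb * TS.K z w * norm (f w) \<le> \<kappa> * TS.K z w * norm (f w)"
              using \<kappa> K0 by (intro mult_right_mono) auto
            also have "\<dots> = lam * (TS.K z w * F w)" using lam by (simp add: F_def gw)
            finally have "ennreal (Cb * TS.K z w * norm (f w)) \<le> ennreal (lam * (TS.K z w * F w))" by (rule ennreal_leI)
            also have "\<dots> = ennreal lam * (ennreal (TS.K z w) * ennreal (F w))"
              using lam K0 F0[of w] by (simp add: ennreal_mult)
            finally show ?thesis using True by simp
          qed simp
        qed
      qed
      also have "\<dots> = (\<integral>\<^sup>+w. ennreal lam * (ennreal (TS.K z w) * ennreal (F w)) \<partial>ball_measure)"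
        by (rule nn_ball[symmetric])
      also have "\<dots> = ennreal lam * TS.T (\<lambda>w. ennreal (F w)) z"
        unfolding TS.T_def
      proof (rule nn_integral_cmult)
        have zs: "z \<in> space ball_measure" using z by (simp add: sp)
        show "(\<lambda>w. ennreal (TS.K z w) * ennreal (F w)) \<in> borel_measurable ball_measure"
          using Fm by (intro borel_measurable_times_ennreal measurable_compose[OF _ measurable_ennreal] TS.K_measurable measurable_const measurable_ident_sets zs refl) auto
      qed
      finally have lt: "ennreal lam < ennreal lam * TS.T (\<lambda>w. ennreal (F w)) z" .
      have "1 < TS.T (\<lambda>w. ennreal (F w)) z"
      proof (rule ccontr)
        assume "\<not> 1 < TS.T (\<lambda>w. ennreal (F w)) z"
        then have "ennreal lam * TS.T (\<lambda>w. ennreal (F w)) z \<le> ennreal lam * 1" by (intro mult_left_mono) auto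
        then show False using lt by simp
      qed
      then show "z \<in> G" using z by (simp add: G_def sp)
    qed
    define h where "h w = norm (f w) / lam * (1 + log_plus (norm (f w) / lam))" for w
    have h0: "0 \<le> h w" for w using lam by (simp add: h_def log_plus_def)
    have hint: "set_integrable lebesgue ?B h"
    proof (rule set_integrable_bounded_ball)
      have "(\<lambda>x. norm (f x)) \<in> borel_measurable (lebesgue_on ?B)" using f by measurable
      then show "h \<in> borel_measurable (lebesgue_on ?B)" unfolding h_def log_plus_def by measurable
      fix x assume "x \<in> ?B"
      then have nb: "norm (f x) / lam \<le> \<bar>Bd\<bar> / lam" using Bd[of x] lam by (intro divide_right_mono) auto
      have "log_plus (norm (f x) / lam) \<le> \<bar>Bd\<bar> / lam"
      proof (cases "norm (f x) = 0")
        case True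
        then show ?thesis using lam by (simp add: log_plus_def)
      next
        case False
        then have "ln (norm (f x) / lam) \<le> norm (f x) / lam - 1" using lam by (intro ln_le_minus_one) simp
        then show ?thesis using nb lam by (simp add: log_plus_def)
      qed
      then have "h x \<le> \<bar>Bd\<bar> / lam * (1 + \<bar>Bd\<bar> / lam)"
        unfolding h_def using nb lam by (intro mult_mono) (auto simp: log_plus_def)
      then show "norm (h x) \<le> \<bar>Bd\<bar> / lam * (1 + \<bar>Bd\<bar> / lam)" using h0[of x] by simp
    qed
    have hI: "(\<integral>\<^sup>+w. ennreal (h w) * indicator ?B w \<partial>lborel) = ennreal (LINT w:?B|lebesgue. h w)"
    proof -
      have "(\<integral>\<^sup>+w. ennreal (h w) * indicator ?B w \<partial>lborel) = (\<integral>\<^sup>+w. ennreal (indicator ?B w *\<^sub>R h w) \<partial>lebesgue)"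
        unfolding nn_integral_completion by (intro nn_integral_cong) (auto simp: indicator_def)
      also have "\<dots> = ennreal (\<integral>w. indicator ?B w *\<^sub>R h w \<partial>lebesgue)"
        using hint h0 unfolding set_integrable_def by (intro nn_integral_eq_integral) (auto simp: indicator_def)
      finally show ?thesis by (simp add: set_lebesgue_integral_def)
    qed
    have LL: "0 \<le> (LINT w:?B|lebesgue. h w)"
      unfolding set_lebesgue_integral_def using h0 by (intro integral_nonneg_AE always_eventually) (auto simp: indicator_def)
    have "emeasure lborel G = emeasure ball_measure G" using Gs by (intro emeasure_restrict_space[symmetric]) auto
    also have "\<dots> \<le> ennreal C1 * (\<integral>\<^sup>+w. ennreal (F w * (1 + log_plus (F w))) \<partial>ball_measure)"
      unfolding G_def using wt Fm F0 by blast
    also have "(\<integral>\<^sup>+w. ennreal (F w * (1 + log_plus (F w))) \<partial>ball_measure) \<le>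
        (\<integral>\<^sup>+w. ennreal (\<kappa> * (1 + ln \<kappa>) * h w) * indicator ?B w \<partial>lborel)"
      unfolding nn_ball
    proof (intro nn_integral_mono_AE)
      show "AE w in lborel. ennreal (F w * (1 + log_plus (F w))) * indicator ?B w \<le> ennreal (\<kappa> * (1 + ln \<kappa>) * h w) * indicator ?B w"
        using ae
      proof eventually_elim
        case (elim w)
        show ?case
        proof (cases "w \<in> ?B")
          case True
          have "norm (f w) = g w" using elim True by simp
            then have gw: "\<bar>g w\<bar> = norm (f w)" by (metis abs_norm_cancel)
          have "F w * (1 + log_plus (F w)) \<le> \<kappa> * (1 + ln \<kappa>) * h w"
            unfolding F_def h_def gw using \<kappa> lam by (intro LlogL_mult_le) auto
          then show ?thesis using True by (simp add: ennreal_leI)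
        qed simp
      qed
    qed
    also have "(\<integral>\<^sup>+w. ennreal (\<kappa> * (1 + ln \<kappa>) * h w) * indicator ?B w \<partial>lborel) =
        (\<integral>\<^sup>+w. ennreal (\<kappa> * (1 + ln \<kappa>)) * ennreal (indicator ?B w *\<^sub>R h w) \<partial>lebesgue)"
      unfolding nn_integral_completion using h0 \<open>0 < 1 + ln \<kappa>\<close> \<kappa>
      by (intro nn_integral_cong) (auto simp: indicator_def ennreal_mult)
    also have "\<dots> = ennreal (\<kappa> * (1 + ln \<kappa>)) * (\<integral>\<^sup>+w. ennreal (indicator ?B w *\<^sub>R h w) \<partial>lebesgue)"
    proof (rule nn_integral_cmult)
      show "(\<lambda>w. ennreal (indicator ?B w *\<^sub>R h w)) \<in> borel_measurable lebesgue"
        using hint unfolding set_integrable_def by (intro measurable_compose[OF _ measurable_ennreal]) (rule borel_measurable_integrable)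
    qed
    also have "(\<integral>\<^sup>+w. ennreal (indicator ?B w *\<^sub>R h w) \<partial>lebesgue) = (\<integral>\<^sup>+w. ennreal (h w) * indicator ?B w \<partial>lborel)"
      unfolding nn_integral_completion by (intro nn_integral_cong) (auto simp: indicator_def)
    also note hI
    finally have em: "emeasure lborel G \<le> ennreal C1 * (ennreal (\<kappa> * (1 + ln \<kappa>)) * ennreal (LINT w:?B|lebesgue. h w))"
      by (simp add: mult_left_mono)
    also have "\<dots> = ennreal (C * (LINT w:?B|lebesgue. h w))"
      unfolding C_def using C1 \<kappa> LL \<open>0 < 1 + ln \<kappa>\<close> by (simp add: ennreal_mult mult.assoc)
    finally have em: "emeasure lborel G \<le> ennreal (C * (LINT w:?B|lebesgue. h w))" .
    have Gf: "G \<in> fmeasurable lebesgue"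
      using em Gs by (intro fmeasurableI) (auto intro: le_less_trans)
    have "measure lebesgue {z \<in> ?B. norm (commutator b f z) > lam} \<le> measure lebesgue G"
      by (rule measure_le_superset[OF sub Gf])
    also have "\<dots> \<le> C * (LINT w:?B|lebesgue. h w)"
    proof -
      have "measure lebesgue G = measure lborel G" using Gs by simp
      also have "measure lborel G \<le> enn2real (ennreal (C * (LINT w:?B|lebesgue. h w)))"
        unfolding measure_def using em by (intro enn2real_mono) auto
      also have "\<dots> = C * (LINT w:?B|lebesgue. h w)" using C LL by simp
      finally show ?thesis .
    qed
    finally show ?thesis unfolding h_def .
  qed
  then show ?thesis using C by blast
qed

lemma indicator_measurable_lebesgue_on:
  assumes "A \<in> sets lebesgue"
  shows "(indicator A :: 'a::euclidean_space \<Rightarrow> complex) \<in> borel_measurable (lebesgue_on (ball 0 1))"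
  using assms by (intro measurable_restrict_space1 borel_measurable_indicator)

theorem bloch_weak_type_indicator:
  fixes b :: "complex ^ 'n \<Rightarrow> complex"
  assumes fr: "framed TYPE('n)" and b: "b \<in> bloch"
  shows "\<exists>C>0. \<forall>A \<in> sets lebesgue. A \<subseteq> ball 0 1 \<longrightarrow> commutator_defined b (indicator A) \<and>
    (\<forall>lam>1. measure lebesgue {z \<in> ball 0 1. norm (commutator b (indicator A) z) > lam} \<le> C * measure lebesgue A / lam)"
proof -
  let ?B = "ball (0 :: complex ^ 'n) 1"
  obtain M where "bloch_function b M" using b by (rule bloch_bloch_function)
  then interpret bloch_function b M .
  obtain C where C: "0 < C" and wt: "\<And>f lam. f \<in> borel_measurable (lebesgue_on ?B) \<Longrightarrow> bounded (f ` ?B) \<Longrightarrow>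
    0 < lam \<Longrightarrow> measure lebesgue {z \<in> ?B. norm (commutator b f z) > lam}
       \<le> C * (LINT z:?B|lebesgue. norm (f z) / lam * (1 + log_plus (norm (f z) / lam)))"
    using bloch_weak_type[OF fr b] by blast
  have "commutator_defined b (indicator A) \<and>
    (\<forall>lam>1. measure lebesgue {z \<in> ?B. norm (commutator b (indicator A) z) > lam} \<le> C * measure lebesgue A / lam)"
    if A: "A \<in> sets lebesgue" "A \<subseteq> ?B" for A
  proof (intro conjI allI impI)
    let ?f = "indicator A :: complex ^ 'n \<Rightarrow> complex"
    have fm: "?f \<in> borel_measurable (lebesgue_on ?B)" by (rule indicator_measurable_lebesgue_on[OF A(1)])
    have f1: "norm (?f x) \<le> 1" for x by (simp add: indicator_def)
    show "commutator_defined b ?f" by (rule commutator_defined_bounded[OF fr fm f1])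
    fix lam :: real assume lam: "1 < lam"
    have "bounded (?f ` ?B)" using f1 by (auto simp: bounded_iff)
    then have "measure lebesgue {z \<in> ?B. norm (commutator b ?f z) > lam}
       \<le> C * (LINT z:?B|lebesgue. norm (?f z) / lam * (1 + log_plus (norm (?f z) / lam)))"
      using lam by (intro wt fm) auto
    also have "(LINT z:?B|lebesgue. norm (?f z) / lam * (1 + log_plus (norm (?f z) / lam))) = measure lebesgue A / lam"
    proof -
      \<comment> \<open>For \<open>lam > 1\<close> the logarithm vanishes, and the
        \<open>L log L\<close> integral of an indicator is the measure divided by
        \<open>lam\<close>.\<close>
      have "log_plus (1 / lam) = 0" using lam by (simp add: log_plus_def ln_div)
      then have "(\<lambda>z. indicator ?B z *\<^sub>R (norm (?f z) / lam * (1 + log_plus (norm (?f z) / lam)))) = (\<lambda>z. (1 / lam) *\<^sub>R indicator A z)"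
      proof (intro ext)
        fix z :: "complex ^ 'n"
        show "indicator ?B z *\<^sub>R (norm (?f z) / lam * (1 + log_plus (norm (?f z) / lam))) = (1 / lam) *\<^sub>R indicator A z"
          using A(2) \<open>log_plus (1 / lam) = 0\<close> by (cases "z \<in> A") auto
      qed
      then show ?thesis unfolding set_lebesgue_integral_def using A(1) by simp
    qed
    finally show "measure lebesgue {z \<in> ?B. norm (commutator b ?f z) > lam} \<le> C * measure lebesgue A / lam" by simp
  qed
  then show ?thesis using C by blast
qed

section \<open>Slices and mean values\<close>

text \<open>Differentiation under the integral by dominated convergence. The Schwarz lemma on a disc
  of radius \<open>\<delta>\<close> dominates the difference quotients by
  \<open>3 * g x / \<delta>\<close>.\<close>

lemma holomorphic_on_parametric_integral:
  fixes f :: "complex \<Rightarrow> 'a \<Rightarrow> complex"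
  assumes T: "open T" and hol: "\<And>x. x \<in> space M \<Longrightarrow> (\<lambda>t. f t x) holomorphic_on T"
    and meas: "\<And>t. t \<in> T \<Longrightarrow> f t \<in> borel_measurable M"
    and bnd: "\<And>t. t \<in> T \<Longrightarrow> \<exists>\<delta>>0. \<exists>g. integrable M g \<and> cball t \<delta> \<subseteq> T \<and>
      (\<forall>s\<in>cball t \<delta>. \<forall>x\<in>space M. norm (f s x) \<le> g x)"
  shows "(\<lambda>t. \<integral>x. f t x \<partial>M) holomorphic_on T"
  unfolding holomorphic_on_open[OF T]
proof
  fix t assume t: "t \<in> T"
  obtain \<delta> g where \<delta>: "0 < \<delta>" and g: "integrable M g" and sub: "cball t \<delta> \<subseteq> T"
    and fg: "\<And>s x. s \<in> cball t \<delta> \<Longrightarrow> x \<in> space M \<Longrightarrow> norm (f s x) \<le> g x" using bnd[OF t] by blast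
  define D where "D x = deriv (\<lambda>t. f t x) t" for x
  have int: "integrable M (f s)" if "s \<in> cball t \<delta>" for s
  proof (rule Bochner_Integration.integrable_bound[OF g])
    show "f s \<in> borel_measurable M" by (rule meas) (use that sub in blast)
    show "AE x in M. norm (f s x) \<le> norm (g x)"
    proof (rule AE_I2)
      fix x assume "x \<in> space M"
      then have "norm (f s x) \<le> g x" by (rule fg[OF that])
      then show "norm (f s x) \<le> norm (g x)" by simp
    qed
  qed
  have der: "((\<lambda>s. (f s x - f t x) / (s - t)) \<longlongrightarrow> D x) (at t within ball t \<delta>)" if x: "x \<in> space M" for x
  proof -
    have "((\<lambda>t. f t x) has_field_derivative D x) (at t)"
      unfolding D_def using hol[OF x] T t by (intro holomorphic_derivI)
    then have "((\<lambda>t. f t x) has_field_derivative D x) (at t within ball t \<delta>)" by (rule has_field_derivative_at_within)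
    then show ?thesis by (simp only: has_field_derivative_iff)
  qed
  have quot: "norm ((f s x - f t x) / (s - t)) \<le> 3 * g x / \<delta>"
    if s: "s \<in> ball t \<delta>" "s \<noteq> t" and x: "x \<in> space M" for s x
  \<comment> \<open>The disc estimate asks for a positive bound; where \<open>g x = 0\<close> both
    values vanish.\<close>
  proof (cases "g x = 0")
    case True
    have "norm (f s x) \<le> g x" by (rule fg) (use s x in auto)
    moreover have "norm (f t x) \<le> g x" by (rule fg) (use \<delta> x in auto)
    ultimately have "f s x = 0" "f t x = 0" unfolding True by simp_all
    then show ?thesis using True by simp
  next
    case False
    have "norm (f t x) \<le> g x" by (rule fg) (use \<delta> x in auto)
    then have "0 \<le> g x" using norm_ge_zero[of "f t x"] by (rule order_trans[rotated])
    then have gp: "0 < g x" using False by simp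
    \<comment> \<open>The line through \<open>t\<close> and \<open>s\<close> is parametrized so that
      \<open>t\<close> is the point 0 and \<open>s\<close> the point 1; the radius
      \<open>\<delta>\<close> then becomes \<open>R\<close>.\<close>
    define R where "R = \<delta> / norm (s - t)"
    have R: "1 < R" using s by (simp add: R_def dist_norm norm_minus_commute)
    have inT: "t + \<zeta> * (s - t) \<in> cball t \<delta>" if "norm \<zeta> < R" for \<zeta>
    proof -
      have "norm \<zeta> * norm (s - t) \<le> R * norm (s - t)" using that by (intro mult_right_mono) auto
      then show ?thesis using s by (simp add: R_def dist_norm norm_mult)
    qed
    define c where "c \<zeta> = f (t + \<zeta> * (s - t)) x" for \<zeta>
    have "c holomorphic_on ball 0 R"
      unfolding c_def using inT sub
      by (intro holomorphic_on_compose_gen[OF _ hol[OF x], unfolded o_def] holomorphic_intros) auto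
    moreover have "norm (c \<zeta>) \<le> g x" if "norm \<zeta> < R" for \<zeta>
      unfolding c_def by (rule fg[OF inT[OF that] x])
    ultimately have "norm (c 1 - c 0) \<le> 3 * g x / R" by (rule norm_diff_le_of_holomorphic_disc[OF _ R gp])
    then have "norm (f s x - f t x) \<le> 3 * g x / \<delta> * norm (s - t)" by (simp add: c_def R_def)
    then show ?thesis using s unfolding norm_divide by (subst pos_divide_le_eq) auto
  qed
  have "((\<lambda>s. ((\<integral>x. f s x \<partial>M) - (\<integral>x. f t x \<partial>M)) / (s - t)) \<longlongrightarrow> (\<integral>x. D x \<partial>M)) (at t within ball t \<delta>)"
    unfolding tendsto_at_iff_sequentially
  proof (intro allI impI)
    fix X assume X: "\<forall>i. X i \<in> ball t \<delta> - {t}" "X \<longlonglongrightarrow> t"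
    have Xb: "X i \<in> cball t \<delta>" "X i \<noteq> t" for i
    proof -
      have "X i \<in> ball t \<delta> - {t}" using X(1) by blast
      then show "X i \<in> cball t \<delta>" "X i \<noteq> t" using ball_subset_cball by blast+
    qed
    have lim: "(\<lambda>i. (f (X i) x - f t x) / (X i - t)) \<longlonglongrightarrow> D x" if "x \<in> space M" for x
      using der[OF that] X unfolding tendsto_at_iff_sequentially o_def by blast
    have ii: "integrable M (\<lambda>x. (f (X i) x - f t x) / (X i - t))" for i
      using \<delta> Xb by (intro integrable_divide Bochner_Integration.integrable_diff int) auto
    have "(\<lambda>i. \<integral>x. (f (X i) x - f t x) / (X i - t) \<partial>M) \<longlonglongrightarrow> (\<integral>x. D x \<partial>M)"
    proof (rule integral_dominated_convergence[where w = "\<lambda>x. 3 * g x / \<delta>"])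
      show "(\<lambda>x. (f (X i) x - f t x) / (X i - t)) \<in> borel_measurable M" for i
        using ii by (rule borel_measurable_integrable)
      show "D \<in> borel_measurable M"
        using borel_measurable_integrable[OF ii] lim by (rule borel_measurable_LIMSEQ_metric)
      show "integrable M (\<lambda>x. 3 * g x / \<delta>)" using integrable_mult_right[OF g, of "3 / \<delta>"] by simp
      show "AE x in M. (\<lambda>i. (f (X i) x - f t x) / (X i - t)) \<longlonglongrightarrow> D x" by (rule AE_I2[OF lim])
      show "AE x in M. norm ((f (X i) x - f t x) / (X i - t)) \<le> 3 * g x / \<delta>" for i
      proof (rule AE_I2)
        fix x assume x: "x \<in> space M"
        have "X i \<in> ball t \<delta>" using X(1) by blast
        then show "norm ((f (X i) x - f t x) / (X i - t)) \<le> 3 * g x / \<delta>" using Xb(2) x by (rule quot)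
      qed
    qed
    moreover have "(\<integral>x. (f (X i) x - f t x) / (X i - t) \<partial>M) = ((\<integral>x. f (X i) x \<partial>M) - (\<integral>x. f t x \<partial>M)) / (X i - t)" for i
      unfolding integral_divide_zero
      by (subst Bochner_Integration.integral_diff[OF int int]) (use \<delta> Xb(1) in simp_all)
    ultimately show "((\<lambda>s. ((\<integral>x. f s x \<partial>M) - (\<integral>x. f t x \<partial>M)) / (s - t)) \<circ> X) \<longlonglongrightarrow> (\<integral>x. D x \<partial>M)"
      by (simp only: o_def)
  qed
  then have "((\<lambda>t. \<integral>x. f t x \<partial>M) has_field_derivative (\<integral>x. D x \<partial>M)) (at t within ball t \<delta>)"
    by (simp only: has_field_derivative_iff)
  then show "\<exists>f'. ((\<lambda>t. \<integral>x. f t x \<partial>M) has_field_derivative f') (at t)"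
    using \<delta> at_within_open[of t "ball t \<delta>"] by auto
qed

text \<open>By Hartogs' theorem this is holomorphy in several variables; only slices are needed here.\<close>

definition slice_holomorphic_on :: "(complex ^ 'n \<Rightarrow> complex) \<Rightarrow> (complex ^ 'n) set \<Rightarrow> bool" where
  "slice_holomorphic_on f S \<longleftrightarrow> continuous_on S f \<and>
    (\<forall>z v T. open T \<longrightarrow> (\<forall>t\<in>T. z + t *s v \<in> S) \<longrightarrow> (\<lambda>t. f (z + t *s v)) holomorphic_on T)"

lemma slice_holomorphic_onD:
  "slice_holomorphic_on f S \<Longrightarrow> open T \<Longrightarrow> (\<And>t. t \<in> T \<Longrightarrow> z + t *s v \<in> S) \<Longrightarrow> (\<lambda>t. f (z + t *s v)) holomorphic_on T"
  by (simp add: slice_holomorphic_on_def)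

lemma slice_holomorphic_on_multi:
  "holomorphic_multi_on b S \<Longrightarrow> slice_holomorphic_on b S"
  unfolding slice_holomorphic_on_def
  by (simp add: holomorphic_multi_continuous_on holomorphic_on_slice)

lemma bergman_kernel_bound:
  assumes K: "compact K" "K \<subseteq> ball (0 :: complex ^ 'n) 1"
  obtains C where "\<And>z w. z \<in> K \<Longrightarrow> w \<in> ball 0 1 \<Longrightarrow> norm (bergman_kernel z w) \<le> C"
proof (cases "K = {}")
  case False
  obtain z0 where z0: "z0 \<in> K" "\<And>z. z \<in> K \<Longrightarrow> norm z \<le> norm z0"
    using continuous_attains_sup[OF K(1) False, of norm] continuous_on_norm_id by blast
  have n0: "norm z0 < 1" using z0 K by auto
  show ?thesis
  proof (rule that)
    fix z w :: "complex ^ 'n" assume z: "z \<in> K" and w: "w \<in> ball 0 1"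
    have "norm (bergman_kernel z w) \<le> bergman_const TYPE('n) / (1 - norm z) ^ (CARD('n) + 1)"
      using z w K by (intro norm_bergman_kernel_le) auto
    also have "\<dots> \<le> bergman_const TYPE('n) / (1 - norm z0) ^ (CARD('n) + 1)"
      using z0 n0 z bergman_const_pos[where 'n = 'n]
      by (intro divide_left_mono power_mono mult_pos_pos zero_less_power) (auto intro: le_less_trans)
    finally show "norm (bergman_kernel z w) \<le> bergman_const TYPE('n) / (1 - norm z0) ^ (CARD('n) + 1)" .
  qed
qed (rule that, simp)

lemma continuous_on_bergman_kernel_left:
  assumes w: "norm w < 1"
  shows "continuous_on (ball 0 1) (\<lambda>z. bergman_kernel z w)"
proof -
  have "1 - cinner z w \<noteq> 0" if "z \<in> ball 0 1" for z using kdist_pos[of z w] that w by auto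
  moreover have "continuous_on (ball 0 1) (\<lambda>z. cinner z w)" unfolding cinner_def[abs_def] by (intro continuous_intros)
  ultimately show ?thesis unfolding bergman_kernel_def[abs_def] by (intro continuous_intros) auto
qed

lemma plus_smult_eq: "a + x *s y = (\<chi> i. a $ i + x * y $ i)"
  by (simp add: vec_eq_iff)

text \<open>On a compact set of \<open>z\<close> the kernel is bounded uniformly in
  \<open>w\<close>, so a multiple of \<open>norm (F w)\<close> dominates. The compact set is a
  convergent sequence with its limit for continuity and a closed disc of the slice for
  holomorphy.\<close>

lemma slice_holomorphic_bergman_proj:
  fixes F :: "complex ^ 'n \<Rightarrow> complex"
  assumes F: "set_integrable lebesgue (ball 0 1) F"
  shows "slice_holomorphic_on (bergman_proj F) (ball 0 1)"
proof -
  let ?B = "ball (0 :: complex ^ 'n) 1"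
  define f where "f z w = indicator ?B w *\<^sub>R (bergman_kernel z w * F w)" for z w
  have P: "bergman_proj F z = (\<integral>w. f z w \<partial>lebesgue)" for z
    by (simp add: bergman_proj_def f_def set_lebesgue_integral_def)
  have int: "integrable lebesgue (f z)" if "z \<in> ?B" for z
    using bergman_defined_integrable[OF F] that unfolding bergman_defined_def set_integrable_def f_def by blast
  have g: "integrable lebesgue (\<lambda>w. C * norm (indicator ?B w *\<^sub>R F w))" for C :: real
    using F unfolding set_integrable_def by (intro integrable_mult_right integrable_norm)
  have bnd: "norm (f z w) \<le> C * norm (indicator ?B w *\<^sub>R F w)"
    if "\<And>w. w \<in> ?B \<Longrightarrow> norm (bergman_kernel z w) \<le> C" for z w C
    using that[of w] by (auto simp: f_def norm_mult indicator_def intro: mult_right_mono)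
  have "continuous_on ?B (\<lambda>z. \<integral>w. f z w \<partial>lebesgue)"
    unfolding continuous_on_sequentially
  proof (intro allI ballI impI, elim conjE)
    fix X a assume a: "a \<in> ?B" and X: "\<forall>n. X n \<in> ?B" "X \<longlonglongrightarrow> a"
    have "compact (insert a (range X))" using X(2) by (rule compact_sequence_with_limit)
    then obtain C where C: "\<And>z w. z \<in> insert a (range X) \<Longrightarrow> w \<in> ?B \<Longrightarrow> norm (bergman_kernel z w) \<le> C"
      using bergman_kernel_bound[of "insert a (range X)"] a X(1) by blast
    have "(\<lambda>i. \<integral>w. f (X i) w \<partial>lebesgue) \<longlonglongrightarrow> (\<integral>w. f a w \<partial>lebesgue)"
    proof (rule integral_dominated_convergence[OF _ _ g[of C]])
      show "f a \<in> borel_measurable lebesgue" using int[OF a] by (rule borel_measurable_integrable)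
      show "f (X i) \<in> borel_measurable lebesgue" for i using int X(1) by (intro borel_measurable_integrable) auto
      show "AE w in lebesgue. norm (f (X i) w) \<le> C * norm (indicator ?B w *\<^sub>R F w)" for i
        by (intro AE_I2 bnd C) auto
      show "AE w in lebesgue. (\<lambda>i. f (X i) w) \<longlonglongrightarrow> f a w"
      proof (intro AE_I2)
        fix w show "(\<lambda>i. f (X i) w) \<longlonglongrightarrow> f a w"
        proof (cases "w \<in> ?B")
          case True
          then have "continuous_on ?B (\<lambda>z. bergman_kernel z w)" by (intro continuous_on_bergman_kernel_left) simp
          then have "(\<lambda>i. bergman_kernel (X i) w) \<longlonglongrightarrow> bergman_kernel a w"
            using X a unfolding continuous_on_sequentially o_def by blast
          then show ?thesis unfolding f_def by (intro tendsto_intros)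
        qed (simp add: f_def)
      qed
    qed
    then show "((\<lambda>z. \<integral>w. f z w \<partial>lebesgue) \<circ> X) \<longlonglongrightarrow> (\<integral>w. f a w \<partial>lebesgue)" by (simp add: o_def)
  qed
  moreover have "(\<lambda>t. \<integral>w. f (z + t *s v) w \<partial>lebesgue) holomorphic_on T"
    if T: "open T" and sub: "\<And>t. t \<in> T \<Longrightarrow> z + t *s v \<in> ?B" for z v T
  proof (rule holomorphic_on_parametric_integral[OF T])
    fix w
    show "(\<lambda>t. f (z + t *s v) w) holomorphic_on T"
    proof (cases "w \<in> ?B")
      case True
      have eq: "1 - cinner (z + t *s v) w = (1 - cinner z w) - t * cinner v w" for t
        by (simp add: cinner_add_left cinner_smult_left)
      have "1 - cinner (z + t *s v) w \<noteq> 0" if "t \<in> T" for t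
        using kdist_pos[of "z + t *s v" w] sub[OF that] True by auto
      then have "(\<lambda>t. bergman_kernel (z + t *s v) w) holomorphic_on T"
        unfolding bergman_kernel_def eq by (intro holomorphic_intros) auto
      then show ?thesis using True by (simp add: f_def holomorphic_on_mult)
    qed (simp add: f_def)
  next
    fix t assume t: "t \<in> T"
    then show "f (z + t *s v) \<in> borel_measurable lebesgue" using int[OF sub] by (intro borel_measurable_integrable)
    obtain \<delta> where \<delta>: "0 < \<delta>" "cball t \<delta> \<subseteq> T" using T t by (auto simp: open_contains_cball)
    have "compact ((\<lambda>t. z + t *s v) ` cball t \<delta>)"
    proof (intro compact_continuous_image compact_cball)
      show "continuous_on (cball t \<delta>) (\<lambda>t. z + t *s v)" unfolding plus_smult_eq by (intro continuous_intros)
    qed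
    moreover have "(\<lambda>t. z + t *s v) ` cball t \<delta> \<subseteq> ?B" using sub \<delta> by auto
    ultimately obtain C where C: "\<And>z' w. z' \<in> (\<lambda>t. z + t *s v) ` cball t \<delta> \<Longrightarrow> w \<in> ?B \<Longrightarrow> norm (bergman_kernel z' w) \<le> C"
      using bergman_kernel_bound by blast
    show "\<exists>\<delta>>0. \<exists>g. integrable lebesgue g \<and> cball t \<delta> \<subseteq> T \<and>
        (\<forall>s\<in>cball t \<delta>. \<forall>x\<in>space lebesgue. norm (f (z + s *s v) x) \<le> g x)"
      using \<delta> g[of C] bnd[OF C] by blast
  qed
  ultimately show ?thesis unfolding slice_holomorphic_on_def P by blast
qed

section \<open>Mean value properties and derivative bounds\<close>

lemma circle_mean_value:
  assumes f: "f holomorphic_on T" "open T" "cball 0 1 \<subseteq> T"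
  shows "(LINT \<theta>:{0..1}|lborel. f (exp (2 * of_real pi * \<i> * of_real \<theta>))) = f 0"
proof -
  let ?c = "\<lambda>\<theta>::real. exp (2 * of_real pi * \<i> * of_real \<theta>) :: complex"
  have "((\<lambda>u. f u / (u - 0)) has_contour_integral (2 * of_real pi * \<i> * f 0)) (circlepath 0 1)"
    by (rule Cauchy_integral_circlepath_simple) (use f in \<open>auto intro: holomorphic_on_subset\<close>)
  then have "((\<lambda>x. f (circlepath 0 1 x) / (circlepath 0 1 x - 0) * vector_derivative (circlepath 0 1) (at x within {0..1}))
      has_integral (2 * of_real pi * \<i> * f 0)) {0..1}"
    by (simp only: has_contour_integral_def)
  then have "((\<lambda>x. 2 * of_real pi * \<i> * f (?c x)) has_integral (2 * of_real pi * \<i> * f 0)) {0..1}"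
  proof (rule has_integral_eq[rotated])
    fix x :: real assume "x \<in> {0..1}"
    then have vd: "vector_derivative (circlepath 0 1) (at x within {0..1}) = 2 * of_real pi * \<i> * ?c x"
      using vector_derivative_circlepath01[of x 0 1] by simp
    have cp: "circlepath 0 1 x = ?c x" by (simp add: circlepath)
    show "f (circlepath 0 1 x) / (circlepath 0 1 x - 0) * vector_derivative (circlepath 0 1) (at x within {0..1}) =
        2 * of_real pi * \<i> * f (?c x)"
      unfolding vd cp by simp
  qed
  then have hi: "((\<lambda>x. f (?c x)) has_integral f 0) {0..1}"
    using has_integral_mult_right[of "\<lambda>x. 2 * of_real pi * \<i> * f (?c x)" "2 * of_real pi * \<i> * f 0" "{0..1}" "1 / (2 * of_real pi * \<i>)"]
    by simp
  have "continuous_on {0..1} (\<lambda>x. f (?c x))"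
  proof (rule continuous_on_compose2[OF holomorphic_on_imp_continuous_on[OF f(1)]])
    show "?c ` {0..1} \<subseteq> T" using f(3) by auto
  qed (intro continuous_intros)
  then have "set_integrable lborel {0..1} (\<lambda>x. f (?c x))"
    unfolding set_integrable_def by (intro borel_integrable_compact) auto
  then show ?thesis using hi by (simp add: set_borel_integral_eq_integral integral_unique)
qed

lemma lborel_distr_isometry:
  fixes U :: "'a::euclidean_space \<Rightarrow> 'a"
  assumes U: "linear U" "\<And>x. norm (U x) = norm x"
  shows "U \<in> borel_measurable borel" "distr lborel borel U = lborel"
proof -
  show m: "U \<in> borel_measurable borel"
    using U(1) by (intro borel_measurable_continuous_onI linear_continuous_on linear_conv_bounded_linear[THEN iffD1])
  show "distr lborel borel U = lborel"
  proof (rule measure_eqI)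
    fix A assume "A \<in> sets (distr lborel borel U)"
    then show "emeasure (distr lborel borel U) A = emeasure lborel A"
      using m emeasure_isometry_vimage[OF U, of A] by (simp add: emeasure_distr)
  qed simp
qed

lemma linear_smult: "linear (\<lambda>u :: complex ^ 'n. c *s u)"
  by (rule linearI) (simp_all add: vec_eq_iff algebra_simps)

text \<open>The rotations \<open>u \<mapsto> c \<theta> *s u\<close> preserve the integral over the
  ball. Averaging over \<open>\<theta>\<close> and exchanging the integrals leaves for each
  \<open>u\<close> a circle mean of the slice \<open>t \<mapsto> f (a + t *s u)\<close>, which is
  \<open>f a\<close> by one-variable theory.\<close>

lemma ball_mean_value:
  fixes f :: "complex ^ 'n \<Rightarrow> complex"
  assumes f: "slice_holomorphic_on f S" and S: "open S" "cball a \<delta> \<subseteq> S" and \<delta>: "0 < \<delta>"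
  shows "(LINT u:cball 0 \<delta>|lborel. f (a + u)) = of_real (measure lborel (cball (0 :: complex ^ 'n) \<delta>)) * f a"
proof -
  define c where "c \<theta> = exp (2 * of_real pi * \<i> * of_real \<theta>)" for \<theta> :: real
  have nc: "norm (c \<theta>) = 1" for \<theta> by (simp add: c_def)
  let ?i = "indicator (cball (0 :: complex ^ 'n) \<delta>) :: complex ^ 'n \<Rightarrow> real"
  let ?j = "indicator {0..1} :: real \<Rightarrow> real"
  have contf: "continuous_on S f" using f by (simp add: slice_holomorphic_on_def)
  have inS: "a + c \<theta> *s u \<in> S" if "u \<in> cball 0 \<delta>" for \<theta> u
    using that S(2) by (intro subsetD[OF S(2)]) (simp add: dist_norm norm_smult nc)
  define H where "H \<theta> u = ?j \<theta> *\<^sub>R (?i u *\<^sub>R f (a + c \<theta> *s u))" for \<theta> u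
  have H: "integrable (lborel \<Otimes>\<^sub>M lborel) (case_prod H)"
  proof -
    have "continuous_on ({0..1} \<times> cball 0 \<delta>) (\<lambda>p. f (a + c (fst p) *s snd p))"
    proof (rule continuous_on_compose2[OF contf])
      show "continuous_on ({0..1} \<times> cball 0 \<delta>) (\<lambda>p. a + c (fst p) *s snd p)"
        unfolding plus_smult_eq c_def by (intro continuous_intros)
      show "(\<lambda>p. a + c (fst p) *s snd p) ` ({0..1} \<times> cball 0 \<delta>) \<subseteq> S" using inS by auto
    qed
    then have "integrable lborel (\<lambda>p. indicator ({0..1} \<times> cball 0 \<delta>) p *\<^sub>R f (a + c (fst p) *s snd p))"
      by (intro borel_integrable_compact compact_Times) auto
    moreover have "(\<lambda>p. indicator ({0..1} \<times> cball 0 \<delta>) p *\<^sub>R f (a + c (fst p) *s snd p)) = case_prod H"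
      by (auto simp: H_def indicator_def)
    ultimately show ?thesis by (simp add: lborel_prod)
  qed
  have rot: "(\<integral>u. ?i u *\<^sub>R f (a + c \<theta> *s u) \<partial>lborel) = (\<integral>u. ?i u *\<^sub>R f (a + u) \<partial>lborel)" for \<theta>
  proof -
    have iso: "norm (c \<theta> *s u) = norm u" for u :: "complex ^ 'n" by (simp add: norm_smult nc)
    note U = lborel_distr_isometry[OF linear_smult[of "c \<theta>"] iso]
    have fm: "(\<lambda>u. ?i u *\<^sub>R f (a + u)) \<in> borel_measurable borel"
    proof (intro borel_measurable_continuous_on_indicator continuous_on_compose2[OF contf] continuous_intros)
      show "(+) a ` cball 0 \<delta> \<subseteq> S" using S(2) by auto
    qed auto
    have "(\<integral>u. ?i u *\<^sub>R f (a + u) \<partial>lborel) = (\<integral>u. ?i u *\<^sub>R f (a + u) \<partial>distr lborel borel (\<lambda>u. c \<theta> *s u))"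
      unfolding U(2) ..
    also have "\<dots> = (\<integral>u. ?i (c \<theta> *s u) *\<^sub>R f (a + c \<theta> *s u) \<partial>lborel)"
      using U(1) fm by (intro integral_distr) auto
    finally show ?thesis using iso by (simp add: indicator_def)
  qed
  have circ: "(\<integral>\<theta>. H \<theta> u \<partial>lborel) = ?i u *\<^sub>R f a" for u
  proof (cases "u \<in> cball 0 \<delta>")
    case True
    define T where "T = (\<lambda>t. a + t *s u) -` S"
    have "continuous_on UNIV (\<lambda>t. a + t *s u)" unfolding plus_smult_eq by (intro continuous_intros)
    then have T: "open T" unfolding T_def using S(1) by (intro open_vimage)
    have "cball 0 1 \<subseteq> T"
    proof
      fix t :: complex assume "t \<in> cball 0 1"
      then have "norm t * norm u \<le> 1 * \<delta>" using True by (intro mult_mono) auto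
      then show "t \<in> T" unfolding T_def using S(2) by (intro vimageI2 subsetD[OF S(2)]) (simp add: dist_norm norm_smult)
    qed
    moreover have "(\<lambda>t. f (a + t *s u)) holomorphic_on T"
      by (rule slice_holomorphic_onD[OF f T]) (simp add: T_def)
    ultimately have "(LINT \<theta>:{0..1}|lborel. f (a + c \<theta> *s u)) = f (a + 0 *s u)"
      unfolding c_def using T by (intro circle_mean_value[where f = "\<lambda>t. f (a + t *s u)"])
    then show ?thesis using True by (simp add: H_def set_lebesgue_integral_def)
  qed (simp add: H_def)
  have "(\<integral>\<theta>. (\<integral>u. H \<theta> u \<partial>lborel) \<partial>lborel) = (\<integral>\<theta>. ?j \<theta> *\<^sub>R (\<integral>u. ?i u *\<^sub>R f (a + u) \<partial>lborel) \<partial>lborel)"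
    unfolding H_def integral_scaleR_right rot ..
  also have "\<dots> = (\<integral>\<theta>. ?j \<theta> \<partial>lborel) *\<^sub>R (\<integral>u. ?i u *\<^sub>R f (a + u) \<partial>lborel)"
    by (intro integral_scaleR_left) simp
  also have "\<dots> = (\<integral>u. ?i u *\<^sub>R f (a + u) \<partial>lborel)" by simp
  finally have "(\<integral>u. ?i u *\<^sub>R f (a + u) \<partial>lborel) = (\<integral>\<theta>. (\<integral>u. H \<theta> u \<partial>lborel) \<partial>lborel)" ..
  also have "\<dots> = (\<integral>u. (\<integral>\<theta>. H \<theta> u \<partial>lborel) \<partial>lborel)"
    by (rule lborel_pair.Fubini_integral[symmetric]) (use H in \<open>simp add: case_prod_unfold\<close>)
  also have "\<dots> = (\<integral>u. ?i u *\<^sub>R f a \<partial>lborel)" by (simp only: circ)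
  also have "\<dots> = measure lborel (cball (0 :: complex ^ 'n) \<delta>) *\<^sub>R f a"
  proof -
    have "integrable lborel ?i"
      using emeasure_lborel_cball_finite[of "0 :: complex ^ 'n" \<delta>] by (intro integrable_real_indicator) auto
    then show ?thesis by (subst integral_scaleR_left) auto
  qed
  finally show ?thesis by (simp add: set_lebesgue_integral_def scaleR_conv_of_real)
qed

text \<open>Conjugation commutes with integration, so the conjugate of \<open>\<beta>\<close> has
  the mean value property too, and with it the difference.\<close>

lemma norm_diff_mean_value_le:
  fixes \<beta> q :: "complex ^ 'n \<Rightarrow> complex"
  assumes \<beta>: "slice_holomorphic_on \<beta> S" and q: "slice_holomorphic_on q S"
    and S: "open S" "cball a \<delta> \<subseteq> S" and \<delta>: "0 < \<delta>"
  shows "ennreal (measure lborel (cball (0 :: complex ^ 'n) \<delta>) * norm (cnj (\<beta> a) - q a)) \<le>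
    (\<integral>\<^sup>+u. ennreal (norm (cnj (\<beta> (a + u)) - q (a + u))) * indicator (cball 0 \<delta>) u \<partial>lborel)"
proof -
  let ?C = "cball (0 :: complex ^ 'n) \<delta>"
  have trans: "(+) a ` ?C \<subseteq> S" using S(2) by auto
  have int: "set_integrable lborel ?C (\<lambda>u. f (a + u))" if "slice_holomorphic_on f S" for f
  proof -
    have "continuous_on S f" using that by (simp add: slice_holomorphic_on_def)
    then have "continuous_on ?C (\<lambda>u. f (a + u))"
      by (rule continuous_on_compose2[OF _ _ trans]) (intro continuous_intros)
    then show ?thesis unfolding set_integrable_def by (intro borel_integrable_compact) auto
  qed
  have i1: "set_integrable lborel ?C (\<lambda>u. cnj (\<beta> (a + u)))" by (rule set_integrable_cnj[OF int[OF \<beta>]])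
  have "(LINT u:?C|lborel. cnj (\<beta> (a + u))) = cnj (LINT u:?C|lborel. \<beta> (a + u))"
    using integral_bounded_linear[OF bounded_linear_cnj int[OF \<beta>, unfolded set_integrable_def]]
    by (simp add: set_lebesgue_integral_def)
  then have "(LINT u:?C|lborel. cnj (\<beta> (a + u)) - q (a + u)) = of_real (measure lborel ?C) * (cnj (\<beta> a) - q a)"
    using set_integral_diff(2)[OF i1 int[OF q]] ball_mean_value[OF \<beta> S \<delta>] ball_mean_value[OF q S \<delta>]
    by (simp add: right_diff_distrib)
  then have "measure lborel ?C * norm (cnj (\<beta> a) - q a) = norm (LINT u:?C|lborel. cnj (\<beta> (a + u)) - q (a + u))"
    by (simp add: norm_mult)
  then have "ennreal (measure lborel ?C * norm (cnj (\<beta> a) - q a)) =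
      ennreal (norm (\<integral>u. indicator ?C u *\<^sub>R (cnj (\<beta> (a + u)) - q (a + u)) \<partial>lborel))"
    by (simp add: set_lebesgue_integral_def)
  also have "\<dots> \<le> (\<integral>\<^sup>+u. norm (indicator ?C u *\<^sub>R (cnj (\<beta> (a + u)) - q (a + u))) \<partial>lborel)"
    using set_integral_diff(1)[OF i1 int[OF q]] unfolding set_integrable_def by (rule integral_norm_bound_ennreal)
  also have "\<dots> = (\<integral>\<^sup>+u. ennreal (norm (cnj (\<beta> (a + u)) - q (a + u))) * indicator ?C u \<partial>lborel)"
    by (intro nn_integral_cong) (auto simp: indicator_def)
  finally show ?thesis .
qed

text \<open>The maximum of \<open>(3/4 - |\<zeta>|)\<^sup>2\<^sup>n |v \<zeta>|\<close> controls \<open>v\<close> on a ball around the maximum point by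
  a multiple of its value \<open>m\<close> there; splitting the mean value at the level \<open>m / 2\<close>, the weak-type
  hypothesis bounds \<open>m\<close>.\<close>

lemma bounded_of_weak_type:
  fixes \<beta> q :: "complex ^ 'n \<Rightarrow> complex"
  assumes \<beta>: "slice_holomorphic_on \<beta> (ball 0 1)" and q: "slice_holomorphic_on q (ball 0 1)"
    and l0: "0 < l0" and K: "0 \<le> K"
    and weak: "\<And>l. l0 \<le> l \<Longrightarrow> measure lborel {\<zeta> \<in> ball 0 1. norm (cnj (\<beta> \<zeta>) - q \<zeta>) > l} \<le> K / l"
    and \<zeta>: "norm \<zeta> \<le> 1/2"
  shows "norm (cnj (\<beta> \<zeta>) - q \<zeta>) \<le>
    16 ^ CARD('n) * (2 * l0 + 4 * 16 ^ CARD('n) * K / measure lborel (ball (0 :: complex ^ 'n) 1))"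
proof -
  define n where "n = CARD('n)"
  define VV where "VV = measure lborel (ball (0 :: complex ^ 'n) 1)"
  have VV: "0 < VV" unfolding VV_def by (rule content_ball_pos) simp
  define v where "v \<zeta> = cnj (\<beta> \<zeta>) - q \<zeta>" for \<zeta>
  have contv: "continuous_on (ball 0 1) v"
    using \<beta> q unfolding v_def slice_holomorphic_on_def by (intro continuous_intros) auto
  \<comment> \<open>The exponent is the real dimension: the weight scales like the volume of the
    balls around \<open>\<zeta>\<close> used below, so the estimate does not degenerate at the
    sphere of radius \<open>3/4\<close>.\<close>
  define \<phi> where "\<phi> \<zeta> = (3 / 4 - norm \<zeta>) ^ (2 * n) * norm (v \<zeta>)" for \<zeta>
  have "continuous_on (cball 0 (3/4)) \<phi>"
    unfolding \<phi>_def by (intro continuous_intros continuous_on_subset[OF contv]) auto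
  then obtain a where a: "a \<in> cball 0 (3/4)" and mx: "\<And>\<zeta>. \<zeta> \<in> cball 0 (3/4) \<Longrightarrow> \<phi> \<zeta> \<le> \<phi> a"
    using continuous_attains_sup[of "cball 0 (3/4)" \<phi>] by auto
  define m where "m = norm (v a)"
  define B where "B = 2 * l0 + 4 * 16 ^ n * K / VV"
  have B: "2 * l0 \<le> B" "4 * 16 ^ n * K / VV \<le> B" "0 \<le> B" using l0 K VV by (auto simp: B_def)
  have \<phi>a: "\<phi> a \<le> B"
  proof (cases "norm a = 3/4")
    case True
    then have "\<phi> a = 0" by (simp add: \<phi>_def n_def)
    then show ?thesis using B by simp
  next
    case False
    then have na: "norm a < 3/4" using a by simp
    define \<delta> where "\<delta> = (3/4 - norm a) / 2"
    have \<delta>: "0 < \<delta>" "2 * \<delta> = 3/4 - norm a" using na by (auto simp: \<delta>_def)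
    have \<delta>1: "2 * \<delta> \<le> 1" using \<delta>(2) norm_ge_zero[of a] by linarith
    show ?thesis
    \<comment> \<open>The weak-type hypothesis will be used at the level \<open>m / 2\<close>, which
      must be at least \<open>l0\<close>. For smaller \<open>m\<close> the weight, being at most 1,
      settles the claim.\<close>
    proof (cases "m \<le> 2 * l0")
      case True
      have "(2 * \<delta>) ^ (2 * n) \<le> 1" using \<delta>(1) \<delta>1 by (intro power_le_one) auto
      then have "(2 * \<delta>) ^ (2 * n) * m \<le> 1 * m" unfolding m_def by (intro mult_right_mono) auto
      then show ?thesis using True B unfolding \<phi>_def m_def[symmetric] \<delta>(2)[symmetric] by linarith
    next
      case False
      then have m: "2 * l0 < m" "0 < m" using l0 by auto
      have sub: "cball a \<delta> \<subseteq> ball 0 1"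
      proof
        fix x assume "x \<in> cball a \<delta>"
        then have "norm (x - a) \<le> \<delta>" by (simp add: dist_norm norm_minus_commute)
        then have "norm x \<le> norm a + \<delta>" using norm_triangle_ineq[of a "x - a"] by simp
        then show "x \<in> ball 0 1" using \<delta> na by simp
      qed
      define W where "W = {\<zeta> \<in> ball 0 1. norm (v \<zeta>) > m / 2}"
      have Wo: "open W"
      proof -
        have "continuous_on (ball 0 1) (\<lambda>\<zeta>. norm (v \<zeta>))" using contv by (rule continuous_on_norm)
        then have "open (ball 0 1 \<inter> (\<lambda>\<zeta>. norm (v \<zeta>)) -` {m / 2 <..})"
          by (rule continuous_open_preimage) auto
        moreover have "W = ball 0 1 \<inter> (\<lambda>\<zeta>. norm (v \<zeta>)) -` {m / 2 <..}" by (auto simp: W_def)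
        ultimately show ?thesis by simp
      qed
      then have Wb: "W \<in> sets borel" by simp
      have "emeasure lborel W \<le> emeasure lborel (ball (0 :: complex ^ 'n) 1)" unfolding W_def by (intro emeasure_mono) auto
      also have "\<dots> < \<infinity>" by (rule emeasure_lborel_ball_finite)
      finally have Wf: "emeasure lborel W = ennreal (measure lborel W)" by (intro emeasure_eq_ennreal_measure) auto
      have Wm: "measure lborel W \<le> K / (m / 2)" unfolding W_def v_def using m by (intro weak) auto
      \<comment> \<open>On \<open>cball a \<delta>\<close> the distance to the sphere is at least
        \<open>\<delta>\<close>, half its value at \<open>a\<close>; maximality of
        \<open>\<phi>\<close> at \<open>a\<close> turns this into the factor
        \<open>2 ^ (2 * n) = 4 ^ n\<close>.\<close>
      have pw: "norm (v (a + u)) \<le> 4 ^ n * m" if u: "u \<in> cball 0 \<delta>" for u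
      proof -
        have nu: "norm (a + u) \<le> norm a + \<delta>" using norm_triangle_ineq[of a u] u by simp
        then have "a + u \<in> cball 0 (3/4)" using \<delta> by simp
        from mx[OF this] have le: "(3/4 - norm (a + u)) ^ (2 * n) * norm (v (a + u)) \<le> (2 * \<delta>) ^ (2 * n) * m"
          unfolding \<phi>_def m_def \<delta>(2) .
        have "\<delta> ^ (2 * n) \<le> (3/4 - norm (a + u)) ^ (2 * n)" using nu \<delta> by (intro power_mono) auto
        then have "\<delta> ^ (2 * n) * norm (v (a + u)) \<le> (3/4 - norm (a + u)) ^ (2 * n) * norm (v (a + u))"
          by (intro mult_right_mono) auto
        also note le
        also have "(2 * \<delta>) ^ (2 * n) * m = \<delta> ^ (2 * n) * (4 ^ n * m)" by (simp add: power_mult_distrib power_mult)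
        finally show ?thesis using \<delta> by simp
      qed
      define vol where "vol = measure lborel (cball (0 :: complex ^ 'n) \<delta>)"
      have vol: "vol = \<delta> ^ (2 * n) * VV"
        unfolding vol_def VV_def using \<delta> by (simp add: content_cball content_ball n_def mult.commute)
      have vol0: "0 \<le> vol" by (simp add: vol_def)
      have volf: "emeasure lborel (cball (0 :: complex ^ 'n) \<delta>) = ennreal vol"
        unfolding vol_def using emeasure_lborel_cball_finite[of "0 :: complex ^ 'n" \<delta>] by (intro emeasure_eq_ennreal_measure) auto
      have "ennreal (vol * m) \<le> (\<integral>\<^sup>+u. ennreal (norm (v (a + u))) * indicator (cball 0 \<delta>) u \<partial>lborel)"
        unfolding vol_def m_def v_def using \<delta> sub by (intro norm_diff_mean_value_le[OF \<beta> q]) auto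
      also have "\<dots> \<le> (\<integral>\<^sup>+u. ennreal (m / 2) * indicator (cball 0 \<delta>) u + ennreal (4 ^ n * m) * indicator W (a + u) \<partial>lborel)"
      proof (intro nn_integral_mono)
        fix u :: "complex ^ 'n"
        show "ennreal (norm (v (a + u))) * indicator (cball 0 \<delta>) u \<le>
          ennreal (m / 2) * indicator (cball 0 \<delta>) u + ennreal (4 ^ n * m) * indicator W (a + u)"
        proof (cases "u \<in> cball 0 \<delta>")
          case True
          show ?thesis
          proof (cases "a + u \<in> W")
            case aW: True
            have "ennreal (norm (v (a + u))) \<le> ennreal (4 ^ n * m)" by (intro ennreal_leI pw True)
            then show ?thesis using True aW by (simp add: add_increasing)
          next
            case nW: False
            have "a + u \<in> ball 0 1" using sub True by (intro subsetD[OF sub]) (simp add: dist_norm)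
            then have "norm (v (a + u)) \<le> m / 2" using nW by (simp add: W_def)
            then show ?thesis using True nW by (simp add: ennreal_leI)
          qed
        qed simp
      qed
      also have "\<dots> = (\<integral>\<^sup>+u. ennreal (m / 2) * indicator (cball (0 :: complex ^ 'n) \<delta>) u \<partial>lborel) + (\<integral>\<^sup>+u. ennreal (4 ^ n * m) * indicator W (a + u) \<partial>lborel)"
      proof (rule nn_integral_add)
        have [measurable]: "cball (0 :: complex ^ 'n) \<delta> \<in> sets borel" by simp
        note Wb [measurable]
        show "(\<lambda>u. ennreal (m / 2) * indicator (cball (0 :: complex ^ 'n) \<delta>) u) \<in> borel_measurable lborel" by measurable
        show "(\<lambda>u. ennreal (4 ^ n * m) * indicator W (a + u)) \<in> borel_measurable lborel" by measurable
      qed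
      also have "(\<integral>\<^sup>+u. ennreal (m / 2) * indicator (cball (0 :: complex ^ 'n) \<delta>) u \<partial>lborel) = ennreal (m / 2) * ennreal vol"
        unfolding volf[symmetric] by (intro nn_integral_cmult_indicator) simp
      also have "(\<integral>\<^sup>+u. ennreal (4 ^ n * m) * indicator W (a + u) \<partial>lborel) = ennreal (4 ^ n * m) * ennreal (measure lborel W)"
      proof -
        have "(\<integral>\<^sup>+u. ennreal (4 ^ n * m) * indicator W (a + u) \<partial>lborel) = (\<integral>\<^sup>+u. ennreal (4 ^ n * m) * indicator W u \<partial>lborel)"
        proof (rule nn_integral_lborel_translate[where f = "\<lambda>u. ennreal (4 ^ n * m) * indicator W u"])
          note Wb [measurable]
          show "(\<lambda>u. ennreal (4 ^ n * m) * indicator W u) \<in> borel_measurable borel" by measurable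
        qed
        also have "\<dots> = ennreal (4 ^ n * m) * emeasure lborel W" using Wb by (intro nn_integral_cmult_indicator) simp
        finally show ?thesis by (simp add: Wf)
      qed
      also have "ennreal (m / 2) * ennreal vol + ennreal (4 ^ n * m) * ennreal (measure lborel W) =
          ennreal (m / 2 * vol + 4 ^ n * m * measure lborel W)"
        using m vol0 by (simp only: ennreal_mult'[symmetric] ennreal_plus[symmetric] measure_nonneg mult_nonneg_nonneg
            zero_le_power zero_le_numeral less_imp_le half_gt_zero)
      finally have "vol * m \<le> m / 2 * vol + 4 ^ n * m * measure lborel W"
        using m vol0 by (subst (asm) ennreal_le_iff) auto
      \<comment> \<open>The decisive cancellation: the pointwise bound contributes a factor
        \<open>m\<close>, the weak type at level \<open>m / 2\<close> a factor \<open>2 / m\<close>.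
        The other term \<open>m / 2 * vol\<close> is absorbed by the left side.\<close>
      moreover have "4 ^ n * m * measure lborel W \<le> 4 ^ n * m * (K / (m / 2))"
        using Wm m by (intro mult_left_mono) auto
      moreover have "4 ^ n * m * (K / (m / 2)) = 2 * (4 ^ n * K)" using m by simp
      moreover have "m / 2 * vol = vol * m / 2" by simp
      ultimately have "vol * m \<le> 4 * (4 ^ n * K)" by linarith
      then have "\<delta> ^ (2 * n) * m * VV \<le> 4 * (4 ^ n * K)" by (simp add: vol mult_ac)
      then have "\<delta> ^ (2 * n) * m \<le> 4 * (4 ^ n * K) / VV" using VV by (simp add: pos_le_divide_eq)
      then have "4 ^ n * (\<delta> ^ (2 * n) * m) \<le> 4 ^ n * (4 * (4 ^ n * K) / VV)" by (intro mult_left_mono) auto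
      also have "4 ^ n * (4 * (4 ^ n * K) / VV) = 4 * 16 ^ n * K / VV"
      proof -
        have "(16::real) ^ n = 4 ^ n * 4 ^ n" by (simp flip: power_mult_distrib)
        then show ?thesis by simp
      qed
      finally have "(2 * \<delta>) ^ (2 * n) * m \<le> B" using B(2) by (simp add: power_mult_distrib power_mult mult.assoc)
      then show ?thesis unfolding \<phi>_def m_def \<delta>(2) .
    qed
  qed
  have "(1/4) ^ (2 * n) \<le> (3/4 - norm \<zeta>) ^ (2 * n)" using \<zeta> by (intro power_mono) auto
  then have "(1/4) ^ (2 * n) * norm (v \<zeta>) \<le> \<phi> \<zeta>" unfolding \<phi>_def by (intro mult_right_mono) auto
  also have "\<phi> \<zeta> \<le> B" using mx[of \<zeta>] \<phi>a \<zeta> by simp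
  finally have "(1/4) ^ (2 * n) * norm (v \<zeta>) \<le> B" .
  moreover have "(1/4 :: real) ^ (2 * n) = 1 / 16 ^ n" unfolding power_mult by (simp add: power2_eq_square power_one_over)
  ultimately have "norm (v \<zeta>) \<le> 16 ^ n * B" by (simp add: pos_divide_le_eq mult.commute)
  then show ?thesis by (simp add: v_def B_def n_def VV_def)
qed

text \<open>\<open>exp f\<close> and its reciprocal are bounded by \<open>exp M\<close>. Cauchy's
  inequality on the circle of radius \<open>1/4\<close> bounds \<open>exp (f 0) * deriv f 0\<close>,
  and removing \<open>exp (f 0)\<close> costs the second factor \<open>exp M\<close>.\<close>

lemma norm_deriv_le_of_Re_bounded:
  assumes f: "f holomorphic_on ball 0 (1/2)" and bnd: "\<And>t. norm t < 1/2 \<Longrightarrow> \<bar>Re (f t)\<bar> \<le> M"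
  shows "norm (deriv f 0) \<le> 4 * exp (2 * M)"
proof -
  define g where "g t = exp (f t)" for t
  have hg: "g holomorphic_on ball 0 (1/2)" unfolding g_def using f by (intro holomorphic_intros)
  have "norm ((deriv ^^ 1) g 0) \<le> fact 1 * exp M / (1/4) ^ 1"
  proof (rule Cauchy_inequality)
    show "g holomorphic_on ball 0 (1/4)" using hg by (rule holomorphic_on_subset) auto
    show "continuous_on (cball 0 (1/4)) g"
      using holomorphic_on_imp_continuous_on[OF hg] by (rule continuous_on_subset) auto
    fix x :: complex assume "norm (0 - x) = 1/4"
    then have "\<bar>Re (f x)\<bar> \<le> M" by (intro bnd) simp
    then show "norm (g x) \<le> exp M" by (simp add: g_def)
  qed simp
  then have "norm (deriv g 0) \<le> 4 * exp M" by simp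
  moreover have "(g has_field_derivative exp (f 0) * deriv f 0) (at 0)"
  proof -
    have "(f has_field_derivative deriv f 0) (at 0)" using f by (intro holomorphic_derivI[where S = "ball 0 (1/2)"]) auto
    then show ?thesis unfolding g_def by (rule DERIV_fun_exp)
  qed
  then have "deriv g 0 = exp (f 0) * deriv f 0" by (rule DERIV_imp_deriv)
  moreover have "exp (- M) \<le> norm (exp (f 0))" using bnd[of 0] by simp
  then have "exp (- M) * norm (deriv f 0) \<le> norm (exp (f 0)) * norm (deriv f 0)" by (intro mult_right_mono) auto
  ultimately have "exp (- M) * norm (deriv f 0) \<le> 4 * exp M" by (simp only: norm_mult)
  then have "exp M * (exp (- M) * norm (deriv f 0)) \<le> exp M * (4 * exp M)" by (intro mult_left_mono) auto
  moreover have "exp M * (exp (- M) * norm (deriv f 0)) = norm (deriv f 0)" unfolding mult.assoc[symmetric] exp_add[symmetric] by simp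
  moreover have "exp M * (4 * exp M) = 4 * exp (2 * M)" by (simp only: mult_2 exp_add mult.left_commute[of "exp M" 4])
  ultimately show ?thesis by simp
qed

text \<open>\<open>cnj f - q\<close> has real part \<open>Re (f - q)\<close> and imaginary part
  \<open>Re (\<i> * (f + q))\<close>. The derivatives of \<open>f - q\<close> and
  \<open>f + q\<close> add up to twice that of \<open>f\<close>, which eliminates
  \<open>q\<close>.\<close>

lemma norm_deriv_le_of_cnj_diff_bounded:
  assumes f: "f holomorphic_on ball 0 (1/2)" and q: "q holomorphic_on ball 0 (1/2)"
    and bnd: "\<And>t. norm t < 1/2 \<Longrightarrow> norm (cnj (f t) - q t) \<le> M"
  shows "norm (deriv f 0) \<le> 4 * exp (2 * M)"
proof -
  have fd: "(f has_field_derivative deriv f 0) (at 0)" "(q has_field_derivative deriv q 0) (at 0)"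
    using f q by (auto intro!: holomorphic_derivI[where S = "ball 0 (1/2)"])
  have 1: "norm (deriv (\<lambda>t. f t - q t) 0) \<le> 4 * exp (2 * M)"
  proof (rule norm_deriv_le_of_Re_bounded)
    fix t :: complex assume "norm t < 1/2"
    from order_trans[OF abs_Re_le_cmod bnd[OF this]] show "\<bar>Re (f t - q t)\<bar> \<le> M" by simp
  qed (intro holomorphic_intros f q)
  have 2: "norm (deriv (\<lambda>t. \<i> * (f t + q t)) 0) \<le> 4 * exp (2 * M)"
  proof (rule norm_deriv_le_of_Re_bounded)
    fix t :: complex assume "norm t < 1/2"
    from order_trans[OF abs_Im_le_cmod bnd[OF this]] show "\<bar>Re (\<i> * (f t + q t))\<bar> \<le> M" by (simp add: abs_minus_commute)
  qed (intro holomorphic_intros f q)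
  have d1: "deriv (\<lambda>t. f t - q t) 0 = deriv f 0 - deriv q 0"
    by (rule DERIV_imp_deriv[OF DERIV_diff[OF fd]])
  have d2: "deriv (\<lambda>t. \<i> * (f t + q t)) 0 = \<i> * (deriv f 0 + deriv q 0)"
    by (rule DERIV_imp_deriv[OF DERIV_cmult[OF DERIV_add[OF fd]]])
  have "2 * norm (deriv f 0) = norm ((deriv f 0 - deriv q 0) + (deriv f 0 + deriv q 0))" by (simp add: norm_mult)
  also have "\<dots> \<le> norm (deriv f 0 - deriv q 0) + norm (deriv f 0 + deriv q 0)" by (rule norm_triangle_ineq)
  also have "norm (deriv f 0 + deriv q 0) = norm (\<i> * (deriv f 0 + deriv q 0))" by (simp add: norm_mult)
  finally show ?thesis using 1 2 unfolding d1 d2 by linarith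
qed

section \<open>Weak-type bounds on small sets\<close>

text \<open>Fixes how close to constant the kernel has to be. The 3 anticipates the three error
  terms of \<open>norm_one_minus_cinner_ellipsoid_le\<close>, and \<open>c \<le> 1 / 2\<close> keeps
  the ellipsoids in the ball.\<close>

lemma Re_inverse_power_near_one:
  "\<exists>c>0. c \<le> 1 / 2 \<and> (\<forall>\<tau>. norm \<tau> \<le> 3 * c \<longrightarrow> 1 / 2 \<le> Re (1 / (1 + \<tau>) ^ N))"
proof -
  have "isCont (\<lambda>\<tau>. Re (1 / (1 + \<tau>) ^ N)) 0" unfolding isCont_def by (intro tendsto_intros) auto
  then obtain \<delta> where \<delta>: "0 < \<delta>" and near: "\<And>\<tau>. dist \<tau> 0 < \<delta> \<Longrightarrow> dist (Re (1 / (1 + \<tau>) ^ N)) (Re (1 / (1 + 0) ^ N)) < 1 / 2"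
    unfolding continuous_at_eps_delta using half_gt_zero[OF zero_less_one] by blast
  have "1 / 2 \<le> Re (1 / (1 + \<tau>) ^ N)" if "norm \<tau> \<le> 3 * min (1 / 2) (\<delta> / 6)" for \<tau>
  proof -
    have "dist \<tau> 0 < \<delta>" using that \<delta> unfolding dist_norm by simp
    from near[OF this] have "\<bar>Re (1 / (1 + \<tau>) ^ N) - 1\<bar> < 1 / 2" by (simp add: dist_real_def)
    then show ?thesis by linarith
  qed
  then show ?thesis using \<delta> by (intro exI[of _ "min (1 / 2) (\<delta> / 6)"]) auto
qed

section \<open>Ellipsoids of parabolic shape\<close>

lemma cinner_perp:
  assumes "norm e = 1"
  shows "cinner (z - cinner z e *s e) (u - cinner u e *s e) = cinner z u - cinner z e * cnj (cinner u e)"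
  using cinner_unit[OF assms] cnj_cinner[of u e]
  by (simp add: cinner_diff_left cinner_diff_right cinner_smult_left cinner_smult_right)

context
  fixes e :: "complex ^ 'n" and \<epsilon> c :: real
  assumes e: "norm e = 1" and \<epsilon>: "0 < \<epsilon>" "\<epsilon> \<le> 1" and c: "0 < c" "c \<le> 1 / 2"
begin

text \<open>With \<open>c \<le> 1 / 2\<close> the radial component is at most
  \<open>1 - \<epsilon> / 2\<close>, with square at most \<open>1 - 3 / 4 * \<epsilon>\<close>, and
  the tangential one has square at most \<open>\<epsilon> / 4\<close>.\<close>

lemma norm_ellipsoid_point_le:
  assumes \<zeta>: "norm \<zeta> < 1"
  shows "(norm ((1 - \<epsilon>) *\<^sub>R e + stretch e (c * \<epsilon>) (c * sqrt \<epsilon>) \<zeta>))\<^sup>2 \<le> 1 - \<epsilon> / 2"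
proof -
  let ?w = "(1 - \<epsilon>) *\<^sub>R e + stretch e (c * \<epsilon>) (c * sqrt \<epsilon>) \<zeta>"
  have \<zeta>1: "norm (cinner \<zeta> e) \<le> 1" using norm_cinner_le[of \<zeta> e] e \<zeta> by simp
  have w1: "cinner ?w e = of_real (1 - \<epsilon>) + of_real (c * \<epsilon>) * cinner \<zeta> e"
    using e by (simp add: cinner_add_left cinner_scaleR_left cinner_stretch cinner_unit)
  have perp: "?w - cinner ?w e *s e = (c * sqrt \<epsilon>) *\<^sub>R (\<zeta> - cinner \<zeta> e *s e)"
    unfolding w1 by (simp add: stretch_def vec_eq_iff algebra_simps scaleR_conv_of_real[where 'a=complex])
  have "norm (cinner ?w e) \<le> (1 - \<epsilon>) + (c * \<epsilon>) * 1"
    unfolding w1 using \<epsilon> c \<zeta>1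
    by (intro norm_triangle_le add_mono) (simp_all only: norm_mult norm_of_real abs_of_nonneg mult_left_mono mult_nonneg_nonneg less_imp_le diff_ge_0_iff_ge order_refl)
  moreover have "c * \<epsilon> \<le> 1 / 2 * \<epsilon>" using c \<epsilon> by (intro mult_right_mono) auto
  ultimately have "norm (cinner ?w e) \<le> 1 - \<epsilon> / 2" by linarith
  then have "(norm (cinner ?w e))\<^sup>2 \<le> (1 - \<epsilon> / 2)\<^sup>2" by (intro power_mono) auto
  moreover have "(1 - \<epsilon> / 2)\<^sup>2 \<le> 1 - 3 / 4 * \<epsilon>"
  proof -
    have "\<epsilon> * \<epsilon> \<le> 1 * \<epsilon>" using \<epsilon> by (intro mult_right_mono) auto
    then show ?thesis by (simp add: power2_eq_square algebra_simps)
  qed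
  moreover have "(norm (?w - cinner ?w e *s e))\<^sup>2 \<le> \<epsilon> / 4"
  proof -
    have "(norm (?w - cinner ?w e *s e))\<^sup>2 = (c\<^sup>2 * \<epsilon>) * (norm (\<zeta> - cinner \<zeta> e *s e))\<^sup>2"
      unfolding perp using \<epsilon> by (simp add: power_mult_distrib)
    also have "\<dots> \<le> ((1 / 2)\<^sup>2 * \<epsilon>) * 1"
    proof (intro mult_mono)
      show "c\<^sup>2 \<le> (1 / 2)\<^sup>2" using c by (intro power_mono) auto
      have "(norm \<zeta>)\<^sup>2 \<le> 1" using \<zeta> by (intro power_le_one) auto
      then show "(norm (\<zeta> - cinner \<zeta> e *s e))\<^sup>2 \<le> 1" unfolding norm_perp[OF e] by (simp add: add.commute add_increasing2 diff_le_eq)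
    qed (use \<epsilon> in auto)
    finally show ?thesis by (simp add: power2_eq_square)
  qed
  moreover have "(norm ?w)\<^sup>2 = (norm (cinner ?w e))\<^sup>2 + (norm (?w - cinner ?w e *s e))\<^sup>2"
    unfolding norm_perp[OF e] by simp
  ultimately show ?thesis by linarith
qed

lemma norm_ellipsoid_point_less:
  assumes \<zeta>: "norm \<zeta> < 1"
  shows "norm ((1 - \<epsilon>) *\<^sub>R e + stretch e (c * \<epsilon>) (c * sqrt \<epsilon>) \<zeta>) < 1" (is "norm ?w < 1")
proof -
  have "(norm ?w)\<^sup>2 < 1\<^sup>2" unfolding one_power2 using norm_ellipsoid_point_le[OF \<zeta>] \<epsilon>(1) by linarith
  then show ?thesis by (rule power_less_imp_less_base) simp
qed

lemma norm_one_minus_ellipsoid_point_le: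
  assumes \<zeta>: "norm \<zeta> < 1"
  shows "norm (1 - cinner ((1 - \<epsilon>) *\<^sub>R e + stretch e (c * \<epsilon>) (c * sqrt \<epsilon>) \<zeta>) e) \<le> 2 * \<epsilon>" (is "norm (1 - cinner ?w e) \<le> _")
proof -
  have \<zeta>1: "norm (cinner \<zeta> e) \<le> 1" using norm_cinner_le[of \<zeta> e] e \<zeta> by simp
  have "1 - cinner ?w e = of_real \<epsilon> - of_real (c * \<epsilon>) * cinner \<zeta> e"
    using e by (simp add: cinner_add_left cinner_scaleR_left cinner_stretch cinner_unit)
  then have "norm (1 - cinner ?w e) \<le> norm (of_real \<epsilon> :: complex) + norm (of_real (c * \<epsilon>) * cinner \<zeta> e)"
    by (simp only: norm_triangle_ineq4)
  also have "norm (of_real (c * \<epsilon>) * cinner \<zeta> e) \<le> (1 * \<epsilon>) * 1"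
    unfolding norm_mult[of "of_real (c * \<epsilon>)"] norm_of_real using \<epsilon> c \<zeta>1 by (intro mult_mono) auto
  finally show ?thesis using \<epsilon> by simp
qed

text \<open>Three errors of size \<open>c * \<epsilon>\<close>: the radial displacement of
  \<open>u\<close>, that of the ellipsoid point, and the product of the tangential parts. For the
  last one, \<open>norm (1 - cinner u e) \<le> c * \<epsilon>\<close> forces the tangential part of
  \<open>u\<close> to be at most \<open>sqrt \<epsilon>\<close>.\<close>

lemma norm_one_minus_cinner_ellipsoid_le:
  assumes \<zeta>: "norm \<zeta> < 1" and u: "norm u < 1" "norm (1 - cinner u e) \<le> c * \<epsilon>"
  shows "norm (1 - cinner ((1 - \<epsilon>) *\<^sub>R e + stretch e (c * \<epsilon>) (c * sqrt \<epsilon>) \<zeta>) u - of_real \<epsilon>) \<le> 3 * c * \<epsilon>"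
proof -
  define u1 where "u1 = cinner u e"
  define \<zeta>1 where "\<zeta>1 = cinner \<zeta> e"
  define p where "p = \<zeta> - \<zeta>1 *s e"
  define q where "q = u - u1 *s e"
  have n\<zeta>1: "norm \<zeta>1 \<le> 1" using norm_cinner_le[of \<zeta> e] e \<zeta> by (simp add: \<zeta>1_def)
  have nu1: "norm u1 \<le> 1" using norm_cinner_le[of u e] e u by (simp add: u1_def)
  have d: "norm (1 - u1) \<le> c * \<epsilon>" using u by (simp add: u1_def)
  have np: "norm p \<le> 1"
  proof -
    have "(norm \<zeta>)\<^sup>2 \<le> 1" using \<zeta> by (intro power_le_one) auto
    then have "(norm p)\<^sup>2 \<le> 1\<^sup>2" unfolding p_def \<zeta>1_def norm_perp[OF e] one_power2 by (simp add: add.commute add_increasing2 diff_le_eq)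
    then show ?thesis by (rule power2_le_imp_le) simp
  qed
  have nq: "norm q \<le> sqrt \<epsilon>"
  proof -
    have "(norm u)\<^sup>2 \<le> 1" using u by (intro power_le_one) auto
    then have "(norm q)\<^sup>2 \<le> 1 - (norm u1)\<^sup>2" unfolding q_def u1_def norm_perp[OF e] by simp
    also have "1 - (norm u1)\<^sup>2 = (1 - norm u1) * (1 + norm u1)" by (simp add: power2_eq_square algebra_simps)
    also have "\<dots> \<le> (c * \<epsilon>) * 2"
    proof (intro mult_mono)
      show "1 - norm u1 \<le> c * \<epsilon>" using norm_triangle_ineq2[of 1 u1] d by simp
    qed (use nu1 c \<epsilon> in auto)
    also have "\<dots> \<le> (1 / 2 * \<epsilon>) * 2" using c \<epsilon> by (intro mult_right_mono) auto
    finally have "(norm q)\<^sup>2 \<le> (sqrt \<epsilon>)\<^sup>2" using \<epsilon> by simp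
    then show ?thesis by (rule power2_le_imp_le) (use \<epsilon> in simp)
  qed
  have eu: "cinner e u = cnj u1" unfolding u1_def cnj_cinner ..
  have "cinner ((1 - \<epsilon>) *\<^sub>R e + stretch e (c * \<epsilon>) (c * sqrt \<epsilon>) \<zeta>) u =
      of_real (1 - \<epsilon>) * cnj u1 + (of_real (c * \<epsilon>) * (\<zeta>1 * cnj u1) + of_real (c * sqrt \<epsilon>) * cinner p q)"
    unfolding p_def q_def \<zeta>1_def u1_def cinner_perp[OF e]
    unfolding stretch_def cinner_add_left cinner_scaleR_left cinner_smult_left eu u1_def by (simp add: algebra_simps)
  then have "1 - cinner ((1 - \<epsilon>) *\<^sub>R e + stretch e (c * \<epsilon>) (c * sqrt \<epsilon>) \<zeta>) u - of_real \<epsilon> =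
      (of_real (1 - \<epsilon>) * cnj (1 - u1) - of_real (c * \<epsilon>) * (\<zeta>1 * cnj u1)) - of_real (c * sqrt \<epsilon>) * cinner p q"
    by (simp add: algebra_simps)
  also have "norm \<dots> \<le> (norm (of_real (1 - \<epsilon>) * cnj (1 - u1)) + norm (of_real (c * \<epsilon>) * (\<zeta>1 * cnj u1))) + norm (of_real (c * sqrt \<epsilon>) * cinner p q)"
    by (intro norm_triangle_le_diff add_right_mono norm_triangle_ineq4)
  also have "norm (of_real (1 - \<epsilon>) * cnj (1 - u1)) \<le> 1 * (c * \<epsilon>)"
    unfolding norm_mult complex_mod_cnj norm_of_real using \<epsilon> d by (intro mult_mono) auto
  also have "norm (of_real (c * \<epsilon>) * (\<zeta>1 * cnj u1)) \<le> (c * \<epsilon>) * (1 * 1)"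
    unfolding norm_mult[of "of_real (c * \<epsilon>)"] norm_mult[of \<zeta>1] complex_mod_cnj norm_of_real using \<epsilon> c n\<zeta>1 nu1 by (intro mult_mono) auto
  also have "norm (of_real (c * sqrt \<epsilon>) * cinner p q) \<le> (c * sqrt \<epsilon>) * (1 * sqrt \<epsilon>)"
  proof -
    have "norm (cinner p q) \<le> 1 * sqrt \<epsilon>" using norm_cinner_le[of p q] mult_mono[OF np nq] by simp
    then show ?thesis unfolding norm_mult[of "of_real (c * sqrt \<epsilon>)"] norm_of_real using \<epsilon> c by (intro mult_mono) auto
  qed
  also have "1 * (c * \<epsilon>) + (c * \<epsilon>) * (1 * 1) + (c * sqrt \<epsilon>) * (1 * sqrt \<epsilon>) = 3 * c * \<epsilon>"
  proof -
    have "sqrt \<epsilon> * sqrt \<epsilon> = \<epsilon>" using \<epsilon> by simp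
    then show ?thesis by (simp add: mult.assoc)
  qed
  finally show ?thesis by simp
qed

end

lemma emeasure_parabolic_stretch_image:
  fixes v :: "'n::finite \<Rightarrow> complex ^ 'n"
  assumes v: "unitary_frame v" and pos: "0 < c" "0 < \<epsilon>" and S: "S \<in> sets borel"
  shows "emeasure lborel ((\<lambda>\<zeta>. a + stretch (v k) (c * \<epsilon>) (c * sqrt \<epsilon>) \<zeta>) ` S) =
      ennreal (c ^ (2 * CARD('n)) * \<epsilon> ^ (CARD('n) + 1)) * emeasure lborel S"
proof -
  obtain m where m: "CARD('n) = Suc m" using zero_less_card_finite[where 'a='n] by (auto simp: gr0_conv_Suc)
  have "(c * sqrt \<epsilon>) ^ (2 * m) = (c\<^sup>2 * \<epsilon>) ^ m" using pos by (simp add: power_mult power_mult_distrib)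
  then have "(c * \<epsilon>)\<^sup>2 * (c * sqrt \<epsilon>) ^ (2 * (CARD('n) - 1)) = c ^ (2 * CARD('n)) * \<epsilon> ^ (CARD('n) + 1)"
    unfolding m by (simp add: power_mult_distrib power_mult power2_eq_square algebra_simps)
  then show ?thesis
    using emeasure_affine_stretch_image[OF v _ _ S, of "c * \<epsilon>" "c * sqrt \<epsilon>" a k] pos by simp
qed

lemma parabolic_ellipsoid:
  fixes v :: "'n::finite \<Rightarrow> complex ^ 'n"
  assumes v: "unitary_frame v" and pos: "0 < c" "0 < \<epsilon>"
  shows lmeasurable_parabolic_ellipsoid: "(\<lambda>\<zeta>. a + stretch (v k) (c * \<epsilon>) (c * sqrt \<epsilon>) \<zeta>) ` ball 0 1 \<in> lmeasurable" (is "?E \<in> _")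
    and measure_parabolic_ellipsoid: "measure lebesgue ((\<lambda>\<zeta>. a + stretch (v k) (c * \<epsilon>) (c * sqrt \<epsilon>) \<zeta>) ` ball 0 1) =
      c ^ (2 * CARD('n)) * \<epsilon> ^ (CARD('n) + 1) * measure lborel (ball (0 :: complex ^ 'n) 1)"
proof -
  have S: "?E \<in> sets borel" using pos by (intro sets_affine_stretch_image[OF v]) auto
  have em: "emeasure lborel ?E = ennreal (c ^ (2 * CARD('n)) * \<epsilon> ^ (CARD('n) + 1) * measure lborel (ball (0 :: complex ^ 'n) 1))"
    using emeasure_parabolic_stretch_image[OF v pos, of "ball 0 1" a k] pos
    by (simp only: borel_open open_ball ennreal_lborel_ball ennreal_mult'[symmetric] zero_le_power less_imp_le mult_nonneg_nonneg)
  show "?E \<in> lmeasurable" using S em by (intro fmeasurableI) auto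
  show "measure lebesgue ?E = c ^ (2 * CARD('n)) * \<epsilon> ^ (CARD('n) + 1) * measure lborel (ball (0 :: complex ^ 'n) 1)"
    using S em pos by (simp add: measure_def)
qed

lemma slice_holomorphic_on_affine_stretch:
  assumes f: "slice_holomorphic_on f S" and sub: "\<And>\<zeta>. \<zeta> \<in> T \<Longrightarrow> a + stretch e \<alpha> \<beta> \<zeta> \<in> S"
  shows "slice_holomorphic_on (\<lambda>\<zeta>. f (a + stretch e \<alpha> \<beta> \<zeta>)) T"
  unfolding slice_holomorphic_on_def
proof (intro conjI allI impI)
  have contf: "continuous_on S f" using f by (simp add: slice_holomorphic_on_def)
  show "continuous_on T (\<lambda>\<zeta>. f (a + stretch e \<alpha> \<beta> \<zeta>))"
  proof (rule continuous_on_compose2[OF contf])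
    show "continuous_on T (\<lambda>\<zeta>. a + stretch e \<alpha> \<beta> \<zeta>)" by (intro continuous_intros continuous_stretch)
  qed (use sub in blast)
next
  fix z v and D :: "complex set" assume D: "open D" and inT: "\<forall>t\<in>D. z + t *s v \<in> T"
  have eq: "a + stretch e \<alpha> \<beta> (z + t *s v) = (a + stretch e \<alpha> \<beta> z) + t *s stretch e \<alpha> \<beta> v" for t
    by (simp add: stretch_add stretch_smult add.assoc)
  have inS: "(a + stretch e \<alpha> \<beta> z) + t *s stretch e \<alpha> \<beta> v \<in> S" if "t \<in> D" for t
    using sub[of "z + t *s v"] inT that unfolding eq by blast
  show "(\<lambda>t. f (a + stretch e \<alpha> \<beta> (z + t *s v))) holomorphic_on D"
    unfolding eq by (rule slice_holomorphic_onD[OF f D inS])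
qed

lemma slice_holomorphic_on_divide:
  assumes f: "slice_holomorphic_on f S" and g: "slice_holomorphic_on g S" and nz: "\<And>z. z \<in> S \<Longrightarrow> g z \<noteq> 0"
  shows "slice_holomorphic_on (\<lambda>z. f z / g z) S"
  unfolding slice_holomorphic_on_def
proof (intro conjI allI impI)
  show "continuous_on S (\<lambda>z. f z / g z)"
    using f g nz by (intro continuous_on_divide) (auto simp: slice_holomorphic_on_def)
next
  fix z v and D :: "complex set" assume D: "open D" and inS: "\<forall>t\<in>D. z + t *s v \<in> S"
  show "(\<lambda>t. f (z + t *s v) / g (z + t *s v)) holomorphic_on D"
    using inS nz by (intro holomorphic_on_divide slice_holomorphic_onD[OF f D] slice_holomorphic_onD[OF g D]) auto
qed

lemma Re_bergman_proj_indicator_ge: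
  fixes A :: "(complex ^ 'n) set"
  assumes A: "A \<in> sets lebesgue" "A \<subseteq> ball 0 1" and w: "norm w < 1"
    and ge: "\<And>u. u \<in> A \<Longrightarrow> m \<le> Re (bergman_kernel w u)"
  shows "m * measure lebesgue A \<le> Re (bergman_proj (indicator A) w)"
proof -
  let ?B = "ball (0 :: complex ^ 'n) 1"
  have fin: "emeasure lebesgue A < \<infinity>"
  proof -
    have "emeasure lebesgue A \<le> emeasure lebesgue ?B" using A(2) by (intro emeasure_mono) auto
    also have "\<dots> < \<infinity>" using lmeasurable_ball by (simp add: fmeasurable_def)
    finally show ?thesis .
  qed
  have "set_integrable lebesgue ?B (indicator A :: complex ^ 'n \<Rightarrow> complex)"
    using indicator_measurable_lebesgue_on[OF A(1)] by (rule set_integrable_bounded_ball[where B = 1]) (simp add: indicator_def)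
  then have "bergman_defined (indicator A :: complex ^ 'n \<Rightarrow> complex)" by (rule bergman_defined_integrable)
  then have int: "integrable lebesgue (\<lambda>u. indicator ?B u *\<^sub>R (bergman_kernel w u * indicator A u))"
    using w unfolding bergman_defined_def set_integrable_def by simp
  have "m * measure lebesgue A = (\<integral>u. m * indicator A u \<partial>lebesgue)" using A(1) by simp
  also have "\<dots> \<le> (\<integral>u. Re (indicator ?B u *\<^sub>R (bergman_kernel w u * indicator A u)) \<partial>lebesgue)"
  proof (rule integral_mono)
    show "integrable lebesgue (\<lambda>u. m * indicator A u)" using A(1) fin by (intro integrable_mult_right integrable_real_indicator) auto
    show "integrable lebesgue (\<lambda>u. Re (indicator ?B u *\<^sub>R (bergman_kernel w u * indicator A u)))" using int by (rule integrable_Re)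
    fix u
    show "m * indicator A u \<le> Re (indicator ?B u *\<^sub>R (bergman_kernel w u * indicator A u))"
    proof (cases "u \<in> A")
      case True
      then have "u \<in> ?B" using A(2) by blast
      then show ?thesis using ge[OF True] True by simp
    qed simp
  qed
  also have "\<dots> = Re (bergman_proj (indicator A) w)"
    unfolding bergman_proj_def set_lebesgue_integral_def using int by (rule integral_Re)
  finally show ?thesis .
qed

lemma Re_bergman_kernel_ge:
  fixes w u :: "complex ^ 'n"
  assumes \<epsilon>: "0 < \<epsilon>" and near: "norm (1 - cinner w u - of_real \<epsilon>) \<le> 3 * c * \<epsilon>"
    and c: "\<And>\<tau>. norm \<tau> \<le> 3 * c \<Longrightarrow> 1 / 2 \<le> Re (1 / (1 + \<tau>) ^ (CARD('n) + 1))"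
  shows "bergman_const TYPE('n) / (2 * \<epsilon> ^ (CARD('n) + 1)) \<le> Re (bergman_kernel w u)"
proof -
  define N where "N = CARD('n) + 1"
  define \<tau> where "\<tau> = (1 - cinner w u - of_real \<epsilon>) / of_real \<epsilon>"
  have "norm \<tau> \<le> 3 * c" unfolding \<tau>_def norm_divide norm_of_real using \<epsilon> near by (simp add: pos_divide_le_eq)
  then have re: "1 / 2 \<le> Re (1 / (1 + \<tau>) ^ N)" unfolding N_def by (rule c)
  have eq: "1 - cinner w u = of_real \<epsilon> * (1 + \<tau>)" using \<epsilon> by (simp add: \<tau>_def field_simps)
  have "bergman_kernel w u = of_real (bergman_const TYPE('n) / \<epsilon> ^ N) * (1 / (1 + \<tau>) ^ N)"
    unfolding bergman_kernel_def eq power_mult_distrib bergman_const_def N_def[symmetric] by simp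
  then have "Re (bergman_kernel w u) = (bergman_const TYPE('n) / \<epsilon> ^ N) * Re (1 / (1 + \<tau>) ^ N)"
    by (simp only: times_complex.sel Re_complex_of_real Im_complex_of_real mult_zero_left diff_0_right)
  moreover have "(bergman_const TYPE('n) / \<epsilon> ^ N) * (1 / 2) \<le> (bergman_const TYPE('n) / \<epsilon> ^ N) * Re (1 / (1 + \<tau>) ^ N)"
    using re \<epsilon> bergman_const_pos[where 'n = 'n] by (intro mult_left_mono) auto
  ultimately show ?thesis by (simp add: N_def)
qed

text \<open>The common core of the three converses: one suitable set for every scale and direction
  is enough, with constants \<open>c\<close>, \<open>a\<close>, \<open>C\<close> independent of
  both. The set lies near the boundary point \<open>e\<close>, not around the point at height
  \<open>\<epsilon>\<close> where the gradient is estimated.\<close>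

lemma bloch_of_weak_type_sets:
  fixes b :: "complex ^ 'n \<Rightarrow> complex"
  assumes fr: "framed TYPE('n)" and hol: "holomorphic_multi_on b (ball 0 1)"
    and c: "0 < c" "c \<le> 1 / 2" "\<And>\<tau>. norm \<tau> \<le> 3 * c \<Longrightarrow> 1 / 2 \<le> Re (1 / (1 + \<tau>) ^ (CARD('n) + 1))"
    and a: "0 < a" and C: "0 \<le> C"
    and sets: "\<And>\<epsilon> e. 0 < \<epsilon> \<Longrightarrow> \<epsilon> \<le> 1 \<Longrightarrow> norm e = 1 \<Longrightarrow> \<exists>A. A \<in> sets lebesgue \<and> A \<subseteq> ball 0 1 \<and>
      (\<forall>u\<in>A. norm (1 - cinner u e) \<le> c * \<epsilon>) \<and> a * \<epsilon> ^ (CARD('n) + 1) \<le> measure lebesgue A \<and>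
      commutator_defined b (indicator A) \<and>
      (\<forall>lam>1. measure lebesgue {w \<in> ball 0 1. norm (commutator b (indicator A) w) > lam} \<le> C * \<epsilon> ^ (CARD('n) + 1) / lam)"
  shows "b \<in> bloch"
proof -
  let ?B = "ball (0 :: complex ^ 'n) 1"
  define n where "n = CARD('n)"
  have n: "0 < n" by (simp add: n_def)
  \<comment> \<open>A kernel of size \<open>1 / \<epsilon> ^ (n + 1)\<close> meets a set of volume
    at least \<open>a * \<epsilon> ^ (n + 1)\<close>, so the lower bound for
    \<open>bergman_proj (indicator A)\<close> is free of \<open>\<epsilon>\<close>.\<close>
  define g0 where "g0 = bergman_const TYPE('n) * a / 2"
  have g0: "0 < g0" using a bergman_const_pos[where 'n = 'n] by (simp add: g0_def)
  \<comment> \<open>Pulling back to the unit ball divides volumes by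
    \<open>c ^ (2 * n) * \<epsilon> ^ (n + 1)\<close>, and dividing the commutator by
    \<open>g\<close> replaces the level \<open>l\<close> by \<open>l * g0\<close>; the powers of
    \<open>\<epsilon>\<close> cancel.\<close>
  define K where "K = C / (c ^ (2 * n) * g0)"
  have K: "0 \<le> K" using C c g0 by (simp add: K_def)
  \<comment> \<open>The lowest level is \<open>2 / g0\<close>: from there on
    \<open>l * g0 \<ge> 2\<close> exceeds 1, as the hypothesis on the commutator requires.\<close>
  define Q where "Q = 16 ^ n * (2 * (2 / g0) + 4 * 16 ^ n * K / measure lborel ?B)"
  have main: "norm (cgrad b w0 $ j) * (1 - norm w0) \<le> 4 * exp (2 * Q) / c" if w0: "w0 \<in> ?B" for w0 j
  proof -
    obtain e where e: "norm e = 1" and w0e: "w0 = norm w0 *\<^sub>R e" by (rule unit_vector_exists)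
    define \<epsilon> where "\<epsilon> = 1 - norm w0"
    have \<epsilon>: "0 < \<epsilon>" "\<epsilon> \<le> 1" using w0 by (auto simp: \<epsilon>_def)
    have w0e': "w0 = (1 - \<epsilon>) *\<^sub>R e" using w0e by (simp add: \<epsilon>_def)
    obtain A where A: "A \<in> sets lebesgue" "A \<subseteq> ?B" and Anear: "\<And>u. u \<in> A \<Longrightarrow> norm (1 - cinner u e) \<le> c * \<epsilon>"
      and Am: "a * \<epsilon> ^ (n + 1) \<le> measure lebesgue A" and cd: "commutator_defined b (indicator A)"
      and weak: "\<And>lam. 1 < lam \<Longrightarrow> measure lebesgue {w \<in> ?B. norm (commutator b (indicator A) w) > lam} \<le> C * \<epsilon> ^ (n + 1) / lam"
      using sets[OF \<epsilon> e] unfolding n_def by blast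
    define f2 where "f2 w = cnj (b w) * indicator A w" for w
    define g where "g = bergman_proj (indicator A)"
    define h where "h = bergman_proj f2"
    have comm: "commutator b (indicator A) w = cnj (b w) * g w - h w" for w
      by (simp add: commutator_def g_def h_def f2_def[abs_def])
    have "set_integrable lebesgue ?B (indicator A :: complex ^ 'n \<Rightarrow> complex)"
      using indicator_measurable_lebesgue_on[OF A(1)] by (rule set_integrable_bounded_ball[where B = 1]) (simp add: indicator_def)
    then have sg: "slice_holomorphic_on g ?B" unfolding g_def by (rule slice_holomorphic_bergman_proj)
    have "set_integrable lebesgue ?B f2"
    proof -
      \<comment> \<open>At the origin the kernel is constant, so definedness of the projection there
        says that \<open>f2\<close> is integrable.\<close>
      have "set_integrable lebesgue ?B (\<lambda>w. bergman_kernel 0 w * f2 w)"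
        using cd unfolding commutator_defined_def bergman_defined_def f2_def by simp
      then have "set_integrable lebesgue ?B (\<lambda>w. of_real (1 / bergman_const TYPE('n)) * (bergman_kernel 0 w * f2 w))"
        by (intro set_integrable_mult_right) simp
      moreover have "of_real (1 / bergman_const TYPE('n)) * (bergman_kernel 0 w * f2 w) = f2 w" for w
        using bergman_const_pos[where 'n = 'n] by (simp add: bergman_kernel_def cinner_zero_left bergman_const_def)
      ultimately show ?thesis by simp
    qed
    then have sh: "slice_holomorphic_on h ?B" unfolding h_def by (rule slice_holomorphic_bergman_proj)
    have sb: "slice_holomorphic_on b ?B" using hol by (rule slice_holomorphic_on_multi)
    define \<phi> where "\<phi> \<zeta> = w0 + stretch e (c * \<epsilon>) (c * sqrt \<epsilon>) \<zeta>" for \<zeta>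
    have \<phi>B: "\<phi> \<zeta> \<in> ?B" if "\<zeta> \<in> ?B" for \<zeta>
      unfolding \<phi>_def w0e' using norm_ellipsoid_point_less[OF e \<epsilon> c(1,2)] that by simp
    have gge: "g0 \<le> norm (g (\<phi> \<zeta>))" if "\<zeta> \<in> ?B" for \<zeta>
    proof -
      have "bergman_const TYPE('n) / (2 * \<epsilon> ^ (n + 1)) \<le> Re (bergman_kernel (\<phi> \<zeta>) u)" if u: "u \<in> A" for u
        unfolding n_def
      proof (rule Re_bergman_kernel_ge[OF \<epsilon>(1) _ c(3)])
        have "norm u < 1" using u A(2) by auto
        then show "norm (1 - cinner (\<phi> \<zeta>) u - of_real \<epsilon>) \<le> 3 * c * \<epsilon>"
          unfolding \<phi>_def w0e' using \<open>\<zeta> \<in> ?B\<close> Anear[OF u] by (intro norm_one_minus_cinner_ellipsoid_le[OF e \<epsilon> c(1,2)]) auto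
      qed
      then have "bergman_const TYPE('n) / (2 * \<epsilon> ^ (n + 1)) * measure lebesgue A \<le> Re (g (\<phi> \<zeta>))"
        unfolding g_def using \<phi>B[OF that] by (intro Re_bergman_proj_indicator_ge[OF A]) auto
      moreover have "bergman_const TYPE('n) / (2 * \<epsilon> ^ (n + 1)) * (a * \<epsilon> ^ (n + 1)) \<le> bergman_const TYPE('n) / (2 * \<epsilon> ^ (n + 1)) * measure lebesgue A"
        using Am \<epsilon> bergman_const_pos[where 'n = 'n] by (intro mult_left_mono) auto
      moreover have "bergman_const TYPE('n) / (2 * \<epsilon> ^ (n + 1)) * (a * \<epsilon> ^ (n + 1)) = g0" using \<epsilon> by (simp add: g0_def)
      ultimately show ?thesis using complex_Re_le_cmod[of "g (\<phi> \<zeta>)"] by linarith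
    qed
    define \<beta> where "\<beta> \<zeta> = b (\<phi> \<zeta>)" for \<zeta>
    define q where "q \<zeta> = h (\<phi> \<zeta>) / g (\<phi> \<zeta>)" for \<zeta>
    have s\<beta>: "slice_holomorphic_on \<beta> ?B" unfolding \<beta>_def \<phi>_def
      using \<phi>B unfolding \<phi>_def by (rule slice_holomorphic_on_affine_stretch[OF sb])
    have sq: "slice_holomorphic_on q ?B" unfolding q_def
    proof (rule slice_holomorphic_on_divide)
      show "slice_holomorphic_on (\<lambda>\<zeta>. h (\<phi> \<zeta>)) ?B" "slice_holomorphic_on (\<lambda>\<zeta>. g (\<phi> \<zeta>)) ?B"
        unfolding \<phi>_def using \<phi>B unfolding \<phi>_def by (auto intro: slice_holomorphic_on_affine_stretch[OF sh] slice_holomorphic_on_affine_stretch[OF sg])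
      show "g (\<phi> \<zeta>) \<noteq> 0" if "\<zeta> \<in> ?B" for \<zeta> using gge[OF that] g0 by auto
    qed
    have comm\<phi>: "norm (commutator b (indicator A) (\<phi> \<zeta>)) = norm (g (\<phi> \<zeta>)) * norm (cnj (\<beta> \<zeta>) - q \<zeta>)" if "\<zeta> \<in> ?B" for \<zeta>
    proof -
      have "g (\<phi> \<zeta>) \<noteq> 0" using gge[OF that] g0 by auto
      then have "commutator b (indicator A) (\<phi> \<zeta>) = g (\<phi> \<zeta>) * (cnj (\<beta> \<zeta>) - q \<zeta>)"
        unfolding comm \<beta>_def q_def by (simp add: right_diff_distrib mult.commute)
      then show ?thesis by (simp only: norm_mult)
    qed
    have contv: "continuous_on ?B (\<lambda>\<zeta>. norm (cnj (\<beta> \<zeta>) - q \<zeta>))"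
      using s\<beta> sq unfolding slice_holomorphic_on_def by (intro continuous_intros) auto
    have contc: "continuous_on ?B (\<lambda>w. norm (commutator b (indicator A) w))"
      unfolding comm using sb sg sh unfolding slice_holomorphic_on_def by (intro continuous_intros) auto
    have level_open: "open {w \<in> ?B. l < F w}" if "continuous_on ?B F" for l and F :: "complex ^ 'n \<Rightarrow> real"
    proof -
      have "open (?B \<inter> F -` {l <..})" using that by (rule continuous_open_preimage) auto
      moreover have "?B \<inter> F -` {l <..} = {w \<in> ?B. l < F w}" by auto
      ultimately show ?thesis by simp
    qed
    obtain V k where V: "unitary_frame V" and Vk: "V k = e" using fr e unfolding framed_def by blast
    have wt: "measure lborel {\<zeta> \<in> ?B. norm (cnj (\<beta> \<zeta>) - q \<zeta>) > l} \<le> K / l" if l: "2 / g0 \<le> l" for l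
    proof -
      have lg: "2 \<le> l * g0" using l g0 by (simp add: pos_divide_le_eq)
      have lpos: "0 < l" using l g0 by (meson divide_pos_pos less_le_trans zero_less_numeral)
      define W where "W = {\<zeta> \<in> ?B. norm (cnj (\<beta> \<zeta>) - q \<zeta>) > l}"
      define G where "G = {w \<in> ?B. norm (commutator b (indicator A) w) > l * g0}"
      have Wb: "W \<in> sets borel" unfolding W_def using level_open[OF contv] by (intro borel_open)
      have "emeasure lborel W \<le> emeasure lborel ?B" unfolding W_def by (intro emeasure_mono) auto
      also have "\<dots> < \<infinity>" by (rule emeasure_lborel_ball_finite)
      finally have Wf: "emeasure lborel W = ennreal (measure lborel W)" by (intro emeasure_eq_ennreal_measure) auto
      have "open G" unfolding G_def by (rule level_open[OF contc])
      then have Gb: "G \<in> sets borel" by (rule borel_open)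
      have "emeasure lborel G \<le> emeasure lborel ?B" unfolding G_def by (intro emeasure_mono) auto
      also have "\<dots> < \<infinity>" by (rule emeasure_lborel_ball_finite)
      finally have Gf: "emeasure lborel G = ennreal (measure lborel G)" by (intro emeasure_eq_ennreal_measure) auto
      have "\<phi> ` W \<subseteq> G"
      proof
        fix w assume "w \<in> \<phi> ` W"
        then obtain \<zeta> where \<zeta>: "\<zeta> \<in> ?B" "norm (cnj (\<beta> \<zeta>) - q \<zeta>) > l" "w = \<phi> \<zeta>" by (auto simp: W_def)
        have "g0 * l < norm (g (\<phi> \<zeta>)) * norm (cnj (\<beta> \<zeta>) - q \<zeta>)"
          using gge[OF \<zeta>(1)] g0 lpos \<zeta>(2) by (intro mult_le_less_imp_less) auto
        then show "w \<in> G" unfolding G_def \<zeta>(3) using \<phi>B[OF \<zeta>(1)] comm\<phi>[OF \<zeta>(1)] by (simp add: mult.commute)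
      qed
      then have "emeasure lborel (\<phi> ` W) \<le> emeasure lborel G" using Gb by (intro emeasure_mono) auto
      moreover have "emeasure lborel (\<phi> ` W) = ennreal (c ^ (2 * n) * \<epsilon> ^ (n + 1)) * emeasure lborel W"
        using emeasure_parabolic_stretch_image[OF V c(1) \<epsilon>(1) Wb, of w0 k] unfolding Vk \<phi>_def n_def .
      ultimately have "ennreal (c ^ (2 * n) * \<epsilon> ^ (n + 1)) * ennreal (measure lborel W) \<le> ennreal (measure lborel G)"
        by (simp only: Wf Gf)
      then have "c ^ (2 * n) * \<epsilon> ^ (n + 1) * measure lborel W \<le> measure lborel G"
        using c \<epsilon> by (simp add: ennreal_mult'[symmetric])
      also have "measure lborel G = measure lebesgue G" using Gb by simp
      also have "\<dots> \<le> C * \<epsilon> ^ (n + 1) / (l * g0)" unfolding G_def using lg by (intro weak) auto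
      finally have "c ^ (2 * n) * measure lborel W * \<epsilon> ^ (n + 1) \<le> C / (l * g0) * \<epsilon> ^ (n + 1)" by (simp add: mult_ac)
      then have "c ^ (2 * n) * measure lborel W \<le> C / (l * g0)" using \<epsilon> by (simp only: mult_le_cancel_right_pos zero_less_power)
      then have "measure lborel W \<le> C / (l * g0) / c ^ (2 * n)" using c by (subst pos_le_divide_eq) (auto simp: mult.commute)
      also have "\<dots> = K / l" by (simp add: K_def)
      finally show ?thesis unfolding W_def .
    qed
    have bounded: "norm (cnj (\<beta> \<zeta>) - q \<zeta>) \<le> Q" if "norm \<zeta> \<le> 1 / 2" for \<zeta>
      unfolding Q_def n_def using g0 that by (intro bounded_of_weak_type[OF s\<beta> sq _ K wt]) auto
    \<comment> \<open>The direction that \<open>\<phi>\<close> maps to a multiple of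
      \<open>axis j 1\<close>: the composed stretches give \<open>c * \<epsilon>\<close> along
      \<open>e\<close> and \<open>c * sqrt \<epsilon> * sqrt \<epsilon> = c * \<epsilon>\<close>
      across it. Its norm is at most 1, so discs of radius \<open>1/2\<close> stay where the bound
      \<open>Q\<close> holds.\<close>
    define \<xi> where "\<xi> = stretch e 1 (sqrt \<epsilon>) (axis j 1 :: complex ^ 'n)"
    have ax: "norm (axis j 1 :: complex ^ 'n) = 1" by simp
    have n\<xi>: "norm \<xi> \<le> 1"
    proof -
      let ?x = "(norm (cinner (axis j 1) e))\<^sup>2"
      have x: "?x \<le> 1" using norm_cinner_unit_le[OF e, of "axis j 1"] unfolding ax by simp
      have "\<epsilon> * (1 - ?x) \<le> 1 * (1 - ?x)" using x \<epsilon> by (intro mult_right_mono) auto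
      then have "(norm \<xi>)\<^sup>2 \<le> 1\<^sup>2" unfolding \<xi>_def norm_stretch[OF e] ax using \<epsilon> by simp
      then show ?thesis by (rule power2_le_imp_le) simp
    qed
    have t\<xi>: "norm (t *s \<xi>) < 1 / 2" if "norm t < 1 / 2" for t
    proof -
      have "norm t * norm \<xi> \<le> norm t * 1" using n\<xi> by (intro mult_left_mono) auto
      then show ?thesis using that unfolding norm_smult by linarith
    qed
    have \<phi>\<xi>: "\<phi> (t *s \<xi>) = w0 + (of_real (c * \<epsilon>) * t) *s axis j 1" for t
    proof -
      have "c * sqrt \<epsilon> * sqrt \<epsilon> = c * \<epsilon>" using \<epsilon> by (simp add: mult.assoc)
      then have "stretch e (c * \<epsilon>) (c * sqrt \<epsilon>) \<xi> = stretch e (c * \<epsilon>) (c * \<epsilon>) (axis j 1)"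
        unfolding \<xi>_def stretch_stretch[OF e] by (simp only: mult_1_right)
      also have "\<dots> = of_real (c * \<epsilon>) *s axis j 1" by (simp add: stretch_def vec_eq_iff scaleR_conv_of_real[where 'a=complex])
      finally show ?thesis unfolding \<phi>_def stretch_smult by (simp add: vector_smult_assoc mult.commute)
    qed
    define F where "F t = \<beta> (t *s \<xi>)" for t
    have Fhol: "F holomorphic_on ball 0 (1/2)"
      using slice_holomorphic_onD[OF s\<beta>, of "ball 0 (1/2)" 0 \<xi>] t\<xi> unfolding F_def by fastforce
    have qhol: "(\<lambda>t. q (t *s \<xi>)) holomorphic_on ball 0 (1/2)"
      using slice_holomorphic_onD[OF sq, of "ball 0 (1/2)" 0 \<xi>] t\<xi> by fastforce
    have dF: "norm (deriv F 0) \<le> 4 * exp (2 * Q)"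
      using Fhol qhol
    proof (rule norm_deriv_le_of_cnj_diff_bounded)
      fix t :: complex assume "norm t < 1 / 2"
      then show "norm (cnj (F t) - q (t *s \<xi>)) \<le> Q" unfolding F_def using t\<xi> by (intro bounded) (simp add: less_imp_le)
    qed
    have "deriv F 0 = of_real (c * \<epsilon>) * cgrad b w0 $ j"
    proof -
      define H where "H t = b (w0 + t *s axis j 1)" for t
      define T where "T = {t :: complex. w0 + t *s axis j 1 \<in> ?B}"
      have "open T"
      proof -
        have "continuous_on UNIV (\<lambda>t :: complex. w0 + t *s axis j 1)" unfolding plus_smult_eq by (intro continuous_intros)
        then have "open ((\<lambda>t :: complex. w0 + t *s axis j 1) -` ?B)" by (intro open_vimage) auto
        then show ?thesis by (simp add: T_def vimage_def)
      qed
      moreover have "H holomorphic_on T" unfolding H_def using \<open>open T\<close> by (rule slice_holomorphic_onD[OF sb]) (simp add: T_def)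
      moreover have "0 \<in> T" using w0 by (simp add: T_def)
      ultimately have "(H has_field_derivative deriv H 0) (at (of_real (c * \<epsilon>) * 0))"
        by (simp add: holomorphic_derivI)
      moreover have "((\<lambda>t. of_real (c * \<epsilon>) * t) has_field_derivative of_real (c * \<epsilon>)) (at (0 :: complex))"
        by (rule DERIV_cmult_Id)
      ultimately have "((\<lambda>t. H (of_real (c * \<epsilon>) * t)) has_field_derivative deriv H 0 * of_real (c * \<epsilon>)) (at 0)"
        by (rule DERIV_chain2)
      moreover have "F = (\<lambda>t. H (of_real (c * \<epsilon>) * t))" unfolding F_def \<beta>_def \<phi>\<xi> H_def ..
      moreover have "deriv H 0 = cgrad b w0 $ j" by (simp add: cgrad_def H_def[abs_def])
      ultimately show ?thesis using DERIV_imp_deriv[of F] by (simp add: mult.commute)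
    qed
    then have "norm (deriv F 0) = (c * \<epsilon>) * norm (cgrad b w0 $ j)"
      using c(1) \<epsilon>(1) by (simp add: norm_mult)
    then have "norm (cgrad b w0 $ j) * \<epsilon> * c \<le> 4 * exp (2 * Q)" using dF by (simp add: mult_ac)
    then show ?thesis unfolding \<epsilon>_def[symmetric] using c by (subst pos_le_divide_eq)
  qed
  have "norm (cgrad b w) * (1 - norm w) \<le> of_nat n * (4 * exp (2 * Q) / c)" if w: "w \<in> ?B" for w
  proof -
    have "norm (cgrad b w) \<le> (\<Sum>j\<in>UNIV. norm (cgrad b w $ j))" unfolding norm_vec_def by (rule L2_set_le_sum) simp
    then have "norm (cgrad b w) * (1 - norm w) \<le> (\<Sum>j\<in>UNIV. norm (cgrad b w $ j)) * (1 - norm w)" using w by (intro mult_right_mono) auto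
    also have "\<dots> = (\<Sum>j\<in>UNIV. norm (cgrad b w $ j) * (1 - norm w))" by (rule sum_distrib_right)
    also have "\<dots> \<le> of_nat n * (4 * exp (2 * Q) / c)" unfolding n_def by (rule sum_bounded_above) (rule main[OF w])
    finally show ?thesis .
  qed
  then have "bdd_above ((\<lambda>z. norm (cgrad b z) * (1 - norm z)) ` ?B)" by (rule bdd_aboveI2)
  then show ?thesis using hol by (simp add: bloch_def)
qed

section \<open>Polydisks and the equivalence\<close>

lemma adapted_frames_unitary: "adapted_frames e k \<Longrightarrow> unitary_frame (e z)"
  by (simp add: adapted_frames_def unitary_frame_def)

text \<open>\<open>z\<close> is \<open>norm z\<close> times \<open>e z k\<close>, also for
  \<open>z = 0\<close>, so both conditions become conditions on the coordinates of
  \<open>w - z\<close>.\<close>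

lemma mem_polydisk_iff:
  assumes e: "adapted_frames e k"
  shows "w \<in> polydisk e k z s \<longleftrightarrow> norm (cinner (w - z) (e z k)) < s \<and> (\<forall>j. j \<noteq> k \<longrightarrow> norm (cinner (w - z) (e z j)) < sqrt s)"
proof -
  have u: "unitary_frame (e z)" using e by (rule adapted_frames_unitary)
  have z: "z = norm z *\<^sub>R e z k" using e by (cases "z = 0") (auto simp: adapted_frames_def)
  have zj: "cinner z (e z j) = (if j = k then of_real (norm z) else 0)" for j
  proof -
    have "cinner z (e z j) = of_real (norm z) * cinner (e z k) (e z j)" by (subst z) (simp only: cinner_scaleR_left)
    then show ?thesis using u by (simp add: unitary_frame_def)
  qed
  have zi: "z $ i = of_real (norm z) * e z k $ i" for i
    using arg_cong[OF z, of "\<lambda>x. x $ i"] by (simp add: scaleR_conv_of_real[where 'a=complex])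
  have "cinner w (e z k) *s e z k - z = cinner (w - z) (e z k) *s e z k"
    by (simp add: vec_eq_iff cinner_diff_left zj zi left_diff_distrib)
  then have "norm (cinner w (e z k) *s e z k - z) = norm (cinner (w - z) (e z k))"
    using unitary_frame_norm[OF u] by (simp add: norm_smult)
  then show ?thesis unfolding polydisk_def by (simp add: cinner_diff_left zj)
qed

lemma open_polydisk: "open (polydisk e k z s)"
proof -
  have cont: "continuous_on UNIV (\<lambda>w. cinner w y)" for y unfolding cinner_def by (intro continuous_intros)
  have "open {w. norm (cinner w (e z k) *s e z k - z) < s}"
  proof (rule open_Collect_less)
    have "cinner w (e z k) *s e z k - z = - z + cinner w (e z k) *s e z k" for w by simp
    then show "continuous_on UNIV (\<lambda>w. norm (cinner w (e z k) *s e z k - z))"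
      unfolding plus_smult_eq by (simp only:) (intro continuous_intros cont)
  qed simp
  moreover have "open (\<Inter>j\<in>UNIV - {k}. {w. norm (cinner w (e z j)) < sqrt s})"
    by (intro open_INT open_Collect_less continuous_intros cont ballI) simp
  ultimately have "open ({w. norm (cinner w (e z k) *s e z k - z) < s} \<inter> (\<Inter>j\<in>UNIV - {k}. {w. norm (cinner w (e z j)) < sqrt s}))"
    by (rule open_Int)
  moreover have "\<dots> = polydisk e k z s" by (auto simp: polydisk_def)
  ultimately show ?thesis by simp
qed

text \<open>Serves the upper volume bound. By Parseval the tangential part has square at most
  \<open>n * s\<close>, and the factor \<open>2 * n\<close> makes each term of the ellipsoid
  inequality at most \<open>1 / 4\<close>.\<close>

lemma polydisk_subset_ellipsoid:
  fixes e :: "complex ^ 'n \<Rightarrow> 'n \<Rightarrow> complex ^ 'n"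
  assumes e: "adapted_frames e k" and s: "0 < s"
  shows "polydisk e k z s \<subseteq> (\<lambda>\<zeta>. z + stretch (e z k) (2 * real CARD('n) * s) (2 * real CARD('n) * sqrt s) \<zeta>) ` ball 0 1"
proof
  fix w assume "w \<in> polydisk e k z s"
  then have w: "norm (cinner (w - z) (e z k)) < s" and wj: "\<And>j. j \<noteq> k \<Longrightarrow> norm (cinner (w - z) (e z j)) < sqrt s"
    unfolding mem_polydisk_iff[OF e] by auto
  have u: "unitary_frame (e z)" using e by (rule adapted_frames_unitary)
  define n where "n = real CARD('n)"
  have n: "1 \<le> n" unfolding n_def using zero_less_card_finite[where 'a='n] by linarith
  have "(norm (w - z))\<^sup>2 = (norm (cinner (w - z) (e z k)))\<^sup>2 + (\<Sum>j\<in>UNIV - {k}. (norm (cinner (w - z) (e z j)))\<^sup>2)"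
    unfolding unitary_frame_parseval[OF u] by (simp add: sum.remove[of UNIV k])
  moreover have "(\<Sum>j\<in>UNIV - {k}. (norm (cinner (w - z) (e z j)))\<^sup>2) \<le> real (card (UNIV - {k})) * s"
  proof (rule sum_bounded_above)
    fix j assume "j \<in> UNIV - {k}"
    then have "norm (cinner (w - z) (e z j)) \<le> sqrt s" using wj[of j] by simp
    then have "(norm (cinner (w - z) (e z j)))\<^sup>2 \<le> (sqrt s)\<^sup>2" by (intro power_mono) auto
    then show "(norm (cinner (w - z) (e z j)))\<^sup>2 \<le> s" using s by simp
  qed
  moreover have "real (card (UNIV - {k})) * s \<le> n * s" unfolding n_def using s by (intro mult_right_mono) (simp_all add: card_Diff_singleton)
  ultimately have Y: "(norm (w - z))\<^sup>2 - (norm (cinner (w - z) (e z k)))\<^sup>2 \<le> n * s" by linarith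
  have "(norm (cinner (w - z) (e z k)))\<^sup>2 \<le> s\<^sup>2" using w by (intro power_mono) auto
  then have "(norm (cinner (w - z) (e z k)))\<^sup>2 / (2 * n * s)\<^sup>2 \<le> s\<^sup>2 / (2 * n * s)\<^sup>2" by (intro divide_right_mono) auto
  also have "\<dots> = 1 / (4 * n\<^sup>2)" using s by (simp add: power_mult_distrib)
  also have "\<dots> \<le> 1 / 4" using n one_le_power[OF n, of 2] by (simp add: divide_simps)
  finally have 1: "(norm (cinner (w - z) (e z k)))\<^sup>2 / (2 * n * s)\<^sup>2 \<le> 1 / 4" .
  have "((norm (w - z))\<^sup>2 - (norm (cinner (w - z) (e z k)))\<^sup>2) / (2 * n * sqrt s)\<^sup>2 \<le> (n * s) / (2 * n * sqrt s)\<^sup>2"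
    using Y by (intro divide_right_mono) auto
  also have "\<dots> = 1 / (4 * n)"
  proof -
    have "(2 * n * sqrt s)\<^sup>2 = 4 * n * (n * s)" using s by (simp add: power_mult_distrib) (simp add: power2_eq_square)
    then show ?thesis using s n by simp
  qed
  also have "\<dots> \<le> 1 / 4" using n by (simp add: divide_simps)
  finally have "(norm (cinner (w - z) (e z k)))\<^sup>2 / (2 * n * s)\<^sup>2 +
      ((norm (w - z))\<^sup>2 - (norm (cinner (w - z) (e z k)))\<^sup>2) / (2 * n * sqrt s)\<^sup>2 < 1" using 1 by linarith
  then show "w \<in> (\<lambda>\<zeta>. z + stretch (e z k) (2 * real CARD('n) * s) (2 * real CARD('n) * sqrt s) \<zeta>) ` ball 0 1"
    using s n unfolding n_def by (subst mem_ellipsoid_iff[OF unitary_frame_norm[OF u]]) auto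
qed

text \<open>Serves the lower volume bound. In the tangential directions \<open>c \<le> 1\<close>
  gives \<open>c * sqrt \<sigma> \<le> sqrt (c * \<sigma>) \<le> sqrt s\<close>.\<close>

lemma ellipsoid_subset_polydisk:
  assumes e: "adapted_frames e k" and \<sigma>: "0 < \<sigma>" and c: "0 < c" "c \<le> 1" and s: "c * \<sigma> \<le> s"
  shows "(\<lambda>\<zeta>. z + stretch (e z k) (c * \<sigma>) (c * sqrt \<sigma>) \<zeta>) ` ball 0 1 \<subseteq> polydisk e k z s"
proof
  fix w assume "w \<in> (\<lambda>\<zeta>. z + stretch (e z k) (c * \<sigma>) (c * sqrt \<sigma>) \<zeta>) ` ball 0 1"
  then obtain \<zeta> where \<zeta>: "norm \<zeta> < 1" and w: "w - z = stretch (e z k) (c * \<sigma>) (c * sqrt \<sigma>) \<zeta>" by auto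
  have u: "unitary_frame (e z)" using e by (rule adapted_frames_unitary)
  have n1: "norm (e z j) = 1" for j using unitary_frame_norm[OF u] .
  have z1: "norm (cinner \<zeta> (e z j)) < 1" for j
    using norm_cinner_le[of \<zeta> "e z j"] n1[of j] \<zeta> by simp
  show "w \<in> polydisk e k z s"
    unfolding mem_polydisk_iff[OF e] w
  proof (intro conjI allI impI)
    have "norm (cinner (stretch (e z k) (c * \<sigma>) (c * sqrt \<sigma>) \<zeta>) (e z k)) = (c * \<sigma>) * norm (cinner \<zeta> (e z k))"
      unfolding cinner_stretch[OF n1] using c \<sigma> by (simp add: norm_mult)
    also have "\<dots> < (c * \<sigma>) * 1" using z1 c \<sigma> by (intro mult_strict_left_mono) auto
    finally show "norm (cinner (stretch (e z k) (c * \<sigma>) (c * sqrt \<sigma>) \<zeta>) (e z k)) < s" using s by simp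
  next
    fix j assume j: "j \<noteq> k"
    have "cinner (e z k) (e z j) = 0" using u j by (simp add: unitary_frame_def)
    then have "cinner (stretch (e z k) (c * \<sigma>) (c * sqrt \<sigma>) \<zeta>) (e z j) = of_real (c * sqrt \<sigma>) * cinner \<zeta> (e z j)"
      by (simp add: stretch_def cinner_add_left cinner_scaleR_left cinner_smult_left)
    then have "norm (cinner (stretch (e z k) (c * \<sigma>) (c * sqrt \<sigma>) \<zeta>) (e z j)) = (c * sqrt \<sigma>) * norm (cinner \<zeta> (e z j))"
      using c \<sigma> by (simp add: norm_mult)
    also have "\<dots> < (c * sqrt \<sigma>) * 1" using z1 c \<sigma> by (intro mult_strict_left_mono) auto
    also have "c * sqrt \<sigma> \<le> sqrt c * sqrt \<sigma>"
    proof (intro mult_right_mono)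
      have "c * c \<le> c * 1" using c by (intro mult_left_mono) auto
      then show "c \<le> sqrt c" by (intro real_le_rsqrt) (simp add: power2_eq_square)
    qed (use \<sigma> in simp)
    also have "sqrt c * sqrt \<sigma> \<le> sqrt s" using s by (simp flip: real_sqrt_mult)
    finally show "norm (cinner (stretch (e z k) (c * \<sigma>) (c * sqrt \<sigma>) \<zeta>) (e z j)) < sqrt s" by simp
  qed
qed

text \<open>For fixed \<open>r\<close> the size is comparable to the height: the denominator in
  \<open>rhat\<close> lies between \<open>1 - (tanh r)\<^sup>2\<close> and 1, and
  \<open>1 - |z|\<^sup>2\<close> between one and two heights.\<close>

lemma rhat_bounds:
  fixes z :: "complex ^ 'n"
  assumes r: "0 < r" and z: "norm z < 1"
  shows rhat_ge: "2 * tanh r * (1 - norm z) \<le> rhat r z"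
    and rhat_le: "rhat r z \<le> 4 * tanh r / (1 - (tanh r)\<^sup>2) * (1 - norm z)"
proof -
  define R where "R = tanh r"
  have R: "0 < R" "R < 1" using r tanh_real_lt_1 by (auto simp: R_def)
  define x where "x = norm z"
  have x: "0 \<le> x" "x < 1" using z by (auto simp: x_def)
  have R2: "0 < 1 - R\<^sup>2" "R\<^sup>2 < 1" using power_strict_mono[OF R(2), of 2] R by auto
  have x2: "x\<^sup>2 \<le> 1" using x by (intro power_le_one) auto
  have "R\<^sup>2 * x\<^sup>2 \<le> R\<^sup>2 * 1" using x2 by (intro mult_left_mono) auto
  then have den: "1 - R\<^sup>2 \<le> 1 - R\<^sup>2 * x\<^sup>2" "0 < 1 - R\<^sup>2 * x\<^sup>2" "1 - R\<^sup>2 * x\<^sup>2 \<le> 1" using R2 by auto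
  have num: "1 - x\<^sup>2 = (1 - x) * (1 + x)" by (simp add: power2_eq_square algebra_simps)
  have n1: "(1 - x) * 1 \<le> (1 - x) * (1 + x)" "(1 - x) * (1 + x) \<le> (1 - x) * 2" by (rule mult_left_mono; use x in simp)+
  have "1 - x \<le> (1 - x\<^sup>2) / (1 - R\<^sup>2 * x\<^sup>2)"
  proof -
    have "(1 - x) * (1 - R\<^sup>2 * x\<^sup>2) \<le> (1 - x) * 1" using den x by (intro mult_left_mono) auto
    then show ?thesis using den n1 num by (subst pos_le_divide_eq) auto
  qed
  then have "2 * R * (1 - x) \<le> 2 * R * ((1 - x\<^sup>2) / (1 - R\<^sup>2 * x\<^sup>2))" using R by (intro mult_left_mono) auto
  then show "2 * tanh r * (1 - norm z) \<le> rhat r z" unfolding rhat_def R_def x_def .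
  have "(1 - x\<^sup>2) / (1 - R\<^sup>2 * x\<^sup>2) \<le> ((1 - x) * 2) / (1 - R\<^sup>2)"
    using den R2 n1 num x by (intro frac_le) auto
  then have "2 * R * ((1 - x\<^sup>2) / (1 - R\<^sup>2 * x\<^sup>2)) \<le> 2 * R * (((1 - x) * 2) / (1 - R\<^sup>2))" using R by (intro mult_left_mono) auto
  also have "\<dots> = 4 * R / (1 - R\<^sup>2) * (1 - x)" by simp
  finally show "rhat r z \<le> 4 * tanh r / (1 - (tanh r)\<^sup>2) * (1 - norm z)" unfolding rhat_def R_def x_def .
qed

section \<open>Test sets for the three converses\<close>

lemma bergman_proj_cong: "(\<And>w. w \<in> ball 0 1 \<Longrightarrow> f w = g w) \<Longrightarrow> bergman_proj f = bergman_proj g"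
  unfolding bergman_proj_def[abs_def] by (intro ext set_lebesgue_integral_cong) auto

lemma bergman_defined_cong: "(\<And>w. w \<in> ball 0 1 \<Longrightarrow> f w = g w) \<Longrightarrow> bergman_defined f \<longleftrightarrow> bergman_defined g"
  unfolding bergman_defined_def by (intro ball_cong set_integrable_cong) auto

text \<open>A polydisk may leave the ball, whereas the projections see only the ball; the arguments
  are applied to the intersection.\<close>

lemma commutator_indicator_Int_ball:
  shows "commutator b (indicator (A \<inter> ball 0 1)) = commutator b (indicator A)"
    and "commutator_defined b (indicator (A \<inter> ball 0 1)) = commutator_defined b (indicator A)"
proof -
  have eq: "indicator (A \<inter> ball 0 1) w = (indicator A w :: complex)" if "w \<in> ball 0 1" for w :: "complex ^ 'a"
    using that by (simp add: indicator_def)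
  have p: "bergman_proj (indicator (A \<inter> ball 0 1)) = bergman_proj (indicator A)"
    "bergman_proj (\<lambda>w. cnj (b w) * indicator (A \<inter> ball 0 1) w) = bergman_proj (\<lambda>w. cnj (b w) * indicator A w)"
    by (intro bergman_proj_cong; simp only: eq)+
  show "commutator b (indicator (A \<inter> ball 0 1)) = commutator b (indicator A)"
    unfolding commutator_def[abs_def] p ..
  have "bergman_defined (indicator (A \<inter> ball 0 1) :: _ \<Rightarrow> complex) = bergman_defined (indicator A :: _ \<Rightarrow> complex)"
    "bergman_defined (\<lambda>w. cnj (b w) * indicator (A \<inter> ball 0 1) w) = bergman_defined (\<lambda>w. cnj (b w) * indicator A w)"
    by (intro bergman_defined_cong; simp only: eq)+
  then show "commutator_defined b (indicator (A \<inter> ball 0 1)) = commutator_defined b (indicator A)"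
    unfolding commutator_defined_def by simp
qed

text \<open>Ellipsoids near the boundary point serve as test sets. They stay in a closed ball of
  radius below 1, so the lemma covers both the condition on compactly supported functions and the
  one on all measurable sets.\<close>

lemma bloch_of_weak_type_compact:
  fixes b :: "complex ^ 'n \<Rightarrow> complex"
  assumes fr: "framed TYPE('n)" and hol: "holomorphic_multi_on b (ball 0 1)" and C: "0 \<le> C"
    and weak: "\<And>A K. A \<in> sets lebesgue \<Longrightarrow> compact K \<Longrightarrow> K \<subseteq> ball 0 1 \<Longrightarrow> A \<subseteq> K \<Longrightarrow> commutator_defined b (indicator A) \<and>
      (\<forall>lam>1. measure lebesgue {w \<in> ball 0 1. norm (commutator b (indicator A) w) > lam} \<le> C * measure lebesgue A / lam)"
  shows "b \<in> bloch"
proof -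
  define n where "n = CARD('n)"
  obtain c where c: "0 < c" "c \<le> 1 / 2" and cre: "\<And>\<tau>. norm \<tau> \<le> 3 * c \<Longrightarrow> 1 / 2 \<le> Re (1 / (1 + \<tau>) ^ (CARD('n) + 1))"
    using Re_inverse_power_near_one by blast
  define VV where "VV = measure lborel (ball (0 :: complex ^ 'n) 1)"
  have VV: "0 < VV" unfolding VV_def by (rule content_ball_pos) simp
  define a where "a = (1 / 2) ^ (2 * n) * (c / 2) ^ (n + 1) * VV"
  have a: "0 < a" using c VV by (simp add: a_def)
  show ?thesis
  proof (rule bloch_of_weak_type_sets[OF fr hol c cre a, of "C * a"])
    show "0 \<le> C * a" using C a by simp
    fix \<epsilon> :: real and e :: "complex ^ 'n" assume \<epsilon>: "0 < \<epsilon>" "\<epsilon> \<le> 1" and e: "norm e = 1"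
    obtain v k where v: "unitary_frame v" and vk: "v k = e" using fr e unfolding framed_def by blast
    \<comment> \<open>Half of \<open>c * \<epsilon>\<close>, since the points of the ellipsoid
      satisfy \<open>norm (1 - cinner u e) \<le> 2 * \<sigma>\<close>.\<close>
    define \<sigma> where "\<sigma> = c / 2 * \<epsilon>"
    have "c / 2 * \<epsilon> \<le> 1 * 1" using c \<epsilon> by (intro mult_mono) auto
    then have \<sigma>: "0 < \<sigma>" "\<sigma> \<le> 1" using c \<epsilon> by (auto simp: \<sigma>_def)
    have half: "0 < (1 / 2 :: real)" "1 / 2 \<le> (1 / 2 :: real)" by auto
    define A where "A = (\<lambda>\<zeta>. (1 - \<sigma>) *\<^sub>R e + stretch e (1 / 2 * \<sigma>) (1 / 2 * sqrt \<sigma>) \<zeta>) ` ball 0 1"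
    have Al: "A \<in> lmeasurable" unfolding A_def vk[symmetric] by (rule lmeasurable_parabolic_ellipsoid[OF v half(1) \<sigma>(1)])
    have "measure lebesgue A = (1 / 2) ^ (2 * n) * \<sigma> ^ (n + 1) * VV"
      unfolding A_def vk[symmetric] n_def VV_def by (rule measure_parabolic_ellipsoid[OF v half(1) \<sigma>(1)])
    then have Am: "measure lebesgue A = a * \<epsilon> ^ (n + 1)" unfolding a_def \<sigma>_def power_mult_distrib by (simp only: mult_ac)
    have AK: "A \<subseteq> cball 0 (sqrt (1 - \<sigma> / 2))"
    proof
      fix w assume "w \<in> A"
      then obtain \<zeta> where \<zeta>: "norm \<zeta> < 1" and w: "w = (1 - \<sigma>) *\<^sub>R e + stretch e (1 / 2 * \<sigma>) (1 / 2 * sqrt \<sigma>) \<zeta>"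
        by (auto simp: A_def)
      have "(norm w)\<^sup>2 \<le> 1 - \<sigma> / 2" unfolding w by (rule norm_ellipsoid_point_le[OF e \<sigma> half \<zeta>])
      then show "w \<in> cball 0 (sqrt (1 - \<sigma> / 2))" by (simp add: real_le_rsqrt)
    qed
    have near: "norm (1 - cinner u e) \<le> c * \<epsilon>" if u: "u \<in> A" for u
    proof -
      obtain \<zeta> where "\<zeta> \<in> ball 0 1" and w: "u = (1 - \<sigma>) *\<^sub>R e + stretch e (1 / 2 * \<sigma>) (1 / 2 * sqrt \<sigma>) \<zeta>"
        using u unfolding A_def by blast
      then have \<zeta>: "norm \<zeta> < 1" by simp
      have "norm (1 - cinner u e) \<le> 2 * \<sigma>" unfolding w by (rule norm_one_minus_ellipsoid_point_le[OF e \<sigma> half \<zeta>])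
      then show ?thesis by (simp add: \<sigma>_def)
    qed
    have KB: "cball 0 (sqrt (1 - \<sigma> / 2)) \<subseteq> ball (0 :: complex ^ 'n) 1"
      using \<sigma> by (simp add: cball_subset_ball_iff)
    have As: "A \<in> sets lebesgue" using Al by (rule fmeasurableD)
    note W = weak[OF As compact_cball KB AK]
    have cd: "commutator_defined b (indicator A)" using W by (rule conjunct1)
    have wt: "\<forall>lam>1. measure lebesgue {w \<in> ball 0 1. norm (commutator b (indicator A) w) > lam} \<le> C * a * \<epsilon> ^ (n + 1) / lam"
      using W unfolding Am mult.assoc by (rule conjunct2)
    show "\<exists>A. A \<in> sets lebesgue \<and> A \<subseteq> ball 0 1 \<and> (\<forall>u\<in>A. norm (1 - cinner u e) \<le> c * \<epsilon>) \<and>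
        a * \<epsilon> ^ (CARD('n) + 1) \<le> measure lebesgue A \<and> commutator_defined b (indicator A) \<and>
        (\<forall>lam>1. measure lebesgue {w \<in> ball 0 1. norm (commutator b (indicator A) w) > lam} \<le> C * a * \<epsilon> ^ (CARD('n) + 1) / lam)"
      using As subset_trans[OF AK KB] near Am cd wt unfolding n_def by (intro exI[of _ A]) simp
  qed
qed

lemma commutator_defined_compact:
  assumes b: "continuous_on (ball 0 1) b" and A: "A \<in> sets lebesgue" "compact K" "K \<subseteq> ball 0 1" "A \<subseteq> K"
  shows "commutator_defined b (indicator A)"
proof -
  have "bounded (b ` K)" using b A by (intro compact_imp_bounded compact_continuous_image) (auto intro: continuous_on_subset)
  then obtain B where B: "\<And>w. w \<in> K \<Longrightarrow> norm (b w) \<le> B" unfolding bounded_iff by blast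
  have "set_integrable lebesgue (ball 0 1) (indicator A :: complex ^ 'a \<Rightarrow> complex)"
    using indicator_measurable_lebesgue_on[OF A(1)] by (rule set_integrable_bounded_ball[where B = 1]) (simp add: indicator_def)
  moreover have "set_integrable lebesgue (ball 0 1) (\<lambda>w. cnj (b w) * indicator A w)"
  proof (rule set_integrable_bounded_ball[where B = "\<bar>B\<bar>"])
    have "(\<lambda>w. cnj (b w)) \<in> borel_measurable (lebesgue_on (ball 0 1))"
      using b by (intro continuous_on_ball_measurable continuous_intros)
    then show "(\<lambda>w. cnj (b w) * indicator A w) \<in> borel_measurable (lebesgue_on (ball 0 1))"
      using indicator_measurable_lebesgue_on[OF A(1)] by (rule borel_measurable_times)
    show "norm (cnj (b w) * indicator A w) \<le> \<bar>B\<bar>" for w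
      using B[of w] A(4) by (auto simp: indicator_def norm_mult)
  qed
  ultimately show ?thesis unfolding commutator_defined_def by (simp add: bergman_defined_integrable)
qed

text \<open>Indicators of subsets of a compact \<open>K\<close> are among the functions of the
  hypothesis, and at levels above 1 the logarithm vanishes. The commutator is defined because
  \<open>b\<close> is bounded on \<open>K\<close>.\<close>

lemma bloch_of_weak_type_LlogL:
  fixes b :: "complex ^ 'n \<Rightarrow> complex"
  assumes fr: "framed TYPE('n)" and hol: "holomorphic_multi_on b (ball 0 1)" and C: "0 \<le> C"
    and weak: "\<And>f lam. f \<in> borel_measurable (lebesgue_on (ball 0 1)) \<Longrightarrow> bounded (f ` ball 0 1) \<Longrightarrow>
      compactly_supported_in f (ball 0 1) \<Longrightarrow> 0 < lam \<Longrightarrow> measure lebesgue {z \<in> ball 0 1. norm (commutator b f z) > lam}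
        \<le> C * (LINT z:ball 0 1|lebesgue. norm (f z) / lam * (1 + log_plus (norm (f z) / lam)))"
  shows "b \<in> bloch"
proof (rule bloch_of_weak_type_compact[OF fr hol C], intro conjI allI impI)
  fix A K :: "(complex ^ 'n) set" assume A: "A \<in> sets lebesgue" "compact K" "K \<subseteq> ball 0 1" "A \<subseteq> K"
  let ?B = "ball (0 :: complex ^ 'n) 1"
  show "commutator_defined b (indicator A)"
    using holomorphic_multi_continuous_on[OF hol] A by (rule commutator_defined_compact)
  fix lam :: real assume lam: "1 < lam"
  let ?f = "indicator A :: complex ^ 'n \<Rightarrow> complex"
  have "bounded (?f ` ?B)" by (rule boundedI[of _ 1]) (auto simp: indicator_def)
  moreover have "compactly_supported_in ?f ?B" unfolding compactly_supported_in_def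
    using A by (intro exI[of _ K]) (auto simp: indicator_def)
  ultimately have "measure lebesgue {z \<in> ?B. norm (commutator b ?f z) > lam}
      \<le> C * (LINT z:?B|lebesgue. norm (?f z) / lam * (1 + log_plus (norm (?f z) / lam)))"
    using lam by (intro weak indicator_measurable_lebesgue_on[OF A(1)]) auto
  also have "(LINT z:?B|lebesgue. norm (?f z) / lam * (1 + log_plus (norm (?f z) / lam))) = measure lebesgue A / lam"
  proof -
    have "log_plus (1 / lam) = 0" using lam by (simp add: log_plus_def)
    then have "indicator ?B z *\<^sub>R (norm (?f z) / lam * (1 + log_plus (norm (?f z) / lam))) = indicator A z / lam" for z
      using A(3,4) by (auto simp: indicator_def)
    then show ?thesis unfolding set_lebesgue_integral_def using A(1) by (simp only:) simp
  qed
  finally show "measure lebesgue {z \<in> ?B. norm (commutator b ?f z) > lam} \<le> C * measure lebesgue A / lam" by simp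
qed

text \<open>With \<open>r\<close> fixed the size of the polydisk is tied to its centre, so the
  centre is the only freedom. It is placed at height \<open>\<kappa> * \<epsilon>\<close>, closer to
  the boundary than the point at height \<open>\<epsilon>\<close> where the gradient is bounded, so
  that the part of the polydisk in the ball is near the boundary point in the sense of
  \<open>bloch_of_weak_type_sets\<close>.\<close>

lemma bloch_of_weak_type_polydisks:
  fixes b :: "complex ^ 'n \<Rightarrow> complex" and e :: "complex ^ 'n \<Rightarrow> 'n \<Rightarrow> complex ^ 'n"
  assumes e: "adapted_frames e k" and hol: "holomorphic_multi_on b (ball 0 1)" and C: "0 \<le> C" and r: "0 < r"
    and weak: "\<And>z. z \<in> ball 0 1 \<Longrightarrow> commutator_defined b (indicator (polydisk e k z (rhat r z))) \<and>
      (\<forall>lam>1. measure lebesgue {w \<in> ball 0 1. norm (commutator b (indicator (polydisk e k z (rhat r z))) w) > lam}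
        \<le> C * measure lebesgue (polydisk e k z (rhat r z)) / lam)"
  shows "b \<in> bloch"
proof -
  define n where "n = CARD('n)"
  have n: "0 < n" by (simp add: n_def)
  have fr: "framed TYPE('n)" using e by (rule adapted_frames_framed)
  obtain c where c: "0 < c" "c \<le> 1 / 2" and cre: "\<And>\<tau>. norm \<tau> \<le> 3 * c \<Longrightarrow> 1 / 2 \<le> Re (1 / (1 + \<tau>) ^ (CARD('n) + 1))"
    using Re_inverse_power_near_one by blast
  define VV where "VV = measure lborel (ball (0 :: complex ^ 'n) 1)"
  have VV: "0 < VV" unfolding VV_def by (rule content_ball_pos) simp
  define R where "R = tanh r"
  have R: "0 < R" "R < 1" using r tanh_real_lt_1 by (auto simp: R_def)
  have R2: "0 < 1 - R\<^sup>2" using power_strict_mono[OF R(2), of 2] R by auto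
  define L where "L = 4 * R / (1 - R\<^sup>2)"
  have L: "0 < L" using R R2 by (simp add: L_def)
  \<comment> \<open>\<open>L\<close> bounds the ratio of \<open>rhat r z\<close> to the height, so
    the radial coordinate in the polydisk is within \<open>(1 + L) * \<sigma>\<close> of 1;
    \<open>\<kappa>\<close> makes this \<open>c * \<epsilon>\<close>.\<close>
  define \<kappa> where "\<kappa> = c / (1 + L)"
  have \<kappa>0: "\<kappa> * (1 + L) = c" using L by (simp add: \<kappa>_def)
  have \<kappa>: "0 < \<kappa>" "\<kappa> + L * \<kappa> = c" using c L \<kappa>0 by (simp_all add: \<kappa>_def[symmetric] distrib_left mult.commute) (simp add: \<kappa>_def)
  have \<kappa>c: "\<kappa> \<le> c" using \<kappa> L by (smt (verit) mult_pos_pos)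
  \<comment> \<open>\<open>c' \<le> 2 * R\<close> puts the ellipsoid around \<open>z\<close> inside
    the polydisk, \<open>c' \<le> 1 / 2\<close> puts it inside the ball.\<close>
  define c' where "c' = min (1 / 2) (2 * R)"
  have c': "0 < c'" "c' \<le> 1 / 2" "c' \<le> 1" "c' \<le> 2 * R" using R by (auto simp: c'_def)
  define a where "a = c' ^ (2 * n) * \<kappa> ^ (n + 1) * VV"
  have a: "0 < a" using c' \<kappa> VV by (simp add: a_def)
  define D where "D = (2 * real n) ^ (2 * n) * (L * \<kappa>) ^ (n + 1) * VV"
  have D: "0 \<le> D" using \<kappa> L VV by (simp add: D_def)
  show ?thesis
  proof (rule bloch_of_weak_type_sets[OF fr hol c cre a, of "C * D"])
    show "0 \<le> C * D" using C D by simp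
    fix \<epsilon> :: real and e0 :: "complex ^ 'n" assume \<epsilon>: "0 < \<epsilon>" "\<epsilon> \<le> 1" and e0: "norm e0 = 1"
    define \<sigma> where "\<sigma> = \<kappa> * \<epsilon>"
    have "\<kappa> * \<epsilon> \<le> 1 / 2 * 1" using \<kappa> \<kappa>c c \<epsilon> by (intro mult_mono) auto
    then have \<sigma>: "0 < \<sigma>" "\<sigma> \<le> 1 / 2" using \<kappa> \<epsilon> by (auto simp: \<sigma>_def)
    have \<sigma>1: "\<sigma> \<le> 1" using \<sigma> by simp
    define z where "z = (1 - \<sigma>) *\<^sub>R e0"
    have nz: "norm z = 1 - \<sigma>" using \<sigma> e0 by (simp add: z_def)
    have zB: "z \<in> ball 0 1" using \<sigma> nz by simp
    \<comment> \<open>\<open>\<sigma> \<le> 1 / 2\<close> keeps \<open>z\<close> off the origin,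
      where the frame is arbitrary; here its distinguished vector is \<open>e0\<close>.\<close>
    have "z \<noteq> 0" using nz \<sigma> by auto
    then have "e z k = z /\<^sub>R norm z" using e by (simp add: adapted_frames_def)
    also have "\<dots> = e0" unfolding nz using \<sigma> by (simp add: z_def)
    finally have ez: "e z k = e0" .
    have uf: "unitary_frame (e z)" using e by (rule adapted_frames_unitary)
    define s where "s = rhat r z"
    have s1: "2 * R * \<sigma> \<le> s" using rhat_ge[OF r, of z] nz \<sigma> by (simp add: s_def R_def)
    have s2: "s \<le> L * \<sigma>" using rhat_le[OF r, of z] nz \<sigma> by (simp add: s_def R_def L_def)
    have s: "0 < s" using s1 R \<sigma> by (smt (verit) mult_pos_pos)
    define P where "P = polydisk e k z s"
    have Po: "open P" unfolding P_def by (rule open_polydisk)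
    have PE: "P \<subseteq> (\<lambda>\<zeta>. z + stretch (e z k) (2 * real n * s) (2 * real n * sqrt s) \<zeta>) ` ball 0 1"
      unfolding P_def n_def by (rule polydisk_subset_ellipsoid[OF e s])
    have n2: "0 < 2 * real n" using n by simp
    have Pm: "measure lebesgue P \<le> D * \<epsilon> ^ (n + 1)"
    proof -
      have "measure lebesgue P \<le> (2 * real n) ^ (2 * n) * s ^ (n + 1) * VV"
        using measure_le_superset[OF PE lmeasurable_parabolic_ellipsoid[OF uf n2 s]]
        unfolding measure_parabolic_ellipsoid[OF uf n2 s] unfolding n_def VV_def .
      also have "\<dots> \<le> (2 * real n) ^ (2 * n) * (L * \<sigma>) ^ (n + 1) * VV"
        using s s2 VV by (intro mult_left_mono mult_right_mono power_mono) auto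
      also have "\<dots> = D * \<epsilon> ^ (n + 1)" unfolding D_def \<sigma>_def mult.assoc[symmetric] power_mult_distrib by (simp only: mult_ac)
      finally show ?thesis .
    qed
    define A where "A = P \<inter> ball 0 1"
    have A: "A \<in> sets lebesgue" using Po by (simp add: A_def borel_open)
    have AB: "A \<subseteq> ball 0 1" by (simp add: A_def)
    have Am: "a * \<epsilon> ^ (n + 1) \<le> measure lebesgue A"
    proof -
      let ?E = "(\<lambda>\<zeta>. z + stretch (e z k) (c' * \<sigma>) (c' * sqrt \<sigma>) \<zeta>) ` ball 0 1"
      have "c' * \<sigma> \<le> 2 * R * \<sigma>" using c' \<sigma> by (intro mult_right_mono) auto
      then have "?E \<subseteq> P" unfolding P_def using s1 by (intro ellipsoid_subset_polydisk[OF e \<sigma>(1) c'(1,3)]) auto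
      moreover have "?E \<subseteq> ball 0 1" unfolding ez unfolding z_def using norm_ellipsoid_point_less[OF e0 \<sigma>(1) \<sigma>1 c'(1,2)] by auto
      ultimately have "?E \<subseteq> A" by (simp add: A_def)
      moreover have "A \<in> lmeasurable"
      proof -
        have "P \<in> sets lebesgue" using borel_open[OF Po] by simp
        then show ?thesis unfolding A_def Int_commute[of P] by (rule fmeasurable_Int_fmeasurable[OF lmeasurable_ball])
      qed
      ultimately have "measure lebesgue ?E \<le> measure lebesgue A" by (rule measure_le_superset)
      also have "measure lebesgue ?E = c' ^ (2 * n) * \<sigma> ^ (n + 1) * VV"
        unfolding n_def VV_def by (rule measure_parabolic_ellipsoid[OF uf c'(1) \<sigma>(1)])
      also have "\<dots> = a * \<epsilon> ^ (n + 1)" unfolding a_def \<sigma>_def power_mult_distrib by (simp only: mult_ac)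
      finally show ?thesis .
    qed
    have near: "norm (1 - cinner u e0) \<le> c * \<epsilon>" if "u \<in> A" for u
    proof -
      have "norm (cinner (u - z) e0) < s" using that unfolding A_def P_def ez[symmetric] by (simp add: mem_polydisk_iff[OF e])
      moreover have "1 - cinner u e0 = of_real \<sigma> - cinner (u - z) e0"
        using e0 by (simp add: z_def cinner_diff_left cinner_scaleR_left cinner_unit)
      then have "norm (1 - cinner u e0) \<le> norm (of_real \<sigma> :: complex) + norm (cinner (u - z) e0)" by (simp only: norm_triangle_ineq4)
      ultimately have "norm (1 - cinner u e0) \<le> \<sigma> + L * \<sigma>" using \<sigma> s2 by simp
      also have "\<dots> = (\<kappa> + L * \<kappa>) * \<epsilon>" by (simp add: \<sigma>_def algebra_simps)
      finally show ?thesis unfolding \<kappa>(2) .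
    qed
    from weak[OF zB] have cd: "commutator_defined b (indicator A)"
      and wt: "\<And>lam. 1 < lam \<Longrightarrow> measure lebesgue {w \<in> ball 0 1. norm (commutator b (indicator A) w) > lam} \<le> C * measure lebesgue P / lam"
      unfolding A_def commutator_indicator_Int_ball P_def s_def by simp_all
    have wt': "measure lebesgue {w \<in> ball 0 1. norm (commutator b (indicator A) w) > lam} \<le> C * D * \<epsilon> ^ (n + 1) / lam" if lam: "1 < lam" for lam
    proof -
      have "C * measure lebesgue P \<le> C * (D * \<epsilon> ^ (n + 1))" using Pm C by (rule mult_left_mono)
      then have "C * measure lebesgue P / lam \<le> C * D * \<epsilon> ^ (n + 1) / lam" using lam by (intro divide_right_mono) (auto simp: mult.assoc)
      then show ?thesis using wt[OF lam] by linarith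
    qed
    show "\<exists>A. A \<in> sets lebesgue \<and> A \<subseteq> ball 0 1 \<and> (\<forall>u\<in>A. norm (1 - cinner u e0) \<le> c * \<epsilon>) \<and>
        a * \<epsilon> ^ (CARD('n) + 1) \<le> measure lebesgue A \<and> commutator_defined b (indicator A) \<and>
        (\<forall>lam>1. measure lebesgue {w \<in> ball 0 1. norm (commutator b (indicator A) w) > lam} \<le> C * D * \<epsilon> ^ (CARD('n) + 1) / lam)"
      using A AB near Am cd wt' unfolding n_def by (intro exI[of _ A]) simp
  qed
qed

text \<open>The hypothesis is applied to the part of the polydisk inside the ball. Enlarging it to
  the polydisk on the right uses that the polydisk has finite measure.\<close>

lemma polydisk_weak_type:
  fixes b :: "complex ^ 'n \<Rightarrow> complex" and e :: "complex ^ 'n \<Rightarrow> 'n \<Rightarrow> complex ^ 'n"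
  assumes e: "adapted_frames e k" and C: "0 \<le> C" and s: "0 < s"
    and weak: "\<And>A. A \<in> sets lebesgue \<Longrightarrow> A \<subseteq> ball 0 1 \<Longrightarrow> commutator_defined b (indicator A) \<and>
      (\<forall>lam>1. measure lebesgue {w \<in> ball 0 1. norm (commutator b (indicator A) w) > lam} \<le> C * measure lebesgue A / lam)"
  shows "commutator_defined b (indicator (polydisk e k z s)) \<and>
    (\<forall>lam>1. measure lebesgue {w \<in> ball 0 1. norm (commutator b (indicator (polydisk e k z s)) w) > lam}
      \<le> C * measure lebesgue (polydisk e k z s) / lam)"
proof -
  let ?P = "polydisk e k z s"
  have n2: "0 < 2 * real CARD('n)" by simp
  note E = lmeasurable_parabolic_ellipsoid[OF adapted_frames_unitary[OF e] n2 s, of z z k]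
  have Ps: "?P \<in> sets lebesgue" using borel_open[OF open_polydisk, of e k z s] by simp
  have Pf: "?P \<in> lmeasurable" using E polydisk_subset_ellipsoid[OF e s] Ps by (rule fmeasurableI2)
  let ?A = "?P \<inter> ball 0 1"
  have A: "?A \<in> sets lebesgue" "?A \<subseteq> ball 0 1" using Ps by auto
  have le: "C * measure lebesgue ?A \<le> C * measure lebesgue ?P"
    using measure_le_superset[OF _ Pf, of ?A] C by (intro mult_left_mono) auto
  from weak[OF A] have cd: "commutator_defined b (indicator ?P)"
    and wt: "\<And>lam. 1 < lam \<Longrightarrow> measure lebesgue {w \<in> ball 0 1. norm (commutator b (indicator ?P) w) > lam} \<le> C * measure lebesgue ?A / lam"
    unfolding commutator_indicator_Int_ball by auto
  have "C * measure lebesgue ?A / lam \<le> C * measure lebesgue ?P / lam" if "1 < lam" for lam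
    using le that by (intro divide_right_mono) auto
  then show ?thesis using cd wt order_trans by blast
qed

theorem theorem4:
  fixes b :: "complex ^ 'n \<Rightarrow> complex"
    and e :: "complex ^ 'n \<Rightarrow> 'n \<Rightarrow> complex ^ 'n" and k :: 'n
  assumes "holomorphic_multi_on b (ball 0 1)"
    and "adapted_frames e k"
  shows
    "(b \<in> bloch \<longleftrightarrow>
       (\<exists>C>0. \<forall>f :: complex ^ 'n \<Rightarrow> complex.
          f \<in> borel_measurable (lebesgue_on (ball 0 1)) \<longrightarrow> bounded (f ` ball 0 1) \<longrightarrow>
          compactly_supported_in f (ball 0 1) \<longrightarrow>
          (\<forall>lam>0. measure lebesgue {z \<in> ball 0 1. norm (commutator b f z) > lam}
             \<le> C * (LINT z:ball 0 1|lebesgue.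
                      norm (f z) / lam * (1 + log_plus (norm (f z) / lam)))))) \<and>
     (b \<in> bloch \<longleftrightarrow>
       (\<exists>C>0. \<forall>A \<in> sets lebesgue. A \<subseteq> ball 0 1 \<longrightarrow>
          commutator_defined b (indicator A) \<and>
          (\<forall>lam>1. measure lebesgue {z \<in> ball 0 1. norm (commutator b (indicator A) z) > lam}
             \<le> C * measure lebesgue A / lam))) \<and>
     (b \<in> bloch \<longleftrightarrow>
       (\<exists>C>0. \<exists>r>0. \<forall>z \<in> ball 0 1.
          commutator_defined b (indicator (polydisk e k z (rhat r z))) \<and>
          (\<forall>lam>1. measure lebesgue
               {w \<in> ball 0 1. norm (commutator b (indicator (polydisk e k z (rhat r z))) w) > lam}
             \<le> C * measure lebesgue (polydisk e k z (rhat r z)) / lam)))"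
    (is "(_ \<longleftrightarrow> ?weak2) \<and> (_ \<longleftrightarrow> ?weak3) \<and> (_ \<longleftrightarrow> ?weak4)")
proof (intro conjI iffI)
  note hol = assms(1) and e = assms(2)
  have fr: "framed TYPE('n)" using e by (rule adapted_frames_framed)
  {
    assume b: "b \<in> bloch"
    then show ?weak2 using bloch_weak_type[OF fr b] by blast
    show weak3: ?weak3 using bloch_weak_type_indicator[OF fr b] .
    then obtain C where C: "0 < C" and weak: "\<And>A. A \<in> sets lebesgue \<Longrightarrow> A \<subseteq> ball 0 1 \<Longrightarrow> commutator_defined b (indicator A) \<and>
      (\<forall>lam>1. measure lebesgue {w \<in> ball 0 1. norm (commutator b (indicator A) w) > lam} \<le> C * measure lebesgue A / lam)"
      by blast
    \<comment> \<open>Any fixed radius serves for the fourth condition; 1 is taken.\<close>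
    have s: "0 < rhat 1 z" if "z \<in> ball 0 1" for z :: "complex ^ 'n"
    proof -
      have "0 < 2 * tanh 1 * (1 - norm z)" using that by simp
      also have "\<dots> \<le> rhat 1 z" using that by (intro rhat_ge) auto
      finally show ?thesis .
    qed
    show ?weak4
      using C by (intro exI[of _ C] exI[of _ 1] conjI ballI polydisk_weak_type[OF e less_imp_le[OF C] s weak]) auto
  next
    assume ?weak2
    then obtain C where C: "0 < C" and weak: "\<And>f lam. f \<in> borel_measurable (lebesgue_on (ball 0 1)) \<Longrightarrow> bounded (f ` ball 0 1) \<Longrightarrow>
      compactly_supported_in f (ball 0 1) \<Longrightarrow> 0 < lam \<Longrightarrow> measure lebesgue {z \<in> ball 0 1. norm (commutator b f z) > lam}
        \<le> C * (LINT z:ball 0 1|lebesgue. norm (f z) / lam * (1 + log_plus (norm (f z) / lam)))"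
      by blast
    show "b \<in> bloch" by (rule bloch_of_weak_type_LlogL[OF fr hol less_imp_le[OF C] weak])
  next
    assume ?weak3
    then obtain C where C: "0 < C" and weak: "\<And>A. A \<in> sets lebesgue \<Longrightarrow> A \<subseteq> ball 0 1 \<Longrightarrow> commutator_defined b (indicator A) \<and>
      (\<forall>lam>1. measure lebesgue {w \<in> ball 0 1. norm (commutator b (indicator A) w) > lam} \<le> C * measure lebesgue A / lam)"
      by blast
    show "b \<in> bloch" by (rule bloch_of_weak_type_compact[OF fr hol less_imp_le[OF C] weak]) auto
  next
    assume ?weak4
    then obtain C r where C: "0 < C" and r: "0 < r" and weak: "\<And>z. z \<in> ball 0 1 \<Longrightarrow> commutator_defined b (indicator (polydisk e k z (rhat r z))) \<and>
      (\<forall>lam>1. measure lebesgue {w \<in> ball 0 1. norm (commutator b (indicator (polydisk e k z (rhat r z))) w) > lam}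
        \<le> C * measure lebesgue (polydisk e k z (rhat r z)) / lam)"
      by blast
    show "b \<in> bloch" by (rule bloch_of_weak_type_polydisks[OF e hol less_imp_le[OF C] r weak])
  }
qed

end
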